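(* Let $U_s$ be a domain on $\mathbb{S}^n$ and let $\partial V_s$ be a sufficiently smooth hypersurface in $U_s$ bounding a subdomain $V_s$ of $U_s$. Let $k\ge0$ and let $f\in C^1(U_s\times\mathbb{R}^n,\mathcal{M}_k)$, $g\in C^1(U_s\times\mathbb{R}^n,\overline{\mathcal{M}}_k)$. Then $$\int_{V_s}\Big(\big(g(x_s,u)R_k^S,\,f(x_s,u)\big)_u+\big(g(x_s,u),\,R_k^Sf(x_s,u)\big)_u\Big)dS(x_s)$$ $$=\int_{\partial V_s}\big(g(x_s,u),\,P_kn(x_s)f(x_s,u)\big)_u\,d\Sigma(x_s)$$ $$=\int_{\partial V_s}\big(g(x_s,u)n(x_s)P_{k,r},\,f(x_s,u)\big)_u\,d\Sigma(x_s)$$ $$=\int_{\partial V_s}\big(g(x_s,u),\,n(x_s)f(x_s,u)\big)_u\,d\Sigma(x_s),$$ where $dS$ is the $n$-dimensional area measure on $V_s$, $d\Sigma$ is the $(n-1)$-dimensional scalar Lebesgue measure on $\partial V_s$, and $n(x_s)$ is the unit vector tangent to $\mathbb{S}^n$ at $x_s$, orthogonal to $\partial V_s$ and pointing outward from $V_s$.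
   Context: $Cl_{n+1}$ is the real Clifford algebra generated by $\mathbb{R}^{n+1}$ with orthonormal basis $e_1,\dots,e_{n+1}$ and relations $e_ie_j+e_je_i=-2\delta_{ij}$; $\mathbb{R}^n=\mathrm{span}(e_1,\dots,e_n)\subset\mathbb{R}^{n+1}\subset Cl_{n+1}$. $\mathbb{S}^n$ is the unit sphere of $\mathbb{R}^{n+1}$ and $\mathbb{S}^{n-1}$ the unit sphere of $\mathbb{R}^n$. Reversion $a\mapsto\tilde a$ is the linear anti-automorphism of $Cl_{n+1}$ fixing all vectors. With $D_u=\sum_{j=1}^ne_j\partial_{u_j}$: $\mathcal{H}_k$ is the space of $Cl_{n+1}$-valued harmonic polynomials in $u\in\mathbb{R}^n$ homogeneous of degree $k$; $\mathcal{M}_k$ (resp. $\overline{\mathcal{M}}_k$) is the space of $Cl_{n+1}$-valued polynomials homogeneous of degree $k$ with $D_up=0$ (left monogenic) (resp. $pD_u=\sum_j\partial_{u_j}p\,e_j=0$, right monogenic); both are $0$ for $k=-1$. $P_k:\mathcal{H}_k=\mathcal{M}_k\oplus u\mathcal{M}_{k-1}\to\mathcal{M}_k$ and $P_{k,r}:\mathcal{H}_k=\overline{\mathcal{M}}_k\oplus\overline{\mathcal{M}}_{k-1}u\to\overline{\mathcal{M}}_k$ are the projections; $P_{k,r}$ is written on the right of its argument. $C^1(U_s\times\mathbb{R}^n,\mathcal{M}_k)$ denotes $C^1$ functions $f(x_s,u)$ with $f(x_s,\cdot)\in\mathcal{M}_k$ for each $x_s$; similarly for $\overline{\mathcal{M}}_k$.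 The spherical Dirac operator is $D_s=D_{s,x_s}=-x_s(\Lambda+\frac n2)$ with $\Lambda=\sum_{1\le i<j\le n+1}e_ie_j\big(x_{s,i}\frac{\partial}{\partial x_{s,j}}-x_{s,j}\frac{\partial}{\partial x_{s,i}}\big)$ (vector fields tangent to $\mathbb{S}^n$). Its right action is $gD_s:=\widetilde{D_s\tilde g}$. The $n$-spherical Rarita-Schwinger type operators are $R_k^Sf(x_s,u)=P_kD_{s,x_s}f(x_s,u)$ (left) and $g(x_s,u)R_k^S=g(x_s,u)D_{s,x_s}P_{k,r}$ (right). For $Cl_{n+1}$-valued polynomials, $(P(u),Q(u))_u=\int_{\mathbb{S}^{n-1}}P(u)Q(u)\,ds(u)$, $ds$ the surface measure on $\mathbb{S}^{n-1}$. *)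

theory Defs
  imports "HOL-Analysis.Analysis" "HOL-Library.Option_ord"
begin

text \<open>
  The Clifford algebra on generators \<open>e\<^sub>i\<close>, indexed by a finite linearly ordered type, is
  represented by coordinates with respect to the basis of blades
  \<open>e\<^sub>A = e\<^bsub>i1\<^esub> \<dots> e\<^bsub>ik\<^esub>\<close> for \<open>A = {i1 < \<dots> < ik}\<close>.  Sorting the product \<open>e\<^sub>A e\<^sub>B\<close> costs a factor
  \<open>- 1\<close> for every pair of distinct generators that has to be interchanged and, because
  \<open>e\<^sub>i e\<^sub>i = - 1\<close>, another one for every generator that occurs in both factors.
  The componentwise multiplication that the library provides on \<open>real ^ 'i set\<close> is not the
  Clifford product.
\<close>

type_synonym 'i clifford = "real ^ ('i set)"

definition blade :: "'i::finite set \<Rightarrow> 'i clifford" where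
  "blade A = axis A 1"

definition blade_sign :: "'i::linorder set \<Rightarrow> 'i set \<Rightarrow> real" where
  "blade_sign A B = (\<Prod>a\<in>A. \<Prod>b\<in>B. if b \<le> a then - 1 else 1)"

definition cmult :: "'i::{finite,linorder} clifford \<Rightarrow> 'i clifford \<Rightarrow> 'i clifford" (infixl \<open>\<odot>\<close> 70)
  where "a \<odot> b = (\<Sum>A\<in>UNIV. \<Sum>B\<in>UNIV. (blade_sign A B * a $ A * b $ B) *\<^sub>R blade (sym_diff A B))"

definition cunit :: "'i::finite clifford" where
  "cunit = blade {}"

definition gen :: "'i::finite \<Rightarrow> 'i clifford" where
  "gen i = blade {i}"

definition reversion :: "'i::finite clifford \<Rightarrow> 'i clifford" where
  "reversion a = (\<Sum>A\<in>UNIV. ((- 1) ^ (card A choose 2) * a $ A) *\<^sub>R blade A)"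

definition cvec :: "(real, 'i) vec \<Rightarrow> 'i::finite clifford" where
  "cvec x = (\<Sum>i\<in>UNIV. x $ i *\<^sub>R gen i)"

lemma blade_sign_sym_diff_left:
  fixes A B C :: "'i::{finite,linorder} set"
  shows "blade_sign (sym_diff A B) C = blade_sign A C * blade_sign B C"
proof -
  define p where "p a = (\<Prod>c\<in>C. if c \<le> a then - 1 else (1::real))" for a
  have sq: "p a * p a = 1" for a
    unfolding p_def prod.distrib[symmetric] by (intro prod.neutral) auto
  have "prod p A * prod p B
      = (prod p (A - B) * prod p (A \<inter> B)) * (prod p (B - A) * prod p (A \<inter> B))"
    by (metis Int_commute finite prod.Int_Diff mult.commute)
  also have "\<dots> = prod p (A - B) * prod p (B - A) * (\<Prod>a\<in>A \<inter> B. p a * p a)"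
    by (simp add: prod.distrib)
  also have "\<dots> = prod p (A - B) * prod p (B - A)"
    by (simp add: sq)
  also have "\<dots> = prod p (sym_diff A B)"
    by (rule prod.union_disjoint[symmetric]) auto
  finally show ?thesis
    by (simp add: blade_sign_def p_def)
qed

lemma blade_sign_sym_diff_right:
  fixes A B C :: "'i::{finite,linorder} set"
  shows "blade_sign C (sym_diff A B) = blade_sign C A * blade_sign C B"
proof -
  have sw: "blade_sign C D = (\<Prod>d\<in>D. \<Prod>c\<in>C. if d \<le> c then - 1 else 1)" for D
    unfolding blade_sign_def by (rule prod.swap)
  define p where "p a = (\<Prod>c\<in>C. if a \<le> c then - 1 else (1::real))" for a
  have sq: "p a * p a = 1" for a
    unfolding p_def prod.distrib[symmetric] by (intro prod.neutral) auto
  have "prod p A * prod p B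
      = (prod p (A - B) * prod p (A \<inter> B)) * (prod p (B - A) * prod p (A \<inter> B))"
    by (metis Int_commute finite prod.Int_Diff mult.commute)
  also have "\<dots> = prod p (A - B) * prod p (B - A) * (\<Prod>a\<in>A \<inter> B. p a * p a)"
    by (simp add: prod.distrib)
  also have "\<dots> = prod p (A - B) * prod p (B - A)"
    by (simp add: sq)
  also have "\<dots> = prod p (sym_diff A B)"
    by (rule prod.union_disjoint[symmetric]) auto
  finally show ?thesis
    by (simp add: sw p_def)
qed

lemma bilinear_cmult: "bilinear (\<odot>)"
  unfolding bilinear_def cmult_def
  by (auto intro!: linearI simp: algebra_simps sum.distrib scaleR_sum_right)

lemma blade_mult: "blade A \<odot> blade B = blade_sign A B *\<^sub>R blade (sym_diff A B)"
  for A B :: "'i::{finite,linorder} set"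
proof -
  have "blade A \<odot> blade B = (\<Sum>A'\<in>UNIV. \<Sum>B'\<in>UNIV.
      if A' = A then if B' = B then blade_sign A B *\<^sub>R blade (sym_diff A B) else 0 else 0)"
    unfolding cmult_def
    by (intro sum.cong refl) (auto simp: blade_def axis_def)
  also have "\<dots> = (\<Sum>A'\<in>UNIV. if A' = A then blade_sign A B *\<^sub>R blade (sym_diff A B) else 0)"
    by (intro sum.cong refl) auto
  finally show ?thesis by simp
qed

lemma clifford_expand: "a = (\<Sum>A\<in>UNIV. a $ A *\<^sub>R blade A)" for a :: "'i::finite clifford"
proof (rule vec_eq_iff[THEN iffD2], intro allI)
  fix B
  have "(\<Sum>A\<in>UNIV. a $ A *\<^sub>R blade A) $ B = (\<Sum>A\<in>UNIV. if B = A then a $ A else 0)"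
    unfolding sum_component by (intro sum.cong refl) (auto simp: blade_def axis_def)
  then show "a $ B = (\<Sum>A\<in>UNIV. a $ A *\<^sub>R blade A) $ B"
    by (simp only: sum.delta' finite UNIV_I if_True)
qed

lemma cmult_assoc: "(a \<odot> b) \<odot> c = a \<odot> (b \<odot> c)"
proof -
  have lin: "linear (\<lambda>x. x \<odot> y)" "linear ((\<odot>) y)" for y :: "'a clifford"
    using bilinear_cmult by (auto simp: bilinear_def)
  have assoc: "(blade A \<odot> blade B) \<odot> blade C = blade A \<odot> (blade B \<odot> blade C)" for A B C :: "'a set"
  proof -
    have "sym_diff (sym_diff A B) C = sym_diff A (sym_diff B C)" by blast
    then show ?thesis
      by (simp add: blade_mult linear_scale[OF lin(1)] linear_scale[OF lin(2)]
          blade_sign_sym_diff_left blade_sign_sym_diff_right)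
  qed
  note l = linear_sum[OF lin(1)] linear_sum[OF lin(2)]
    linear_scale[OF lin(1)] linear_scale[OF lin(2)]
  show ?thesis
    apply (subst (1 2) clifford_expand[of a])
    apply (subst (1 2) clifford_expand[of b])
    apply (subst (1 2) clifford_expand[of c])
    apply (simp only: l assoc)
    done
qed

lemma cunit_mult [simp]: "cunit \<odot> a = a" "a \<odot> cunit = a"
proof -
  have lin: "linear (\<lambda>x. x \<odot> y)" "linear ((\<odot>) y)" for y :: "'a clifford"
    using bilinear_cmult by (auto simp: bilinear_def)
  have b: "cunit \<odot> blade A = blade A" "blade A \<odot> cunit = blade A" for A :: "'a set"
    by (simp_all add: cunit_def blade_mult blade_sign_def)
  show "cunit \<odot> a = a" "a \<odot> cunit = a"
    by (subst (1 2) clifford_expand[of a];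
        simp only: linear_sum[OF lin(1)] linear_sum[OF lin(2)]
          linear_scale[OF lin(1)] linear_scale[OF lin(2)] b)+
qed

lemma gen_relations:
  "gen i \<odot> gen j + gen j \<odot> gen i = (if i = j then - 2 else 0) *\<^sub>R cunit"
proof (cases "i = j")
  case True
  then show ?thesis
    by (simp add: gen_def blade_mult blade_sign_def cunit_def vec_eq_iff)
next
  case False
  then have "sym_diff {i} {j} = sym_diff {j} {i}" by blast
  with False show ?thesis
    by (auto simp: gen_def blade_mult blade_sign_def)
qed

lemma blade_insert_less:
  assumes "\<And>a. a \<in> A \<Longrightarrow> i < a"
  shows "blade (insert i A) = gen i \<odot> blade A"
proof -
  have "i \<notin> A" using assms by blast
  then have "sym_diff {i} A = insert i A" by blast
  moreover have "blade_sign {i} A = 1"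
    using assms by (force simp: blade_sign_def intro!: prod.neutral)
  ultimately show ?thesis
    by (simp add: gen_def blade_mult)
qed

lemma reversion_blade: "reversion (blade A) = (- 1) ^ (card A choose 2) *\<^sub>R blade A"
proof -
  have "reversion (blade A) = (\<Sum>B\<in>UNIV. if B = A then (- 1) ^ (card A choose 2) *\<^sub>R blade A else 0)"
    unfolding reversion_def by (intro sum.cong refl) (auto simp: blade_def axis_def)
  then show ?thesis by simp
qed

lemma linear_reversion: "linear reversion"
  unfolding reversion_def
  by (intro linearI) (simp_all add: algebra_simps sum.distrib scaleR_sum_right)

lemma reversion_cvec: "reversion (cvec x) = cvec x"
  by (simp add: cvec_def linear_sum[OF linear_reversion] linear_scale[OF linear_reversion]
      gen_def reversion_blade numeral_2_eq_2)

lemma blade_sign_swap: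
  fixes A B :: "'i::{finite,linorder} set"
  shows "blade_sign A B * blade_sign B A = (- 1) ^ (card A * card B + card (A \<inter> B))"
proof -
  have "blade_sign A B * blade_sign B A
      = (\<Prod>a\<in>A. \<Prod>b\<in>B. (if b \<le> a then - 1 else 1) * (if a \<le> b then - 1 else 1))"
    by (subst (2) blade_sign_def, subst prod.swap) (simp add: blade_sign_def prod.distrib)
  also have "\<dots> = (\<Prod>a\<in>A. \<Prod>b\<in>B. - 1 * (if b = a then - 1 else (1::real)))"
    by (intro prod.cong refl) auto
  also have "\<dots> = (\<Prod>a\<in>A. (- 1) ^ card B * (if a \<in> B then - 1 else (1::real)))"
    by (intro prod.cong refl, subst prod.distrib) (simp add: prod.delta)
  also have "\<dots> = ((- 1) ^ card B) ^ card A * (\<Prod>a\<in>A. if a \<in> B then - 1 else (1::real))"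
    by (simp add: prod.distrib)
  also have "(\<Prod>a\<in>A. if a \<in> B then - 1 else (1::real)) = (- 1) ^ card (A \<inter> B)"
    by (simp add: prod.If_cases Int_def)
  finally show ?thesis
    by (simp add: power_add power_mult[symmetric] mult.commute)
qed

lemma reversion_mult: "reversion (a \<odot> b) = reversion b \<odot> reversion a"
proof -
  have lin: "linear (\<lambda>x. x \<odot> y)" "linear ((\<odot>) y)" for y :: "'a clifford"
    using bilinear_cmult by (auto simp: bilinear_def)
  have bl: "reversion (blade A \<odot> blade B) = reversion (blade B) \<odot> reversion (blade A)"
    for A B :: "'a set"
  proof -
    define m p q where "m = card (A \<inter> B)" and "p = card (A - B)" and "q = card (B - A)"
    have cA: "card A = p + m" and cB: "card B = q + m"
      unfolding m_def p_def q_def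
      by (metis Int_commute add.commute card_Int_Diff finite)+
    have cS: "card (sym_diff A B) = p + q"
      unfolding p_def q_def by (intro card_Un_disjoint) auto
    have ch: "(x + y choose 2) = (x choose 2) + (y choose 2) + x * y" for x y :: nat
      by (induction x) (auto simp: numeral_2_eq_2)
    have ev: "even ((p + m) * (q + m) + m + (p + q choose 2) + (p + m choose 2) + (q + m choose 2))"
      unfolding ch by (simp add: algebra_simps)
    have sq: "blade_sign A B * blade_sign A B = 1"
      unfolding blade_sign_def prod.distrib[symmetric] by (intro prod.neutral ballI) auto
    have "blade_sign B A = blade_sign A B * (blade_sign A B * blade_sign B A)"
      using sq by (metis mult.assoc mult_1)
    then have sw: "blade_sign B A = blade_sign A B * (- 1) ^ ((p + m) * (q + m) + m)"
      by (simp add: blade_sign_swap cA cB m_def)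
    have sg: "(- 1) ^ (p + q choose 2)
        = (- 1) ^ ((p + m) * (q + m) + m) * ((- 1) ^ (p + m choose 2) * (- 1 :: real) ^ (q + m choose 2))"
      using ev unfolding power_add[symmetric] minus_one_power_iff by auto
    have "sym_diff B A = sym_diff A B" by blast
    then show ?thesis
      by (simp add: blade_mult reversion_blade linear_scale[OF linear_reversion]
          linear_scale[OF lin(1)] linear_scale[OF lin(2)] cA cB cS sw sg mult_ac)
  qed
  note l = linear_sum[OF lin(1)] linear_sum[OF lin(2)] linear_sum[OF linear_reversion]
    linear_scale[OF lin(1)] linear_scale[OF lin(2)] linear_scale[OF linear_reversion]
  have "reversion (a \<odot> b) = (\<Sum>A\<in>UNIV. \<Sum>B\<in>UNIV. (a $ A * b $ B) *\<^sub>R reversion (blade A \<odot> blade B))"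
    apply (subst clifford_expand[of a])
    apply (subst clifford_expand[of b])
    apply (simp only: l scaleR_sum_right scaleR_scaleR)
    apply (subst sum.swap)
    apply (simp only: mult.commute)
    done
  also have "\<dots> = (\<Sum>B\<in>UNIV. \<Sum>A\<in>UNIV. (b $ B * a $ A) *\<^sub>R (reversion (blade B) \<odot> reversion (blade A)))"
    by (subst sum.swap) (simp add: bl mult.commute)
  also have "\<dots> = reversion b \<odot> reversion a"
    apply (subst (2) clifford_expand[of b])
    apply (subst (2) clifford_expand[of a])
    apply (simp only: l scaleR_sum_right scaleR_scaleR)
    apply (subst sum.swap)
    apply (simp only: mult.commute)
    done
  finally show ?thesis .
qed

text \<open>
  \<open>\<real>\<^sup>n\<close> is \<open>real ^ 'n\<close> and \<open>\<real>\<^sup>n\<^sup>+\<^sup>1\<close> is \<open>real ^ 'n option\<close>: the index \<open>Some j\<close> stands for \<open>j\<close> and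
  \<open>None\<close> for \<open>n + 1\<close>.  (In the order on \<^typ>\<open>'n option\<close> the extra index comes first; this
  only permutes the labels of the orthonormal basis.)
\<close>

definition cvec_n :: "(real, 'n) vec \<Rightarrow> 'n::finite option clifford" where
  "cvec_n u = (\<Sum>j\<in>UNIV. u $ j *\<^sub>R gen (Some j))"

definition partial_diff :: "'j::finite \<Rightarrow> ((real, 'j) vec \<Rightarrow> 'b::real_normed_vector) \<Rightarrow> (real, 'j) vec \<Rightarrow> 'b" where
  "partial_diff j p u = frechet_derivative p (at u) (axis j 1)"

definition dirac_left ::
  "((real, 'n) vec \<Rightarrow> 'n::{finite,linorder} option clifford) \<Rightarrow> (real, 'n) vec \<Rightarrow> 'n option clifford" where
  "dirac_left p u = (\<Sum>j\<in>UNIV. gen (Some j) \<odot> partial_diff j p u)"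

definition dirac_right ::
  "((real, 'n) vec \<Rightarrow> 'n::{finite,linorder} option clifford) \<Rightarrow> (real, 'n) vec \<Rightarrow> 'n option clifford" where
  "dirac_right p u = (\<Sum>j\<in>UNIV. partial_diff j p u \<odot> gen (Some j))"

definition hom_polys :: "int \<Rightarrow> ('a::real_normed_vector \<Rightarrow> 'b::real_normed_vector) set" where
  "hom_polys k = (if k < 0 then {\<lambda>_. 0} else
     {p. polynomial_function p \<and> (\<forall>t u. p (t *\<^sub>R u) = t ^ nat k *\<^sub>R p u)})"

definition harmonic_polys :: "int \<Rightarrow> ((real, 'n::finite) vec \<Rightarrow> 'n option clifford) set" where
  "harmonic_polys k =
     {p \<in> hom_polys k. \<forall>u. (\<Sum>j\<in>UNIV. partial_diff j (partial_diff j p) u) = 0}"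

definition monogenics_left :: "int \<Rightarrow> ((real, 'n::{finite,linorder}) vec \<Rightarrow> 'n option clifford) set" where
  "monogenics_left k = {p \<in> hom_polys k. \<forall>u. dirac_left p u = 0}"

definition monogenics_right :: "int \<Rightarrow> ((real, 'n::{finite,linorder}) vec \<Rightarrow> 'n option clifford) set" where
  "monogenics_right k = {p \<in> hom_polys k. \<forall>u. dirac_right p u = 0}"

definition proj_left :: "int \<Rightarrow> ((real, 'n::{finite,linorder}) vec \<Rightarrow> 'n option clifford)
    \<Rightarrow> ((real, 'n) vec \<Rightarrow> 'n option clifford)" where
  "proj_left k = (\<lambda>h\<in>harmonic_polys k. THE p. p \<in> monogenics_left k \<and>
     (\<exists>q\<in>monogenics_left (k - 1). h = (\<lambda>u. p u + cvec_n u \<odot> q u)))"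

definition proj_right :: "int \<Rightarrow> ((real, 'n::{finite,linorder}) vec \<Rightarrow> 'n option clifford)
    \<Rightarrow> ((real, 'n) vec \<Rightarrow> 'n option clifford)" where
  "proj_right k = (\<lambda>h\<in>harmonic_polys k. THE p. p \<in> monogenics_right k \<and>
     (\<exists>q\<in>monogenics_right (k - 1). h = (\<lambda>u. p u + q u \<odot> cvec_n u)))"

text \<open>
  Functions on the sphere are differentiated by means of their extension that is constant on
  rays.  The operators below only involve vector fields tangent to the sphere, so that the
  choice of the extension is immaterial; and a function on an open subset of the sphere is
  \<open>C\<^sup>1\<close> iff this extension is \<open>C\<^sup>1\<close>.
\<close>

definition radial_ext :: "('a::real_normed_vector \<Rightarrow> 'b) \<Rightarrow> 'a \<Rightarrow> 'b" where
  "radial_ext \<phi> y = \<phi> (y /\<^sub>R norm y)"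

definition C1_on :: "'a::real_normed_vector set \<Rightarrow> ('a \<Rightarrow> 'b::real_normed_vector) \<Rightarrow> bool" where
  "C1_on S F \<longleftrightarrow> (\<exists>F'. (\<forall>x\<in>S. (F has_derivative blinfun_apply (F' x)) (at x)) \<and> continuous_on S F')"

definition C1_space :: "'a::real_normed_vector set \<Rightarrow>
    ('c::real_normed_vector \<Rightarrow> 'b::real_normed_vector) set \<Rightarrow> ('a \<Rightarrow> 'c \<Rightarrow> 'b) set" where
  "C1_space U M = {f. C1_on {(y, u). y \<noteq> 0 \<and> y /\<^sub>R norm y \<in> U} (\<lambda>(y, u). radial_ext f y u)
     \<and> (\<forall>x\<in>U. f x \<in> M)}"

definition sph_Lambda :: "((real, 'i) vec \<Rightarrow> 'i clifford) \<Rightarrow> (real, 'i) vec \<Rightarrow> 'i::{finite,linorder} clifford" where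
  "sph_Lambda \<phi> x = (\<Sum>(i, j) | i < j. gen i \<odot> gen j \<odot>
     (x $ i *\<^sub>R partial_diff j (radial_ext \<phi>) x - x $ j *\<^sub>R partial_diff i (radial_ext \<phi>) x))"

definition sph_dirac :: "(real ^ 'n option \<Rightarrow> 'n option clifford) \<Rightarrow> real ^ 'n option
    \<Rightarrow> 'n::{finite,linorder} option clifford" where
  "sph_dirac \<phi> x = - (cvec x \<odot> (sph_Lambda \<phi> x + (real CARD('n) / 2) *\<^sub>R \<phi> x))"

definition sph_dirac_right :: "(real ^ 'n option \<Rightarrow> 'n option clifford) \<Rightarrow> real ^ 'n option
    \<Rightarrow> 'n::{finite,linorder} option clifford" where
  "sph_dirac_right \<phi> x = reversion (sph_dirac (\<lambda>y. reversion (\<phi> y)) x)"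

definition RS_left :: "int \<Rightarrow> (real ^ 'n option \<Rightarrow> (real, 'n) vec \<Rightarrow> 'n option clifford)
    \<Rightarrow> real ^ 'n option \<Rightarrow> (real, 'n) vec \<Rightarrow> 'n::{finite,linorder} option clifford" where
  "RS_left k f x = proj_left k (\<lambda>u. sph_dirac (\<lambda>y. f y u) x)"

definition RS_right :: "int \<Rightarrow> (real ^ 'n option \<Rightarrow> (real, 'n) vec \<Rightarrow> 'n option clifford)
    \<Rightarrow> real ^ 'n option \<Rightarrow> (real, 'n) vec \<Rightarrow> 'n::{finite,linorder} option clifford" where
  "RS_right k g x = proj_right k (\<lambda>u. sph_dirac_right (\<lambda>y. g y u) x)"

text \<open>
  Lebesgue measure on the coordinate subspace spanned by a set \<open>B\<close> of basis vectors; for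
  \<open>B = Basis\<close> this is the library's definition of \<^const>\<open>lborel\<close>, for \<open>B = {}\<close> the point mass
  at \<open>0\<close>.
\<close>

definition lborel_span :: "'a set \<Rightarrow> 'a::euclidean_space measure" where
  "lborel_span B = distr (\<Pi>\<^sub>M b\<in>B. lborel) borel (\<lambda>c. \<Sum>b\<in>B. c b *\<^sub>R b)"

definition dir_deriv :: "('a::real_normed_vector \<Rightarrow> 'b::real_normed_vector) \<Rightarrow> 'a \<Rightarrow> 'a \<Rightarrow> 'b" where
  "dir_deriv \<phi> b t = vector_derivative (\<lambda>s. \<phi> (t + s *\<^sub>R b)) (at (0::real))"

definition gram_det :: "'a set \<Rightarrow> ('a::euclidean_space \<Rightarrow> 'a) \<Rightarrow> 'a \<Rightarrow> real" where
  "gram_det B \<phi> t = (\<Sum>\<pi> | \<pi> permutes B.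
     of_int (sign \<pi>) * (\<Prod>b\<in>B. dir_deriv \<phi> b t \<bullet> dir_deriv \<phi> (\<pi> b) t))"

text \<open>
  Regular local parametrizations of a \<open>d\<close>-dimensional \<open>C\<^sup>1\<close> submanifold \<open>M\<close>.  The parameter domain
  \<open>\<Omega>\<close> is an open subset of a \<open>d\<close>-dimensional coordinate subspace rather than of a type of
  dimension \<open>d\<close>; this includes \<open>d = 0\<close>.
\<close>

definition local_param ::
  "nat \<Rightarrow> 'a::euclidean_space set \<Rightarrow> 'a set \<Rightarrow> 'a set \<Rightarrow> ('a \<Rightarrow> 'a) \<Rightarrow> bool" where
  "local_param d M B \<Omega> \<phi> \<longleftrightarrow>
     B \<subseteq> Basis \<and> card B = d \<and>
     openin (top_of_set (span B)) \<Omega> \<and> openin (top_of_set M) (\<phi> ` \<Omega>) \<and>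
     (\<exists>\<psi>. homeomorphism \<Omega> (\<phi> ` \<Omega>) \<phi> \<psi>) \<and>
     (\<forall>b\<in>B. (\<forall>t\<in>\<Omega>. (\<lambda>s. \<phi> (t + s *\<^sub>R b)) differentiable at (0::real)) \<and>
              continuous_on \<Omega> (dir_deriv \<phi> b)) \<and>
     (\<forall>t\<in>\<Omega>. gram_det B \<phi> t \<noteq> 0)"

text \<open>
  On an embedded \<open>d\<close>-dimensional \<open>C\<^sup>1\<close> submanifold \<open>M\<close> there is exactly one measure with the
  following property, its (Riemannian) \<open>d\<close>-dimensional Lebesgue measure; here it is regarded as a
  measure on the ambient space that is concentrated on \<open>M\<close>.
\<close>

definition is_lebesgue_measure_on :: "nat \<Rightarrow> 'a::euclidean_space set \<Rightarrow> 'a measure \<Rightarrow> bool" where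
  "is_lebesgue_measure_on d M \<mu> \<longleftrightarrow>
     sets \<mu> = sets borel \<and> emeasure \<mu> (- M) = 0 \<and>
     (\<forall>B \<Omega> \<phi> E. local_param d M B \<Omega> \<phi> \<longrightarrow> E \<in> sets borel \<longrightarrow> E \<subseteq> \<Omega> \<longrightarrow>
        emeasure \<mu> (\<phi> ` E) = (\<integral>\<^sup>+ t\<in>E. ennreal (sqrt (gram_det B \<phi> t)) \<partial>lborel_span B))"

definition u_pairing :: "((real, 'n) vec) measure \<Rightarrow> ((real, 'n) vec \<Rightarrow> 'n option clifford)
    \<Rightarrow> ((real, 'n) vec \<Rightarrow> 'n option clifford) \<Rightarrow> 'n::{finite,linorder} option clifford" where
  "u_pairing ds P Q = (LINT u:sphere 0 1|ds. P u \<odot> Q u)"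

definition sph_domain :: "'a::euclidean_space set \<Rightarrow> bool" where
  "sph_domain U \<longleftrightarrow> openin (top_of_set (sphere 0 1)) U \<and> connected U \<and> U \<noteq> {}"

definition sph_boundary :: "'a::euclidean_space set \<Rightarrow> 'a set" where
  "sph_boundary V = top_of_set (sphere 0 1) frontier_of V"

text \<open>
  The boundary of \<open>V\<close> relative to the sphere is a \<open>C\<^sup>1\<close> hypersurface of the sphere and \<open>V\<close> lies
  locally on one side of it.  The last condition says that the derivative of the defining
  function does not vanish on the tangent space of the sphere.
\<close>

definition C1_boundary :: "'a::euclidean_space set \<Rightarrow> bool" where
  "C1_boundary V \<longleftrightarrow> (\<forall>p\<in>sph_boundary V. \<exists>W \<rho>. open W \<and> p \<in> W \<and> C1_on W (\<rho> :: 'a \<Rightarrow> real) \<and>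
     V \<inter> W = {x \<in> sphere 0 1 \<inter> W. \<rho> x < 0} \<and>
     sph_boundary V \<inter> W = {x \<in> sphere 0 1 \<inter> W. \<rho> x = 0} \<and>
     (\<forall>x\<in>sph_boundary V \<inter> W. \<exists>v. x \<bullet> v = 0 \<and> frechet_derivative \<rho> (at x) v \<noteq> 0))"

definition tangent_vector :: "'a::euclidean_space set \<Rightarrow> 'a \<Rightarrow> 'a \<Rightarrow> bool" where
  "tangent_vector M x \<tau> \<longleftrightarrow> (\<exists>\<gamma> :: real \<Rightarrow> 'a. \<gamma> 0 = x \<and> (\<forall>\<^sub>F t in at 0. \<gamma> t \<in> M) \<and>
     (\<gamma> has_vector_derivative \<tau>) (at 0))"

definition outward_unit_normal :: "'a::euclidean_space set \<Rightarrow> 'a \<Rightarrow> 'a \<Rightarrow> bool" where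
  "outward_unit_normal V x \<nu> \<longleftrightarrow> norm \<nu> = 1 \<and> tangent_vector (sphere 0 1) x \<nu> \<and>
     (\<forall>\<tau>. tangent_vector (sph_boundary V) x \<tau> \<longrightarrow> \<nu> \<bullet> \<tau> = 0) \<and>
     (\<forall>\<^sub>F t in at_right 0. sgn (x - t *\<^sub>R \<nu>) \<in> V \<and> sgn (x + t *\<^sub>R \<nu>) \<notin> V)"

end

theory Submission
  imports Defs
begin

text \<open>
  Write \<open>L\<^sub>i\<^sub>j = x\<^sub>i \<partial>\<^sub>j - x\<^sub>j \<partial>\<^sub>i\<close>.  Surface measure on the sphere is determined by its charts, hence
  rotation invariant, so \<open>L\<^sub>i\<^sub>j h\<close> has integral \<open>0\<close> over the whole sphere for every \<open>h\<close> of class \<open>C\<^sup>1\<close>.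
  Applied to \<open>h = \<eta> (m \<rho>) G\<close>, where \<open>\<rho>\<close> is a local defining function of \<open>V\<close>, \<open>G\<close> has small support and
  \<open>\<eta> (m \<rho>)\<close> increases to the indicator of \<open>V\<close> as \<open>m \<rightarrow> \<infinity>\<close>, this gives the flux formula
  \<open>\<integral>\<^sub>V L\<^sub>i\<^sub>j G dS = \<integral>\<^sub>\<partial>\<^sub>V (x\<^sub>i \<nu>\<^sub>j - x\<^sub>j \<nu>\<^sub>i) G d\<Sigma>\<close>: the layer where \<open>\<eta> (m \<rho>)\<close> varies collapses onto \<open>\<partial>V\<close>.
  Only first derivatives of \<open>\<rho>\<close> occur, so a boundary of class \<open>C\<^sup>1\<close> is enough.  A partition of unity
  removes the condition on the support, and \<open>\<Sum>\<^sub>i L\<^sub>i\<^sub>j (x\<^sub>i F) = \<partial>\<^sub>j F - n x\<^sub>j F\<close> for \<open>F\<close> homogeneous of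
  degree \<open>0\<close> turns the flux formula into the divergence theorem on the sphere.

  Since \<open>D\<^sub>s = \<Sum>\<^sub>j e\<^sub>j (\<partial>\<^sub>j - n/2 x\<^sub>j)\<close> on such functions, the divergence theorem for
  \<open>(g, e\<^sub>j f)\<^sub>u\<close> is Stokes' formula without the projections.  These may be inserted because
  \<open>\<H>\<^sub>k = \<M>\<^sub>k \<oplus> u \<M>\<^sub>k\<^sub>-\<^sub>1\<close> and \<open>(g, u q)\<^sub>u = 0\<close> for right monogenic \<open>g\<close> and left monogenic \<open>q\<close>, which is once
  more the vanishing of the integrals of \<open>L\<^sub>i\<^sub>j\<close>, now over the unit sphere of \<open>\<real>\<^sup>n\<close>.
\<close>

section \<open>Local parametrizations and their measures\<close>

text \<open>The measures are known only through their values on images of charts, so finiteness,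
  integrals and invariance under isometries all have to be read off charts. Integration by parts
  inside a chart would differentiate its volume density, which is merely continuous for a boundary
  of class C1; differentiating a rotation-invariant integral in the angle avoids this. The second
  obstacle is the variable \<open>u\<close>. Being C1 in \<open>(x, u)\<close> jointly gives no
  mixed derivatives, yet \<open>proj_left\<close> and \<open>proj_right\<close> are specified on
  harmonic polynomials only, so applying the spherical Dirac operator must be shown to stay among
  them. This, and the exchange of derivatives in \<open>x\<close> with the integral over
  \<open>u\<close>, is settled by interpolation: for fixed nodes \<open>a j\<close> and weights
  \<open>l j\<close> every homogeneous polynomial of degree \<open>k\<close> is the sum of the
  \<open>l j u *\<^sub>R p (a j)\<close>. The pairing thereby becomes a finite bilinear expression
  in C1 functions of \<open>x\<close>.\<close>

lemma linear_blinfun: "linear (blinfun_apply A)"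
  by (simp add: bounded_linear.linear blinfun.bounded_linear_right)

lemma axis_expansion: "(\<Sum>j\<in>UNIV. x $ j *\<^sub>R axis j 1) = (x :: real ^ 'm::finite)"
  by (simp add: basis_expansion flip: scalar_mult_eq_scaleR)

lemma linear_axis_sum:
  fixes F :: "real ^ 'm::finite \<Rightarrow> 'b::real_vector"
  assumes "linear F"
  shows "F x = (\<Sum>j\<in>UNIV. x $ j *\<^sub>R F (axis j 1))"
  using arg_cong[OF axis_expansion[of x, symmetric], of F]
  by (simp add: linear_sum[OF assms] linear_scale[OF assms])

lemma continuous_on_compact_bound:
  fixes f :: "'a::topological_space \<Rightarrow> 'b::real_normed_vector"
  assumes "compact K" "continuous_on K f"
  obtains C where "\<And>x. x \<in> K \<Longrightarrow> norm (f x) \<le> C"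
  using compact_imp_bounded[OF compact_continuous_image[OF assms(2,1)]] unfolding bounded_iff by blast

lemma set_integral_cong_on:
  fixes h h' :: "'a \<Rightarrow> 'b::{banach, second_countable_topology}"
  assumes "\<And>x. x \<in> A \<Longrightarrow> h x = h' x"
  shows "(LINT x:A|M. h x) = (LINT x:A|M. h' x)"
  unfolding set_lebesgue_integral_def
  by (intro Bochner_Integration.integral_cong refl) (use assms in \<open>auto simp: indicator_def\<close>)

text \<open>Placed as a block next to an identity matrix, the Gram matrix over \<open>I\<close> gets
  the full size of the index type, where \<open>det\<close> and its product rule are available. A
  permutation that moves an index outside \<open>I\<close> meets an off-diagonal zero, so the
  enlargement changes nothing.\<close>

lemma gram_det_axis:
  fixes \<phi> :: "real ^ 'm \<Rightarrow> real ^ 'm" and I :: "'m::finite set" and t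
  defines "v \<equiv> \<lambda>i. dir_deriv \<phi> (axis i 1) t"
  shows "gram_det ((\<lambda>i. axis i 1) ` I) \<phi> t
    = det (\<chi> i j. if i \<in> I \<and> j \<in> I then v i \<bullet> v j else if i = j then 1 else 0)"
proof -
  define A :: "real^'m^'m" where "A = (\<chi> i j. if i \<in> I \<and> j \<in> I then v i \<bullet> v j else if i = j then 1 else 0)"
  let ?a = "\<lambda>i::'m. axis i (1::real)"
  have inj: "inj_on ?a J" for J
    by (auto simp: inj_on_def axis_eq_axis)
  have "det A = (\<Sum>p | p permutes I. of_int (sign p) * (\<Prod>i\<in>UNIV. A $ i $ p i))"
    unfolding det_def
  proof (rule sum.mono_neutral_right)
    show "{p. p permutes I} \<subseteq> {p. p permutes (UNIV::'m set)}"
      using permutes_subset by blast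
    show "\<forall>p\<in>{p. p permutes (UNIV::'m set)} - {p. p permutes I}. of_int (sign p) * (\<Prod>i\<in>UNIV. A $ i $ p i) = 0"
    proof
      fix p assume p: "p \<in> {p. p permutes (UNIV::'m set)} - {p. p permutes I}"
      then have "\<exists>i. i \<notin> I \<and> p i \<noteq> i"
        by (metis (mono_tags, lifting) DiffE mem_Collect_eq permutes_superset permutes_subset UNIV_I DiffD2 permutes_def)
      then obtain i where "i \<notin> I" "p i \<noteq> i" by blast
      then have "A $ i $ p i = 0" by (auto simp: A_def)
      then show "of_int (sign p) * (\<Prod>i\<in>UNIV. A $ i $ p i) = 0"
        by (metis finite UNIV_I mult_zero_right prod_zero)
    qed
  qed auto
  also have "\<dots> = (\<Sum>p | p permutes I. of_int (sign p) * (\<Prod>i\<in>I. v i \<bullet> v (p i)))"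
  proof (rule sum.cong[OF refl])
    fix p assume "p \<in> {p. p permutes I}"
    then have p: "p permutes I" by simp
    have "(\<Prod>i\<in>UNIV. A $ i $ p i) = (\<Prod>i\<in>I. A $ i $ p i)"
      by (rule prod.mono_neutral_right) (use p in \<open>auto simp: A_def permutes_not_in\<close>)
    also have "\<dots> = (\<Prod>i\<in>I. v i \<bullet> v (p i))"
      by (rule prod.cong) (use p in \<open>auto simp: A_def permutes_in_image\<close>)
    finally show "of_int (sign p) * (\<Prod>i\<in>UNIV. A $ i $ p i) = of_int (sign p) * (\<Prod>i\<in>I. v i \<bullet> v (p i))"
      by simp
  qed
  also have "\<dots> = gram_det (?a ` I) \<phi> t"
    unfolding gram_det_def
  \<comment> \<open>Conjugation by \<open>axis\<close> matches permutations of indices with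
    permutations of basis vectors and preserves signs.\<close>
  proof (rule sum.reindex_bij_witness[where j = "map_permutation I ?a" and i = "map_permutation (?a ` I) (inv_into I ?a)"])
    fix p assume "p \<in> {p. p permutes I}"
    then have p: "p permutes I" by simp
    show "map_permutation (?a ` I) (inv_into I ?a) (map_permutation I ?a p) = p"
      by (rule map_permutation_compose_inv[OF _ p]) (auto simp: bij_betw_def inj inv_into_f_f[OF inj])
    show "map_permutation I ?a p \<in> {\<pi>. \<pi> permutes ?a ` I}"
      using map_permutation_permutes[OF _ p] inj by (auto simp: bij_betw_def)
    have "(\<Prod>b\<in>?a ` I. dir_deriv \<phi> b t \<bullet> dir_deriv \<phi> (map_permutation I ?a p b) t) = (\<Prod>i\<in>I. v i \<bullet> v (p i))"
      by (subst prod.reindex[OF inj]) (simp add: map_permutation_apply[OF inj] v_def)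
    then show "of_int (sign (map_permutation I ?a p)) *
        (\<Prod>b\<in>?a ` I. dir_deriv \<phi> b t \<bullet> dir_deriv \<phi> (map_permutation I ?a p b) t)
        = of_int (sign p) * (\<Prod>i\<in>I. v i \<bullet> v (p i))"
      using sign_map_permutation[OF inj p] by simp
  next
    fix \<pi> assume "\<pi> \<in> {\<pi>. \<pi> permutes ?a ` I}"
    then have p: "\<pi> permutes ?a ` I" by simp
    have b: "bij_betw (inv_into I ?a) (?a ` I) I"
      using inj by (simp add: bij_betw_inv_into bij_betw_def inj_on_inv_into)
    show "map_permutation (?a ` I) (inv_into I ?a) \<pi> \<in> {p. p permutes I}"
      using map_permutation_permutes[OF b p] by simp
    show "map_permutation I ?a (map_permutation (?a ` I) (inv_into I ?a) \<pi>) = \<pi>"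
      by (rule map_permutation_compose_inv[OF b p]) (auto simp: inv_into_f_f[OF inj])
  qed
  finally show ?thesis by (simp add: A_def)
qed

text \<open>Once the tangent vectors are completed by orthonormal vectors \<open>w\<close>
  orthogonal to them, the block matrix is \<open>A ** transpose A\<close>, so the Gram determinant
  is a square. Written as determinants, the densities of nested charts can be compared by linear
  algebra.\<close>

lemma sqrt_gram_det_axis:
  fixes \<phi> :: "real ^ 'm \<Rightarrow> real ^ 'm" and I :: "'m::finite set" and t
  defines "v \<equiv> \<lambda>i. dir_deriv \<phi> (axis i 1) t"
  assumes "\<And>i j. i \<in> I \<Longrightarrow> j \<notin> I \<Longrightarrow> v i \<bullet> w j = 0"
    and "\<And>i j. i \<notin> I \<Longrightarrow> j \<notin> I \<Longrightarrow> w i \<bullet> w j = (if i = j then 1 else 0)"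
  shows "sqrt (gram_det ((\<lambda>i. axis i 1) ` I) \<phi> t) = \<bar>det (\<chi> i. if i \<in> I then v i else w i)\<bar>"
proof -
  let ?A = "(\<chi> i. if i \<in> I then v i else w i) :: real^'m^'m"
  have "(\<chi> i j. if i \<in> I \<and> j \<in> I then v i \<bullet> v j else if i = j then 1 else 0) = ?A ** transpose ?A"
    using assms(2,3)
    by (auto simp: vec_eq_iff matrix_matrix_mult_def transpose_def inner_vec_def mult.commute)
  moreover have "gram_det ((\<lambda>i. axis i 1) ` I) \<phi> t
      = det (\<chi> i j. if i \<in> I \<and> j \<in> I then v i \<bullet> v j else if i = j then 1 else 0)"
    unfolding gram_det_axis v_def ..
  ultimately have "gram_det ((\<lambda>i. axis i 1) ` I) \<phi> t = (det ?A)\<^sup>2"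
    by (simp only: det_mul det_transpose power2_eq_square)
  then show ?thesis by simp
qed

text \<open>A kernel vector \<open>y\<close> of the block matrix gives a combination
  \<open>z\<close> of the images under \<open>D\<close> with \<open>z \<bullet> z = 0\<close>;
  injectivity of \<open>D\<close> then forces \<open>y = 0\<close>.\<close>

lemma gram_det_axis_nonzero:
  fixes \<phi> D :: "real ^ 'm \<Rightarrow> real ^ 'm" and I :: "'m::finite set"
  assumes "linear D" "inj D" "\<And>i. i \<in> I \<Longrightarrow> dir_deriv \<phi> (axis i 1) t = D (axis i 1)"
  shows "gram_det ((\<lambda>i. axis i 1) ` I) \<phi> t \<noteq> 0"
proof -
  define v where "v i = D (axis i 1)" for i
  define A :: "real^'m^'m" where "A = (\<chi> i j. if i \<in> I \<and> j \<in> I then v i \<bullet> v j else if i = j then 1 else 0)"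
  have A: "A = (\<chi> i j. if i \<in> I \<and> j \<in> I then dir_deriv \<phi> (axis i 1) t \<bullet> dir_deriv \<phi> (axis j 1) t else if i = j then 1 else 0)"
    by (auto simp: A_def v_def vec_eq_iff assms(3))
  have "y = 0" if "A *v y = 0" for y
  proof -
    have eq: "(A *v y) $ i = (if i \<in> I then v i \<bullet> (\<Sum>j\<in>I. y $ j *\<^sub>R v j) else y $ i)" for i
    proof (cases "i \<in> I")
      case True
      then have "(A *v y) $ i = (\<Sum>j\<in>UNIV. if j \<in> I then y $ j * (v i \<bullet> v j) else 0)"
        by (auto simp: matrix_vector_mult_def A_def intro!: sum.cong)
      also have "\<dots> = (\<Sum>j\<in>I. y $ j * (v i \<bullet> v j))"
        by (simp add: sum.If_cases)
      finally show ?thesis using True by (simp add: inner_sum_right)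
    next
      case False
      have "(A *v y) $ i = (\<Sum>j\<in>UNIV. A $ i $ j * y $ j)"
        by (simp add: matrix_vector_mult_def)
      also have "\<dots> = (\<Sum>j\<in>UNIV. if i = j then y $ j else 0)"
        by (rule sum.cong) (use False in \<open>auto simp: A_def\<close>)
      also have "\<dots> = y $ i" by simp
      finally show ?thesis using False by simp
    qed
    have out: "y $ i = 0" if "i \<notin> I" for i
      using eq[of i] that \<open>A *v y = 0\<close> by simp
    define z where "z = (\<Sum>j\<in>I. y $ j *\<^sub>R v j)"
    have "v i \<bullet> z = 0" if "i \<in> I" for i
      using eq[of i] that \<open>A *v y = 0\<close> by (simp add: z_def)
    then have "z \<bullet> z = 0"
      by (subst (1) z_def) (simp add: inner_sum_left)
    then have "z = 0" by simp
    have "z = D (\<Sum>j\<in>I. y $ j *\<^sub>R axis j 1)"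
      by (simp add: z_def v_def linear_sum[OF assms(1)] linear_scale[OF assms(1)])
    also have "(\<Sum>j\<in>I. y $ j *\<^sub>R axis j 1) = (\<Sum>j\<in>UNIV. y $ j *\<^sub>R axis j (1::real))"
      by (rule sum.mono_neutral_left) (auto simp: out)
    also have "(\<Sum>j\<in>UNIV. y $ j *\<^sub>R axis j (1::real)) = y"
      by (rule axis_expansion)
    finally have "D y = D 0" using \<open>z = 0\<close> linear_0[OF assms(1)] by simp
    then show ?thesis using assms(2) by (auto dest: injD)
  qed
  then have "inj ((*v) A)"
    using linear_injective_0[of "(*v) A"] by auto
  then have "det A \<noteq> 0"
    by (simp add: invertible_det_nz[symmetric] invertible_left_inverse matrix_left_invertible_injective)
  then show ?thesis by (simp add: gram_det_axis A)
qed

section \<open>Integration over a single chart\<close>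

lemma sets_lborel_span [simp, measurable_cong]: "sets (lborel_span B) = sets borel"
  by (simp add: lborel_span_def)

lemma space_lborel_span [simp]: "space (lborel_span B) = UNIV"
  by (simp add: lborel_span_def)

lemma borel_openin_span:
  assumes "openin (top_of_set (span B)) \<Omega>"
  shows "\<Omega> \<in> sets (borel :: 'a::euclidean_space measure)"
proof -
  obtain T where "open T" "\<Omega> = span B \<inter> T"
    using assms by (auto simp: openin_open)
  then show ?thesis
    by (auto intro!: sets.Int borel_closed borel_open closed_span)
qed

lemma borel_openin_closed:
  assumes "openin (top_of_set M) N" "closed M"
  shows "N \<in> sets (borel :: 'a::euclidean_space measure)"
proof -
  obtain T where "open T" "N = M \<inter> T"
    using assms by (auto simp: openin_open)
  then show ?thesis using assms
    by (auto intro!: sets.Int borel_closed borel_open)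
qed

lemma continuous_on_gram_det:
  assumes "\<forall>b\<in>B. continuous_on S (dir_deriv \<phi> b)"
  shows "continuous_on S (gram_det B \<phi>)"
  unfolding gram_det_def
proof (intro continuous_intros)
  fix \<pi> b assume "\<pi> \<in> {\<pi>. \<pi> permutes B}" "b \<in> B"
  then have "\<pi> b \<in> B" by (simp add: permutes_in_image)
  then show "continuous_on S (dir_deriv \<phi> (\<pi> b))" "continuous_on S (dir_deriv \<phi> b)"
    using assms \<open>b \<in> B\<close> by (auto simp: eta_contract_eq)
qed

text \<open>The defining property speaks of images of Borel sets of parameters; restated as an
  equality of measures it becomes a change of variables. The value 0 off \<open>\<Omega>\<close>
  only makes the map total: the indicator in the density removes it.\<close>

lemma local_param_measure_eq:
  fixes \<mu> :: "'a::euclidean_space measure"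
  assumes "is_lebesgue_measure_on d M \<mu>" and "closed M" and "local_param d M B \<Omega> \<phi>"
  shows "density \<mu> (indicator (\<phi> ` \<Omega>)) =
    distr (density (lborel_span B) (\<lambda>t. indicator \<Omega> t * ennreal (sqrt (gram_det B \<phi> t)))) borel
      (\<lambda>t. if t \<in> \<Omega> then \<phi> t else 0)" (is "?L = distr ?D _ ?f")
    and "(\<lambda>t. if t \<in> \<Omega> then \<phi> t else 0) \<in> borel_measurable borel"
    and "(\<lambda>t. indicator \<Omega> t *\<^sub>R sqrt (gram_det B \<phi> t)) \<in> borel_measurable borel"
    and "\<phi> ` \<Omega> \<in> sets borel" and "\<Omega> \<in> sets borel"
proof -
  have sets: "sets \<mu> = sets borel"
    using assms by (simp add: is_lebesgue_measure_on_def)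
  obtain \<psi> where hom: "homeomorphism \<Omega> (\<phi> ` \<Omega>) \<phi> \<psi>"
    using assms(3) by (auto simp: local_param_def)
  show \<Omega>: "\<Omega> \<in> sets borel"
    using assms(3) by (auto simp: local_param_def intro: borel_openin_span)
  show \<phi>\<Omega>: "\<phi> ` \<Omega> \<in> sets borel"
    using assms by (auto simp: local_param_def intro: borel_openin_closed)
  have c: "continuous_on \<Omega> \<phi>"
    using hom by (simp add: homeomorphism_def)
  have g: "continuous_on \<Omega> (\<lambda>t. sqrt (gram_det B \<phi> t))"
    using assms(3) continuous_on_gram_det[of B \<Omega> \<phi>]
    by (auto simp: local_param_def intro!: continuous_intros)
  show f: "?f \<in> borel_measurable borel"
    using borel_measurable_continuous_on_if[OF \<Omega> c, of "\<lambda>_. 0"] by simp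
  show gm: "(\<lambda>t. indicator \<Omega> t *\<^sub>R sqrt (gram_det B \<phi> t)) \<in> borel_measurable borel"
    by (rule borel_measurable_continuous_on_indicator[OF \<Omega> g])
  have gm': "(\<lambda>t. indicator \<Omega> t * ennreal (sqrt (gram_det B \<phi> t))) \<in> borel_measurable borel"
  proof -
    have "(\<lambda>t. indicator \<Omega> t * ennreal (sqrt (gram_det B \<phi> t))) = (\<lambda>t. ennreal (indicator \<Omega> t *\<^sub>R sqrt (gram_det B \<phi> t)))"
      by (auto simp: fun_eq_iff indicator_def)
    then show ?thesis using gm by simp
  qed
  show "?L = distr ?D borel ?f"
  proof (rule measure_eqI)
    show "sets ?L = sets (distr ?D borel ?f)"
      by (simp add: sets)
    fix A assume "A \<in> sets ?L"
    then have A: "A \<in> sets borel" by (simp add: sets)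
    define E where "E = ?f -` A \<inter> \<Omega>"
    have E: "E \<in> sets borel"
      using measurable_sets[OF f A] \<Omega> by (auto simp: E_def)
    have "E \<subseteq> \<Omega>" and im: "\<phi> ` E = A \<inter> \<phi> ` \<Omega>" by (auto simp: E_def)
    have "emeasure ?L A = (\<integral>\<^sup>+ x. indicator (\<phi> ` \<Omega>) x * indicator A x \<partial>\<mu>)"
      by (rule emeasure_density) (use A sets \<phi>\<Omega> in auto)
    also have "\<dots> = (\<integral>\<^sup>+ x. indicator (\<phi> ` E) x \<partial>\<mu>)"
      unfolding im by (intro nn_integral_cong) (auto simp: indicator_def)
    also have "\<dots> = emeasure \<mu> (\<phi> ` E)"
      by (rule nn_integral_indicator) (use A sets \<phi>\<Omega> im in auto)
    also have "\<dots> = (\<integral>\<^sup>+ t\<in>E. ennreal (sqrt (gram_det B \<phi> t)) \<partial>lborel_span B)"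
      using assms(1,3) E \<open>E \<subseteq> \<Omega>\<close> by (simp add: is_lebesgue_measure_on_def)
    also have "\<dots> = emeasure (distr ?D borel ?f) A"
    proof -
      have "emeasure (distr ?D borel ?f) A = emeasure ?D (?f -` A)"
        by (subst emeasure_distr) (use f A in auto)
      also have "\<dots> = (\<integral>\<^sup>+ t. indicator \<Omega> t * ennreal (sqrt (gram_det B \<phi> t)) * indicator (?f -` A) t \<partial>lborel_span B)"
        by (subst emeasure_density) (use gm' measurable_sets[OF f A] in auto)
      also have "\<dots> = (\<integral>\<^sup>+ t\<in>E. ennreal (sqrt (gram_det B \<phi> t)) \<partial>lborel_span B)"
        by (intro nn_integral_cong) (auto simp: E_def indicator_def)
      finally show ?thesis by simp
    qed
    finally show "emeasure ?L A = emeasure (distr ?D borel ?f) A" .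
  qed
qed

text \<open>Both sides integrate against one and the same transported measure. \<open>J\<close> is
  asked to be nonnegative because \<open>sqrt\<close> of a negative number is negative, while
  \<open>ennreal\<close> truncates it to 0.\<close>

lemma local_param_integral:
  fixes \<mu> :: "'a::euclidean_space measure" and h :: "'a \<Rightarrow> 'b::{banach, second_countable_topology}"
  assumes "is_lebesgue_measure_on d M \<mu>" and "closed M" and "local_param d M B \<Omega> \<phi>"
    and J: "\<And>t. t \<in> \<Omega> \<Longrightarrow> sqrt (gram_det B \<phi> t) = J t" "\<And>t. t \<in> \<Omega> \<Longrightarrow> 0 \<le> J t"
    and h: "h \<in> borel_measurable borel"
  shows "(LINT x:\<phi> ` \<Omega>|\<mu>. h x) = (LINT t:\<Omega>|lborel_span B. J t *\<^sub>R h (\<phi> t))"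
proof -
  note m = local_param_measure_eq[OF assms(1-3)]
  let ?w = "\<lambda>t. indicator \<Omega> t *\<^sub>R sqrt (gram_det B \<phi> t)"
  let ?D = "density (lborel_span B) (\<lambda>t. ennreal (?w t))"
  let ?f = "\<lambda>t. if t \<in> \<Omega> then \<phi> t else 0"
  have sets: "sets \<mu> = sets borel"
    using assms by (simp add: is_lebesgue_measure_on_def)
  have w: "?w \<in> borel_measurable (lborel_span B)" "0 \<le> ?w t" for t
    using m(3) J by (auto simp: indicator_def)
  have D: "density (lborel_span B) (\<lambda>t. indicator \<Omega> t * ennreal (sqrt (gram_det B \<phi> t))) = ?D"
    by (intro arg_cong[where f = "density _"]) (auto simp: fun_eq_iff indicator_def)
  have "(LINT x:\<phi> ` \<Omega>|\<mu>. h x) = integral\<^sup>L (density \<mu> (\<lambda>x. ennreal (indicator (\<phi> ` \<Omega>) x))) h"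
    unfolding set_lebesgue_integral_def
    by (subst integral_density) (use sets h m(4) in \<open>auto cong: measurable_cong_sets\<close>)
  also have "density \<mu> (\<lambda>x. ennreal (indicator (\<phi> ` \<Omega>) x)) = distr ?D borel ?f"
    using m(1) by (simp add: D ennreal_indicator)
  also have "integral\<^sup>L \<dots> h = (LINT t|?D. h (?f t))"
    using h m(2) by (subst integral_distr) auto
  also have "\<dots> = (LINT t|lborel_span B. ?w t *\<^sub>R h (?f t))"
    using measurable_compose[OF m(2) h] w by (subst integral_density) (auto intro!: AE_I2)
  also have "\<dots> = (LINT t:\<Omega>|lborel_span B. J t *\<^sub>R h (\<phi> t))"
    unfolding set_lebesgue_integral_def by (intro Bochner_Integration.integral_cong) (auto simp: indicator_def J)
  finally show ?thesis .
qed

text \<open>The ball lies in a box, whose measure is a finite product of interval lengths.\<close>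

lemma lborel_span_cball_finite:
  fixes B :: "'a::euclidean_space set"
  assumes "B \<subseteq> Basis"
  shows "emeasure (lborel_span B) (cball a r) < \<infinity>"
proof -
  interpret product_sigma_finite "\<lambda>_::'a. lborel :: real measure" by standard
  have fin: "finite B" using assms finite_subset finite_Basis by blast
  let ?f = "\<lambda>c::'a \<Rightarrow> real. \<Sum>b\<in>B. c b *\<^sub>R b"
  have f: "?f \<in> measurable (\<Pi>\<^sub>M b\<in>B. lborel) borel" by measurable
  have "emeasure (lborel_span B) (cball a r) = emeasure (\<Pi>\<^sub>M b\<in>B. lborel) (?f -` cball a r \<inter> space (\<Pi>\<^sub>M b\<in>B. lborel))"
    unfolding lborel_span_def by (subst emeasure_distr[OF f]) auto
  also have "\<dots> \<le> emeasure (\<Pi>\<^sub>M b\<in>B. lborel) (\<Pi>\<^sub>E b\<in>B. {a \<bullet> b - r .. a \<bullet> b + r})"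
  proof (rule emeasure_mono)
    show "?f -` cball a r \<inter> space (\<Pi>\<^sub>M b\<in>B. lborel) \<subseteq> (\<Pi>\<^sub>E b\<in>B. {a \<bullet> b - r .. a \<bullet> b + r})"
    proof
      fix c assume c: "c \<in> ?f -` cball a r \<inter> space (\<Pi>\<^sub>M b\<in>B. lborel)"
      have "\<bar>(a \<bullet> b) - c b\<bar> \<le> r" if "b \<in> B" for b
      proof -
        have "?f c \<bullet> b = c b"
          using assms fin that by (simp add: inner_sum_left inner_Basis subset_iff if_distrib cong: if_cong sum.cong)
        then have "a \<bullet> b - c b = (a - ?f c) \<bullet> b" by (simp add: inner_diff_left)
        also have "\<bar>\<dots>\<bar> \<le> norm (a - ?f c)"
          using that assms by (intro Basis_le_norm) auto
        also have "\<dots> \<le> r" using c by (simp add: dist_norm)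
        finally show ?thesis .
      qed
      then show "c \<in> (\<Pi>\<^sub>E b\<in>B. {a \<bullet> b - r .. a \<bullet> b + r})"
        using c by (auto simp: space_PiM PiE_iff abs_le_iff) (smt (verit))+
    qed
  qed (auto intro!: sets_PiM_I_finite fin)
  also have "\<dots> = (\<Prod>b\<in>B. emeasure lborel {a \<bullet> b - r .. a \<bullet> b + r})"
    by (rule emeasure_PiM[OF fin]) auto
  also have "\<dots> < \<infinity>"
    by (auto simp: ennreal_prod_eq_top less_top[symmetric] emeasure_lborel_Icc_eq)
  finally show ?thesis .
qed

text \<open>Near each point the density is bounded on a compact piece of a chart, which has finite
  measure. Finitely many such neighbourhoods cover \<open>M\<close>, and the complement of
  \<open>M\<close> is null.\<close>

lemma lebesgue_measure_on_compact_finite: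
  fixes M :: "'a::euclidean_space set"
  assumes \<mu>: "is_lebesgue_measure_on d M \<mu>" and "compact M"
    and charts: "\<And>x. x \<in> M \<Longrightarrow> \<exists>B \<Omega> \<phi>. local_param d M B \<Omega> \<phi> \<and> x \<in> \<phi> ` \<Omega>"
  shows "finite_measure \<mu>"
proof
  have sets: "sets \<mu> = sets borel" and null: "emeasure \<mu> (- M) = 0"
    using \<mu> by (auto simp: is_lebesgue_measure_on_def)
  have loc: "\<exists>N. open N \<and> x \<in> N \<and> emeasure \<mu> (M \<inter> N) < \<infinity>" if x: "x \<in> M" for x
  proof -
    obtain B \<Omega> \<phi> where lp: "local_param d M B \<Omega> \<phi>" and "x \<in> \<phi> ` \<Omega>"
      using charts[OF x] by blast
    then obtain t where t: "t \<in> \<Omega>" "x = \<phi> t" by blast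
    obtain \<psi> where hom: "homeomorphism \<Omega> (\<phi> ` \<Omega>) \<phi> \<psi>" and op: "openin (top_of_set (span B)) \<Omega>"
      and opM: "openin (top_of_set M) (\<phi> ` \<Omega>)" and B: "B \<subseteq> Basis"
      and dc: "\<forall>b\<in>B. continuous_on \<Omega> (dir_deriv \<phi> b)"
      using lp by (auto simp: local_param_def)
    obtain r where r: "0 < r" "cball t r \<inter> span B \<subseteq> \<Omega>"
      using op t(1) by (meson openin_contains_cball)
    let ?K = "cball t r \<inter> span B"
    have "compact ?K" by (simp add: compact_Int_closed closed_span)
    moreover have "continuous_on ?K (\<lambda>t. sqrt (gram_det B \<phi> t))"
      using continuous_on_subset[OF continuous_on_gram_det[OF dc] r(2)] by (intro continuous_intros)
    ultimately obtain C where C: "\<And>s. s \<in> ?K \<Longrightarrow> norm (sqrt (gram_det B \<phi> s)) \<le> C"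
      by (rule continuous_on_compact_bound) blast
    have "?K \<in> sets borel" by (auto intro!: borel_closed closed_Int closed_span)
    then have "emeasure \<mu> (\<phi> ` ?K) = (\<integral>\<^sup>+ s\<in>?K. ennreal (sqrt (gram_det B \<phi> s)) \<partial>lborel_span B)"
      using \<mu> lp r(2) by (auto simp: is_lebesgue_measure_on_def)
    also have "\<dots> \<le> (\<integral>\<^sup>+ s. ennreal C * indicator (cball t r) s \<partial>lborel_span B)"
    proof (rule nn_integral_mono)
      fix s
      show "ennreal (sqrt (gram_det B \<phi> s)) * indicator ?K s \<le> ennreal C * indicator (cball t r) s"
      proof (cases "s \<in> ?K")
        case True
        then have "sqrt (gram_det B \<phi> s) \<le> C" using C[OF True] by simp
        then show ?thesis using True by (simp add: ennreal_leI)
      qed simp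
    qed
    also have "\<dots> = ennreal C * emeasure (lborel_span B) (cball t r)"
      by (subst nn_integral_cmult_indicator) auto
    also have "\<dots> < \<infinity>"
      using lborel_span_cball_finite[OF B] by (simp add: ennreal_mult_less_top)
    finally have fin: "emeasure \<mu> (\<phi> ` ?K) < \<infinity>" .
    have "openin (top_of_set \<Omega>) (ball t r \<inter> \<Omega>)" by (auto simp: openin_open)
    then have "openin (top_of_set (\<phi> ` \<Omega>)) (\<phi> ` (ball t r \<inter> \<Omega>))"
      using homeomorphism_imp_open_map[OF hom] by blast
    then have "openin (top_of_set M) (\<phi> ` (ball t r \<inter> \<Omega>))"
      using opM openin_trans by blast
    then obtain N where N: "open N" "\<phi> ` (ball t r \<inter> \<Omega>) = M \<inter> N"
      by (auto simp: openin_open)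
    have "\<Omega> \<subseteq> span B" using op openin_imp_subset by blast
    then have "M \<inter> N \<subseteq> \<phi> ` ?K"
      unfolding N(2)[symmetric] by (intro image_mono) auto
    moreover have "\<phi> ` ?K \<in> sets \<mu>"
      unfolding sets using \<open>compact ?K\<close> r(2) hom
      by (intro borel_closed compact_imp_closed compact_continuous_image) (auto simp: homeomorphism_def intro: continuous_on_subset)
    ultimately have "emeasure \<mu> (M \<inter> N) < \<infinity>"
      using fin by (meson emeasure_mono order_le_less_trans)
    moreover have "x \<in> N" using N(2) t r(1) by auto
    ultimately show ?thesis using N(1) by blast
  qed
  then obtain N where N: "\<And>x. x \<in> M \<Longrightarrow> open (N x) \<and> x \<in> N x \<and> emeasure \<mu> (M \<inter> N x) < \<infinity>"
    by metis
  have "M \<subseteq> (\<Union>x\<in>M. N x)" using N by blast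
  then obtain P where P: "P \<subseteq> M" "finite P" "M \<subseteq> (\<Union>x\<in>P. N x)"
    using compactE_image[OF \<open>compact M\<close>, of M N] N by blast
  have Mc: "M \<in> sets borel" using \<open>compact M\<close> by (simp add: borel_compact)
  have "emeasure \<mu> M \<le> emeasure \<mu> (\<Union>x\<in>P. M \<inter> N x)"
    using P N Mc by (intro emeasure_mono sets.finite_UN) (auto simp: sets intro!: sets.Int)
  also have "\<dots> \<le> (\<Sum>x\<in>P. emeasure \<mu> (M \<inter> N x))"
    using P N Mc by (intro emeasure_subadditive_finite) (auto simp: sets intro!: sets.Int)
  also have "\<dots> < \<infinity>"
    using P N by (auto simp: less_top[symmetric])
  finally have "emeasure \<mu> M < \<infinity>" .
  moreover have "emeasure \<mu> (space \<mu>) \<le> emeasure \<mu> M + emeasure \<mu> (- M)"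
  proof -
    have "space \<mu> = M \<union> - M" using sets_eq_imp_space_eq[OF sets] by auto
    then show ?thesis using Mc by (metis sets emeasure_subadditive borel_comp)
  qed
  ultimately show "emeasure \<mu> (space \<mu>) \<noteq> \<infinity>" using null by auto
qed

section \<open>Charts from the inverse function theorem\<close>

text \<open>At \<open>a\<close> the map satisfies \<open>c * norm v \<le> norm (A a v)\<close>, and
  for \<open>t\<close> near \<open>a\<close> the perturbation costs at most \<open>c / 2\<close>.
  Hence the preimages of \<open>w\<close> under \<open>A t\<close> and \<open>A a\<close> differ by
  at most \<open>2 / c\<close> times \<open>norm (A t - A a)\<close> times the norm of the latter.
  Charts call for this because their directional derivatives have to be continuous.\<close>

lemma continuous_on_inv_blinfun:
  fixes A :: "'a::topological_space \<Rightarrow> ('b::euclidean_space \<Rightarrow>\<^sub>L 'b)"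
  assumes cont: "continuous_on T A" and bij: "\<And>t. t \<in> T \<Longrightarrow> bij (blinfun_apply (A t))"
  shows "continuous_on T (\<lambda>t. inv (blinfun_apply (A t)) w)"
  unfolding continuous_on_def
proof
  fix a assume a: "a \<in> T"
  obtain c where c: "c > 0" "\<And>v. c * norm v \<le> norm (A a v)"
    using linear_inj_bounded_below_pos[OF linear_blinfun bij_is_inj[OF bij[OF a]]] by blast
  define z where "z = inv (blinfun_apply (A a)) w"
  have Az: "A a z = w" unfolding z_def by (rule surj_f_inv_f) (rule bij_is_surj[OF bij[OF a]])
  have tA: "(A \<longlongrightarrow> A a) (at a within T)"
    using cont a by (simp add: continuous_on_def)
  then have n0: "((\<lambda>t. norm (A t - A a)) \<longlongrightarrow> 0) (at a within T)"
    by (simp add: LIM_zero tendsto_norm_zero)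
  then have "\<forall>\<^sub>F t in at a within T. norm (A t - A a) < c / 2"
    by (rule order_tendstoD) (use c in simp)
  moreover have "\<forall>\<^sub>F t in at a within T. t \<in> T"
    by (auto simp: eventually_at_filter)
  ultimately have "\<forall>\<^sub>F t in at a within T.
      norm (inv (blinfun_apply (A t)) w - z) \<le> norm (A t - A a) * (norm z * 2 / c)"
  proof eventually_elim
    case (elim t)
    define y where "y = inv (blinfun_apply (A t)) w - z"
    have "A t (inv (blinfun_apply (A t)) w) = w"
      by (rule surj_f_inv_f) (rule bij_is_surj[OF bij[OF elim(2)]])
    then have "A t y = - (A t - A a) z"
      by (simp add: y_def blinfun.diff_right blinfun.diff_left Az)
    then have 1: "norm (A t y) \<le> norm (A t - A a) * norm z"
      by (simp add: norm_blinfun)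
    have "c * norm y \<le> norm (A a y)" by (rule c)
    also have "A a y = A t y - (A t - A a) y"
      by (simp add: blinfun.diff_left)
    also have "norm \<dots> \<le> norm (A t - A a) * norm z + norm (A t - A a) * norm y"
      using norm_triangle_ineq4[of "A t y" "(A t - A a) y"] 1 norm_blinfun[of "A t - A a" y] by linarith
    also have "norm (A t - A a) * norm y \<le> c / 2 * norm y"
      using elim(1) by (intro mult_right_mono) auto
    finally have "c / 2 * norm y \<le> norm (A t - A a) * norm z"
      by (simp add: field_simps)
    then show ?case
      using c(1) by (simp add: y_def[symmetric] field_simps)
  qed
  moreover have "((\<lambda>t. norm (A t - A a) * (norm z * 2 / c)) \<longlongrightarrow> 0) (at a within T)"
    using tendsto_mult_left_zero[OF n0] .
  ultimately have "((\<lambda>t. inv (blinfun_apply (A t)) w - z) \<longlongrightarrow> 0) (at a within T)"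
    by (rule Lim_null_comparison)
  then show "((\<lambda>t. inv (blinfun_apply (A t)) w) \<longlongrightarrow> inv (blinfun_apply (A a)) w) (at a within T)"
    unfolding z_def by (rule LIM_zero_cancel)
qed

text \<open>The inverse function theorem, completed by the continuity of the derivative of the
  inverse. In finite dimension an injective derivative already has the left inverse that the theorem
  asks for.\<close>

lemma C1_straightening:
  fixes \<Psi> :: "'a::euclidean_space \<Rightarrow> 'a"
  assumes "open W" and der: "\<And>x. x \<in> W \<Longrightarrow> (\<Psi> has_derivative blinfun_apply (\<Psi>' x)) (at x)"
    and cont: "continuous_on W \<Psi>'" and "p \<in> W" and inj: "inj (blinfun_apply (\<Psi>' p))"
  obtains N T \<Phi> where "open N" "p \<in> N" "N \<subseteq> W" "open T" "homeomorphism N T \<Psi> \<Phi>"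
    "\<And>t. t \<in> T \<Longrightarrow> (\<Phi> has_derivative inv (blinfun_apply (\<Psi>' (\<Phi> t)))) (at t)"
    "\<And>t. t \<in> T \<Longrightarrow> bij (blinfun_apply (\<Psi>' (\<Phi> t)))"
    "\<And>w. continuous_on T (\<lambda>t. inv (blinfun_apply (\<Psi>' (\<Phi> t))) w)"
proof -
  obtain g where g: "linear g" "g \<circ> blinfun_apply (\<Psi>' p) = id"
    using linear_injective_left_inverse[OF linear_blinfun inj] by blast
  have "bounded_linear g" using g(1) by (simp add: linear_conv_bounded_linear)
  then have "Blinfun g o\<^sub>L \<Psi>' p = id_blinfun"
    by (intro blinfun_eqI) (simp add: bounded_linear_Blinfun_apply pointfree_idE[OF g(2)])
  from inverse_function_theorem[OF \<open>open W\<close> der cont \<open>p \<in> W\<close> this]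
  obtain N T \<Phi> \<Phi>' where N: "open N" "N \<subseteq> W" "p \<in> N" "open T" "homeomorphism N T \<Psi> \<Phi>"
    and d: "\<And>y. y \<in> T \<Longrightarrow> (\<Phi> has_derivative \<Phi>' y) (at y)"
      "\<And>y. y \<in> T \<Longrightarrow> \<Phi>' y = inv (blinfun_apply (\<Psi>' (\<Phi> y)))"
      "\<And>y. y \<in> T \<Longrightarrow> bij (blinfun_apply (\<Psi>' (\<Phi> y)))"
    by metis
  have "continuous_on T (\<lambda>t. \<Psi>' (\<Phi> t))"
    using N cont by (intro continuous_on_compose2[OF cont]) (auto simp: homeomorphism_def)
  then have "continuous_on T (\<lambda>t. inv (blinfun_apply (\<Psi>' (\<Phi> t))) w)" for w
    using d(3) by (rule continuous_on_inv_blinfun)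
  then show thesis using that N d by metis
qed

lemma has_derivative_line:
  assumes "(\<phi> has_derivative D) (at t)"
  shows "((\<lambda>s. \<phi> (t + s *\<^sub>R b)) has_vector_derivative D b) (at (0::real))"
proof -
  have "((\<lambda>s::real. t + s *\<^sub>R b) has_derivative (\<lambda>s. s *\<^sub>R b)) (at 0)"
    by (auto intro!: derivative_eq_intros)
  moreover have "(\<phi> has_derivative D) (at (t + 0 *\<^sub>R b))" using assms by simp
  ultimately have "((\<lambda>s. \<phi> (t + s *\<^sub>R b)) has_derivative (\<lambda>s. D (s *\<^sub>R b))) (at 0)"
    by (rule has_derivative_compose)
  then show ?thesis
    using linear_scale[OF has_derivative_linear[OF assms]] by (simp add: has_vector_derivative_def)
qed

lemma dir_deriv_eq:
  assumes "(\<phi> has_derivative D) (at t)"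
  shows "dir_deriv \<phi> b t = D b"
  unfolding dir_deriv_def using has_derivative_line[OF assms] by (rule vector_derivative_at)

lemma span_axis:
  "span ((\<lambda>i. axis i 1) ` J) = {x :: real ^ 'm::finite. \<forall>i. i \<notin> J \<longrightarrow> x $ i = 0}"
proof -
  have "(\<lambda>i. axis i (1::real)) ` J \<subseteq> (Basis :: (real ^ 'm) set)"
    by (auto simp: axis_in_Basis_iff)
  then show ?thesis
    by (auto simp: span_substd_basis Basis_vec_def inner_axis axis_eq_axis image_iff)
qed

text \<open>\<open>I\<close> collects the coordinates of \<open>\<Psi>\<close> that vanish on
  \<open>M\<close>, and the remaining ones are the parameters. Regularity holds because
  \<open>D t\<close> is injective on the whole space, in particular on the parameter
  directions.\<close>

lemma local_param_straightening:
  fixes \<Psi> :: "real ^ 'm \<Rightarrow> real ^ 'm" and I :: "'m::finite set"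
  defines "B \<equiv> (\<lambda>i. axis i 1) ` (- I)"
  assumes hom: "homeomorphism N T \<Psi> \<Phi>" and "open N" "open T"
    and der: "\<And>t. t \<in> T \<Longrightarrow> (\<Phi> has_derivative D t) (at t)"
    and inj: "\<And>t. t \<in> T \<Longrightarrow> inj (D t)"
    and cont: "\<And>w. continuous_on T (\<lambda>t. D t w)"
    and M: "M \<inter> N = {x \<in> N. \<forall>i\<in>I. \<Psi> x $ i = 0}"
  shows "local_param (CARD('m) - card I) M B (T \<inter> span B) \<Phi>" and "\<Phi> ` (T \<inter> span B) = M \<inter> N"
proof -
  have sp: "span B = {x. \<forall>i\<in>I. x $ i = 0}"
    unfolding B_def span_axis by auto
  have N: "\<Psi> ` N = T" "\<Phi> ` T = N" "\<And>x. x \<in> N \<Longrightarrow> \<Phi> (\<Psi> x) = x" "\<And>t. t \<in> T \<Longrightarrow> \<Psi> (\<Phi> t) = t"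
    using hom by (auto simp: homeomorphism_def)
  show im: "\<Phi> ` (T \<inter> span B) = M \<inter> N"
  proof
    show "\<Phi> ` (T \<inter> span B) \<subseteq> M \<inter> N"
      using N unfolding M sp by force
    show "M \<inter> N \<subseteq> \<Phi> ` (T \<inter> span B)"
    proof
      fix x assume "x \<in> M \<inter> N"
      then have "\<Psi> x \<in> T \<inter> span B" "x = \<Phi> (\<Psi> x)"
        using N unfolding M sp by auto
      then show "x \<in> \<Phi> ` (T \<inter> span B)" by blast
    qed
  qed
  have dd: "dir_deriv \<Phi> b t = D t b" if "t \<in> T" for b t
    by (rule dir_deriv_eq[OF der[OF that]])
  have "homeomorphism (T \<inter> span B) (\<Phi> ` (T \<inter> span B)) \<Phi> \<Psi>"
    by (rule homeomorphism_of_subsets[OF homeomorphism_symD[OF hom]]) (use N in auto)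
  moreover have "card B = CARD('m) - card I"
    unfolding B_def by (subst card_image) (auto simp: inj_on_def axis_eq_axis Compl_eq_Diff_UNIV card_Diff_subset)
  moreover have "B \<subseteq> Basis"
    by (auto simp: B_def axis_in_Basis_iff)
  moreover have "openin (top_of_set M) (\<Phi> ` (T \<inter> span B))"
    unfolding im using \<open>open N\<close> by (auto simp: openin_open)
  moreover have "openin (top_of_set (span B)) (T \<inter> span B)"
    using \<open>open T\<close> by (auto simp: openin_open)
  moreover have "(\<lambda>s. \<Phi> (t + s *\<^sub>R b)) differentiable at 0" if "t \<in> T \<inter> span B" for t b
    using has_derivative_line[OF der, of t b] that
    by (auto simp: has_vector_derivative_def differentiable_def)
  moreover have "continuous_on (T \<inter> span B) (dir_deriv \<Phi> b)" for b
    by (rule continuous_on_eq[OF continuous_on_subset[OF cont, of "T \<inter> span B" b]]) (auto simp: dd)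
  moreover have "gram_det B \<Phi> t \<noteq> 0" if "t \<in> T \<inter> span B" for t
    unfolding B_def
    by (rule gram_det_axis_nonzero[where D = "D t"])
      (use that inj dd has_derivative_linear[OF der] in auto)
  ultimately show "local_param (CARD('m) - card I) M B (T \<inter> span B) \<Phi>"
    unfolding local_param_def by blast
qed

lemma sphere_local_param:
  fixes p :: "real ^ 'm::finite"
  assumes "p \<in> sphere 0 1"
  shows "\<exists>B \<Omega> \<phi>. local_param (CARD('m) - 1) (sphere 0 1) B \<Omega> \<phi> \<and> p \<in> \<phi> ` \<Omega>"
proof -
  have "p \<noteq> 0" using assms by auto
  then obtain i where i: "p $ i \<noteq> 0" by (auto simp: vec_eq_iff)
  \<comment> \<open>\<open>\<Psi>\<close> trades the coordinate \<open>x $ i\<close> for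
    \<open>x \<bullet> x - 1\<close> and keeps the others. Since \<open>p $ i \<noteq> 0\<close>,
    its derivative at \<open>p\<close> is injective.\<close>
  define \<Psi> :: "real ^ 'm \<Rightarrow> real ^ 'm" where "\<Psi> x = x + (x \<bullet> x - 1 - x $ i) *\<^sub>R axis i 1" for x
  define \<Psi>' where "\<Psi>' x = Blinfun (\<lambda>w. w + (2 * (x \<bullet> w) - w $ i) *\<^sub>R axis i 1)" for x :: "real ^ 'm"
  have der0: "(\<Psi> has_derivative (\<lambda>w. w + (2 * (x \<bullet> w) - w $ i) *\<^sub>R axis i 1)) (at x)" for x
    unfolding \<Psi>_def[abs_def]
    by (auto intro!: derivative_eq_intros bounded_linear_imp_has_derivative[OF bounded_linear_vec_nth] simp: inner_commute)
  have ap: "blinfun_apply (\<Psi>' x) = (\<lambda>w. w + (2 * (x \<bullet> w) - w $ i) *\<^sub>R axis i 1)" for x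
    unfolding \<Psi>'_def by (rule bounded_linear_Blinfun_apply[OF has_derivative_bounded_linear[OF der0]])
  have der: "(\<Psi> has_derivative blinfun_apply (\<Psi>' x)) (at x)" for x
    unfolding ap by (rule der0)
  have cont: "continuous_on UNIV \<Psi>'"
    by (rule continuous_on_blinfun_componentwise) (auto simp: ap intro!: continuous_intros)
  have "w = 0" if "blinfun_apply (\<Psi>' p) w = 0" for w
  proof -
    have "(w + (2 * (p \<bullet> w) - w $ i) *\<^sub>R axis i 1) $ k = 0" for k
      using that by (simp only: ap zero_index)
    note eq = this[unfolded vector_add_component vector_scaleR_component axis_def vec_lambda_beta]
    have "w $ k = 0" if "k \<noteq> i" for k
      using eq[of k] that by simp
    moreover have "p \<bullet> w = 0" using eq[of i] by simp
    moreover have "p \<bullet> w = (\<Sum>k\<in>UNIV. if k = i then p $ i * w $ i else 0)"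
      unfolding inner_vec_def by (rule sum.cong) (auto simp: calculation(1))
    ultimately show "w = 0" using i by (auto simp: vec_eq_iff) metis
  qed
  then have inj: "inj (blinfun_apply (\<Psi>' p))"
    by (subst linear_injective_0[OF linear_blinfun]) blast
  obtain N T \<Phi> where N: "open N" "p \<in> N" "open T" "homeomorphism N T \<Psi> \<Phi>"
    "\<And>t. t \<in> T \<Longrightarrow> (\<Phi> has_derivative inv (blinfun_apply (\<Psi>' (\<Phi> t)))) (at t)"
    "\<And>t. t \<in> T \<Longrightarrow> bij (blinfun_apply (\<Psi>' (\<Phi> t)))"
    "\<And>w. continuous_on T (\<lambda>t. inv (blinfun_apply (\<Psi>' (\<Phi> t))) w)"
    using C1_straightening[OF open_UNIV der cont UNIV_I inj] by metis
  have M: "sphere 0 1 \<inter> N = {x \<in> N. \<forall>k\<in>{i}. \<Psi> x $ k = 0}"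
    by (auto simp: \<Psi>_def axis_def norm_eq_1)
  have "inj (inv (blinfun_apply (\<Psi>' (\<Phi> t))))" if "t \<in> T" for t
    using N(6)[OF that] bij_imp_bij_inv bij_is_inj by blast
  note lp = local_param_straightening[OF N(4,1,3,5) this N(7) M]
  show ?thesis
    using lp assms N(2) by (metis IntI One_nat_def card.empty card.insert empty_iff finite.emptyI)
qed

section \<open>Rotations of the sphere\<close>

text \<open>\<open>R\<close> preserves the inner products of directional derivatives, hence every
  entry of the Gram matrix.\<close>

lemma local_param_isometry:
  fixes M :: "'a::euclidean_space set"
  assumes R: "orthogonal_transformation R" and RM: "R ` M = M" and lp: "local_param d M B \<Omega> \<phi>"
  shows "local_param d M B \<Omega> (R \<circ> \<phi>)" and "t \<in> \<Omega> \<Longrightarrow> gram_det B (R \<circ> \<phi>) t = gram_det B \<phi> t"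
proof -
  have lin: "linear R" using R by (rule orthogonal_transformation_linear)
  then have bl: "bounded_linear R" by (simp add: linear_conv_bounded_linear)
  have bij: "bij R" using R by (rule orthogonal_transformation_bij)
  have linv: "linear (inv R)"
    using orthogonal_transformation_linear[OF orthogonal_transformation_inv[OF R]] .
  have cont: "continuous_on S R" "continuous_on S (inv R)" for S
    using lin linv by (auto intro: linear_continuous_on simp: linear_conv_bounded_linear)
  have vd: "((\<lambda>s. (R \<circ> \<phi>) (t + s *\<^sub>R b)) has_vector_derivative R (dir_deriv \<phi> b t)) (at 0)"
    if "t \<in> \<Omega>" "b \<in> B" for t b
  proof -
    have "((\<lambda>s. \<phi> (t + s *\<^sub>R b)) has_vector_derivative dir_deriv \<phi> b t) (at 0)"
      using lp that by (auto simp: local_param_def dir_deriv_def vector_derivative_works)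
    then show ?thesis
      using bounded_linear.has_vector_derivative[OF bl] by (simp add: o_def)
  qed
  then have dd: "dir_deriv (R \<circ> \<phi>) b t = R (dir_deriv \<phi> b t)" if "t \<in> \<Omega>" "b \<in> B" for t b
    using that by (simp add: dir_deriv_def vector_derivative_at)
  show gram: "gram_det B (R \<circ> \<phi>) t = gram_det B \<phi> t" if "t \<in> \<Omega>" for t
    unfolding gram_det_def
  proof (rule sum.cong[OF refl])
    fix p assume "p \<in> {p. p permutes B}"
    then have p: "p b \<in> B" if "b \<in> B" for b using that by (simp add: permutes_in_image)
    have "(\<Prod>b\<in>B. dir_deriv (R \<circ> \<phi>) b t \<bullet> dir_deriv (R \<circ> \<phi>) (p b) t)
        = (\<Prod>b\<in>B. dir_deriv \<phi> b t \<bullet> dir_deriv \<phi> (p b) t)"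
      using R that p by (intro prod.cong refl) (simp add: dd orthogonal_transformation_def)
    then show "of_int (sign p) * (\<Prod>b\<in>B. dir_deriv (R \<circ> \<phi>) b t \<bullet> dir_deriv (R \<circ> \<phi>) (p b) t)
        = of_int (sign p) * (\<Prod>b\<in>B. dir_deriv \<phi> b t \<bullet> dir_deriv \<phi> (p b) t)" by simp
  qed
  obtain \<psi> where hom: "homeomorphism \<Omega> (\<phi> ` \<Omega>) \<phi> \<psi>"
    and opM: "openin (top_of_set M) (\<phi> ` \<Omega>)"
    using lp by (auto simp: local_param_def)
  have homR: "homeomorphism S (R ` S) R (inv R)" for S
    using cont bij by (auto simp: homeomorphism_def bij_is_inj image_comp o_def)
  have "homeomorphism \<Omega> ((R \<circ> \<phi>) ` \<Omega>) (R \<circ> \<phi>) (\<psi> \<circ> inv R)"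
    using homeomorphism_compose[OF hom homR] by (simp add: image_comp)
  moreover have "openin (top_of_set M) ((R \<circ> \<phi>) ` \<Omega>)"
    using homeomorphism_imp_open_map[OF homR[of M] opM] by (simp add: RM image_comp)
  moreover have "(\<lambda>s. (R \<circ> \<phi>) (t + s *\<^sub>R b)) differentiable at 0" if "t \<in> \<Omega>" "b \<in> B" for t b
    using vd[OF that] by (auto simp: has_vector_derivative_def differentiable_def)
  moreover have "continuous_on \<Omega> (dir_deriv (R \<circ> \<phi>) b)" if "b \<in> B" for b
  proof -
    have "continuous_on \<Omega> (\<lambda>t. R (dir_deriv \<phi> b t))"
      using lp that by (intro continuous_on_compose2[OF cont(1)[of UNIV]]) (auto simp: local_param_def eta_contract_eq)
    then show ?thesis by (rule continuous_on_eq) (simp add: dd that)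
  qed
  ultimately show "local_param d M B \<Omega> (R \<circ> \<phi>)"
    using lp gram unfolding local_param_def by fastforce
qed

text \<open>Charts remain charts after composition with \<open>R\<close>, with unchanged Gram
  determinants, so \<open>R\<close> preserves the measure of Borel sets inside a single chart image.
  A finite cover by chart images, cut into disjoint pieces, extends this to all Borel sets.\<close>

lemma lebesgue_measure_on_isometry:
  fixes M :: "'a::euclidean_space set"
  assumes \<mu>: "is_lebesgue_measure_on d M \<mu>" and "compact M"
    and charts: "\<And>x. x \<in> M \<Longrightarrow> \<exists>B \<Omega> \<phi>. local_param d M B \<Omega> \<phi> \<and> x \<in> \<phi> ` \<Omega>"
    and R: "orthogonal_transformation R" and RM: "R ` M = M"
  shows "distr \<mu> borel R = \<mu>"
proof -
  have sets: "sets \<mu> = sets borel" and null: "emeasure \<mu> (- M) = 0"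
    using \<mu> by (auto simp: is_lebesgue_measure_on_def)
  have sp: "space \<mu> = UNIV" using sets_eq_imp_space_eq[OF sets] by simp
  have bij: "bij R" using R by (rule orthogonal_transformation_bij)
  have linv: "linear (inv R)" "linear R"
    using orthogonal_transformation_linear orthogonal_transformation_inv R by auto
  then have cont: "continuous_on S (inv R)" "continuous_on S R" for S
    by (auto intro: linear_continuous_on simp: linear_conv_bounded_linear)
  then have meas: "R \<in> measurable borel borel" "inv R \<in> measurable borel borel"
    by (auto intro: borel_measurable_continuous_onI)
  have Rb: "R ` A \<in> sets borel" if "A \<in> sets borel" for A
    using measurable_sets[OF meas(2) that] bij by (simp add: bij_vimage_eq_inv_image bij_imp_bij_inv inv_inv_eq)
  have Mb: "M \<in> sets borel" using \<open>compact M\<close> by (simp add: borel_compact)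
  obtain N where N: "\<And>x. x \<in> M \<Longrightarrow> x \<in> N x \<and> openin (top_of_set M) (N x) \<and> (\<exists>B \<Omega> \<phi>. local_param d M B \<Omega> \<phi> \<and> N x = \<phi> ` \<Omega>)"
  proof -
    have "\<exists>N. x \<in> N \<and> openin (top_of_set M) N \<and> (\<exists>B \<Omega> \<phi>. local_param d M B \<Omega> \<phi> \<and> N = \<phi> ` \<Omega>)" if x: "x \<in> M" for x
    proof -
      obtain B \<Omega> \<phi> where lp: "local_param d M B \<Omega> \<phi>" "x \<in> \<phi> ` \<Omega>"
        using charts[OF x] by blast
      then have "openin (top_of_set M) (\<phi> ` \<Omega>)" by (simp add: local_param_def)
      with lp show ?thesis by blast
    qed
    then show thesis using that by metis
  qed
  have Nb: "N x \<in> sets borel" if "x \<in> M" for x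
    using N[OF that] compact_imp_closed[OF \<open>compact M\<close>] borel_openin_closed by blast
  have loc: "emeasure \<mu> (R ` A) = emeasure \<mu> A" if x: "x \<in> M" and A: "A \<subseteq> N x" "A \<in> sets borel" for x A
  proof -
    obtain B \<Omega> \<phi> where lp: "local_param d M B \<Omega> \<phi>" and Nx: "N x = \<phi> ` \<Omega>"
      using N[OF x] by blast
    note lpR = local_param_isometry[OF R RM lp]
    note m = local_param_measure_eq(2,5)[OF \<mu> compact_imp_closed[OF \<open>compact M\<close>] lp]
    define E where "E = (\<lambda>t. if t \<in> \<Omega> then \<phi> t else 0) -` A \<inter> \<Omega>"
    have E: "E \<in> sets borel" "E \<subseteq> \<Omega>" "\<phi> ` E = A"
      using measurable_sets[OF m(1) A(2)] m(2) A(1) Nx by (auto simp: E_def)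
    have "emeasure \<mu> ((R \<circ> \<phi>) ` E) = (\<integral>\<^sup>+ t\<in>E. ennreal (sqrt (gram_det B (R \<circ> \<phi>) t)) \<partial>lborel_span B)"
      using \<mu> lpR(1) E unfolding is_lebesgue_measure_on_def by blast
    also have "\<dots> = (\<integral>\<^sup>+ t\<in>E. ennreal (sqrt (gram_det B \<phi> t)) \<partial>lborel_span B)"
      using E(2) lpR(2) by (intro nn_integral_cong) (auto simp: indicator_def subset_iff)
    also have "\<dots> = emeasure \<mu> (\<phi> ` E)"
      using \<mu> lp E unfolding is_lebesgue_measure_on_def by (metis (no_types, lifting))
    finally show ?thesis using E(3) by (simp only: image_comp[symmetric])
  qed
  have fin: "emeasure \<mu> (R ` (A \<inter> (\<Union>x\<in>P. N x))) = emeasure \<mu> (A \<inter> (\<Union>x\<in>P. N x))"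
    if "finite P" "P \<subseteq> M" "A \<in> sets borel" for P A
    using that
  proof (induction P arbitrary: A rule: finite_induct)
    case empty
    then show ?case by simp
  next
    case (insert x P)
    \<comment> \<open>Splitting off one chart image leaves two disjoint parts, and their images are
      disjoint too, so additivity applies before and after \<open>R\<close>.\<close>
    let ?A1 = "A \<inter> N x" and ?A2 = "(A - N x) \<inter> (\<Union>x\<in>P. N x)"
    have b: "?A1 \<in> sets borel" "?A2 \<in> sets borel"
      using insert Nb by (auto intro!: sets.Int sets.Diff sets.finite_UN)
    have eq: "A \<inter> (\<Union>x\<in>insert x P. N x) = ?A1 \<union> ?A2" by auto
    have "R ` ?A1 \<inter> R ` ?A2 = {}"
      using bij_is_inj[OF bij] by (auto dest: injD)
    then have "emeasure \<mu> (R ` (?A1 \<union> ?A2)) = emeasure \<mu> (R ` ?A1) + emeasure \<mu> (R ` ?A2)"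
      unfolding image_Un using b Rb sets by (intro plus_emeasure[symmetric]) auto
    also have "\<dots> = emeasure \<mu> ?A1 + emeasure \<mu> ?A2"
      using insert loc[of x ?A1] insert.IH[of "A - N x"] b Nb by (auto intro: sets.Diff)
    also have "\<dots> = emeasure \<mu> (?A1 \<union> ?A2)"
      using b sets by (intro plus_emeasure) auto
    finally show ?case unfolding eq .
  qed
  have "\<exists>P. finite P \<and> P \<subseteq> M \<and> M \<subseteq> (\<Union>x\<in>P. N x)"
  proof -
    have "\<forall>x\<in>M. \<exists>T. open T \<and> N x = M \<inter> T" using N by (simp add: openin_open)
    then obtain T where T: "\<And>x. x \<in> M \<Longrightarrow> open (T x) \<and> N x = M \<inter> T x" by metis
    have "M \<subseteq> (\<Union>x\<in>M. T x)" using T N by blast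
    then obtain P where "P \<subseteq> M" "finite P" "M \<subseteq> (\<Union>x\<in>P. T x)"
      using compactE_image[OF \<open>compact M\<close>, of M T] T by blast
    then show ?thesis using T by (intro exI[of _ P]) blast
  qed
  then obtain P where P: "finite P" "P \<subseteq> M" "M \<subseteq> (\<Union>x\<in>P. N x)" by blast
  have NM: "N x \<subseteq> M" if "x \<in> M" for x using N[OF that] openin_imp_subset by blast
  have img: "emeasure \<mu> (R ` (A \<inter> M)) = emeasure \<mu> (A \<inter> M)" if "A \<in> sets borel" for A
  proof -
    have "(\<Union>x\<in>P. N x) = M" using P NM by blast
    then show ?thesis using fin[OF P(1,2) that] by simp
  qed
  have cut: "emeasure \<mu> A = emeasure \<mu> (A \<inter> M)" if "A \<in> sets borel" for A
  proof -
    have "- M \<in> null_sets \<mu>" using null Mb sets by (auto simp: null_sets_def)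
    then have "emeasure \<mu> (A - (- M)) = emeasure \<mu> A"
      using that sets by (intro emeasure_Diff_null_set) auto
    then show ?thesis by (simp add: Diff_Compl)
  qed
  show ?thesis
  proof (rule measure_eqI)
    show "sets (distr \<mu> borel R) = sets \<mu>" using sets by simp
    fix A assume "A \<in> sets (distr \<mu> borel R)"
    then have A: "A \<in> sets borel" by simp
    have RA: "R -` A \<in> sets borel" using measurable_sets[OF meas(1) A] by simp
    have "emeasure (distr \<mu> borel R) A = emeasure \<mu> (R -` A)"
      using A meas(1) sets sp by (subst emeasure_distr) (auto cong: measurable_cong_sets)
    also have "\<dots> = emeasure \<mu> (R -` A \<inter> M)" by (rule cut[OF RA])
    also have "\<dots> = emeasure \<mu> (R ` (R -` A \<inter> M))" by (rule img[OF RA, symmetric])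
    also have "R ` (R -` A \<inter> M) = A \<inter> M"
    proof -
      have "R ` (R -` A \<inter> M) = A \<inter> R ` M" by auto
      then show ?thesis by (simp add: RM)
    qed
    also have "emeasure \<mu> \<dots> = emeasure \<mu> A" by (rule cut[OF A, symmetric])
    finally show "emeasure (distr \<mu> borel R) A = emeasure \<mu> A" .
  qed
qed

definition rot :: "'m \<Rightarrow> 'm \<Rightarrow> real \<Rightarrow> real ^ 'm::finite \<Rightarrow> real ^ 'm" where
  "rot i j \<theta> x = (\<chi> k. if k = i then cos \<theta> * x $ i - sin \<theta> * x $ j
     else if k = j then sin \<theta> * x $ i + cos \<theta> * x $ j else x $ k)"

text \<open>The velocity of \<open>rot i j \<theta> x\<close> at \<open>\<theta> = 0\<close>; a
  derivative in this direction is the operator L with indices \<open>i\<close> and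
  \<open>j\<close>.\<close>

definition rot_gen :: "'m \<Rightarrow> 'm \<Rightarrow> real ^ 'm::finite \<Rightarrow> real ^ 'm" where
  "rot_gen i j x = x $ i *\<^sub>R axis j 1 - x $ j *\<^sub>R axis i 1"

lemma rot_0 [simp]: "rot i j 0 x = x"
  by (simp add: rot_def vec_eq_iff)

lemma rot_add: "i \<noteq> j \<Longrightarrow> rot i j (\<alpha> + \<beta>) x = rot i j \<alpha> (rot i j \<beta> x)"
  by (simp add: rot_def vec_eq_iff cos_add sin_add algebra_simps)

lemma orthogonal_transformation_rot:
  assumes "i \<noteq> j"
  shows "orthogonal_transformation (rot i j \<theta>)"
  unfolding orthogonal_transformation
proof
  show "linear (rot i j \<theta>)"
    by (rule linearI) (auto simp: rot_def vec_eq_iff algebra_simps)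
  show "\<forall>x. norm (rot i j \<theta> x) = norm x"
  proof
    fix x :: "real ^ 'a"
    have split: "(\<Sum>k\<in>UNIV. f k) = f i + f j + (\<Sum>k\<in>UNIV - {i} - {j}. f k)" for f :: "'a \<Rightarrow> real"
      using assms by (simp add: sum.remove[of UNIV i] sum.remove[of "UNIV - {i}" j])
    have "rot i j \<theta> x \<bullet> rot i j \<theta> x = x \<bullet> x"
    proof -
      have "(\<Sum>k\<in>UNIV - {i} - {j}. rot i j \<theta> x $ k * rot i j \<theta> x $ k) = (\<Sum>k\<in>UNIV - {i} - {j}. x $ k * x $ k)"
        by (rule sum.cong) (auto simp: rot_def)
      moreover have "rot i j \<theta> x $ i * rot i j \<theta> x $ i + rot i j \<theta> x $ j * rot i j \<theta> x $ j
          = x $ i * x $ i + x $ j * x $ j"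
      proof -
        have "(c * p - s * q) * (c * p - s * q) + (s * p + c * q) * (s * p + c * q)
            = (c\<^sup>2 + s\<^sup>2) * (p * p + q * q)" for c s p q :: real
          by (simp add: power2_eq_square algebra_simps)
        note this[of "cos \<theta>" "x $ i" "sin \<theta>" "x $ j"]
        then show ?thesis using assms by (simp add: rot_def)
      qed
      ultimately show ?thesis
        by (simp add: inner_vec_def split)
    qed
    then show "norm (rot i j \<theta> x) = norm x" by (simp add: norm_eq)
  qed
qed

lemma rot_sphere:
  assumes "i \<noteq> j"
  shows "rot i j \<theta> ` sphere 0 1 = sphere 0 1"
proof
  show "rot i j \<theta> ` sphere 0 1 \<subseteq> sphere 0 1"
    using orthogonal_transformation_norm[OF orthogonal_transformation_rot[OF assms]] by auto
  show "sphere 0 1 \<subseteq> rot i j \<theta> ` sphere 0 1"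
  proof
    fix x :: "real ^ 'a" assume x: "x \<in> sphere 0 1"
    have "x = rot i j \<theta> (rot i j (- \<theta>) x)" using rot_add[OF assms, of \<theta> "- \<theta>" x] by simp
    moreover have "rot i j (- \<theta>) x \<in> sphere 0 1"
      using x orthogonal_transformation_norm[OF orthogonal_transformation_rot[OF assms]] by auto
    ultimately show "x \<in> rot i j \<theta> ` sphere 0 1" by blast
  qed
qed

lemma rot_has_vector_derivative:
  assumes "i \<noteq> j"
  shows "((\<lambda>\<theta>. rot i j \<theta> x) has_vector_derivative rot_gen i j x) (at 0)"
proof -
  have eq: "rot i j \<theta> x = x + ((cos \<theta> - 1) * x $ i - sin \<theta> * x $ j) *\<^sub>R axis i 1
      + (sin \<theta> * x $ i + (cos \<theta> - 1) * x $ j) *\<^sub>R axis j 1" for \<theta>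
    using assms by (simp add: rot_def vec_eq_iff axis_def algebra_simps)
  show ?thesis
    unfolding eq rot_gen_def by (auto intro!: derivative_eq_intros)
qed

lemma set_integrable_continuous_compact:
  fixes f :: "'a::euclidean_space \<Rightarrow> 'b::{banach, second_countable_topology}"
  assumes "finite_measure \<mu>" and "sets \<mu> = sets borel" and "compact K" and "continuous_on K f"
  shows "set_integrable \<mu> K f"
proof -
  interpret finite_measure \<mu> by fact
  obtain C where C: "\<And>x. x \<in> K \<Longrightarrow> norm (f x) \<le> C"
    using continuous_on_compact_bound[OF assms(3,4)] by blast
  have m: "(\<lambda>x. indicator K x *\<^sub>R f x) \<in> borel_measurable borel"
    using assms by (intro borel_measurable_continuous_on_indicator) (auto simp: borel_compact)
  show ?thesis
    unfolding set_integrable_def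
  proof (rule integrable_const_bound[where B = "max 0 C"])
    show "AE x in \<mu>. norm (indicator K x *\<^sub>R f x) \<le> max 0 C"
      using C by (intro AE_I2) (auto simp: indicator_def le_max_iff_disj)
    show "(\<lambda>x. indicator K x *\<^sub>R f x) \<in> borel_measurable \<mu>"
      using m assms(2) by (simp cong: measurable_cong_sets)
  qed
qed

lemma sphere_finite_measure:
  fixes \<mu> :: "(real ^ 'm::finite) measure"
  assumes "is_lebesgue_measure_on (CARD('m) - 1) (sphere 0 1) \<mu>"
  shows "finite_measure \<mu>"
  using lebesgue_measure_on_compact_finite[OF assms compact_sphere sphere_local_param] .

text \<open>The integral of \<open>H\<close> composed with a rotation does not depend on the angle.
  The claim is its derivative at angle 0, taken under the integral sign by dominated convergence of
  difference quotients. Only derivatives along orbits enter, so \<open>H\<close> may be given by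
  cases on the sphere.\<close>

lemma integral_sphere_rotation_derivative:
  fixes \<mu> :: "(real ^ 'm::finite) measure" and H K :: "real ^ 'm \<Rightarrow> 'b::{banach, second_countable_topology}"
  assumes \<mu>: "is_lebesgue_measure_on (CARD('m) - 1) (sphere 0 1) \<mu>" and ij: "i \<noteq> j"
    and H: "continuous_on (sphere 0 1) H" and K: "continuous_on (sphere 0 1) K"
    and der: "\<And>x. x \<in> sphere 0 1 \<Longrightarrow> ((\<lambda>\<theta>. H (rot i j \<theta> x)) has_vector_derivative K x) (at 0)"
  shows "(LINT x:sphere 0 1|\<mu>. K x) = 0"
proof -
  let ?S = "sphere 0 1 :: (real ^ 'm) set"
  have sets: "sets \<mu> = sets borel" using \<mu> by (simp add: is_lebesgue_measure_on_def)
  note fin = sphere_finite_measure[OF \<mu>]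
  interpret finite_measure \<mu> by (rule fin)
  have lin: "linear (rot i j \<theta>)" for \<theta>
    using orthogonal_transformation_rot[OF ij] by (rule orthogonal_transformation_linear)
  then have crot: "continuous_on S (rot i j \<theta>)" for S \<theta>
    by (auto intro: linear_continuous_on simp: linear_conv_bounded_linear)
  have rotS: "rot i j \<theta> x \<in> ?S \<longleftrightarrow> x \<in> ?S" for \<theta> x
    using orthogonal_transformation_norm[OF orthogonal_transformation_rot[OF ij]] by auto
  have inv: "(LINT x:?S|\<mu>. H (rot i j \<theta> x)) = (LINT x:?S|\<mu>. H x)" for \<theta>
  proof -
    have d: "distr \<mu> borel (rot i j \<theta>) = \<mu>"
      using lebesgue_measure_on_isometry[OF \<mu> compact_sphere sphere_local_param
          orthogonal_transformation_rot[OF ij] rot_sphere[OF ij]] .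
    have m: "(\<lambda>x. indicator ?S x *\<^sub>R H x) \<in> borel_measurable borel"
      using H by (intro borel_measurable_continuous_on_indicator) auto
    have "(LINT x:?S|\<mu>. H x) = (LINT x|distr \<mu> borel (rot i j \<theta>). indicator ?S x *\<^sub>R H x)"
      by (simp add: d set_lebesgue_integral_def)
    also have "\<dots> = (LINT x|\<mu>. indicator ?S (rot i j \<theta> x) *\<^sub>R H (rot i j \<theta> x))"
      using m crot[of UNIV \<theta>] sets
      by (intro integral_distr) (auto intro: borel_measurable_continuous_onI cong: measurable_cong_sets)
    also have "\<dots> = (LINT x:?S|\<mu>. H (rot i j \<theta> x))"
      unfolding set_lebesgue_integral_def
      by (intro Bochner_Integration.integral_cong) (use rotS in \<open>auto simp: indicator_def\<close>)
    finally show ?thesis by simp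
  qed
  obtain C where C: "\<And>x. x \<in> ?S \<Longrightarrow> norm (K x) \<le> C"
    using continuous_on_compact_bound[OF compact_sphere K] by blast
  define Q where "Q n x = real (Suc n) *\<^sub>R (H (rot i j (1 / real (Suc n)) x) - H x)" for n x
  \<comment> \<open>The group law moves the derivative from angle 0 to every angle.\<close>
  have der': "((\<lambda>\<theta>. H (rot i j \<theta> x)) has_vector_derivative K (rot i j \<theta> x)) (at \<theta>)" if "x \<in> ?S" for x \<theta>
  proof -
    have "((\<lambda>\<eta>. H (rot i j \<eta> (rot i j \<theta> x))) has_vector_derivative K (rot i j \<theta> x)) (at (\<theta> - \<theta>))"
      using der[of "rot i j \<theta> x"] that rotS by simp
    moreover have "((\<lambda>\<eta>. \<eta> - \<theta>) has_vector_derivative 1) (at \<theta>)"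
      by (auto intro!: derivative_eq_intros)
    ultimately have "(((\<lambda>\<eta>. H (rot i j \<eta> (rot i j \<theta> x))) \<circ> (\<lambda>\<eta>. \<eta> - \<theta>)) has_vector_derivative 1 *\<^sub>R K (rot i j \<theta> x)) (at \<theta>)"
      by (intro vector_diff_chain_at)
    moreover have "((\<lambda>\<eta>. H (rot i j \<eta> (rot i j \<theta> x))) \<circ> (\<lambda>\<eta>. \<eta> - \<theta>)) = (\<lambda>\<eta>. H (rot i j \<eta> x))"
      by (simp add: fun_eq_iff rot_add[OF ij, symmetric])
    ultimately show ?thesis by simp
  qed
  \<comment> \<open>\<open>2 * C\<close> bounds the oscillation of \<open>K\<close> along the orbit,
    hence the linearization error; the linear term contributes one more \<open>C\<close>.\<close>
  have Q_bound: "norm (Q n x) \<le> 3 * C" if x: "x \<in> ?S" for n x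
  proof -
    let ?h = "1 / real (Suc n)"
    have "norm (H (rot i j ?h x) - H (rot i j 0 x) - (?h - 0) *\<^sub>R K (rot i j 0 x)) \<le> norm (?h - 0) * (2 * C)"
    proof (rule vector_differentiable_bound_linearization[where S = UNIV and f = "\<lambda>\<theta>. H (rot i j \<theta> x)" and f' = "\<lambda>\<theta>. K (rot i j \<theta> x)"])
      fix \<theta> :: real
      show "((\<lambda>\<theta>. H (rot i j \<theta> x)) has_vector_derivative K (rot i j \<theta> x)) (at \<theta>)"
        by (rule der'[OF x])
      show "norm (K (rot i j \<theta> x) - K (rot i j 0 x)) \<le> 2 * C"
        using C[of "rot i j \<theta> x"] C[of x] x rotS norm_triangle_ineq4[of "K (rot i j \<theta> x)" "K x"] by fastforce
    qed auto
    then have "norm (H (rot i j ?h x) - H x) \<le> ?h * (2 * C) + norm (?h *\<^sub>R K x)"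
      using norm_triangle_sub[of "H (rot i j ?h x) - H x" "?h *\<^sub>R K x"] by simp
    also have "\<dots> \<le> ?h * (2 * C) + ?h * C"
      using mult_left_mono[OF C[OF x], of ?h] by simp
    also have "\<dots> = ?h * (3 * C)" by (simp only: distrib_left[symmetric]) simp
    finally have h: "norm (H (rot i j ?h x) - H x) \<le> ?h * (3 * C)" .
    have "norm (Q n x) = real (Suc n) * norm (H (rot i j ?h x) - H x)"
      by (simp only: Q_def norm_scaleR abs_of_nat)
    also have "\<dots> \<le> real (Suc n) * (?h * (3 * C))"
      by (rule mult_left_mono[OF h]) simp
    also have "\<dots> = 3 * C" by (simp del: of_nat_Suc)
    finally show ?thesis .
  qed
  have Q_lim: "(\<lambda>n. Q n x) \<longlonglongrightarrow> K x" if x: "x \<in> ?S" for x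
  proof -
    have "((\<lambda>\<theta>. (H (rot i j (0 + \<theta>) x) - H (rot i j 0 x)) /\<^sub>R \<theta>) \<longlongrightarrow> K x) (at 0)"
    proof (rule LIM_zero_cancel, rule tendsto_norm_zero_cancel)
      have "((\<lambda>\<theta>. norm (H (rot i j (0 + \<theta>) x) - H (rot i j 0 x) - \<theta> *\<^sub>R K x) / norm \<theta>) \<longlongrightarrow> 0) (at 0)"
        using der[OF x] unfolding has_vector_derivative_def has_derivative_at by blast
      moreover have "\<forall>\<^sub>F \<theta> in at 0. norm (H (rot i j (0 + \<theta>) x) - H (rot i j 0 x) - \<theta> *\<^sub>R K x) / norm \<theta>
          = norm ((H (rot i j (0 + \<theta>) x) - H (rot i j 0 x)) /\<^sub>R \<theta> - K x)"
      proof (rule eventually_at_filter[THEN iffD2, OF always_eventually], intro allI impI)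
        fix \<theta> :: real assume \<theta>: "\<theta> \<noteq> 0"
        then have "(H (rot i j (0 + \<theta>) x) - H (rot i j 0 x)) /\<^sub>R \<theta> - K x
            = (H (rot i j (0 + \<theta>) x) - H (rot i j 0 x) - \<theta> *\<^sub>R K x) /\<^sub>R \<theta>"
          by (simp add: scaleR_diff_right)
        then show "norm (H (rot i j (0 + \<theta>) x) - H (rot i j 0 x) - \<theta> *\<^sub>R K x) / norm \<theta>
          = norm ((H (rot i j (0 + \<theta>) x) - H (rot i j 0 x)) /\<^sub>R \<theta> - K x)"
          by (simp add: divide_inverse mult.commute)
      qed
      ultimately show "((\<lambda>\<theta>. norm ((H (rot i j (0 + \<theta>) x) - H (rot i j 0 x)) /\<^sub>R \<theta> - K x)) \<longlongrightarrow> 0) (at 0)"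
        by (rule Lim_transform_eventually)
    qed
    moreover have "filterlim (\<lambda>n. 1 / real (Suc n)) (at 0) sequentially"
      by (intro filterlim_atI LIMSEQ_Suc[OF lim_const_over_n]) auto
    ultimately have "(\<lambda>n. (H (rot i j (0 + 1 / real (Suc n)) x) - H (rot i j 0 x)) /\<^sub>R (1 / real (Suc n))) \<longlonglongrightarrow> K x"
      by (rule filterlim_compose)
    then show ?thesis by (simp add: Q_def)
  qed
  have int_H: "set_integrable \<mu> ?S (\<lambda>x. H (rot i j \<theta> x))" for \<theta>
    by (rule set_integrable_continuous_compact[OF fin sets compact_sphere])
      (intro continuous_on_compose2[OF H crot], use rotS in auto)
  have "(LINT x:?S|\<mu>. Q n x) = 0" for n
  proof -
    have "(LINT x:?S|\<mu>. Q n x) = real (Suc n) *\<^sub>R ((LINT x:?S|\<mu>. H (rot i j (1 / real (Suc n)) x)) - (LINT x:?S|\<mu>. H x))"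
      unfolding Q_def using int_H[of "1 / real (Suc n)"] int_H[of 0] by (simp add: set_integral_diff)
    then show ?thesis using inv by simp
  qed
  moreover have "(\<lambda>n. LINT x:?S|\<mu>. Q n x) \<longlonglongrightarrow> (LINT x:?S|\<mu>. K x)"
    unfolding set_lebesgue_integral_def
  proof (rule integral_dominated_convergence[where w = "\<lambda>_. 3 * C"])
    show "(\<lambda>x. indicator ?S x *\<^sub>R K x) \<in> borel_measurable \<mu>"
      using set_integrable_continuous_compact[OF fin sets compact_sphere K]
      by (auto simp: set_integrable_def)
    show "(\<lambda>x. indicator ?S x *\<^sub>R Q n x) \<in> borel_measurable \<mu>" for n
    proof -
      have "set_integrable \<mu> ?S (Q n)"
        unfolding Q_def using int_H[of "1 / real (Suc n)"] int_H[of 0] by simp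
      then show ?thesis by (auto simp: set_integrable_def)
    qed
    show "AE x in \<mu>. (\<lambda>n. indicator ?S x *\<^sub>R Q n x) \<longlonglongrightarrow> indicator ?S x *\<^sub>R K x"
    proof (rule AE_I2)
      fix x
      show "(\<lambda>n. indicator ?S x *\<^sub>R Q n x) \<longlonglongrightarrow> indicator ?S x *\<^sub>R K x"
        by (cases "x \<in> ?S") (use Q_lim[of x] in auto)
    qed
    show "AE x in \<mu>. norm (indicator ?S x *\<^sub>R Q n x) \<le> 3 * C" for n
    proof -
      \<comment> \<open>Off the sphere the integrand is 0, so the bound has to be nonnegative; a
        point of the sphere shows this.\<close>
      have "axis i 1 \<in> ?S" by simp
      then have "0 \<le> C" using C norm_ge_zero order_trans by blast
      then show ?thesis using Q_bound[of _ n] by (intro AE_I2) (auto simp: indicator_def)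
    qed
  qed auto
  ultimately show ?thesis by (simp add: LIMSEQ_const_iff)
qed

section \<open>Charts adapted to the boundary\<close>

text \<open>Differentiate \<open>\<gamma> t \<bullet> \<gamma> t = 1\<close>. The curve is known to
  be on the sphere only for parameters near but different from 0, so \<open>norm x = 1\<close> has
  to come from continuity.\<close>

lemma tangent_vector_sphere_orthogonal:
  assumes "tangent_vector (sphere 0 1) x v"
  shows "x \<bullet> v = 0"
proof -
  obtain \<gamma> where \<gamma>: "\<gamma> 0 = x" "\<forall>\<^sub>F t in at 0. \<gamma> t \<in> sphere 0 1" "(\<gamma> has_vector_derivative v) (at 0)"
    using assms by (auto simp: tangent_vector_def)
  have "((\<lambda>t. \<gamma> t \<bullet> \<gamma> t) has_derivative (\<lambda>s. \<gamma> 0 \<bullet> (s *\<^sub>R v) + (s *\<^sub>R v) \<bullet> \<gamma> 0)) (at 0)"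
    using \<gamma>(3) unfolding has_vector_derivative_def by (intro has_derivative_inner)
  moreover have "(\<gamma> \<longlongrightarrow> x) (at 0)"
    using has_vector_derivative_continuous[OF \<gamma>(3)] \<gamma>(1) by (simp add: continuous_at)
  then have "((\<lambda>t. norm (\<gamma> t)) \<longlongrightarrow> norm x) (at 0)" by (rule tendsto_norm)
  moreover have "\<forall>\<^sub>F t in at 0. 1 = norm (\<gamma> t)"
    using \<gamma>(2) by eventually_elim auto
  then have "((\<lambda>t. norm (\<gamma> t)) \<longlongrightarrow> 1) (at 0)"
    using tendsto_const by (rule Lim_transform_eventually[rotated])
  ultimately have x1: "norm x = 1" and
    d: "((\<lambda>t. \<gamma> t \<bullet> \<gamma> t) has_derivative (\<lambda>s. \<gamma> 0 \<bullet> (s *\<^sub>R v) + (s *\<^sub>R v) \<bullet> \<gamma> 0)) (at 0)"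
    using tendsto_unique[of "at (0::real)" "\<lambda>t. norm (\<gamma> t)"] by auto
  have "((\<lambda>t. 1::real) has_derivative (\<lambda>s. \<gamma> 0 \<bullet> (s *\<^sub>R v) + (s *\<^sub>R v) \<bullet> \<gamma> 0)) (at 0)"
  proof (rule has_derivative_transform_eventually[OF d])
    show "\<forall>\<^sub>F t in at 0. \<gamma> t \<bullet> \<gamma> t = 1"
      using \<gamma>(2) by eventually_elim (simp add: norm_eq_1)
    show "\<gamma> 0 \<bullet> \<gamma> 0 = 1" using x1 \<gamma>(1) by (simp add: norm_eq_1)
  qed simp
  then have "(\<lambda>s::real. \<gamma> 0 \<bullet> (s *\<^sub>R v) + (s *\<^sub>R v) \<bullet> \<gamma> 0) = (\<lambda>_. 0)"
    by (rule has_derivative_unique) (rule has_derivative_const)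
  from fun_cong[OF this, of 1] show ?thesis
    using \<gamma>(1) by (simp add: inner_commute)
qed

text \<open>If \<open>\<rho>' \<nu>\<close> were negative, \<open>\<rho>\<close> would increase from
  0 along the inward curve, which runs in \<open>V\<close>, where \<open>\<rho>\<close> is negative.
  The strict sign is obtained later from the chart.\<close>

lemma outward_normal_derivative_nonneg:
  fixes x \<nu> :: "'a::euclidean_space" and \<rho> :: "'a \<Rightarrow> real"
  assumes out: "outward_unit_normal V x \<nu>" and x: "x \<in> sphere 0 1"
    and N: "open N" "x \<in> N" "V \<inter> N \<subseteq> {y. \<rho> y < 0}" "\<rho> x = 0"
    and der: "(\<rho> has_derivative \<rho>') (at x)"
  shows "0 \<le> \<rho>' \<nu>"
proof (rule ccontr)
  assume neg: "\<not> 0 \<le> \<rho>' \<nu>"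
  have orth: "x \<bullet> \<nu> = 0" and n1: "norm \<nu> = 1"
    and ev: "\<forall>\<^sub>F t in at_right 0. sgn (x - t *\<^sub>R \<nu>) \<in> V"
    using out tangent_vector_sphere_orthogonal
    by (auto simp: outward_unit_normal_def elim: eventually_mono)
  \<comment> \<open>This is \<open>sgn (x - t *\<^sub>R \<nu>)\<close> in closed form: \<nu> is a
    unit vector orthogonal to \<open>x\<close>, which gives the norm
    \<open>sqrt (1 + t\<^sup>2)\<close>. The velocity at 0 is \<open>- \<nu>\<close>.\<close>
  define \<gamma> where "\<gamma> t = (x - t *\<^sub>R \<nu>) /\<^sub>R sqrt (1 + t\<^sup>2)" for t :: real
  have sq: "(norm (x - t *\<^sub>R \<nu>))\<^sup>2 = 1 + t\<^sup>2" for t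
    using x n1 orth
    by (simp add: power2_norm_eq_inner inner_diff_left inner_diff_right inner_commute[of \<nu> x] norm_eq_1)
      (simp add: power2_eq_square)
  have "norm (x - t *\<^sub>R \<nu>) = sqrt (1 + t\<^sup>2)" for t
    using arg_cong[OF sq[of t], of sqrt] by simp
  then have sg: "sgn (x - t *\<^sub>R \<nu>) = \<gamma> t" for t
    by (simp add: sgn_div_norm \<gamma>_def)
  have "((\<lambda>t. inverse (sqrt (1 + t\<^sup>2))) has_real_derivative 0) (at 0)"
    by (auto intro!: derivative_eq_intros)
  then have d\<gamma>: "(\<gamma> has_vector_derivative - \<nu>) (at 0)"
    unfolding \<gamma>_def by (auto intro!: derivative_eq_intros)
  have \<gamma>0: "\<gamma> 0 = x" by (simp add: \<gamma>_def)
  have lin: "linear \<rho>'" using der by (rule has_derivative_linear)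
  have "((\<rho> \<circ> \<gamma>) has_real_derivative \<rho>' (- \<nu>)) (at 0)"
  proof -
    have "((\<rho> \<circ> \<gamma>) has_derivative (\<rho>' \<circ> (\<lambda>s. s *\<^sub>R - \<nu>))) (at 0)"
      by (rule diff_chain_at) (use d\<gamma> der \<gamma>0 in \<open>simp_all add: has_vector_derivative_def\<close>)
    moreover have "\<rho>' \<circ> (\<lambda>s. s *\<^sub>R - \<nu>) = (*) (\<rho>' (- \<nu>))"
      by (rule ext) (simp only: o_apply linear_scale[OF lin] real_scaleR_def mult.commute)
    ultimately show ?thesis by (simp only: has_field_derivative_def)
  qed
  then have "((\<rho> \<circ> \<gamma>) has_real_derivative \<rho>' (- \<nu>)) (at 0 within UNIV)" by simp
  from has_real_derivative_pos_inc_right[OF this] neg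
  obtain d where d: "d > 0" "\<And>h. 0 < h \<Longrightarrow> h < d \<Longrightarrow> (\<rho> \<circ> \<gamma>) 0 < (\<rho> \<circ> \<gamma>) h"
    by (auto simp: linear_neg[OF lin])
  have "(\<gamma> \<longlongrightarrow> x) (at 0)"
    using has_vector_derivative_continuous[OF d\<gamma>] \<gamma>0 by (simp add: continuous_at)
  then have "\<forall>\<^sub>F t in at 0. \<gamma> t \<in> N" using N by (metis topological_tendstoD)
  then have "\<forall>\<^sub>F t in at_right 0. \<gamma> t \<in> N"
    by (simp add: eventually_at_split)
  with ev have "\<forall>\<^sub>F t in at_right 0. \<rho> (\<gamma> t) < 0"
    by eventually_elim (use N sg in auto)
  moreover have "\<forall>\<^sub>F t in at_right 0. t \<in> {0<..<d}"
    using d(1) by (rule eventually_at_right_real)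
  ultimately have "\<forall>\<^sub>F t::real in at_right 0. False"
    by eventually_elim (use d(2) N(4) \<gamma>0 in fastforce)
  then show False by simp
qed

text \<open>
  One local diffeomorphism \<open>\<Psi>\<close> straightens the sphere and the boundary at once: its \<open>i\<close>-th coordinate
  is \<open>\<bar>x\<bar>\<^sup>2 - 1\<close> and its \<open>j\<close>-th coordinate is the defining function \<open>\<rho>\<close>.  The restrictions of its
  inverse \<open>\<Phi>\<close> to coordinate subspaces parametrize both; \<open>D\<close> is the derivative of \<open>\<Phi>\<close>.
\<close>

definition boundary_chart ::
  "(real ^ 'm::finite) set \<Rightarrow> 'm \<Rightarrow> 'm \<Rightarrow> (real ^ 'm) set \<Rightarrow> (real ^ 'm) set \<Rightarrow> (real ^ 'm \<Rightarrow> real ^ 'm) \<Rightarrow>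
   (real ^ 'm \<Rightarrow> real ^ 'm) \<Rightarrow> (real ^ 'm \<Rightarrow> real ^ 'm \<Rightarrow> real ^ 'm) \<Rightarrow>
   (real ^ 'm \<Rightarrow> real) \<Rightarrow> (real ^ 'm \<Rightarrow> (real ^ 'm) \<Rightarrow>\<^sub>L real) \<Rightarrow> bool" where
  "boundary_chart V i j N T \<Psi> \<Phi> D \<rho> \<rho>' \<longleftrightarrow> i \<noteq> j \<and> open N \<and> open T \<and> homeomorphism N T \<Psi> \<Phi> \<and>
     (\<forall>t\<in>T. (\<Phi> has_derivative D t) (at t) \<and> inj (D t)) \<and> (\<forall>w. continuous_on T (\<lambda>t. D t w)) \<and>
     (\<forall>x\<in>N. \<Psi> x $ i = x \<bullet> x - 1 \<and> \<Psi> x $ j = \<rho> x \<and> (\<rho> has_derivative blinfun_apply (\<rho>' x)) (at x)) \<and>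
     continuous_on N \<rho>' \<and>
     (\<forall>t\<in>T. \<forall>k. \<Phi> t \<bullet> D t (axis k 1) = (if k = i then 1 / 2 else 0) \<and>
        \<rho>' (\<Phi> t) (D t (axis k 1)) = (if k = j then 1 else 0)) \<and>
     V \<inter> N = {x \<in> sphere 0 1 \<inter> N. \<rho> x < 0} \<and>
     sph_boundary V \<inter> N = {x \<in> sphere 0 1 \<inter> N. \<rho> x = 0}"

text \<open>The condition on tangent vectors says that the gradient of \<open>\<rho>\<close> at
  \<open>p\<close> is not a multiple of \<open>p\<close>. So some 2 by 2 minor of these two vectors
  is nonzero, and its indices \<open>i\<close>, \<open>j\<close> are the coordinates that
  \<open>\<Psi>\<close> replaces.\<close>

lemma boundary_chart_exists:
  fixes V :: "(real ^ 'm::finite) set"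
  assumes V: "C1_boundary V" and p: "p \<in> sph_boundary V"
  obtains i j N T \<Psi> \<Phi> D \<rho> \<rho>' where "boundary_chart V i j N T \<Psi> \<Phi> D \<rho> \<rho>'" "p \<in> N"
proof -
  obtain W and \<rho> :: "real ^ 'm \<Rightarrow> real" where W: "open W" "p \<in> W" "C1_on W \<rho>"
    "V \<inter> W = {x \<in> sphere 0 1 \<inter> W. \<rho> x < 0}"
    "sph_boundary V \<inter> W = {x \<in> sphere 0 1 \<inter> W. \<rho> x = 0}"
    "\<forall>x\<in>sph_boundary V \<inter> W. \<exists>v. x \<bullet> v = 0 \<and> frechet_derivative \<rho> (at x) v \<noteq> 0"
    using bspec[OF V[unfolded C1_boundary_def] p] by (elim exE conjE) blast
  obtain \<rho>' where \<rho>': "\<And>x. x \<in> W \<Longrightarrow> (\<rho> has_derivative blinfun_apply (\<rho>' x)) (at x)" "continuous_on W \<rho>'"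
    using W(3) by (auto simp: C1_on_def)
  have fr: "frechet_derivative \<rho> (at p) = blinfun_apply (\<rho>' p)"
    using frechet_derivative_at[OF \<rho>'(1)[OF W(2)]] by simp
  obtain v where v: "p \<bullet> v = 0" "\<rho>' p v \<noteq> 0" using bspec[OF W(6), of p] W(2) p fr by auto
  have pS: "p \<in> sphere 0 1" using W(2,5) p by blast
  have \<rho>exp: "\<rho>' p y = (\<Sum>k\<in>UNIV. y $ k * \<rho>' p (axis k 1))" for y
    using linear_axis_sum[OF linear_blinfun, of "\<rho>' p" y] by simp
  obtain i where i: "p $ i \<noteq> 0"
    using pS by (metis norm_zero vec_eq_iff zero_index zero_neq_one mem_sphere_0)
  \<comment> \<open>If every minor containing the index \<open>i\<close> vanished,
    \<open>p $ i * \<rho>' p v\<close> would be a multiple of \<open>p \<bullet> v\<close>, which is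
    0.\<close>
  have "\<exists>j. p $ i * \<rho>' p (axis j 1) \<noteq> p $ j * \<rho>' p (axis i 1)"
  proof (rule ccontr)
    assume "\<not> ?thesis"
    then have eq: "p $ i * \<rho>' p (axis j 1) = p $ j * \<rho>' p (axis i 1)" for j by auto
    have "p $ i * \<rho>' p v = (\<Sum>k\<in>UNIV. v $ k * (p $ i * \<rho>' p (axis k 1)))"
      by (subst \<rho>exp) (simp add: sum_distrib_left algebra_simps)
    also have "\<dots> = (p \<bullet> v) * \<rho>' p (axis i 1)"
      by (simp add: eq inner_vec_def sum_distrib_right sum_distrib_left algebra_simps)
    finally show False using v i by simp
  qed
  then obtain j where j: "p $ i * \<rho>' p (axis j 1) \<noteq> p $ j * \<rho>' p (axis i 1)" by blast
  then have ij: "i \<noteq> j" by auto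
  define \<Psi> :: "real ^ 'm \<Rightarrow> real ^ 'm"
    where "\<Psi> x = x + (x \<bullet> x - 1 - x $ i) *\<^sub>R axis i 1 + (\<rho> x - x $ j) *\<^sub>R axis j 1" for x
  define d\<Psi> where "d\<Psi> x w = w + (2 * (x \<bullet> w) - w $ i) *\<^sub>R axis i 1 + (\<rho>' x w - w $ j) *\<^sub>R axis j 1"
    for x w :: "real ^ 'm"
  have der0: "(\<Psi> has_derivative d\<Psi> x) (at x)" if "x \<in> W" for x
    unfolding \<Psi>_def[abs_def] d\<Psi>_def[abs_def]
    by (auto intro!: derivative_eq_intros \<rho>'(1)[OF that] bounded_linear_imp_has_derivative[OF bounded_linear_vec_nth] simp: inner_commute)
  define \<Psi>' where "\<Psi>' x = Blinfun (d\<Psi> x)" for x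
  have ap: "blinfun_apply (\<Psi>' x) = d\<Psi> x" if "x \<in> W" for x
    unfolding \<Psi>'_def by (rule bounded_linear_Blinfun_apply[OF has_derivative_bounded_linear[OF der0[OF that]]])
  have der: "(\<Psi> has_derivative blinfun_apply (\<Psi>' x)) (at x)" if "x \<in> W" for x
    unfolding ap[OF that] by (rule der0[OF that])
  have cont: "continuous_on W \<Psi>'"
  proof (rule continuous_on_blinfun_componentwise)
    fix b :: "real ^ 'm"
    have "continuous_on W (\<lambda>x. d\<Psi> x b)"
      unfolding d\<Psi>_def by (intro continuous_intros \<rho>'(2))
    then show "continuous_on W (\<lambda>x. blinfun_apply (\<Psi>' x) b)"
      by (rule continuous_on_eq) (simp add: ap)
  qed
  have comp: "d\<Psi> x w $ k = (if k = i then 2 * (x \<bullet> w) else if k = j then \<rho>' x w else w $ k)" for x w k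
    using ij by (simp add: d\<Psi>_def axis_def)
  have "w = 0" if "blinfun_apply (\<Psi>' p) w = 0" for w
  proof -
    have c: "d\<Psi> p w $ k = 0" for k using that ap[OF W(2)] by simp
    have wk: "w $ k = 0" if "k \<noteq> i" "k \<noteq> j" for k
      using c[of k] comp[of p w k] that by simp
    have split: "(\<Sum>k\<in>UNIV. f k) = f i + f j" if "\<And>k. k \<noteq> i \<Longrightarrow> k \<noteq> j \<Longrightarrow> f k = 0" for f :: "'m \<Rightarrow> real"
    proof -
      have "sum f UNIV = sum f {i, j}" by (rule sum.mono_neutral_right) (use that in auto)
      then show ?thesis using ij by simp
    qed
    have 1: "p $ i * w $ i + p $ j * w $ j = 0"
      using c[of i] comp[of p w i] split[of "\<lambda>k. p $ k * w $ k"] wk by (simp add: inner_vec_def)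
    have 2: "w $ i * \<rho>' p (axis i 1) + w $ j * \<rho>' p (axis j 1) = 0"
      using c[of j] comp[of p w j] ij split[of "\<lambda>k. w $ k * \<rho>' p (axis k 1)"] wk by (simp add: \<rho>exp[of w])
    \<comment> \<open>Eliminating \<open>w $ i\<close> from the two equations leaves
      \<open>w $ j\<close> times the nonzero minor.\<close>
    have "w $ j * (p $ i * \<rho>' p (axis j 1) - p $ j * \<rho>' p (axis i 1))
        = p $ i * (w $ i * \<rho>' p (axis i 1) + w $ j * \<rho>' p (axis j 1)) - \<rho>' p (axis i 1) * (p $ i * w $ i + p $ j * w $ j)"
      by (simp add: algebra_simps)
    then have "w $ j = 0" using 1 2 j by simp
    moreover have "w $ i = 0" using 1 i \<open>w $ j = 0\<close> by simp
    ultimately show "w = 0" using wk by (metis vec_eq_iff zero_index)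
  qed
  then have inj: "inj (blinfun_apply (\<Psi>' p))"
    by (subst linear_injective_0[OF linear_blinfun]) blast
  obtain N T \<Phi> where N: "open N" "p \<in> N" "N \<subseteq> W" "open T" "homeomorphism N T \<Psi> \<Phi>"
    "\<And>t. t \<in> T \<Longrightarrow> (\<Phi> has_derivative inv (blinfun_apply (\<Psi>' (\<Phi> t)))) (at t)"
    "\<And>t. t \<in> T \<Longrightarrow> bij (blinfun_apply (\<Psi>' (\<Phi> t)))"
    "\<And>w. continuous_on T (\<lambda>t. inv (blinfun_apply (\<Psi>' (\<Phi> t))) w)"
    using C1_straightening[OF W(1) der cont W(2) inj] by metis
  define D where "D t = inv (blinfun_apply (\<Psi>' (\<Phi> t)))" for t
  have injD: "inj (D t)" if "t \<in> T" for t
    unfolding D_def using N(7)[OF that] bij_imp_bij_inv bij_is_inj by blast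
  have \<Phi>W: "\<Phi> t \<in> N" if "t \<in> T" for t
    using N(5) that by (auto simp: homeomorphism_def)
  have dD: "d\<Psi> (\<Phi> t) (D t w) = w" if "t \<in> T" for t w
    using surj_f_inv_f[OF bij_is_surj[OF N(7)[OF that]], of w] ap[of "\<Phi> t"] \<Phi>W[OF that] N(3)
    by (auto simp: D_def)
  have "boundary_chart V i j N T \<Psi> \<Phi> D \<rho> \<rho>'"
    unfolding boundary_chart_def
  proof (intro conjI ballI allI)
    fix x assume "x \<in> N"
    show "\<Psi> x $ i = x \<bullet> x - 1" "\<Psi> x $ j = \<rho> x"
      using ij by (simp_all add: \<Psi>_def axis_def)
    show "(\<rho> has_derivative blinfun_apply (\<rho>' x)) (at x)" using \<rho>' \<open>x \<in> N\<close> N(3) by blast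
  next
    fix t k assume t: "t \<in> T"
    have c: "d\<Psi> (\<Phi> t) (D t (axis k 1)) $ l = (if l = k then 1 else 0)" for l
      by (simp add: dD[OF t] axis_def)
    \<comment> \<open>The i-th coordinate of \<open>\<Psi>\<close> has derivative
      \<open>2 * (x \<bullet> w)\<close>, whence the value 1/2.\<close>
    show "\<Phi> t \<bullet> D t (axis k 1) = (if k = i then 1 / 2 else 0)"
      using c[of i] comp[of "\<Phi> t" "D t (axis k 1)" i] by (auto split: if_splits)
    show "\<rho>' (\<Phi> t) (D t (axis k 1)) = (if k = j then 1 else 0)"
      using c[of j] comp[of "\<Phi> t" "D t (axis k 1)" j] ij by (auto split: if_splits)
  next
    show "V \<inter> N = {x \<in> sphere 0 1 \<inter> N. \<rho> x < 0}" "sph_boundary V \<inter> N = {x \<in> sphere 0 1 \<inter> N. \<rho> x = 0}"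
      using W(4,5) N(3) by blast+
    show "continuous_on N \<rho>'" using \<rho>'(2) N(3) by (rule continuous_on_subset)
    show "continuous_on T (\<lambda>t. D t w)" for w unfolding D_def by (rule N(8))
    show "(\<Phi> has_derivative D t) (at t)" if "t \<in> T" for t unfolding D_def by (rule N(6)[OF that])
  qed (use ij N injD in auto)
  then show thesis using N(2) that by blast
qed

lemma boundary_chart_local_param:
  fixes V :: "(real ^ 'm::finite) set"
  assumes "boundary_chart V i j N T \<Psi> \<Phi> D \<rho> \<rho>'"
  shows "local_param (CARD('m) - 1) (sphere 0 1) ((\<lambda>k. axis k 1) ` (- {i})) (T \<inter> span ((\<lambda>k. axis k 1) ` (- {i}))) \<Phi>"
    and "\<Phi> ` (T \<inter> span ((\<lambda>k. axis k 1) ` (- {i}))) = sphere 0 1 \<inter> N"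
    and "local_param (CARD('m) - 2) (sph_boundary V) ((\<lambda>k. axis k 1) ` (- {i, j})) (T \<inter> span ((\<lambda>k. axis k 1) ` (- {i, j}))) \<Phi>"
    and "\<Phi> ` (T \<inter> span ((\<lambda>k. axis k 1) ` (- {i, j}))) = sph_boundary V \<inter> N"
proof -
  note b = assms[unfolded boundary_chart_def]
  have M1: "sphere 0 1 \<inter> N = {x \<in> N. \<forall>k\<in>{i}. \<Psi> x $ k = 0}"
    using b by (auto simp: norm_eq_1)
  have M2: "sph_boundary V \<inter> N = {x \<in> N. \<forall>k\<in>{i, j}. \<Psi> x $ k = 0}"
    using b by (auto simp: norm_eq_1)
  have c: "card {i, j} = 2" "card {i} = 1" using b by auto
  have h: "homeomorphism N T \<Psi> \<Phi>" "open N" "open T" using b by auto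
  have d: "\<And>t. t \<in> T \<Longrightarrow> (\<Phi> has_derivative D t) (at t)" "\<And>t. t \<in> T \<Longrightarrow> inj (D t)"
    "\<And>w. continuous_on T (\<lambda>t. D t w)" using b by auto
  have l: "local_param (CARD('m) - card I) M ((\<lambda>k. axis k 1) ` (- I)) (T \<inter> span ((\<lambda>k. axis k 1) ` (- I))) \<Phi>"
    if "M \<inter> N = {x \<in> N. \<forall>k\<in>I. \<Psi> x $ k = 0}" for I M
    by (rule local_param_straightening(1)[OF h _ _ _ that]) (use d in auto)
  have im: "\<Phi> ` (T \<inter> span ((\<lambda>k. axis k 1) ` (- I))) = M \<inter> N"
    if "M \<inter> N = {x \<in> N. \<forall>k\<in>I. \<Psi> x $ k = 0}" for I M
    by (rule local_param_straightening(2)[OF h _ _ _ that]) (use d in auto)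
  show "local_param (CARD('m) - 1) (sphere 0 1) ((\<lambda>k. axis k 1) ` (- {i})) (T \<inter> span ((\<lambda>k. axis k 1) ` (- {i}))) \<Phi>"
    using l[OF M1] by (simp only: c)
  show "\<Phi> ` (T \<inter> span ((\<lambda>k. axis k 1) ` (- {i}))) = sphere 0 1 \<inter> N"
    by (rule im[OF M1])
  show "local_param (CARD('m) - 2) (sph_boundary V) ((\<lambda>k. axis k 1) ` (- {i, j})) (T \<inter> span ((\<lambda>k. axis k 1) ` (- {i, j}))) \<Phi>"
    using l[OF M2] by (simp only: c)
  show "\<Phi> ` (T \<inter> span ((\<lambda>k. axis k 1) ` (- {i, j}))) = sph_boundary V \<inter> N"
    by (rule im[OF M2])
qed

text \<open>
  The two volume densities are \<open>J = \<bar>det (v, x)\<bar>\<close> and \<open>J' = \<bar>det (v, \<nu>, x)\<bar>\<close>, and by Cramer's rule they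
  differ by the factor \<open>v\<^sub>j \<bullet> \<nu> = 1 / \<rho>' \<nu>\<close>.
\<close>

lemma boundary_chart_normal:
  fixes V :: "(real ^ 'm::finite) set"
  assumes bc: "boundary_chart V i j N T \<Psi> \<Phi> D \<rho> \<rho>'"
    and t: "t \<in> T \<inter> span ((\<lambda>k. axis k 1) ` (- {i, j}))"
    and out: "outward_unit_normal V (\<Phi> t) \<nu>" and w: "\<Phi> t \<bullet> w = 0"
  defines "J \<equiv> sqrt (gram_det ((\<lambda>k. axis k 1) ` (- {i})) \<Phi> t)"
    and "J' \<equiv> sqrt (gram_det ((\<lambda>k. axis k 1) ` (- {i, j})) \<Phi> t)"
  shows "0 < \<rho>' (\<Phi> t) \<nu>" and "\<rho>' (\<Phi> t) w = (w \<bullet> \<nu>) * \<rho>' (\<Phi> t) \<nu>"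
    and "J * \<rho>' (\<Phi> t) w = J' * (w \<bullet> \<nu>)" and "0 \<le> J'"
proof -
  note b = bc[unfolded boundary_chart_def]
  note lp = boundary_chart_local_param[OF bc]
  let ?x = "\<Phi> t" and ?B = "(\<lambda>k::'m. axis k (1::real)) ` (- {i, j})"
  define v where "v k = D t (axis k 1)" for k
  have ij: "i \<noteq> j" using b by simp
  have tT: "t \<in> T" using t by simp
  have x: "?x \<in> sph_boundary V \<inter> N" using lp(4) t by blast
  then have xS: "?x \<in> sphere 0 1" "\<rho> ?x = 0" using b by blast+
  have vx: "v k \<bullet> ?x = (if k = i then 1 / 2 else 0)" and v\<rho>: "\<rho>' ?x (v k) = (if k = j then 1 else 0)" for k
    using b tT by (auto simp: v_def inner_commute)
  have der: "(\<Phi> has_derivative D t) (at t)" using b tT by blast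
  have dd: "dir_deriv \<Phi> (axis k 1) t = v k" for k
    unfolding v_def by (rule dir_deriv_eq[OF der])
  have x\<nu>: "?x \<bullet> \<nu> = 0" and n1: "\<nu> \<bullet> \<nu> = 1"
    using out tangent_vector_sphere_orthogonal by (auto simp: outward_unit_normal_def norm_eq_1)
  \<comment> \<open>For these \<open>k\<close> the coordinate lines of the chart run in the
    boundary, so their velocities \<open>v k\<close> are tangent to it.\<close>
  have v\<nu>: "v k \<bullet> \<nu> = 0" if k: "k \<notin> {i, j}" for k
  proof -
    have "tangent_vector (sph_boundary V) ?x (v k)"
      unfolding tangent_vector_def
    proof (intro exI conjI)
      show "\<Phi> (t + 0 *\<^sub>R axis k 1) = ?x" by simp
      show "((\<lambda>s. \<Phi> (t + s *\<^sub>R axis k 1)) has_vector_derivative v k) (at 0)"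
        unfolding v_def by (rule has_derivative_line[OF der])
      have "((\<lambda>s. t + s *\<^sub>R axis k 1) \<longlongrightarrow> t + 0 *\<^sub>R axis k 1) (at (0::real))"
        by (intro tendsto_intros)
      then have "\<forall>\<^sub>F s in at (0::real). t + s *\<^sub>R axis k 1 \<in> T"
        by (rule topological_tendstoD) (use b tT in auto)
      then show "\<forall>\<^sub>F s in at 0. \<Phi> (t + s *\<^sub>R axis k 1) \<in> sph_boundary V"
      proof eventually_elim
        case (elim s)
        have "t + s *\<^sub>R axis k 1 \<in> span ?B"
          using t k by (intro span_add span_scale) (auto intro: span_base)
        then show ?case using elim lp(4) by blast
      qed
    qed
    then show ?thesis using out by (auto simp: outward_unit_normal_def inner_commute)
  qed
  \<comment> \<open>\<open>A'\<close> completes the tangent frame of the boundary by the position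
    vector in row \<open>i\<close> and by \<nu> in row \<open>j\<close>; \<open>A\<close> keeps
    \<open>v j\<close> in row \<open>j\<close>.\<close>
  define A' :: "real^'m^'m" where "A' = (\<chi> k. if k \<in> - {i, j} then v k else if k = i then ?x else \<nu>)"
  define A :: "real^'m^'m" where "A = (\<chi> k. if k \<in> - {i} then v k else ?x)"
  have J': "J' = \<bar>det A'\<bar>"
    unfolding J'_def A'_def dd[symmetric]
    by (rule sqrt_gram_det_axis) (use ij vx v\<nu> x\<nu> n1 xS in \<open>auto simp: dd inner_commute norm_eq_1\<close>)
  have J: "J = \<bar>det A\<bar>"
    unfolding J_def A_def dd[symmetric]
    by (rule sqrt_gram_det_axis) (use vx xS in \<open>auto simp: dd norm_eq_1\<close>)
  show "0 \<le> J'" using J' by simp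
  have "gram_det ?B \<Phi> t \<noteq> 0" using lp(3) t by (auto simp: local_param_def)
  then have "det A' \<noteq> 0" using J' by (auto simp: J'_def)
  \<comment> \<open>The rows of \<open>A'\<close> form a basis. All rows but the j-th are orthogonal
    to \<nu>, so the coefficient there is \<open>y \<bullet> \<nu>\<close>; in the same way row
    \<open>i\<close> carries the component along the position vector.\<close>
  have expand: "\<exists>a. y = (\<Sum>k\<in>UNIV. a $ k *s row k A') \<and> a $ j = y \<bullet> \<nu> \<and> (y \<bullet> ?x = 0 \<longrightarrow> a $ i = 0)" for y
  proof -
    have "invertible (transpose A')" using \<open>det A' \<noteq> 0\<close> by (simp add: invertible_det_nz)
    then obtain a where a: "transpose A' *v a = y"
      by (metis invertible_def matrix_vector_mul_assoc matrix_vector_mul_lid)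
    have y: "y = (\<Sum>k\<in>UNIV. a $ k *s row k A')"
      using a by (simp add: matrix_mult_sum)
    have r: "row k A' = (if k \<in> - {i, j} then v k else if k = i then ?x else \<nu>)" for k
      by (simp add: row_def A'_def vec_eq_iff)
    have dot: "y \<bullet> z = (\<Sum>k\<in>UNIV. a $ k * (row k A' \<bullet> z))" for z
      by (subst y) (simp add: inner_sum_left scalar_mult_eq_scaleR)
    have "y \<bullet> \<nu> = (\<Sum>k\<in>UNIV. if k = j then a $ j else 0)"
      unfolding dot by (rule sum.cong) (use ij v\<nu> x\<nu> n1 in \<open>auto simp: r\<close>)
    moreover have "y \<bullet> ?x = (\<Sum>k\<in>UNIV. if k = i then a $ i else 0)"
      unfolding dot by (rule sum.cong) (use ij vx x\<nu> xS in \<open>auto simp: r inner_commute norm_eq_1\<close>)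
    ultimately show ?thesis using y by auto
  qed
  \<comment> \<open>On the tangent space of the sphere only the coefficient of \<nu> survives,
    because \<open>\<rho>'\<close> vanishes on the tangent frame of the boundary.\<close>
  have grad: "\<rho>' ?x y = (y \<bullet> \<nu>) * \<rho>' ?x \<nu>" if y0: "y \<bullet> ?x = 0" for y
  proof -
    obtain a where a: "y = (\<Sum>k\<in>UNIV. a $ k *s row k A')" "a $ j = y \<bullet> \<nu>" "a $ i = 0"
      using expand[of y] y0 by blast
    have "\<rho>' ?x y = (\<Sum>k\<in>UNIV. a $ k * \<rho>' ?x (row k A'))"
      by (subst a(1)) (simp add: scalar_mult_eq_scaleR linear_sum[OF linear_blinfun] linear_scale[OF linear_blinfun])
    also have "\<dots> = (\<Sum>k\<in>UNIV. if k = j then (y \<bullet> \<nu>) * \<rho>' ?x \<nu> else 0)"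
    proof (rule sum.cong[OF refl])
      fix k
      have "row k A' = (if k \<in> - {i, j} then v k else if k = i then ?x else \<nu>)"
        by (simp add: row_def A'_def vec_eq_iff)
      then show "a $ k * \<rho>' ?x (row k A') = (if k = j then (y \<bullet> \<nu>) * \<rho>' ?x \<nu> else 0)"
        using ij a v\<rho> by auto
    qed
    finally show ?thesis by simp
  qed
  define c where "c = v j \<bullet> \<nu>"
  have c: "c * \<rho>' ?x \<nu> = 1"
    using grad[of "v j"] v\<rho>[of j] vx[of j] ij by (simp add: c_def)
  have "0 \<le> \<rho>' ?x \<nu>"
  proof (rule outward_normal_derivative_nonneg[OF out xS(1)])
    show "open N" "?x \<in> N" "\<rho> ?x = 0" using b x xS by simp_all
    show "V \<inter> N \<subseteq> {y. \<rho> y < 0}" using b by blast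
    show "(\<rho> has_derivative blinfun_apply (\<rho>' ?x)) (at ?x)" using b x by blast
  qed
  moreover have "\<rho>' ?x \<nu> \<noteq> 0" using c by auto
  ultimately show pos: "0 < \<rho>' ?x \<nu>" by simp
  show g: "\<rho>' ?x w = (w \<bullet> \<nu>) * \<rho>' ?x \<nu>" using grad w by (simp add: inner_commute)
  obtain a where a: "v j = (\<Sum>k\<in>UNIV. a $ k *s row k A')" "a $ j = c"
    using expand[of "v j"] by (auto simp: c_def)
  \<comment> \<open>\<open>A\<close> arises from \<open>A'\<close> by putting \<open>v j\<close> in
    row \<open>j\<close>, and \<open>c\<close> is the coefficient of \<open>v j\<close> with respect
    to the row it replaces.\<close>
  have "A = (\<chi> k. if k = j then \<Sum>k\<in>UNIV. a $ k *s row k A' else row k A')"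
    unfolding a(1)[symmetric] using ij by (auto simp: A_def A'_def vec_eq_iff row_def)
  then have "det A = c * det A'"
    using cramer_lemma_transpose[of j a A'] a(2) by simp
  moreover have "c > 0" using c pos by (metis zero_less_mult_pos2 zero_less_one)
  ultimately have "J = c * J'" by (simp add: J J' abs_mult)
  then have "J * \<rho>' ?x w = J' * (w \<bullet> \<nu>) * (c * \<rho>' ?x \<nu>)" by (simp add: g)
  then show "J * \<rho>' ?x w = J' * (w \<bullet> \<nu>)" by (simp add: c)
qed

text \<open>\<nu> is given pointwise only. Near a boundary point it is the normalization of
  \<open>m\<close>, the gradient of \<open>\<rho>\<close> projected to the tangent space of the
  sphere, and \<open>m\<close> is continuous because \<open>\<rho>\<close> is C1.\<close>

lemma continuous_on_outward_normal:
  fixes V :: "(real ^ 'm::finite) set"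
  assumes V: "C1_boundary V" and out: "\<And>x. x \<in> sph_boundary V \<Longrightarrow> outward_unit_normal V x (\<nu> x)"
  shows "continuous_on (sph_boundary V) \<nu>"
  unfolding continuous_on_eq_continuous_within
proof
  fix p assume p: "p \<in> sph_boundary V"
  obtain i j N T \<Psi> \<Phi> D \<rho> \<rho>' where bc: "boundary_chart V i j N T \<Psi> \<Phi> D \<rho> \<rho>'" "p \<in> N"
    using boundary_chart_exists[OF V p] by blast
  note b = bc(1)[unfolded boundary_chart_def]
  define m where "m x = (\<chi> k. \<rho>' x (axis k 1 - (x $ k) *\<^sub>R x))" for x
  have mc: "continuous_on N m"
    unfolding m_def using b by (intro continuous_intros) auto
  have eq: "\<nu> x = m x /\<^sub>R norm (m x)" "norm (m x) \<noteq> 0" if x: "x \<in> sph_boundary V \<inter> N" for x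
  proof -
    obtain t where t: "t \<in> T \<inter> span ((\<lambda>k. axis k 1) ` (- {i, j}))" "x = \<Phi> t"
      using boundary_chart_local_param(4)[OF bc(1)] x by blast
    have o: "outward_unit_normal V (\<Phi> t) (\<nu> x)" using out x t by blast
    note n = boundary_chart_normal(1,2)[OF bc(1) t(1) o]
    have xx: "x \<bullet> x = 1" using x b by (auto simp: norm_eq_1)
    have x\<nu>: "x \<bullet> \<nu> x = 0" and n1: "norm (\<nu> x) = 1"
      using out x tangent_vector_sphere_orthogonal by (auto simp: outward_unit_normal_def)
    have "m x = \<rho>' x (\<nu> x) *\<^sub>R \<nu> x"
    proof (rule vec_eq_iff[THEN iffD2], rule allI)
      fix k
      have "x \<bullet> (axis k 1 - (x $ k) *\<^sub>R x) = 0"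
        by (simp add: inner_diff_right inner_axis xx)
      then have "m x $ k = ((axis k 1 - (x $ k) *\<^sub>R x) \<bullet> \<nu> x) * \<rho>' x (\<nu> x)"
        using n(2) by (simp add: m_def t(2))
      also have "(axis k 1 - (x $ k) *\<^sub>R x) \<bullet> \<nu> x = \<nu> x $ k"
        by (simp add: inner_diff_left x\<nu> inner_axis' )
      finally show "m x $ k = (\<rho>' x (\<nu> x) *\<^sub>R \<nu> x) $ k" by simp
    qed
    moreover have "0 < \<rho>' x (\<nu> x)" using n(1)[of 0] by (simp add: t(2))
    ultimately show "\<nu> x = m x /\<^sub>R norm (m x)" "norm (m x) \<noteq> 0"
      using n1 by auto
  qed
  have "continuous_on (sph_boundary V \<inter> N) (\<lambda>x. m x /\<^sub>R norm (m x))"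
    using eq(2) by (intro continuous_intros continuous_on_subset[OF mc]) auto
  then have "continuous_on (sph_boundary V \<inter> N) \<nu>"
    by (rule continuous_on_eq) (simp add: eq(1))
  then have "continuous (at p within (sph_boundary V \<inter> N)) \<nu>"
    using p bc(2) by (simp add: continuous_on_eq_continuous_within)
  moreover have "at p within sph_boundary V = at p within (sph_boundary V \<inter> N)"
    by (rule at_within_nhd[of p N]) (use b bc(2) in auto)
  ultimately show "continuous (at p within sph_boundary V) \<nu>"
    by (simp only:)
qed

section \<open>The flux of a rotation field through the boundary\<close>

lemma max_0_square_has_real_derivative:
  "((\<lambda>s. (max 0 s)\<^sup>2) has_real_derivative 2 * max 0 s) (at (s::real))"
proof -
  consider "s > 0" | "s < 0" | "s = 0" by linarith
  then show ?thesis
  proof cases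
    case 1
    have "((\<lambda>s. s\<^sup>2) has_real_derivative 2 * max 0 s) (at s)"
      using 1 by (auto intro!: derivative_eq_intros)
    then show ?thesis
      by (rule has_field_derivative_transform_within_open[of _ _ _ "{0<..}"]) (use 1 in auto)
  next
    case 2
    have "((\<lambda>s. 0) has_real_derivative 2 * max 0 s) (at s)"
      using 2 by (auto intro!: derivative_eq_intros)
    then show ?thesis
      by (rule has_field_derivative_transform_within_open[of _ _ _ "{..<0}"]) (use 2 in auto)
  next
    case 3
    have "((\<lambda>h::real. (max 0 (0 + h))\<^sup>2 / h) \<longlongrightarrow> 0) (at 0)"
    proof (rule Lim_null_comparison)
      show "\<forall>\<^sub>F h in at (0::real). norm ((max 0 (0 + h))\<^sup>2 / h) \<le> \<bar>h\<bar>"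
        by (rule always_eventually) (auto simp: max_def power2_eq_square)
      show "((\<lambda>h::real. \<bar>h\<bar>) \<longlongrightarrow> 0) (at 0)"
        by (rule tendsto_rabs_zero) (rule tendsto_ident_at)
    qed
    then show ?thesis using 3 by (simp add: DERIV_def)
  qed
qed

text \<open>\<open>- \<eta>'\<close> is the tent function on the interval from -1 to 0 with peak 2
  and area 1. The coefficients 2, -4, 2 express its primitive by squares of positive parts.\<close>

lemma C1_step_function:
  obtains \<eta> \<eta>' :: "real \<Rightarrow> real"
  where "\<And>s. (\<eta> has_real_derivative \<eta>' s) (at s)" "continuous_on UNIV \<eta>'"
    "\<And>s. 0 \<le> s \<Longrightarrow> \<eta> s = 0" "\<And>s. s \<le> - 1 \<Longrightarrow> \<eta> s = 1" "\<And>s. s \<notin> {- 1<..<0} \<Longrightarrow> \<eta>' s = 0"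
proof
  define \<eta> :: "real \<Rightarrow> real"
    where "\<eta> s = 2 * (max 0 (- s))\<^sup>2 - 4 * (max 0 (- s - 1 / 2))\<^sup>2 + 2 * (max 0 (- s - 1))\<^sup>2" for s
  define \<eta>' :: "real \<Rightarrow> real"
    where "\<eta>' s = - 4 * max 0 (- s) + 8 * max 0 (- s - 1 / 2) - 4 * max 0 (- s - 1)" for s
  have m: "((\<lambda>s. (max 0 (- s - c))\<^sup>2) has_real_derivative - (2 * max 0 (- s - c))) (at s)" for c s :: real
  proof -
    have "((\<lambda>s. - s - c) has_real_derivative - 1) (at s)"
      by (auto intro!: derivative_eq_intros)
    from DERIV_chain2[OF max_0_square_has_real_derivative this] show ?thesis by simp
  qed
  show "(\<eta> has_real_derivative \<eta>' s) (at s)" for s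
    unfolding \<eta>_def \<eta>'_def
    by (rule derivative_eq_intros m m[of 0, simplified] refl)+ simp
  show "continuous_on UNIV \<eta>'"
    unfolding \<eta>'_def by (intro continuous_intros)
  show "\<eta> s = 0" if "0 \<le> s" for s
    using that by (simp add: \<eta>_def)
  show "\<eta> s = 1" if "s \<le> - 1" for s
    using that by (simp add: \<eta>_def power2_eq_square algebra_simps)
  show "\<eta>' s = 0" if "s \<notin> {- 1<..<0}" for s
    using that by (auto simp: \<eta>'_def max_def)
qed

lemma AE_lborel_span: "AE t in lborel_span B. t \<in> span B"
proof -
  have "{t. t \<in> span B} \<in> sets borel" by (simp add: borel_closed)
  then show ?thesis
    unfolding lborel_span_def
    by (subst AE_distr_iff) (auto intro!: AE_I2 span_sum span_scale intro: span_base)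
qed

lemma integrable_lborel_span_bounded:
  fixes f :: "'a::euclidean_space \<Rightarrow> 'b::{banach, second_countable_topology}"
  assumes "B \<subseteq> Basis" "f \<in> borel_measurable borel" "\<And>t. norm (f t) \<le> C * indicator (cball 0 R) t"
  shows "integrable (lborel_span B) f"
proof -
  have "integrable (lborel_span B) (\<lambda>t. C * indicator (cball 0 R) t)"
    using lborel_span_cball_finite[OF assms(1), of 0 R]
    by (intro integrable_mult_right integrable_real_indicator) auto
  then show ?thesis
    by (rule Bochner_Integration.integrable_bound) (use assms(2,3) in \<open>auto intro!: AE_I2 order_trans[OF assms(3)]\<close>)
qed

text \<open>Fubini's theorem for one coordinate direction: in coordinates, the measure on the larger
  subspace is a product with one more factor.\<close>

lemma lborel_span_insert_integral:
  fixes f :: "'a::euclidean_space \<Rightarrow> 'b::{banach, second_countable_topology}"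
  assumes B: "insert e B \<subseteq> Basis" "e \<notin> B" and f: "integrable (lborel_span (insert e B)) f"
    and m: "f \<in> borel_measurable borel"
  shows "(LINT t|lborel_span (insert e B). f t) = (LINT t|lborel_span B. LINT s|lborel. f (t + s *\<^sub>R e))"
proof -
  interpret product_sigma_finite "\<lambda>_::'a. lborel :: real measure" by standard
  have fin: "finite B" using B finite_subset[OF _ finite_Basis] by blast
  let ?g = "\<lambda>B (c::'a \<Rightarrow> real). \<Sum>b\<in>B. c b *\<^sub>R b"
  have g: "?g B \<in> measurable (\<Pi>\<^sub>M b\<in>B. lborel) borel" for B by measurable
  have i: "integrable (\<Pi>\<^sub>M b\<in>insert e B. lborel) (\<lambda>c. f (?g (insert e B) c))"
    using f unfolding lborel_span_def by (rule integrable_distr[OF g])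
  have "(LINT t|lborel_span (insert e B). f t) = (LINT c|(\<Pi>\<^sub>M b\<in>insert e B. lborel). f (?g (insert e B) c))"
    unfolding lborel_span_def by (rule integral_distr[OF g m])
  also have "\<dots> = (LINT c|(\<Pi>\<^sub>M b\<in>B. lborel). LINT s|lborel. f (?g (insert e B) (c(e := s))))"
    by (rule product_integral_insert[OF fin B(2) i])
  also have "\<dots> = (LINT c|(\<Pi>\<^sub>M b\<in>B. lborel). LINT s|lborel. f (?g B c + s *\<^sub>R e))"
  proof -
    have "?g (insert e B) (c(e := s)) = ?g B c + s *\<^sub>R e" for c s
      using fin B(2) by (simp add: add.commute) (intro sum.cong refl, auto)
    then show ?thesis by simp
  qed
  also have "\<dots> = (LINT t|lborel_span B. LINT s|lborel. f (t + s *\<^sub>R e))"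
    unfolding lborel_span_def
  proof (rule integral_distr[OF g, symmetric])
    show "(\<lambda>t. LINT s|lborel. f (t + s *\<^sub>R e)) \<in> borel_measurable borel"
      using m by measurable
  qed
  finally show ?thesis .
qed

text \<open>The weights \<open>- m * \<eta>' (m * s)\<close> with \<open>m = Suc n\<close> have
  integral 1 and vanish unless \<open>- 1 / m < s < 0\<close>: a one-sided approximate identity in
  the coordinate \<open>s = t \<bullet> e\<close>. This is why continuity of \<open>q\<close> on the
  closed half space \<open>t \<bullet> e \<le> 0\<close> is the right assumption.\<close>

lemma slab_integral_limit:
  fixes q :: "'a::euclidean_space \<Rightarrow> 'b::{banach, second_countable_topology}"
  assumes B: "insert e B \<subseteq> Basis" "e \<notin> B"
    and q: "q \<in> borel_measurable borel" "\<And>t. norm (q t) \<le> C * indicator (cball 0 R) t"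
    and qc: "continuous_on {t \<in> span (insert e B). t \<bullet> e \<le> 0} q"
    and \<eta>: "\<And>s. (\<eta> has_real_derivative \<eta>' s) (at s)" "continuous_on UNIV \<eta>'"
    and \<eta>0: "\<eta> 0 = 0" and \<eta>1: "\<eta> (- 1) = (1::real)" and \<eta>'0: "\<And>s. s \<notin> {- 1<..<0} \<Longrightarrow> \<eta>' s = 0"
  shows "(\<lambda>n. LINT t|lborel_span (insert e B). (real (Suc n) * \<eta>' (real (Suc n) * (t \<bullet> e))) *\<^sub>R q t)
     \<longlonglongrightarrow> - (LINT t|lborel_span B. q t)"
proof -
  have ind: "\<eta>' s = indicator {- 1..0} s *\<^sub>R \<eta>' s" for s
    using \<eta>'0[of s] by (cases "s \<in> {- 1..0}") auto
  have int\<eta>: "integrable lborel \<eta>'"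
    using borel_integrable_atLeastAtMost'[of "- 1" 0 \<eta>'] continuous_on_subset[OF \<eta>(2)]
    unfolding set_integrable_def ind[symmetric] by blast
  have "(LBINT s:{- 1..0}. \<eta>' s) = \<eta> 0 - \<eta> (- 1)"
    unfolding set_lebesgue_integral_def
    by (rule integral_FTC_atLeastAtMost)
      (use \<eta> in \<open>auto intro: continuous_on_subset has_field_derivative_at_within simp: has_real_derivative_iff_has_vector_derivative[symmetric]\<close>)
  then have LINT\<eta>: "(LINT s|lborel. \<eta>' s) = - 1"
    using \<eta>0 \<eta>1 by (simp add: set_lebesgue_integral_def ind[symmetric] del: real_scaleR_def)
  have m\<eta>: "\<eta>' \<in> borel_measurable borel"
    using \<eta>(2) by (rule borel_measurable_continuous_onI)
  obtain C\<eta> where C\<eta>: "\<And>s. \<bar>\<eta>' s\<bar> \<le> C\<eta>"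
  proof -
    obtain c where c: "\<And>s. s \<in> {- 1..0} \<Longrightarrow> norm (\<eta>' s) \<le> c"
      using continuous_on_compact_bound[OF compact_Icc continuous_on_subset[OF \<eta>(2) subset_UNIV]] by blast
    have "\<bar>\<eta>' s\<bar> \<le> max 0 c" for s
      using c[of s] \<eta>'0[of s] by (cases "s \<in> {- 1..0}") auto
    then show thesis using that by blast
  qed
  have "0 \<le> C\<eta>" using C\<eta>[of 0] by linarith
  have C: "norm (q t) \<le> \<bar>C\<bar>" for t
    using q(2)[of t] by (cases "t \<in> cball 0 R") auto
  have eB: "e \<bullet> e = 1" using B by (auto simp: inner_Basis)
  have te: "t \<bullet> e = 0" if "t \<in> span B" for t
  proof -
    have "span B \<subseteq> {t. t \<bullet> e = 0}"
      using B by (intro span_minimal) (auto simp: inner_Basis subspace_def inner_add_left)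
    then show ?thesis using that by blast
  qed
  define I where "I n t = (LINT s|lborel. \<eta>' s *\<^sub>R q (t + (s / real (Suc n)) *\<^sub>R e))" for n t
  have fubini: "(LINT t|lborel_span (insert e B). (real (Suc n) * \<eta>' (real (Suc n) * (t \<bullet> e))) *\<^sub>R q t)
      = (LINT t|lborel_span B. I n t)" for n
  proof -
    let ?m = "real (Suc n)"
    let ?f = "\<lambda>t. (?m * \<eta>' (?m * (t \<bullet> e))) *\<^sub>R q t"
    have mf: "?f \<in> borel_measurable borel"
      using q(1) m\<eta> by measurable
    have bf: "norm (?f t) \<le> (?m * C\<eta> * \<bar>C\<bar>) * indicator (cball 0 R) t" for t
    proof -
      have "norm (?f t) \<le> (?m * C\<eta>) * (C * indicator (cball 0 R) t)"
        unfolding norm_scaleR using C\<eta> q(2) \<open>0 \<le> C\<eta>\<close>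
        by (intro mult_mono) (auto simp: abs_mult intro!: mult_left_mono)
      also have "\<dots> \<le> (?m * C\<eta> * \<bar>C\<bar>) * indicator (cball 0 R) t"
        using \<open>0 \<le> C\<eta>\<close> by (auto simp: indicator_def intro!: mult_left_mono)
      finally show ?thesis .
    qed
    have "(LINT t|lborel_span (insert e B). ?f t) = (LINT t|lborel_span B. LINT s|lborel. ?f (t + s *\<^sub>R e))"
      by (rule lborel_span_insert_integral[OF B integrable_lborel_span_bounded[OF B(1) mf bf] mf])
    also have "\<dots> = (LINT t|lborel_span B. I n t)"
    proof (rule integral_cong_AE)
      show "(\<lambda>t. LINT s|lborel. ?f (t + s *\<^sub>R e)) \<in> borel_measurable (lborel_span B)"
        using mf by measurable
      show "I n \<in> borel_measurable (lborel_span B)"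
        unfolding I_def using q(1) m\<eta> by measurable
      show "AE t in lborel_span B. (LINT s|lborel. ?f (t + s *\<^sub>R e)) = I n t"
        using AE_lborel_span
      proof eventually_elim
        case (elim t)
        have "(LINT s|lborel. ?f (t + s *\<^sub>R e)) = (LINT s|lborel. (?m * \<eta>' (?m * s)) *\<^sub>R q (t + s *\<^sub>R e))"
          by (simp only: inner_add_left inner_scaleR_left te[OF elim] eB mult_1_right add_0_left)
        \<comment> \<open>Substituting \<open>s / ?m\<close> for \<open>s\<close> absorbs the factor
          in front of \<open>\<eta>'\<close>.\<close>
        also have "\<dots> = \<bar>1 / ?m\<bar> *\<^sub>R (LINT s|lborel. (?m * \<eta>' (?m * (0 + 1 / ?m * s))) *\<^sub>R q (t + (0 + 1 / ?m * s) *\<^sub>R e))"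
          by (rule lborel_integral_real_affine) simp
        also have "\<dots> = (1 / ?m) *\<^sub>R (LINT s|lborel. ?m *\<^sub>R (\<eta>' s *\<^sub>R q (t + (s / ?m) *\<^sub>R e)))"
          by (simp del: of_nat_Suc)
        also have "\<dots> = I n t"
          unfolding I_def integral_scaleR_right by (simp del: of_nat_Suc)
        finally show ?case .
      qed
    qed
    finally show ?thesis .
  qed
  have "(\<lambda>n. LINT t|lborel_span B. I n t) \<longlonglongrightarrow> (LINT t|lborel_span B. - q t)"
  proof (rule integral_dominated_convergence[where w = "\<lambda>t. (C\<eta> * \<bar>C\<bar>) * indicator (cball 0 (R + 1)) t"])
    show "(\<lambda>t. - q t) \<in> borel_measurable (lborel_span B)" using q(1) by measurable
    show "I n \<in> borel_measurable (lborel_span B)" for n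
      unfolding I_def using q(1) m\<eta> by measurable
    show "integrable (lborel_span B) (\<lambda>t. (C\<eta> * \<bar>C\<bar>) * indicator (cball 0 (R + 1)) t)"
      using lborel_span_cball_finite[of B 0 "R + 1"] B(1)
      by (intro integrable_mult_right integrable_real_indicator) auto
    show "AE t in lborel_span B. (\<lambda>n. I n t) \<longlonglongrightarrow> - q t"
      using AE_lborel_span
    proof eventually_elim
      case (elim t)
      have "(\<lambda>n. I n t) \<longlonglongrightarrow> (LINT s|lborel. \<eta>' s *\<^sub>R q t)"
        unfolding I_def
      proof (rule integral_dominated_convergence[where w = "\<lambda>s. \<bar>\<eta>' s\<bar> * \<bar>C\<bar>"])
        show "integrable lborel (\<lambda>s. \<bar>\<eta>' s\<bar> * \<bar>C\<bar>)" using int\<eta> by auto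
        show "AE s in lborel. norm (\<eta>' s *\<^sub>R q (t + (s / real (Suc n)) *\<^sub>R e)) \<le> \<bar>\<eta>' s\<bar> * \<bar>C\<bar>" for n
          using C by (intro AE_I2) (auto intro!: mult_left_mono)
        show "AE s in lborel. (\<lambda>n. \<eta>' s *\<^sub>R q (t + (s / real (Suc n)) *\<^sub>R e)) \<longlonglongrightarrow> \<eta>' s *\<^sub>R q t"
        proof (rule AE_I2)
          fix s :: real
          show "(\<lambda>n. \<eta>' s *\<^sub>R q (t + (s / real (Suc n)) *\<^sub>R e)) \<longlonglongrightarrow> \<eta>' s *\<^sub>R q t"
          proof (cases "s \<in> {- 1..0}")
            case True
            have tB: "t \<in> span (insert e B)" using elim span_mono[of B "insert e B"] by blast
            have "(\<lambda>n. t + (s / real (Suc n)) *\<^sub>R e) \<longlonglongrightarrow> t + 0 *\<^sub>R e"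
              by (intro tendsto_intros LIMSEQ_Suc[OF lim_const_over_n])
            then have "(\<lambda>n. q (t + (s / real (Suc n)) *\<^sub>R e)) \<longlonglongrightarrow> q t"
            proof (intro continuous_on_tendsto_compose[OF qc])
              show "t \<in> {t \<in> span (insert e B). t \<bullet> e \<le> 0}" using tB te[OF elim] by simp
              show "\<forall>\<^sub>F n in sequentially. t + (s / real (Suc n)) *\<^sub>R e \<in> {t \<in> span (insert e B). t \<bullet> e \<le> 0}"
              proof (intro always_eventually allI, rule CollectI, rule conjI)
                fix n
                show "t + (s / real (Suc n)) *\<^sub>R e \<in> span (insert e B)"
                  by (intro span_add[OF tB] span_scale span_base) simp
                show "(t + (s / real (Suc n)) *\<^sub>R e) \<bullet> e \<le> 0"
                  using True te[OF elim] by (simp add: inner_add_left eB divide_nonpos_pos)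
              qed
            qed simp
            then show ?thesis by (intro tendsto_scaleR tendsto_const)
          next
            case False
            then have "\<eta>' s = 0" by (intro \<eta>'0) auto
            then show ?thesis by simp
          qed
        qed
        show "(\<lambda>s. \<eta>' s *\<^sub>R q t) \<in> borel_measurable lborel" using m\<eta> by measurable
        show "(\<lambda>s. \<eta>' s *\<^sub>R q (t + (s / real (Suc n)) *\<^sub>R e)) \<in> borel_measurable lborel" for n
          using m\<eta> q(1) by measurable
      qed
      also have "(LINT s|lborel. \<eta>' s *\<^sub>R q t) = - q t"
        using LINT\<eta> int\<eta> by simp
      finally show ?case .
    qed
    show "AE t in lborel_span B. norm (I n t) \<le> (C\<eta> * \<bar>C\<bar>) * indicator (cball 0 (R + 1)) t" for n
    proof (rule AE_I2)
      fix t
      \<comment> \<open>A shift by \<open>s / Suc n\<close> has length at most 1, so all supports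
        stay in the ball of radius \<open>R + 1\<close>.\<close>
      have pt: "norm (\<eta>' s *\<^sub>R q (t + (s / real (Suc n)) *\<^sub>R e))
          \<le> indicator {- 1..0} s * (C\<eta> * \<bar>C\<bar> * indicator (cball 0 (R + 1)) t)" for s
      proof (cases "s \<in> {- 1..0} \<and> q (t + (s / real (Suc n)) *\<^sub>R e) \<noteq> 0")
        case True
        then have "norm (t + (s / real (Suc n)) *\<^sub>R e) \<le> R"
          using q(2)[of "t + (s / real (Suc n)) *\<^sub>R e"]
          by (cases "t + (s / real (Suc n)) *\<^sub>R e \<in> cball 0 R") auto
        moreover have "norm ((s / real (Suc n)) *\<^sub>R e) \<le> 1"
          using True B(1) by (simp add: abs_le_iff field_simps)
        moreover have "norm t \<le> norm (t + (s / real (Suc n)) *\<^sub>R e) + norm ((s / real (Suc n)) *\<^sub>R e)"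
          using norm_triangle_ineq4[of "t + (s / real (Suc n)) *\<^sub>R e" "(s / real (Suc n)) *\<^sub>R e"]
          by (simp only: add_diff_cancel_right')
        ultimately have "norm t \<le> R + 1" by linarith
        then show ?thesis
          using True C\<eta>[of s] C \<open>0 \<le> C\<eta>\<close> by (auto intro!: mult_mono)
      next
        case False
        then show ?thesis using \<eta>'0[of s] \<open>0 \<le> C\<eta>\<close> by auto
      qed
      have ig: "integrable lborel (\<lambda>s. indicator {- 1..0::real} s * (C\<eta> * \<bar>C\<bar> * indicator (cball 0 (R + 1)) t))"
        by (intro integrable_mult_left integrable_real_indicator) (auto simp: emeasure_lborel_Icc_eq)
      have "(\<lambda>s. \<eta>' s *\<^sub>R q (t + (s / real (Suc n)) *\<^sub>R e)) \<in> borel_measurable lborel"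
        using m\<eta> q(1) by measurable
      then have if': "integrable lborel (\<lambda>s. \<eta>' s *\<^sub>R q (t + (s / real (Suc n)) *\<^sub>R e))"
      proof (rule Bochner_Integration.integrable_bound[OF ig], intro AE_I2)
        fix s
        show "norm (\<eta>' s *\<^sub>R q (t + (s / real (Suc n)) *\<^sub>R e))
            \<le> norm (indicator {- 1..0::real} s * (C\<eta> * \<bar>C\<bar> * indicator (cball 0 (R + 1)) t))"
          using pt[of s] unfolding real_norm_def by linarith
      qed
      have "norm (I n t) \<le> (LINT s|lborel. indicator {- 1..0::real} s * (C\<eta> * \<bar>C\<bar> * indicator (cball 0 (R + 1)) t))"
        unfolding I_def by (rule Bochner_Integration.integral_norm_bound_integral[OF if' ig pt])
      also have "\<dots> = (C\<eta> * \<bar>C\<bar>) * indicator (cball 0 (R + 1)) t"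
        by simp
      finally show "norm (I n t) \<le> (C\<eta> * \<bar>C\<bar>) * indicator (cball 0 (R + 1)) t" .
    qed
  qed
  then show ?thesis
    using fubini by simp
qed

section \<open>Rotation derivatives of functions patched together locally\<close>

lemma rot_gen_orthogonal: "x \<bullet> rot_gen a b x = 0"
  by (simp add: rot_gen_def inner_diff_right inner_axis)

lemma continuous_on_rot_gen [continuous_intros]:
  "continuous_on S f \<Longrightarrow> continuous_on S (\<lambda>x. rot_gen a b (f x))"
  unfolding rot_gen_def by (intro continuous_intros)

text \<open>A C1 representative is asked for only near each single point of the sphere. A function
  defined by cases, such as one extended by 0 across the boundary of \<open>V\<close>, qualifies in
  this way.\<close>

lemma integral_sphere_rot_gen:
  fixes \<mu> :: "(real ^ 'm::finite) measure" and H K :: "real ^ 'm \<Rightarrow> 'b::{banach, second_countable_topology}"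
  assumes \<mu>: "is_lebesgue_measure_on (CARD('m) - 1) (sphere 0 1) \<mu>" and ab: "a \<noteq> b"
    and loc: "\<And>x. x \<in> sphere 0 1 \<Longrightarrow> \<exists>Y h h'. open Y \<and> x \<in> Y \<and>
      (\<forall>y\<in>Y. (h has_derivative blinfun_apply (h' y)) (at y)) \<and> continuous_on Y h' \<and>
      (\<forall>y\<in>Y \<inter> sphere 0 1. H y = h y \<and> K y = h' y (rot_gen a b y))"
  shows "(LINT x:sphere 0 1|\<mu>. K x) = 0"
proof (rule integral_sphere_rotation_derivative[OF \<mu> ab])
  let ?S = "sphere 0 1 :: (real ^ 'm) set"
  have "continuous (at x within ?S) H \<and> continuous (at x within ?S) K \<and>
    ((\<lambda>\<theta>. H (rot a b \<theta> x)) has_vector_derivative K x) (at 0)" if x: "x \<in> ?S" for x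
  proof -
    obtain Y h h' where Y: "open Y" "x \<in> Y" and d: "\<And>y. y \<in> Y \<Longrightarrow> (h has_derivative blinfun_apply (h' y)) (at y)"
      and c: "continuous_on Y h'" and eq: "\<And>y. y \<in> Y \<inter> ?S \<Longrightarrow> H y = h y \<and> K y = h' y (rot_gen a b y)"
      using loc[OF x] by blast
    have nhd: "at x within ?S = at x within (Y \<inter> ?S)"
      by (rule at_within_nhd[of x Y]) (use Y in auto)
    have ch: "continuous_on (Y \<inter> ?S) h"
      by (rule continuous_at_imp_continuous_on) (use d has_derivative_continuous in blast)
    have "continuous_on (Y \<inter> ?S) H"
      by (rule continuous_on_eq[OF ch]) (simp add: eq)
    moreover have "continuous_on (Y \<inter> ?S) K"
    proof (rule continuous_on_eq)
      show "continuous_on (Y \<inter> ?S) (\<lambda>y. h' y (rot_gen a b y))"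
        by (intro continuous_intros continuous_on_subset[OF c]) auto
    qed (simp add: eq)
    ultimately have 1: "continuous (at x within ?S) H" "continuous (at x within ?S) K"
      using x Y by (auto simp: nhd continuous_on_eq_continuous_within)
    have rd: "((\<lambda>\<theta>. rot a b \<theta> x) has_vector_derivative rot_gen a b x) (at 0)"
      by (rule rot_has_vector_derivative[OF ab])
    have dh: "((h \<circ> (\<lambda>\<theta>. rot a b \<theta> x)) has_vector_derivative h' x (rot_gen a b x)) (at 0)"
    proof -
      have "((h \<circ> (\<lambda>\<theta>. rot a b \<theta> x)) has_derivative (blinfun_apply (h' x) \<circ> (\<lambda>s. s *\<^sub>R rot_gen a b x))) (at 0)"
        by (rule diff_chain_at) (use rd d[OF Y(2)] in \<open>simp_all add: has_vector_derivative_def\<close>)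
      moreover have "blinfun_apply (h' x) \<circ> (\<lambda>s. s *\<^sub>R rot_gen a b x) = (\<lambda>s. s *\<^sub>R h' x (rot_gen a b x))"
        by (simp add: fun_eq_iff blinfun.scaleR_right)
      ultimately show ?thesis by (simp only: has_vector_derivative_def)
    qed
    have "((\<lambda>\<theta>. rot a b \<theta> x) \<longlongrightarrow> rot a b 0 x) (at 0)"
      using has_vector_derivative_continuous[OF rd] by (simp only: continuous_at)
    then have ev: "\<forall>\<^sub>F \<theta> in at 0. rot a b \<theta> x \<in> Y"
      by (rule topological_tendstoD) (use Y in auto)
    have rS: "rot a b \<theta> x \<in> ?S" for \<theta>
      using x orthogonal_transformation_norm[OF orthogonal_transformation_rot[OF ab]] by auto
    have "((\<lambda>\<theta>. H (rot a b \<theta> x)) has_vector_derivative h' x (rot_gen a b x)) (at 0)"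
      unfolding has_vector_derivative_def
    proof (rule has_derivative_transform_eventually[OF dh[unfolded has_vector_derivative_def]])
      show "\<forall>\<^sub>F \<theta> in at 0. (h \<circ> (\<lambda>\<theta>. rot a b \<theta> x)) \<theta> = H (rot a b \<theta> x)"
        using ev by eventually_elim (use rS eq in auto)
      show "(h \<circ> (\<lambda>\<theta>. rot a b \<theta> x)) 0 = H (rot a b 0 x)" using eq x Y by simp
    qed auto
    then show ?thesis using 1 eq[of x] x Y by simp
  qed
  then show "continuous_on ?S H" "continuous_on ?S K"
    "\<And>x. x \<in> ?S \<Longrightarrow> ((\<lambda>\<theta>. H (rot a b \<theta> x)) has_vector_derivative K x) (at 0)"
    by (auto simp: continuous_on_eq_continuous_within)
qed

text \<open>The factor \<open>u\<close> may be arbitrary away from \<open>N\<close>, but there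
  \<open>g\<close> vanishes. The relatively open sets \<open>C \<inter> N\<close> and
  \<open>C - Z\<close> cover \<open>C\<close>.\<close>

lemma continuous_on_supported_scaleR:
  fixes g :: "'a::topological_space \<Rightarrow> 'b::real_normed_vector"
  assumes "continuous_on (C \<inter> N) u" "continuous_on C g" "open N" "closed Z" "Z \<subseteq> N"
    and "\<And>x. x \<in> C - Z \<Longrightarrow> g x = 0"
  shows "continuous_on C (\<lambda>x. u x *\<^sub>R g x)"
proof -
  have C: "C = (C \<inter> N) \<union> (C - Z)" using assms(5) by blast
  have "continuous_on ((C \<inter> N) \<union> (C - Z)) (\<lambda>x. u x *\<^sub>R g x)"
  proof (rule continuous_on_Un_local_open)
    show "openin (top_of_set ((C \<inter> N) \<union> (C - Z))) (C \<inter> N)"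
      unfolding C[symmetric] using assms(3) by (auto simp: openin_open)
    show "openin (top_of_set ((C \<inter> N) \<union> (C - Z))) (C - Z)"
      unfolding C[symmetric] using assms(4) by (auto simp: openin_open intro!: exI[of _ "- Z"])
    show "continuous_on (C \<inter> N) (\<lambda>x. u x *\<^sub>R g x)"
      using assms(1) continuous_on_subset[OF assms(2)] by (intro continuous_intros) auto
    show "continuous_on (C - Z) (\<lambda>x. u x *\<^sub>R g x)"
      by (rule continuous_on_eq[OF continuous_on_const[of _ 0]]) (simp add: assms(6))
  qed
  then show ?thesis using C by simp
qed

lemma has_derivative_zero_outside:
  fixes G :: "'a::real_normed_vector \<Rightarrow> 'b::real_normed_vector"
  assumes "(G has_derivative G') (at x)" "closed Z" "x \<notin> Z" "\<And>y. y \<notin> Z \<Longrightarrow> G y = 0"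
  shows "G' v = 0"
proof -
  have "((\<lambda>_. 0) has_derivative G') (at x)"
    by (rule has_derivative_transform_within_open[OF assms(1), of "- Z"]) (use assms in auto)
  then have "G' = (\<lambda>_. 0)"
    by (rule has_derivative_unique) (rule has_derivative_const)
  then show ?thesis by simp
qed

text \<open>The relative boundary of the open set \<open>V\<close> is its relative closure minus
  \<open>V\<close>, and compactness is inherited from the sphere.\<close>

lemma sph_closure:
  assumes "openin (top_of_set (sphere 0 1)) V"
  shows "compact (V \<union> sph_boundary V)" "V \<inter> sph_boundary V = {}" "V \<union> sph_boundary V \<subseteq> sphere 0 1"
    "compact (sph_boundary V)" "V \<in> sets borel"
proof -
  let ?T = "top_of_set (sphere 0 1) :: 'a topology"
  have b: "sph_boundary V = ?T closure_of V - V"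
    unfolding sph_boundary_def by (rule frontier_of_openin[OF assms])
  have sub: "V \<subseteq> ?T closure_of V" using assms by (meson closure_of_subset openin_subset)
  have c: "V \<union> sph_boundary V = ?T closure_of V" using b sub by blast
  show "compact (V \<union> sph_boundary V)"
    unfolding c by (rule closedin_compact[OF compact_sphere closedin_closure_of])
  show "V \<inter> sph_boundary V = {}" using b by blast
  show "V \<union> sph_boundary V \<subseteq> sphere 0 1"
    unfolding c using closure_of_subset_topspace[of ?T V] by simp
  have "closedin ?T (sph_boundary V)" unfolding sph_boundary_def by (rule closedin_frontier_of)
  then show "compact (sph_boundary V)"
    by (rule closedin_compact[OF compact_sphere])
  show "V \<in> sets borel" by (rule borel_openin_closed[OF assms closed_sphere])
qed

lemma sph_boundary_finite_measure:
  fixes V :: "(real ^ 'm::finite) set"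
  assumes \<sigma>: "is_lebesgue_measure_on (CARD('m) - 2) (sph_boundary V) \<sigma>" and V: "openin (top_of_set (sphere 0 1)) V" "C1_boundary V"
  shows "finite_measure \<sigma>"
proof (rule lebesgue_measure_on_compact_finite[OF \<sigma> sph_closure(4)[OF V(1)]])
  fix x assume x: "x \<in> sph_boundary V"
  obtain i j N T \<Psi> \<Phi> D \<rho> \<rho>' where bc: "boundary_chart V i j N T \<Psi> \<Phi> D \<rho> \<rho>'" "x \<in> N"
    using boundary_chart_exists[OF V(2) x] by blast
  show "\<exists>B \<Omega> \<phi>. local_param (CARD('m) - 2) (sph_boundary V) B \<Omega> \<phi> \<and> x \<in> \<phi> ` \<Omega>"
    using boundary_chart_local_param(3,4)[OF bc(1)] bc(2) x by blast
qed

text \<open>Nonnegativity is not automatic, as \<open>sqrt\<close> is an odd function on the reals.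
  Completing the frame by the position vector exhibits the density as the absolute value of a
  determinant.\<close>

lemma boundary_chart_gram_nonneg:
  fixes V :: "(real ^ 'm::finite) set"
  assumes bc: "boundary_chart V i j N T \<Psi> \<Phi> D \<rho> \<rho>'" and t: "t \<in> T \<inter> span ((\<lambda>k. axis k 1) ` (- {i}))"
  shows "0 \<le> sqrt (gram_det ((\<lambda>k. axis k 1) ` (- {i})) \<Phi> t)"
proof -
  note b = bc[unfolded boundary_chart_def]
  have xS: "\<Phi> t \<in> sphere 0 1" using boundary_chart_local_param(2)[OF bc] t by blast
  have dd: "dir_deriv \<Phi> (axis k 1) t = D t (axis k 1)" for k
    by (rule dir_deriv_eq) (use b t in blast)
  have orth: "D t (axis k 1) \<bullet> \<Phi> t = (if k = i then 1 / 2 else 0)" for k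
    using b t by (simp add: inner_commute)
  have "sqrt (gram_det ((\<lambda>k. axis k 1) ` (- {i})) \<Phi> t)
      = \<bar>det (\<chi> k. if k \<in> - {i} then dir_deriv \<Phi> (axis k 1) t else \<Phi> t)\<bar>"
    by (rule sqrt_gram_det_axis) (use orth xS in \<open>auto simp: dd norm_eq_1\<close>)
  then show ?thesis by simp
qed

text \<open>The two chart densities are linked by
  \<open>J * \<rho>' w = J' * (w \<bullet> \<nu>)\<close>: it turns the weight
  \<open>\<rho>' w\<close>, left over from differentiating the cutoff, into the flux density. The
  ball keeps the support of \<open>G\<close> inside the single chart \<open>N\<close>.\<close>

lemma rot_flux_at_boundary:
  fixes V :: "(real ^ 'm::finite) set" and G :: "real ^ 'm \<Rightarrow> 'b::euclidean_space"
  assumes \<mu>: "is_lebesgue_measure_on (CARD('m) - 1) (sphere 0 1) \<mu>"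
    and \<sigma>: "is_lebesgue_measure_on (CARD('m) - 2) (sph_boundary V) \<sigma>"
    and V: "openin (top_of_set (sphere 0 1)) V" "C1_boundary V"
    and out: "\<And>x. x \<in> sph_boundary V \<Longrightarrow> outward_unit_normal V x (\<nu> x)" and ab: "a \<noteq> b"
    and bc: "boundary_chart V i j N T \<Psi> \<Phi> D \<rho> \<rho>'" and r: "cball p r \<subseteq> N"
    and M: "open M" "V \<union> sph_boundary V \<subseteq> M"
    and G: "\<And>x. x \<in> M \<Longrightarrow> (G has_derivative blinfun_apply (G' x)) (at x)" "continuous_on M G'"
    and supp: "\<And>x. x \<notin> ball p r \<Longrightarrow> G x = 0"
  shows "(LINT x:V|\<mu>. G' x (rot_gen a b x)) = (LINT x:sph_boundary V|\<sigma>. (rot_gen a b x \<bullet> \<nu> x) *\<^sub>R G x)"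
proof -
  let ?S = "sphere 0 1 :: (real ^ 'm) set" and ?bV = "sph_boundary V"
  define C where "C = V \<union> ?bV"
  define Z where "Z = cball p r"
  note b = bc[unfolded boundary_chart_def]
  note bcl = boundary_chart_local_param[OF bc]
  note cl = sph_closure[OF V(1)]
  have Z: "closed Z" "Z \<subseteq> N" "compact Z" using r by (auto simp: Z_def)
  have C: "compact C" "C \<subseteq> ?S" "C \<subseteq> M" "closed C" "C \<in> sets borel"
    using cl M by (auto simp: C_def compact_imp_closed borel_compact)
  have sets: "sets \<mu> = sets borel" "sets \<sigma> = sets borel"
    using \<mu> \<sigma> by (auto simp: is_lebesgue_measure_on_def)
  note finS = sphere_finite_measure[OF \<mu>]
  interpret \<mu>: finite_measure \<mu> by (rule finS)
  have oN: "open N" using b by simp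
  have VN: "x \<in> V \<longleftrightarrow> \<rho> x < 0" and bVN: "x \<in> ?bV \<longleftrightarrow> \<rho> x = 0" if "x \<in> ?S" "x \<in> N" for x
    using b that by blast+
  have supp': "G x = 0" if "x \<notin> Z" for x using supp that by (auto simp: Z_def)
  have G'0: "G' x v = 0" if "x \<in> M" "x \<notin> Z" for x v
    by (rule has_derivative_zero_outside[OF G(1)[OF that(1)] Z(1) that(2) supp'])
  have Gc: "continuous_on M G"
    by (rule continuous_at_imp_continuous_on) (use G(1) has_derivative_continuous in blast)
  have \<rho>d: "(\<rho> has_derivative blinfun_apply (\<rho>' x)) (at x)" if "x \<in> N" for x
    using b that by blast
  have \<rho>'c: "continuous_on N \<rho>'" using b by simp
  have \<rho>c: "continuous_on N \<rho>"
    by (rule continuous_at_imp_continuous_on) (use \<rho>d has_derivative_continuous in blast)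
  obtain \<eta> \<eta>' :: "real \<Rightarrow> real" where \<eta>: "\<And>s. (\<eta> has_real_derivative \<eta>' s) (at s)" "continuous_on UNIV \<eta>'"
    and \<eta>0: "\<And>s. 0 \<le> s \<Longrightarrow> \<eta> s = 0" and \<eta>1: "\<And>s. s \<le> - 1 \<Longrightarrow> \<eta> s = 1"
    and \<eta>'z: "\<And>s. s \<notin> {- 1<..<0} \<Longrightarrow> \<eta>' s = 0"
    using C1_step_function by metis
  have \<eta>c: "continuous_on UNIV \<eta>"
    by (rule DERIV_continuous_on) (rule has_field_derivative_at_within[OF \<eta>(1)])
  have \<eta>'0: "\<eta>' s = 0" if "s \<ge> 0" for s using that by (intro \<eta>'z) simp
  obtain C\<eta> where C\<eta>: "\<And>s. \<bar>\<eta> s\<bar> \<le> C\<eta>"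
  proof -
    obtain c where c: "\<And>s. s \<in> {- 1..0} \<Longrightarrow> norm (\<eta> s) \<le> c"
      using continuous_on_compact_bound[OF compact_Icc continuous_on_subset[OF \<eta>c subset_UNIV]] by blast
    have "\<bar>\<eta> s\<bar> \<le> max 1 c" for s
      using c[of s] \<eta>0[of s] \<eta>1[of s] by (cases "s \<in> {- 1..0}") auto
    then show thesis using that by blast
  qed
  define w where "w x = rot_gen a b x" for x :: "real ^ 'm"
  have wc: "continuous_on X w" for X unfolding w_def by (intro continuous_intros)
  have xw: "x \<bullet> w x = 0" for x by (simp add: w_def rot_gen_orthogonal)
  define g where "g x = G' x (w x)" for x
  define m where "m n = real (Suc n)" for n
  have m: "m n \<ge> 1" for n by (simp add: m_def)
  \<comment> \<open>\<alpha> and \<beta> are the two terms of the product rule for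
    \<open>\<eta> (m n * \<rho> x) *\<^sub>R G x\<close> along \<open>w\<close>: the first tends to
    the interior integrand, the second lives in the layer.\<close>
  define \<alpha> where "\<alpha> n x = \<eta> (m n * \<rho> x) *\<^sub>R g x" for n x
  define \<beta> where "\<beta> n x = (m n * \<eta>' (m n * \<rho> x) * \<rho>' x (w x)) *\<^sub>R G x" for n x
  have gc: "continuous_on C g"
    unfolding g_def using continuous_on_subset[OF G(2) C(3)] wc by (intro continuous_intros)
  have g0: "g x = 0" if "x \<in> C - Z" for x using G'0 C(3) that by (auto simp: g_def)
  have \<alpha>c: "continuous_on C (\<alpha> n)" for n
    unfolding \<alpha>_def
  proof (rule continuous_on_supported_scaleR[OF _ gc oN Z(1,2) g0])
    show "continuous_on (C \<inter> N) (\<lambda>x. \<eta> (m n * \<rho> x))"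
      by (intro continuous_on_compose2[OF \<eta>c] continuous_intros continuous_on_subset[OF \<rho>c]) auto
  qed
  have \<beta>c: "continuous_on C (\<beta> n)" for n
    unfolding \<beta>_def
  proof (rule continuous_on_supported_scaleR[OF _ continuous_on_subset[OF Gc C(3)] oN Z(1,2)])
    show "continuous_on (C \<inter> N) (\<lambda>x. m n * \<eta>' (m n * \<rho> x) * \<rho>' x (w x))"
      by (intro continuous_on_compose2[OF \<eta>(2)] continuous_intros continuous_on_subset[OF \<rho>c] continuous_on_subset[OF \<rho>'c] wc) auto
  qed (use supp' in auto)
  have intC: "set_integrable \<mu> V h" if "continuous_on C h" for h :: "real ^ 'm \<Rightarrow> 'b"
    by (rule set_integrable_subset[OF set_integrable_continuous_compact[OF finS sets(1) C(1) that]])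
      (use cl(5) sets in \<open>auto simp: C_def\<close>)
  have sum0: "(LINT x:V|\<mu>. \<alpha> n x) + (LINT x:V|\<mu>. \<beta> n x) = 0" for n
  proof -
    \<comment> \<open>Extension by 0 creates no jump: on the part of the sphere in \<open>N\<close>
      but outside \<open>V\<close> the argument is nonnegative, where \<open>\<eta>\<close> and
      \<open>\<eta>'\<close> vanish.\<close>
    define H where "H x = (if x \<in> V then \<eta> (m n * \<rho> x) *\<^sub>R G x else 0)" for x
    define K where "K x = (if x \<in> V then \<alpha> n x + \<beta> n x else 0)" for x
    have "(LINT x:?S|\<mu>. K x) = 0"
    proof (rule integral_sphere_rot_gen[OF \<mu> ab, where H = H])
      fix x assume x: "x \<in> ?S"
      show "\<exists>Y h h'. open Y \<and> x \<in> Y \<and> (\<forall>y\<in>Y. (h has_derivative blinfun_apply (h' y)) (at y)) \<and>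
          continuous_on Y h' \<and> (\<forall>y\<in>Y \<inter> ?S. H y = h y \<and> K y = h' y (rot_gen a b y))"
      proof (cases "x \<in> C \<inter> N")
        case True
        define h where "h y = \<eta> (m n * \<rho> y) *\<^sub>R G y" for y
        define h' where "h' y = \<eta> (m n * \<rho> y) *\<^sub>R G' y
          + (m n * \<eta>' (m n * \<rho> y)) *\<^sub>R (blinfun_scaleR_left (G y) o\<^sub>L \<rho>' y)" for y
        have h'ap: "h' y v = \<eta> (m n * \<rho> y) *\<^sub>R G' y v + (m n * \<eta>' (m n * \<rho> y) * \<rho>' y v) *\<^sub>R G y" for y v
          by (simp add: h'_def blinfun.add_left blinfun.scaleR_left)
        show ?thesis
        proof (intro exI conjI ballI)
          show "open (M \<inter> N)" "x \<in> M \<inter> N" using True C(3) M(1) oN by auto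
          fix y assume y: "y \<in> M \<inter> N"
          have "((\<lambda>y. \<eta> (m n * \<rho> y)) has_derivative (\<lambda>v. m n * \<rho>' y v * \<eta>' (m n * \<rho> y))) (at y)"
            by (rule DERIV_compose_FDERIV[OF \<eta>(1)]) (use y in \<open>auto intro!: derivative_eq_intros \<rho>d\<close>)
          from has_derivative_scaleR[OF this G(1)[of y]] y
          show "(h has_derivative blinfun_apply (h' y)) (at y)"
            unfolding h_def h'ap[abs_def] by (simp add: mult_ac add.commute)
        next
          show "continuous_on (M \<inter> N) h'"
          proof (rule continuous_on_blinfun_componentwise)
            fix v
            show "continuous_on (M \<inter> N) (\<lambda>y. blinfun_apply (h' y) v)"
              unfolding h'ap
              by (intro continuous_intros continuous_on_compose2[OF \<eta>(2)] continuous_on_compose2[OF \<eta>c]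
                  continuous_on_subset[OF \<rho>c] continuous_on_subset[OF \<rho>'c] continuous_on_subset[OF G(2)] continuous_on_subset[OF Gc]) auto
          qed
        next
          fix y assume y: "y \<in> M \<inter> N \<inter> ?S"
          have pos: "0 \<le> m n * \<rho> y" if "y \<notin> V" using VN[of y] y that m[of n] by auto
          show "H y = h y" using \<eta>0[OF pos] by (auto simp: H_def h_def)
          show "K y = h' y (rot_gen a b y)"
            using \<eta>0[OF pos] \<eta>'0[OF pos] by (auto simp: K_def h'ap \<alpha>_def \<beta>_def g_def w_def)
        qed
      next
        case False
        \<comment> \<open>Such a point has a neighbourhood that misses the closed set
          \<open>C \<inter> Z\<close>; there every point of \<open>V\<close> lies outside the
          support of \<open>G\<close>.\<close>
        have z: "y \<in> V \<Longrightarrow> y \<notin> Z" if "y \<in> - (C \<inter> Z)" for y using that by (auto simp: C_def)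
        show ?thesis
        proof (intro exI conjI ballI)
          show "open (- (C \<inter> Z))" using C(4) Z(1) by auto
          show "x \<in> - (C \<inter> Z)" using False Z(2) by auto
          show "((\<lambda>_. 0) has_derivative blinfun_apply 0) (at y)" for y :: "real ^ 'm"
            unfolding zero_blinfun.rep_eq by (rule has_derivative_const)
          show "continuous_on (- (C \<inter> Z)) (\<lambda>_. 0)" by simp
          fix y assume y: "y \<in> - (C \<inter> Z) \<inter> ?S"
          show "H y = 0" using z[of y] y supp' by (auto simp: H_def)
          show "K y = blinfun_apply 0 (rot_gen a b y)"
            using z[of y] y supp' g0[of y] by (auto simp: K_def \<alpha>_def \<beta>_def C_def blinfun.zero_left)
        qed
      qed
    qed
    moreover have "(LINT x:?S|\<mu>. K x) = (LINT x:V|\<mu>. \<alpha> n x + \<beta> n x)"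
      unfolding set_lebesgue_integral_def using C(2)
      by (intro Bochner_Integration.integral_cong) (auto simp: K_def indicator_def C_def)
    moreover have "(LINT x:V|\<mu>. \<alpha> n x + \<beta> n x) = (LINT x:V|\<mu>. \<alpha> n x) + (LINT x:V|\<mu>. \<beta> n x)"
      by (rule set_integral_add) (intro intC \<alpha>c \<beta>c)+
    ultimately show ?thesis by simp
  qed
  have lim\<alpha>: "(\<lambda>n. LINT x:V|\<mu>. \<alpha> n x) \<longlonglongrightarrow> (LINT x:V|\<mu>. g x)"
    unfolding set_lebesgue_integral_def
  proof (rule integral_dominated_convergence[where w = "\<lambda>x. C\<eta> * norm (indicator V x *\<^sub>R g x)"])
    show "(\<lambda>x. indicator V x *\<^sub>R g x) \<in> borel_measurable \<mu>"
      using intC[OF gc] by (auto simp: set_integrable_def)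
    show "(\<lambda>x. indicator V x *\<^sub>R \<alpha> n x) \<in> borel_measurable \<mu>" for n
      using intC[OF \<alpha>c] by (auto simp: set_integrable_def)
    show "integrable \<mu> (\<lambda>x. C\<eta> * norm (indicator V x *\<^sub>R g x))"
      using intC[OF gc] by (intro integrable_mult_right integrable_norm) (auto simp: set_integrable_def)
    show "AE x in \<mu>. (\<lambda>n. indicator V x *\<^sub>R \<alpha> n x) \<longlonglongrightarrow> indicator V x *\<^sub>R g x"
    proof (rule AE_I2)
      fix x
      show "(\<lambda>n. indicator V x *\<^sub>R \<alpha> n x) \<longlonglongrightarrow> indicator V x *\<^sub>R g x"
      proof (cases "x \<in> V \<and> x \<in> Z")
        case True
        then have "x \<in> ?S" "x \<in> N" using Z(2) C(2) unfolding C_def by blast+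
        then have neg: "\<rho> x < 0" using VN True by blast
        obtain n0 where n0: "1 / - \<rho> x \<le> real n0" using real_arch_simple by blast
        \<comment> \<open>As soon as \<open>m n\<close> reaches \<open>1 / - \<rho> x\<close>, the
          cutoff equals 1 at \<open>x\<close>.\<close>
        have "\<alpha> n x = g x" if "n \<ge> n0" for n
        proof -
          have "1 / - \<rho> x \<le> m n" using n0 that by (simp add: m_def)
          then have "m n * \<rho> x \<le> - 1" using neg by (simp add: field_simps)
          then show ?thesis by (simp add: \<alpha>_def \<eta>1)
        qed
        then have "\<forall>\<^sub>F n in sequentially. indicator V x *\<^sub>R \<alpha> n x = indicator V x *\<^sub>R g x"
          by (auto simp: eventually_sequentially)
        then show ?thesis by (rule tendsto_eventually)
      next
        case False
        then have "x \<notin> V \<or> g x = 0" using g0[of x] by (auto simp: C_def)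
        then show ?thesis by (auto simp: \<alpha>_def)
      qed
    qed
    show "AE x in \<mu>. norm (indicator V x *\<^sub>R \<alpha> n x) \<le> C\<eta> * norm (indicator V x *\<^sub>R g x)" for n
      using C\<eta> by (intro AE_I2) (auto simp: \<alpha>_def indicator_def intro!: mult_right_mono)
  qed
  have lim\<beta>: "(\<lambda>n. LINT x:V|\<mu>. \<beta> n x) \<longlonglongrightarrow> - (LINT x:?bV|\<sigma>. (w x \<bullet> \<nu> x) *\<^sub>R G x)"
  proof -
    define B where "B = (\<lambda>k::'m. axis k (1::real)) ` (- {i})"
    define B' where "B' = (\<lambda>k::'m. axis k (1::real)) ` (- {i, j})"
    define e where "e = (axis j 1 :: real ^ 'm)"
    have "- {i} = insert j (- {i, j})" using b by auto
    then have Be: "B = insert e B'" by (simp add: B_def B'_def e_def)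
    have BB: "insert e B' \<subseteq> Basis" "e \<notin> B'"
      by (auto simp: B'_def e_def axis_in_Basis_iff axis_eq_axis)
    have te: "t \<bullet> e = t $ j" for t by (simp add: e_def inner_axis)
    define J where "J t = sqrt (gram_det B \<Phi> t)" for t
    define J' where "J' t = sqrt (gram_det B' \<Phi> t)" for t
    have im: "\<Phi> ` (T \<inter> span B) = ?S \<inter> N" and im': "\<Phi> ` (T \<inter> span B') = ?bV \<inter> N"
      using bcl(2,4) by (simp_all add: B_def B'_def)
    have lp: "local_param (CARD('m) - 1) ?S B (T \<inter> span B) \<Phi>"
      and lp': "local_param (CARD('m) - 2) ?bV B' (T \<inter> span B') \<Phi>"
      using bcl(1,3) by (simp_all add: B_def B'_def)
    have hom: "\<Phi> t \<in> N" "\<Psi> (\<Phi> t) = t" if "t \<in> T" for t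
      using b that by (auto simp: homeomorphism_def)
    have \<rho>\<Phi>: "\<rho> (\<Phi> t) = t $ j" if "t \<in> T" for t
      using b hom[OF that] by metis
    \<comment> \<open>The half of the parameter domain that \<open>\<Phi>\<close> maps into the
      closure of \<open>V\<close>, where \<open>G\<close> is controlled.\<close>
    define D1 where "D1 = {t \<in> T \<inter> span B. t $ j \<le> 0}"
    have \<Phi>C: "\<Phi> t \<in> C" if "t \<in> D1" for t
    proof -
      have "\<Phi> t \<in> ?S" "t \<in> T" using im that by (auto simp: D1_def)
      then show ?thesis using VN[of "\<Phi> t"] bVN[of "\<Phi> t"] hom \<rho>\<Phi>[of t] that
        by (auto simp: C_def D1_def)
    qed
    \<comment> \<open>The parameters of the part of the closure of \<open>V\<close> that meets
      \<open>Z\<close>. Its compactness makes \<open>q\<close> bounded, of bounded support and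
      Borel.\<close>
    define K0 where "K0 = \<Psi> ` (C \<inter> Z)"
    have "continuous_on (C \<inter> Z) \<Psi>"
      using b Z(2) by (auto simp: homeomorphism_def intro: continuous_on_subset)
    then have K0c: "compact K0" unfolding K0_def
      using C(1) Z(1) by (intro compact_continuous_image compact_Int_closed)
    have K0: "K0 \<subseteq> D1"
    proof
      fix t assume "t \<in> K0"
      then obtain x where x: "x \<in> C" "x \<in> Z" "t = \<Psi> x" by (auto simp: K0_def)
      then have "x \<in> ?S \<inter> N" using C(2) Z(2) by blast
      then obtain t' where t': "t' \<in> T \<inter> span B" "x = \<Phi> t'" using im by blast
      then have "t = t'" using x hom by simp
      moreover have "\<rho> x \<le> 0"
        using \<open>x \<in> ?S \<inter> N\<close> VN[of x] bVN[of x] x(1) by (auto simp: C_def)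
      ultimately show "t \<in> D1" using t' \<rho>\<Phi>[of t'] by (auto simp: D1_def)
    qed
    define q0 where "q0 t = (J t * \<rho>' (\<Phi> t) (w (\<Phi> t))) *\<^sub>R G (\<Phi> t)" for t
    \<comment> \<open>\<open>q0\<close> is meaningful on \<open>D1\<close> only. The cutoff to
      \<open>K0\<close> extends it by 0 to the whole space without changing it on
      \<open>D1\<close>.\<close>
    define q where "q t = indicator K0 t *\<^sub>R q0 t" for t
    have q0z: "q0 t = 0" if "t \<in> D1" "t \<notin> K0" for t
    proof -
      have "\<Phi> t \<notin> Z"
      proof
        assume "\<Phi> t \<in> Z"
        then have "\<Psi> (\<Phi> t) \<in> K0" using \<Phi>C that(1) by (auto simp: K0_def)
        then show False using that hom by (auto simp: D1_def)
      qed
      then show ?thesis using supp' by (simp add: q0_def)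
    qed
    have qq0: "q t = q0 t" if "t \<in> D1" for t
      using q0z[OF that] by (cases "t \<in> K0") (auto simp: q_def)
    have \<Phi>c: "continuous_on D1 \<Phi>"
      using b by (auto simp: homeomorphism_def D1_def intro: continuous_on_subset)
    have "continuous_on (T \<inter> span B) (gram_det B \<Phi>)"
      using lp by (intro continuous_on_gram_det) (auto simp: local_param_def)
    then have Jc: "continuous_on D1 J"
      unfolding J_def by (intro continuous_intros) (auto simp: D1_def intro: continuous_on_subset)
    have q0c: "continuous_on D1 q0"
      unfolding q0_def
    proof (intro continuous_intros Jc)
      show "continuous_on D1 (\<lambda>t. \<rho>' (\<Phi> t))"
        by (rule continuous_on_compose2[OF \<rho>'c \<Phi>c]) (auto simp: D1_def hom)
      show "continuous_on D1 (\<lambda>t. w (\<Phi> t))"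
        by (rule continuous_on_compose2[OF wc[of UNIV] \<Phi>c]) auto
      show "continuous_on D1 (\<lambda>t. G (\<Phi> t))"
        by (rule continuous_on_compose2[OF Gc \<Phi>c]) (use \<Phi>C C(3) in auto)
    qed
    have qm: "q \<in> borel_measurable borel"
      unfolding q_def using K0c continuous_on_subset[OF q0c K0]
      by (intro borel_measurable_continuous_on_indicator) (auto simp: borel_compact)
    obtain C0 where C0: "\<And>t. t \<in> K0 \<Longrightarrow> norm (q0 t) \<le> C0"
      using continuous_on_compact_bound[OF K0c continuous_on_subset[OF q0c K0]] by blast
    obtain R where R: "\<And>t. t \<in> K0 \<Longrightarrow> norm t \<le> R"
      using compact_imp_bounded[OF K0c] unfolding bounded_iff by blast
    have qb: "norm (q t) \<le> \<bar>C0\<bar> * indicator (cball 0 R) t" for t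
      using C0[of t] R[of t] by (cases "t \<in> K0") (auto simp: q_def)
    have qc: "continuous_on {t \<in> span (insert e B'). t \<bullet> e \<le> 0} q"
    proof -
      \<comment> \<open>\<open>q\<close> agrees with \<open>q0\<close> on the part in
        \<open>T\<close> and is 0 off \<open>K0\<close>; these two relatively open sets cover the
        half space.\<close>
      let ?D0 = "{t \<in> span B. t $ j \<le> 0}"
      have D0: "?D0 = (?D0 \<inter> T) \<union> (?D0 - K0)" using K0 by (auto simp: D1_def)
      have "continuous_on ((?D0 \<inter> T) \<union> (?D0 - K0)) q"
      proof (rule continuous_on_Un_local_open)
        show "openin (top_of_set ((?D0 \<inter> T) \<union> (?D0 - K0))) (?D0 \<inter> T)"
          unfolding D0[symmetric] using b by (auto simp: openin_open)
        show "openin (top_of_set ((?D0 \<inter> T) \<union> (?D0 - K0))) (?D0 - K0)"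
          unfolding D0[symmetric] using compact_imp_closed[OF K0c]
          by (auto simp: openin_open intro!: exI[of _ "- K0"])
        have D: "?D0 \<inter> T = D1" by (auto simp: D1_def)
        show "continuous_on (?D0 \<inter> T) q"
          unfolding D by (rule continuous_on_eq[OF q0c]) (simp add: qq0)
        show "continuous_on (?D0 - K0) q"
          by (rule continuous_on_eq[OF continuous_on_const[of _ 0]]) (simp add: q_def)
      qed
      then show ?thesis using D0 by (simp add: te Be)
    qed
    have chart: "(LINT x:V|\<mu>. \<beta> n x) = (LINT t|lborel_span B. (m n * \<eta>' (m n * (t \<bullet> e))) *\<^sub>R q t)" for n
    proof -
      \<comment> \<open>The indicator of \<open>C\<close> turns \<beta>, whose continuity is known
        on \<open>C\<close> only, into a Borel function on the whole space.\<close>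
      define h where "h x = (indicator V x :: real) *\<^sub>R ((indicator C x :: real) *\<^sub>R \<beta> n x)" for x
      have hm: "h \<in> borel_measurable borel"
        unfolding h_def
        by (rule borel_measurable_scaleR[OF borel_measurable_indicator[OF cl(5)]
              borel_measurable_continuous_on_indicator[OF C(5) \<beta>c]])
      have "(LINT x:V|\<mu>. \<beta> n x) = (LINT x:\<Phi> ` (T \<inter> span B)|\<mu>. h x)"
        unfolding set_lebesgue_integral_def im
      proof (intro Bochner_Integration.integral_cong refl)
        fix x
        show "indicator V x *\<^sub>R \<beta> n x = indicator (?S \<inter> N) x *\<^sub>R h x"
          using C(2) Z(2) supp'[of x] by (auto simp: h_def indicator_def C_def \<beta>_def)
      qed
      also have "\<dots> = (LINT t:T \<inter> span B|lborel_span B. J t *\<^sub>R h (\<Phi> t))"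
        by (rule local_param_integral[OF \<mu> closed_sphere lp _ _ hm])
          (use boundary_chart_gram_nonneg[OF bc] in \<open>auto simp: J_def B_def\<close>)
      also have "\<dots> = (LINT t|lborel_span B. (m n * \<eta>' (m n * (t \<bullet> e))) *\<^sub>R q t)"
        unfolding set_lebesgue_integral_def te
      proof (intro Bochner_Integration.integral_cong refl)
        fix t
        show "indicator (T \<inter> span B) t *\<^sub>R J t *\<^sub>R h (\<Phi> t) = (m n * \<eta>' (m n * t $ j)) *\<^sub>R q t"
        proof (cases "t \<in> T \<inter> span B")
          case True
          then have x: "\<Phi> t \<in> ?S" "\<Phi> t \<in> N" using im by auto
          show ?thesis
          proof (cases "t $ j < 0")
            case neg: True
            then have "t \<in> D1" "\<Phi> t \<in> V" using True x VN \<rho>\<Phi>[of t] by (auto simp: D1_def)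
            then show ?thesis
              using True \<rho>\<Phi>[of t] by (simp add: qq0 q0_def h_def C_def \<beta>_def mult_ac)
          next
            case False
            then have "\<Phi> t \<notin> V" using True x VN \<rho>\<Phi>[of t] by auto
            moreover have "\<eta>' (m n * t $ j) = 0" using False m[of n] by (intro \<eta>'0) simp
            ultimately show ?thesis by (simp add: h_def)
          qed
        next
          case False
          then have "t \<notin> K0" using K0 by (auto simp: D1_def)
          then show ?thesis using False by (simp add: q_def)
        qed
      qed
      finally show ?thesis .
    qed
    have fin: "(LINT t|lborel_span B'. q t) = (LINT x:?bV|\<sigma>. (w x \<bullet> \<nu> x) *\<^sub>R G x)"
    proof -
      define h where "h x = (indicator ?bV x :: real) *\<^sub>R ((w x \<bullet> \<nu> x) *\<^sub>R G x)" for x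
      have "continuous_on ?bV (\<lambda>x. (w x \<bullet> \<nu> x) *\<^sub>R G x)"
        using continuous_on_outward_normal[OF V(2) out] M(2)
        by (intro continuous_intros wc continuous_on_subset[OF Gc]) auto
      then have hm: "h \<in> borel_measurable borel"
        unfolding h_def using cl(4) by (intro borel_measurable_continuous_on_indicator) (auto simp: borel_compact)
      have "(LINT t|lborel_span B'. q t) = (LINT t|lborel_span B'. indicator (span B') t *\<^sub>R q t)"
      proof (rule integral_cong_AE)
        show "AE t in lborel_span B'. q t = indicator (span B') t *\<^sub>R q t"
          using AE_lborel_span by eventually_elim simp
        have "span B' \<in> sets borel" by (simp add: borel_closed)
        then show "(\<lambda>t. indicator (span B') t *\<^sub>R q t) \<in> borel_measurable (lborel_span B')"
          using qm by (intro borel_measurable_scaleR borel_measurable_indicator) auto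
      qed (use qm in auto)
      also have "\<dots> = (LINT t:T \<inter> span B'|lborel_span B'. J' t *\<^sub>R h (\<Phi> t))"
        unfolding set_lebesgue_integral_def
      proof (intro Bochner_Integration.integral_cong refl)
        fix t
        show "indicator (span B') t *\<^sub>R q t = indicator (T \<inter> span B') t *\<^sub>R J' t *\<^sub>R h (\<Phi> t)"
        proof (cases "t \<in> T \<inter> span B'")
          case True
          then have x: "\<Phi> t \<in> ?bV" "\<Phi> t \<in> N" using im' by auto
          have "span B' \<subseteq> span B" unfolding Be by (rule span_mono) auto
          moreover have "t $ j = 0" using bVN[of "\<Phi> t"] x \<rho>\<Phi>[of t] True cl(3) by auto
          ultimately have "t \<in> D1" using True by (auto simp: D1_def)
          \<comment> \<open>Here the density of the sphere chart is exchanged for that of the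
            boundary chart.\<close>
          moreover have "J t * \<rho>' (\<Phi> t) (w (\<Phi> t)) = J' t * (w (\<Phi> t) \<bullet> \<nu> (\<Phi> t))"
            using boundary_chart_normal(3)[OF bc _ out[OF x(1)] xw] True
            by (simp add: J_def J'_def B_def B'_def)
          ultimately show ?thesis using True x by (simp add: qq0 q0_def h_def)
        next
          case False
          then show ?thesis using K0 by (auto simp: q_def D1_def indicator_def)
        qed
      qed
      also have "\<dots> = (LINT x:\<Phi> ` (T \<inter> span B')|\<sigma>. h x)"
      proof (rule local_param_integral[OF \<sigma> compact_imp_closed[OF cl(4)] lp' _ _ hm, symmetric])
        fix t assume t: "t \<in> T \<inter> span B'"
        show "sqrt (gram_det B' \<Phi> t) = J' t" by (simp add: J'_def)
        have "outward_unit_normal V (\<Phi> t) (\<nu> (\<Phi> t))" using out im' t by blast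
        then show "0 \<le> J' t"
          using boundary_chart_normal(4)[OF bc _ _ xw] t by (simp add: J'_def B'_def)
      qed
      also have "\<dots> = (LINT x:?bV|\<sigma>. (w x \<bullet> \<nu> x) *\<^sub>R G x)"
        unfolding set_lebesgue_integral_def im'
      proof (intro Bochner_Integration.integral_cong refl)
        fix x
        show "indicator (?bV \<inter> N) x *\<^sub>R h x = indicator ?bV x *\<^sub>R (w x \<bullet> \<nu> x) *\<^sub>R G x"
          using supp'[of x] Z(2) by (auto simp: h_def indicator_def)
      qed
      finally show ?thesis .
    qed
    have "(\<lambda>n. LINT t|lborel_span (insert e B'). (real (Suc n) * \<eta>' (real (Suc n) * (t \<bullet> e))) *\<^sub>R q t)
       \<longlonglongrightarrow> - (LINT t|lborel_span B'. q t)"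
      by (rule slab_integral_limit[OF BB qm qb qc \<eta> \<eta>0[OF order_refl] \<eta>1[OF order_refl] \<eta>'z])
    then show ?thesis by (simp only: chart fin m_def Be)
  qed
  have "(\<lambda>n. (LINT x:V|\<mu>. \<alpha> n x) + (LINT x:V|\<mu>. \<beta> n x)) \<longlonglongrightarrow> (LINT x:V|\<mu>. g x) + - (LINT x:?bV|\<sigma>. (w x \<bullet> \<nu> x) *\<^sub>R G x)"
    by (rule tendsto_add[OF lim\<alpha> lim\<beta>])
  then have "(LINT x:V|\<mu>. g x) + - (LINT x:?bV|\<sigma>. (w x \<bullet> \<nu> x) *\<^sub>R G x) = 0"
    by (simp add: sum0 LIMSEQ_const_iff)
  then show ?thesis by (simp add: g_def w_def)
qed

section \<open>Functions of class \<open>C\<^sup>1\<close> and partitions of unity\<close>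

text \<open>The domain is finite-dimensional, so continuity of each directional derivative already
  gives continuity of the derivative in operator norm.\<close>

lemma C1_onI:
  fixes F :: "'a::euclidean_space \<Rightarrow> 'b::real_normed_vector"
  assumes "\<And>x. x \<in> S \<Longrightarrow> (F has_derivative F' x) (at x)" "\<And>v. continuous_on S (\<lambda>x. F' x v)"
  shows "C1_on S F"
  unfolding C1_on_def
proof (intro exI conjI ballI)
  have ap: "blinfun_apply (Blinfun (F' x)) = F' x" if "x \<in> S" for x
    by (rule bounded_linear_Blinfun_apply[OF has_derivative_bounded_linear[OF assms(1)[OF that]]])
  show "(F has_derivative blinfun_apply (Blinfun (F' x))) (at x)" if "x \<in> S" for x
    using assms(1)[OF that] ap[OF that] by simp
  show "continuous_on S (\<lambda>x. Blinfun (F' x))"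
    by (rule continuous_on_blinfun_componentwise) (rule continuous_on_eq[OF assms(2)], simp add: ap)
qed

lemma C1_onE:
  assumes "C1_on S F"
  obtains F' where "\<And>x. x \<in> S \<Longrightarrow> (F has_derivative blinfun_apply (F' x)) (at x)" "continuous_on S F'"
    "\<And>x. x \<in> S \<Longrightarrow> frechet_derivative F (at x) = blinfun_apply (F' x)"
proof -
  obtain F' where "\<And>x. x \<in> S \<Longrightarrow> (F has_derivative blinfun_apply (F' x)) (at x)" "continuous_on S F'"
    using assms by (auto simp: C1_on_def)
  then show thesis using that frechet_derivative_at by metis
qed

lemma C1_on_has_derivative:
  "C1_on S F \<Longrightarrow> x \<in> S \<Longrightarrow> (F has_derivative frechet_derivative F (at x)) (at x)"
  by (metis C1_onE)

lemma C1_on_continuous_frechet: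
  assumes "C1_on S F" "T \<subseteq> S" "continuous_on T w"
  shows "continuous_on T (\<lambda>x. frechet_derivative F (at x) (w x))"
proof -
  obtain F' where F': "continuous_on S F'" "\<And>x. x \<in> S \<Longrightarrow> frechet_derivative F (at x) = blinfun_apply (F' x)"
    using C1_onE[OF assms(1)] by metis
  have "continuous_on T (\<lambda>x. blinfun_apply (F' x) (w x))"
    using continuous_on_subset[OF F'(1) assms(2)] assms(3) by (intro continuous_intros)
  then show ?thesis by (rule continuous_on_eq) (use F'(2) assms(2) in auto)
qed

lemmas C1_on_continuous_directional = C1_on_continuous_frechet[OF _ order_refl continuous_on_const]

lemma C1_on_continuous: "C1_on S F \<Longrightarrow> continuous_on S F"
  by (rule continuous_at_imp_continuous_on) (use C1_on_has_derivative has_derivative_continuous in blast)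

lemma C1_on_subset: "C1_on S F \<Longrightarrow> T \<subseteq> S \<Longrightarrow> C1_on T F"
  unfolding C1_on_def by (meson continuous_on_subset subsetD)

lemma C1_on_scaleR:
  fixes F :: "'a::euclidean_space \<Rightarrow> 'b::real_normed_vector"
  assumes "C1_on S u" "C1_on S F"
  shows "C1_on S (\<lambda>x. u x *\<^sub>R F x)"
proof (rule C1_onI)
  fix x assume x: "x \<in> S"
  show "((\<lambda>x. u x *\<^sub>R F x) has_derivative
      (\<lambda>v. u x *\<^sub>R frechet_derivative F (at x) v + frechet_derivative u (at x) v *\<^sub>R F x)) (at x)"
    by (rule has_derivative_scaleR[OF C1_on_has_derivative[OF assms(1) x] C1_on_has_derivative[OF assms(2) x]])
next
  fix v
  show "continuous_on S (\<lambda>x. u x *\<^sub>R frechet_derivative F (at x) v + frechet_derivative u (at x) v *\<^sub>R F x)"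
    by (intro continuous_intros C1_on_continuous[OF assms(1)] C1_on_continuous[OF assms(2)]
      C1_on_continuous_directional[OF assms(1)]
      C1_on_continuous_directional[OF assms(2)])
qed

lemma C1_on_inverse:
  fixes u :: "'a::euclidean_space \<Rightarrow> real"
  assumes "C1_on S u" "\<And>x. x \<in> S \<Longrightarrow> u x \<noteq> 0"
  shows "C1_on S (\<lambda>x. inverse (u x))"
proof (rule C1_onI)
  fix x assume x: "x \<in> S"
  show "((\<lambda>x. inverse (u x)) has_derivative (\<lambda>v. - (inverse (u x) * frechet_derivative u (at x) v * inverse (u x)))) (at x)"
    by (rule Deriv.has_derivative_inverse[OF assms(2)[OF x] C1_on_has_derivative[OF assms(1) x]])
next
  fix v
  show "continuous_on S (\<lambda>x. - (inverse (u x) * frechet_derivative u (at x) v * inverse (u x)))"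
    by (intro continuous_intros C1_on_continuous[OF assms(1)] ballI assms(2)
      C1_on_continuous_directional[OF assms(1)])
qed

lemma C1_on_sum:
  fixes F :: "'i \<Rightarrow> 'a::euclidean_space \<Rightarrow> 'b::real_normed_vector"
  assumes "\<And>i. i \<in> I \<Longrightarrow> C1_on S (F i)"
  shows "C1_on S (\<lambda>x. \<Sum>i\<in>I. F i x)"
proof (rule C1_onI)
  show "((\<lambda>x. \<Sum>i\<in>I. F i x) has_derivative (\<lambda>v. \<Sum>i\<in>I. frechet_derivative (F i) (at x) v)) (at x)" if "x \<in> S" for x
    by (rule has_derivative_sum) (rule C1_on_has_derivative[OF assms that])
  show "continuous_on S (\<lambda>x. \<Sum>i\<in>I. frechet_derivative (F i) (at x) v)" for v
    by (rule continuous_on_sum) (rule C1_on_continuous_directional[OF assms])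
qed

lemma C1_on_bounded_linear:
  fixes l :: "'a::euclidean_space \<Rightarrow> 'b::real_normed_vector"
  shows "bounded_linear l \<Longrightarrow> C1_on S l"
  by (rule C1_onI[where F' = "\<lambda>_. l"]) (auto intro: bounded_linear_imp_has_derivative)

text \<open>The outer square makes the function C1 where the positive part has its kink, on the
  sphere of radius \<open>r\<close> about \<open>p\<close>.\<close>

definition bump :: "'a::real_inner \<Rightarrow> real \<Rightarrow> 'a \<Rightarrow> real" where
  "bump p r x = (max 0 (r\<^sup>2 - (x - p) \<bullet> (x - p)))\<^sup>2"

lemma bump_nonneg: "0 \<le> bump p r x"
  by (simp add: bump_def)

lemma bump_pos: "x \<in> ball p r \<Longrightarrow> 0 < bump p r x"
proof -
  assume x: "x \<in> ball p r"
  then have "(norm (x - p))\<^sup>2 < r\<^sup>2"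
    by (intro power_strict_mono) (auto simp: dist_norm norm_minus_commute)
  then show ?thesis by (simp add: bump_def power2_norm_eq_inner)
qed

lemma bump_outside:
  assumes "x \<notin> ball p r" "0 \<le> r"
  shows "bump p r x = 0"
proof -
  have "r\<^sup>2 \<le> (norm (x - p))\<^sup>2"
    using assms by (intro power_mono) (auto simp: dist_norm norm_minus_commute)
  then show ?thesis by (simp add: bump_def power2_norm_eq_inner)
qed

lemma C1_on_bump: "C1_on S (bump (p :: 'a::euclidean_space) r)"
proof (rule C1_onI)
  fix x :: 'a
  have "((\<lambda>x. r\<^sup>2 - (x - p) \<bullet> (x - p)) has_derivative (\<lambda>v. - (2 * ((x - p) \<bullet> v)))) (at x)"
    by (auto intro!: derivative_eq_intros simp: inner_commute)
  from DERIV_compose_FDERIV[OF max_0_square_has_real_derivative this]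
  show "(bump p r has_derivative (\<lambda>v. - (2 * ((x - p) \<bullet> v)) * (2 * max 0 (r\<^sup>2 - (x - p) \<bullet> (x - p))))) (at x)"
    unfolding bump_def[abs_def] .
next
  fix v :: 'a
  show "continuous_on S (\<lambda>x. - (2 * ((x - p) \<bullet> v)) * (2 * max 0 (r\<^sup>2 - (x - p) \<bullet> (x - p))))"
    by (intro continuous_intros)
qed

text \<open>The radius has to be fixed before \<open>M\<close> and \<open>G\<close>, because the
  partition of unity is built from these radii. At an interior point the ball can be taken so small
  that \<open>G\<close> vanishes on the boundary and extends by 0 to the sphere; then both sides are
  0.\<close>

lemma rot_flux_local:
  fixes V :: "(real ^ 'm::finite) set"
  assumes \<mu>: "is_lebesgue_measure_on (CARD('m) - 1) (sphere 0 1) \<mu>"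
    and \<sigma>: "is_lebesgue_measure_on (CARD('m) - 2) (sph_boundary V) \<sigma>"
    and V: "openin (top_of_set (sphere 0 1)) V" "C1_boundary V"
    and out: "\<And>x. x \<in> sph_boundary V \<Longrightarrow> outward_unit_normal V x (\<nu> x)" and ab: "a \<noteq> b"
    and p: "p \<in> V \<union> sph_boundary V"
  shows "\<exists>r>0. \<forall>M (G :: real ^ 'm \<Rightarrow> 'b::euclidean_space).
    open M \<longrightarrow> V \<union> sph_boundary V \<subseteq> M \<longrightarrow> C1_on M G \<longrightarrow> (\<forall>x. x \<notin> ball p r \<longrightarrow> G x = 0) \<longrightarrow>
    (LINT x:V|\<mu>. frechet_derivative G (at x) (rot_gen a b x)) = (LINT x:sph_boundary V|\<sigma>. (rot_gen a b x \<bullet> \<nu> x) *\<^sub>R G x)"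
proof (cases "p \<in> V")
  case False
  then have p: "p \<in> sph_boundary V" using p by blast
  obtain i j N T \<Psi> \<Phi> D \<rho> \<rho>' where bc: "boundary_chart V i j N T \<Psi> \<Phi> D \<rho> \<rho>'" "p \<in> N"
    using boundary_chart_exists[OF V(2) p] by blast
  then have "open N" by (simp add: boundary_chart_def)
  then obtain r where r: "r > 0" "cball p r \<subseteq> N" using bc(2) open_contains_cball by blast
  show ?thesis
  proof (intro exI[of _ r] conjI allI impI)
    fix M and G :: "real ^ 'm \<Rightarrow> 'b"
    assume M: "open M" "V \<union> sph_boundary V \<subseteq> M" and G: "C1_on M G" and s: "\<forall>x. x \<notin> ball p r \<longrightarrow> G x = 0"
    obtain G' where G': "\<And>x. x \<in> M \<Longrightarrow> (G has_derivative blinfun_apply (G' x)) (at x)" "continuous_on M G'"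
      "\<And>x. x \<in> M \<Longrightarrow> frechet_derivative G (at x) = blinfun_apply (G' x)"
      using C1_onE[OF G] by metis
    have "(LINT x:V|\<mu>. frechet_derivative G (at x) (rot_gen a b x)) = (LINT x:V|\<mu>. G' x (rot_gen a b x))"
      unfolding set_lebesgue_integral_def
      by (intro Bochner_Integration.integral_cong) (use M(2) G'(3) in \<open>auto simp: indicator_def\<close>)
    also have "\<dots> = (LINT x:sph_boundary V|\<sigma>. (rot_gen a b x \<bullet> \<nu> x) *\<^sub>R G x)"
      by (rule rot_flux_at_boundary[OF \<mu> \<sigma> V out ab bc(1) r(2) M G'(1,2)]) (use s in auto)
    finally show "(LINT x:V|\<mu>. frechet_derivative G (at x) (rot_gen a b x)) = (LINT x:sph_boundary V|\<sigma>. (rot_gen a b x \<bullet> \<nu> x) *\<^sub>R G x)" .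
  qed (use r in auto)
next
  case True
  obtain r where r: "r > 0" "cball p r \<inter> sphere 0 1 \<subseteq> V"
    using V(1) True by (meson openin_contains_cball)
  obtain T where T: "open T" "V = sphere 0 1 \<inter> T" using V(1) by (auto simp: openin_open)
  show ?thesis
  proof (intro exI[of _ r] conjI allI impI)
    fix M and G :: "real ^ 'm \<Rightarrow> 'b"
    assume M: "open M" "V \<union> sph_boundary V \<subseteq> M" and G: "C1_on M G" and s: "\<forall>x. x \<notin> ball p r \<longrightarrow> G x = 0"
    obtain G' where G': "\<And>x. x \<in> M \<Longrightarrow> (G has_derivative blinfun_apply (G' x)) (at x)" "continuous_on M G'"
      "\<And>x. x \<in> M \<Longrightarrow> frechet_derivative G (at x) = blinfun_apply (G' x)"
      using C1_onE[OF G] by metis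
    define K where "K x = (if x \<in> V then G' x (rot_gen a b x) else 0)" for x
    have "(LINT x:sphere 0 1|\<mu>. K x) = 0"
    proof (rule integral_sphere_rot_gen[OF \<mu> ab, where H = "\<lambda>x. if x \<in> V then G x else 0"])
      fix x :: "real ^ 'm" assume x: "x \<in> sphere 0 1"
      show "\<exists>Y h h'. open Y \<and> x \<in> Y \<and> (\<forall>y\<in>Y. (h has_derivative blinfun_apply (h' y)) (at y)) \<and>
          continuous_on Y h' \<and> (\<forall>y\<in>Y \<inter> sphere 0 1. (if y \<in> V then G y else 0) = h y \<and> K y = h' y (rot_gen a b y))"
      proof (cases "x \<in> V")
        case True
        show ?thesis
        proof (intro exI conjI ballI)
          show "open (M \<inter> T)" "x \<in> M \<inter> T" using M T True by auto
          show "(G has_derivative blinfun_apply (G' y)) (at y)" if "y \<in> M \<inter> T" for y using G'(1) that by blast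
          show "continuous_on (M \<inter> T) G'" by (rule continuous_on_subset[OF G'(2)]) auto
          fix y assume "y \<in> M \<inter> T \<inter> sphere 0 1"
          then have "y \<in> V" using T by auto
          then show "(if y \<in> V then G y else 0) = G y" "K y = G' y (rot_gen a b y)" by (simp_all add: K_def)
        qed
      next
        case False
        have Gz: "G y = 0" if "y \<notin> cball p r" for y using s that by auto
        show ?thesis
        proof (intro exI conjI ballI)
          show "open (- cball p r)" "x \<in> - cball p r" using False x r(2) by auto
          show "((\<lambda>_. 0) has_derivative blinfun_apply 0) (at y)" for y :: "real ^ 'm"
            unfolding zero_blinfun.rep_eq by (rule has_derivative_const)
          show "continuous_on (- cball p r) (\<lambda>_. 0)" by simp
          fix y assume y: "y \<in> - cball p r \<inter> sphere 0 1"
          show "(if y \<in> V then G y else 0) = 0" using y Gz by auto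
          have "G' y v = 0" if "y \<in> V" for v
            by (rule has_derivative_zero_outside[OF G'(1) closed_cball[of p r]]) (use y M that Gz in auto)
          then show "K y = blinfun_apply 0 (rot_gen a b y)" by (auto simp: K_def)
        qed
      qed
    qed
    moreover have "(LINT x:sphere 0 1|\<mu>. K x) = (LINT x:V|\<mu>. frechet_derivative G (at x) (rot_gen a b x))"
      unfolding set_lebesgue_integral_def
      by (intro Bochner_Integration.integral_cong) (use T(2) M(2) G'(3) in \<open>auto simp: indicator_def K_def\<close>)
    moreover have "(LINT x:sph_boundary V|\<sigma>. (rot_gen a b x \<bullet> \<nu> x) *\<^sub>R G x) = (LINT x|\<sigma>. 0)"
      unfolding set_lebesgue_integral_def
    proof (intro Bochner_Integration.integral_cong refl)
      fix x
      have "G x = 0" if "x \<in> sph_boundary V"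
      proof -
        have "x \<notin> V" "x \<in> sphere 0 1" using sph_closure(2,3)[OF V(1)] that by blast+
        then have "x \<notin> ball p r" using r(2) ball_subset_cball by blast
        then show ?thesis using s by blast
      qed
      then show "indicator (sph_boundary V) x *\<^sub>R (rot_gen a b x \<bullet> \<nu> x) *\<^sub>R G x = 0"
        by (auto simp: indicator_def)
    qed
    ultimately show "(LINT x:V|\<mu>. frechet_derivative G (at x) (rot_gen a b x)) = (LINT x:sph_boundary V|\<sigma>. (rot_gen a b x \<bullet> \<nu> x) *\<^sub>R G x)"
      by simp
  qed (use r in auto)
qed

text \<open>The partition of unity consists of the quotients \<open>bump p (r p) x / s x\<close>,
  with \<open>s\<close> the sum of the finitely many bumps. Dividing by \<open>s\<close> shrinks the
  domain from \<open>M\<close> to a neighbourhood \<open>Y\<close> of the closure of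
  \<open>V\<close> on which \<open>s\<close> is positive.\<close>

theorem rot_flux:
  fixes V :: "(real ^ 'm::finite) set" and G :: "real ^ 'm \<Rightarrow> 'b::euclidean_space"
  assumes \<mu>: "is_lebesgue_measure_on (CARD('m) - 1) (sphere 0 1) \<mu>"
    and \<sigma>: "is_lebesgue_measure_on (CARD('m) - 2) (sph_boundary V) \<sigma>"
    and V: "openin (top_of_set (sphere 0 1)) V" "C1_boundary V"
    and out: "\<And>x. x \<in> sph_boundary V \<Longrightarrow> outward_unit_normal V x (\<nu> x)" and ab: "a \<noteq> b"
    and M: "open M" "V \<union> sph_boundary V \<subseteq> M" and G: "C1_on M G"
  shows "(LINT x:V|\<mu>. frechet_derivative G (at x) (rot_gen a b x)) = (LINT x:sph_boundary V|\<sigma>. (rot_gen a b x \<bullet> \<nu> x) *\<^sub>R G x)"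
proof -
  define C where "C = V \<union> sph_boundary V"
  note cl = sph_closure[OF V(1)]
  have sets: "sets \<mu> = sets borel" "sets \<sigma> = sets borel"
    using \<mu> \<sigma> by (auto simp: is_lebesgue_measure_on_def)
  define Q where "Q p r \<longleftrightarrow> (\<forall>M (G :: real ^ 'm \<Rightarrow> 'b).
    open M \<longrightarrow> C \<subseteq> M \<longrightarrow> C1_on M G \<longrightarrow> (\<forall>x. x \<notin> ball p r \<longrightarrow> G x = 0) \<longrightarrow>
    (LINT x:V|\<mu>. frechet_derivative G (at x) (rot_gen a b x)) = (LINT x:sph_boundary V|\<sigma>. (rot_gen a b x \<bullet> \<nu> x) *\<^sub>R G x))"
    for p r
  have "\<forall>p\<in>C. \<exists>r>0. Q p r"
    unfolding Q_def C_def by (intro ballI rot_flux_local[OF \<mu> \<sigma> V out ab])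
  then obtain r where r: "\<And>p. p \<in> C \<Longrightarrow> 0 < r p" and rQ: "\<And>p. p \<in> C \<Longrightarrow> Q p (r p)"
    by (auto dest!: bchoice)
  note rI = rQ[unfolded Q_def, rule_format]
  have "C \<subseteq> (\<Union>p\<in>C. ball p (r p))" using r by force
  then obtain P where P: "P \<subseteq> C" "finite P" "C \<subseteq> (\<Union>p\<in>P. ball p (r p))"
    using compactE_image[OF cl(1)[folded C_def], of C "\<lambda>p. ball p (r p)"] by auto
  define s where "s x = (\<Sum>p\<in>P. bump p (r p) x)" for x
  define Y where "Y = M \<inter> (\<Union>p\<in>P. ball p (r p))"
  have Y: "open Y" "C \<subseteq> Y" "Y \<subseteq> M" using M P by (auto simp: Y_def C_def)
  have spos: "s x \<noteq> 0" if x: "x \<in> Y" for x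
  proof -
    obtain p where p: "p \<in> P" "x \<in> ball p (r p)" using x unfolding Y_def by blast
    have "0 < bump p (r p) x" by (rule bump_pos[OF p(2)])
    also have "\<dots> \<le> s x" unfolding s_def
      by (rule member_le_sum) (use p P(2) bump_nonneg in auto)
    finally show ?thesis by simp
  qed
  define F where "F p x = bump p (r p) x *\<^sub>R (inverse (s x) *\<^sub>R G x)" for p x
  have sC1: "C1_on Y (\<lambda>x. inverse (s x))"
    by (rule C1_on_inverse[OF _ spos]) (auto simp: s_def[abs_def] intro!: C1_on_sum C1_on_bump)
  have F: "C1_on Y (F p)" for p
    unfolding F_def[abs_def] by (intro C1_on_scaleR C1_on_bump sC1 C1_on_subset[OF G Y(3)])
  have FI: "(LINT x:V|\<mu>. frechet_derivative (F p) (at x) (rot_gen a b x)) = (LINT x:sph_boundary V|\<sigma>. (rot_gen a b x \<bullet> \<nu> x) *\<^sub>R F p x)"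
    if p: "p \<in> P" for p
  proof (rule rI[of p Y])
    show "F p x = 0" if "x \<notin> ball p (r p)" for x
      using bump_outside[OF that] r[of p] p P(1) by (auto simp: F_def)
  qed (use p P(1) Y F in auto)
  have Gsum: "G x = (\<Sum>p\<in>P. F p x)" if "x \<in> Y" for x
    using spos[OF that] by (simp add: F_def scaleR_sum_left[symmetric] sum_distrib_right[symmetric] s_def[symmetric])
  have dG: "frechet_derivative G (at x) v = (\<Sum>p\<in>P. frechet_derivative (F p) (at x) v)" if x: "x \<in> Y" for x v
  proof -
    have "((\<lambda>x. \<Sum>p\<in>P. F p x) has_derivative (\<lambda>v. \<Sum>p\<in>P. frechet_derivative (F p) (at x) v)) (at x)"
      by (rule has_derivative_sum) (rule C1_on_has_derivative[OF F x])
    then have "(G has_derivative (\<lambda>v. \<Sum>p\<in>P. frechet_derivative (F p) (at x) v)) (at x)"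
      by (rule has_derivative_transform_within_open[OF _ Y(1) x]) (simp add: Gsum)
    then show ?thesis using frechet_derivative_at by metis
  qed
  have i1: "set_integrable \<mu> V (\<lambda>x. frechet_derivative (F p) (at x) (rot_gen a b x))" for p
  proof (rule set_integrable_subset[of _ C])
    show "set_integrable \<mu> C (\<lambda>x. frechet_derivative (F p) (at x) (rot_gen a b x))"
      by (rule set_integrable_continuous_compact[OF sphere_finite_measure[OF \<mu>] sets(1) cl(1)[folded C_def]])
        (intro C1_on_continuous_frechet[OF F Y(2)] continuous_intros)
  qed (use cl(5) sets in \<open>auto simp: C_def\<close>)
  have i2: "set_integrable \<sigma> (sph_boundary V) (\<lambda>x. (rot_gen a b x \<bullet> \<nu> x) *\<^sub>R F p x)" for p
    by (rule set_integrable_continuous_compact[OF sph_boundary_finite_measure[OF \<sigma> V] sets(2) cl(4)])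
      (use Y(2) in \<open>auto simp: C_def intro!: continuous_intros continuous_on_outward_normal[OF V(2) out] continuous_on_subset[OF C1_on_continuous[OF F]]\<close>)
  have "(LINT x:V|\<mu>. frechet_derivative G (at x) (rot_gen a b x))
      = (LINT x:V|\<mu>. \<Sum>p\<in>P. frechet_derivative (F p) (at x) (rot_gen a b x))"
    unfolding set_lebesgue_integral_def
    by (intro Bochner_Integration.integral_cong) (use Y(2) dG in \<open>auto simp: indicator_def C_def\<close>)
  also have "\<dots> = (\<Sum>p\<in>P. LINT x:V|\<mu>. frechet_derivative (F p) (at x) (rot_gen a b x))"
    using i1 unfolding set_lebesgue_integral_def set_integrable_def
    by (simp add: scaleR_sum_right Bochner_Integration.integral_sum)
  also have "\<dots> = (\<Sum>p\<in>P. LINT x:sph_boundary V|\<sigma>. (rot_gen a b x \<bullet> \<nu> x) *\<^sub>R F p x)"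
    by (rule sum.cong[OF refl FI])
  also have "\<dots> = (LINT x:sph_boundary V|\<sigma>. \<Sum>p\<in>P. (rot_gen a b x \<bullet> \<nu> x) *\<^sub>R F p x)"
    using i2 unfolding set_lebesgue_integral_def set_integrable_def
    by (simp add: scaleR_sum_right Bochner_Integration.integral_sum)
  also have "\<dots> = (LINT x:sph_boundary V|\<sigma>. (rot_gen a b x \<bullet> \<nu> x) *\<^sub>R G x)"
    unfolding set_lebesgue_integral_def
    by (intro Bochner_Integration.integral_cong) (use Y(2) Gsum in \<open>auto simp: indicator_def C_def scaleR_sum_right\<close>)
  finally show ?thesis .
qed

section \<open>The divergence theorem on the sphere\<close>

lemma set_integral_finite_sum:
  fixes f :: "'i \<Rightarrow> 'a \<Rightarrow> 'b::{banach, second_countable_topology}"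
  assumes "\<And>i. i \<in> I \<Longrightarrow> set_integrable M A (f i)"
  shows "(LINT x:A|M. \<Sum>i\<in>I. f i x) = (\<Sum>i\<in>I. LINT x:A|M. f i x)" and "set_integrable M A (\<lambda>x. \<Sum>i\<in>I. f i x)"
proof -
  show "(LINT x:A|M. \<Sum>i\<in>I. f i x) = (\<Sum>i\<in>I. LINT x:A|M. f i x)"
    unfolding set_lebesgue_integral_def scaleR_sum_right
    by (rule Bochner_Integration.integral_sum) (use assms in \<open>simp add: set_integrable_def\<close>)
  show "set_integrable M A (\<lambda>x. \<Sum>i\<in>I. f i x)"
    unfolding set_integrable_def scaleR_sum_right
    by (rule Bochner_Integration.integrable_sum) (use assms in \<open>simp add: set_integrable_def\<close>)
qed

text \<open>The product rule contributes \<open>rot_gen i j x $ i = - x $ j\<close> once for each of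
  the \<open>CARD('m) - 1\<close> indices, Euler's relation contributes \<open>c\<close>, and the
  terms with the square of \<open>x $ j\<close> cancel. For functions constant on rays
  \<open>c = 0\<close>; for homogeneous polynomials it is the degree.\<close>

lemma rot_gen_sum:
  fixes F :: "real ^ 'm::finite \<Rightarrow> 'b::real_normed_vector"
  assumes x: "norm x = 1" and F: "(F has_derivative F') (at x)" and euler: "F' x = c *\<^sub>R F x"
  shows "(\<Sum>i\<in>UNIV - {j}. frechet_derivative (\<lambda>y. y $ i *\<^sub>R F y) (at x) (rot_gen i j x))
    = F' (axis j 1) - ((c + real (CARD('m) - 1)) * x $ j) *\<^sub>R F x"
proof -
  have lin: "linear F'" using F by (rule has_derivative_linear)
  have d: "frechet_derivative (\<lambda>y. y $ i *\<^sub>R F y) (at x) v = x $ i *\<^sub>R F' v + v $ i *\<^sub>R F x" for i v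
  proof -
    have "((\<lambda>y. y $ i *\<^sub>R F y) has_derivative (\<lambda>v. x $ i *\<^sub>R F' v + v $ i *\<^sub>R F x)) (at x)"
      by (rule has_derivative_scaleR[OF bounded_linear_imp_has_derivative[OF bounded_linear_vec_nth] F])
    from fun_cong[OF frechet_derivative_at[OF this], of v] show ?thesis by (rule sym)
  qed
  note F'x = linear_axis_sum[OF lin, of x]
  have xx: "(\<Sum>i\<in>UNIV. x $ i * x $ i) = 1"
    using x by (simp add: norm_eq_1 inner_vec_def)
  have "(\<Sum>i\<in>UNIV - {j}. frechet_derivative (\<lambda>y. y $ i *\<^sub>R F y) (at x) (rot_gen i j x))
      = (\<Sum>i\<in>UNIV - {j}. (x $ i * x $ i) *\<^sub>R F' (axis j 1) - x $ j *\<^sub>R (x $ i *\<^sub>R F' (axis i 1)) - x $ j *\<^sub>R F x)"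
  proof (rule sum.cong[OF refl])
    fix i assume "i \<in> UNIV - {j}"
    then have r: "rot_gen i j x $ i = - x $ j" by (simp add: rot_gen_def axis_def)
    have "F' (rot_gen i j x) = x $ i *\<^sub>R F' (axis j 1) - x $ j *\<^sub>R F' (axis i 1)"
      by (simp only: rot_gen_def linear_diff[OF lin] linear_scale[OF lin])
    then show "frechet_derivative (\<lambda>y. y $ i *\<^sub>R F y) (at x) (rot_gen i j x)
        = (x $ i * x $ i) *\<^sub>R F' (axis j 1) - x $ j *\<^sub>R (x $ i *\<^sub>R F' (axis i 1)) - x $ j *\<^sub>R F x"
      by (simp add: d r scaleR_diff_right mult.commute)
  qed
  also have "\<dots> = (\<Sum>i\<in>UNIV - {j}. x $ i * x $ i) *\<^sub>R F' (axis j 1)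
      - x $ j *\<^sub>R (\<Sum>i\<in>UNIV - {j}. x $ i *\<^sub>R F' (axis i 1)) - (real (CARD('m) - 1) * x $ j) *\<^sub>R F x"
    by (simp add: sum_subtractf scaleR_sum_left scaleR_sum_right sum_constant_scaleR card_Diff_singleton del: of_nat_diff)
  also have "\<dots> = F' (axis j 1) - ((c + real (CARD('m) - 1)) * x $ j) *\<^sub>R F x"
    by (simp only: sum_diff1 finite UNIV_I if_True xx F'x[symmetric] euler) (simp add: algebra_simps del: of_nat_diff)
  finally show ?thesis .
qed

lemma C1_on_coord_scaleR:
  fixes F :: "real ^ 'm::finite \<Rightarrow> 'b::real_normed_vector"
  assumes "C1_on M F"
  shows "C1_on M (\<lambda>y. y $ i *\<^sub>R F y)"
  by (rule C1_on_scaleR[OF C1_on_bounded_linear[OF bounded_linear_vec_nth] assms])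

text \<open>On the boundary \<open>norm x = 1\<close> and \<open>x \<bullet> \<nu> x = 0\<close>
  reduce the summed flux densities to \<open>\<nu> x $ j\<close>. Integrability is recorded because
  the formula will be summed over \<open>j\<close>.\<close>

theorem sphere_divergence:
  fixes V :: "(real ^ 'm::finite) set" and F :: "real ^ 'm \<Rightarrow> 'b::euclidean_space"
  assumes \<mu>: "is_lebesgue_measure_on (CARD('m) - 1) (sphere 0 1) \<mu>"
    and \<sigma>: "is_lebesgue_measure_on (CARD('m) - 2) (sph_boundary V) \<sigma>"
    and V: "openin (top_of_set (sphere 0 1)) V" "C1_boundary V"
    and out: "\<And>x. x \<in> sph_boundary V \<Longrightarrow> outward_unit_normal V x (\<nu> x)"
    and M: "open M" "V \<union> sph_boundary V \<subseteq> M" and F: "C1_on M F"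
    and radial: "\<And>x. x \<in> V \<Longrightarrow> frechet_derivative F (at x) x = 0"
  shows "(LINT x:V|\<mu>. partial_diff j F x - (real (CARD('m) - 1) * x $ j) *\<^sub>R F x)
      = (LINT x:sph_boundary V|\<sigma>. \<nu> x $ j *\<^sub>R F x)"
    and "set_integrable \<mu> V (\<lambda>x. partial_diff j F x - (real (CARD('m) - 1) * x $ j) *\<^sub>R F x)"
    and "set_integrable \<sigma> (sph_boundary V) (\<lambda>x. \<nu> x $ j *\<^sub>R F x)"
proof -
  note cl = sph_closure[OF V(1)]
  have sets: "sets \<mu> = sets borel" "sets \<sigma> = sets borel"
    using \<mu> \<sigma> by (auto simp: is_lebesgue_measure_on_def)
  have MV: "x \<in> M" "norm x = 1" if "x \<in> V" for x using M(2) cl(3) that by auto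
  let ?G = "\<lambda>i y. y $ i *\<^sub>R F y"
  note G = C1_on_coord_scaleR[OF F]
  have intV: "set_integrable \<mu> V h" if "continuous_on (V \<union> sph_boundary V) h" for h :: "real ^ 'm \<Rightarrow> 'b"
    by (rule set_integrable_subset[OF set_integrable_continuous_compact[OF sphere_finite_measure[OF \<mu>] sets(1) cl(1) that]])
      (use cl(5) sets in auto)
  have intB: "set_integrable \<sigma> (sph_boundary V) h" if "continuous_on (sph_boundary V) h" for h :: "real ^ 'm \<Rightarrow> 'b"
    by (rule set_integrable_continuous_compact[OF sph_boundary_finite_measure[OF \<sigma> V] sets(2) cl(4) that])
  have \<nu>c: "continuous_on (sph_boundary V) \<nu>" by (rule continuous_on_outward_normal[OF V(2) out])
  have Fc: "continuous_on (sph_boundary V) F" "continuous_on (V \<union> sph_boundary V) F"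
    using continuous_on_subset[OF C1_on_continuous[OF F]] M(2) by auto
  show "set_integrable \<mu> V (\<lambda>x. partial_diff j F x - (real (CARD('m) - 1) * x $ j) *\<^sub>R F x)"
    unfolding partial_diff_def
    by (intro intV continuous_intros C1_on_continuous_frechet[OF F M(2)] Fc)
  show "set_integrable \<sigma> (sph_boundary V) (\<lambda>x. \<nu> x $ j *\<^sub>R F x)"
    by (intro intB continuous_intros \<nu>c Fc)
  have i1: "set_integrable \<mu> V (\<lambda>x. frechet_derivative (?G i) (at x) (rot_gen i j x))" for i
    by (intro intV C1_on_continuous_frechet[OF G M(2)] continuous_intros)
  have i2: "set_integrable \<sigma> (sph_boundary V) (\<lambda>x. (rot_gen i j x \<bullet> \<nu> x) *\<^sub>R ?G i x)" for i
    by (intro intB continuous_intros \<nu>c Fc)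
  have "(LINT x:V|\<mu>. partial_diff j F x - (real (CARD('m) - 1) * x $ j) *\<^sub>R F x)
      = (LINT x:V|\<mu>. \<Sum>i\<in>UNIV - {j}. frechet_derivative (?G i) (at x) (rot_gen i j x))"
    unfolding set_lebesgue_integral_def
  proof (intro Bochner_Integration.integral_cong refl)
    fix x
    show "indicator V x *\<^sub>R (partial_diff j F x - (real (CARD('m) - 1) * x $ j) *\<^sub>R F x)
      = indicator V x *\<^sub>R (\<Sum>i\<in>UNIV - {j}. frechet_derivative (?G i) (at x) (rot_gen i j x))"
    proof (cases "x \<in> V")
      case True
      have "frechet_derivative F (at x) x = 0 *\<^sub>R F x" using radial[OF True] by simp
      from rot_gen_sum[OF MV(2)[OF True] C1_on_has_derivative[OF F MV(1)[OF True]] this, of j]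
      show ?thesis by (simp add: partial_diff_def)
    qed simp
  qed
  also have "\<dots> = (\<Sum>i\<in>UNIV - {j}. LINT x:V|\<mu>. frechet_derivative (?G i) (at x) (rot_gen i j x))"
    by (rule set_integral_finite_sum(1)) (rule i1)
  also have "\<dots> = (\<Sum>i\<in>UNIV - {j}. LINT x:sph_boundary V|\<sigma>. (rot_gen i j x \<bullet> \<nu> x) *\<^sub>R ?G i x)"
    by (intro sum.cong refl rot_flux[OF \<mu> \<sigma> V out _ M G]) auto
  also have "\<dots> = (LINT x:sph_boundary V|\<sigma>. \<Sum>i\<in>UNIV - {j}. (rot_gen i j x \<bullet> \<nu> x) *\<^sub>R ?G i x)"
    by (rule set_integral_finite_sum(1)[symmetric]) (rule i2)
  also have "\<dots> = (LINT x:sph_boundary V|\<sigma>. \<nu> x $ j *\<^sub>R F x)"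
    unfolding set_lebesgue_integral_def
  proof (intro Bochner_Integration.integral_cong refl)
    fix x
    show "indicator (sph_boundary V) x *\<^sub>R (\<Sum>i\<in>UNIV - {j}. (rot_gen i j x \<bullet> \<nu> x) *\<^sub>R ?G i x)
      = indicator (sph_boundary V) x *\<^sub>R (\<nu> x $ j *\<^sub>R F x)"
    proof (cases "x \<in> sph_boundary V")
      case True
      have xx: "(\<Sum>i\<in>UNIV. x $ i * x $ i) = 1"
        using True cl(3) by (auto simp: norm_eq_1 inner_vec_def)
      have "x \<bullet> \<nu> x = 0"
        using out[OF True] tangent_vector_sphere_orthogonal by (auto simp: outward_unit_normal_def)
      then have x\<nu>: "(\<Sum>i\<in>UNIV. x $ i * \<nu> x $ i) = 0"
        by (simp add: inner_vec_def)
      have "(\<Sum>i\<in>UNIV - {j}. (rot_gen i j x \<bullet> \<nu> x) *\<^sub>R ?G i x)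
          = (\<Sum>i\<in>UNIV - {j}. (x $ i * x $ i) * \<nu> x $ j - x $ j * (x $ i * \<nu> x $ i)) *\<^sub>R F x"
        unfolding scaleR_sum_left
        by (intro sum.cong refl) (simp add: rot_gen_def inner_diff_left inner_axis' algebra_simps)
      also have "(\<Sum>i\<in>UNIV - {j}. (x $ i * x $ i) * \<nu> x $ j - x $ j * (x $ i * \<nu> x $ i))
          = (\<Sum>i\<in>UNIV - {j}. x $ i * x $ i) * \<nu> x $ j - x $ j * (\<Sum>i\<in>UNIV - {j}. x $ i * \<nu> x $ i)"
        by (simp only: sum_subtractf sum_distrib_left sum_distrib_right)
      also have "\<dots> = \<nu> x $ j"
        by (simp only: sum_diff1 finite UNIV_I if_True xx x\<nu>) (simp add: algebra_simps)
      finally show ?thesis by simp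
    qed simp
  qed
  finally show "(LINT x:V|\<mu>. partial_diff j F x - (real (CARD('m) - 1) * x $ j) *\<^sub>R F x)
      = (LINT x:sph_boundary V|\<sigma>. \<nu> x $ j *\<^sub>R F x)" .
qed

text \<open>Summing the rotation identity over \<open>j\<close> leaves the integral of the
  divergence, which is 0, minus \<open>c + CARD('m) - 1\<close> times that of the radial component.
  This takes the place of the divergence theorem in the unit ball, so no volume integral
  occurs.\<close>

lemma sphere_integral_solenoidal:
  fixes h :: "'m::finite \<Rightarrow> real ^ 'm \<Rightarrow> 'b::euclidean_space"
  assumes \<mu>: "is_lebesgue_measure_on (CARD('m) - 1) (sphere 0 1) \<mu>"
    and h: "\<And>j. C1_on UNIV (h j)"
    and euler: "\<And>j x. frechet_derivative (h j) (at x) x = c *\<^sub>R h j x"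
    and div: "\<And>x. (\<Sum>j\<in>UNIV. partial_diff j (h j) x) = 0" and c: "c + real (CARD('m) - 1) \<noteq> 0"
  shows "(LINT x:sphere 0 1|\<mu>. \<Sum>j\<in>UNIV. x $ j *\<^sub>R h j x) = 0"
proof -
  let ?S = "sphere 0 1 :: (real ^ 'm) set"
  have sets: "sets \<mu> = sets borel" using \<mu> by (auto simp: is_lebesgue_measure_on_def)
  let ?D = "\<lambda>i j x. frechet_derivative (\<lambda>y. y $ i *\<^sub>R h j y) (at x) (rot_gen i j x)"
  have z: "(LINT x:?S|\<mu>. ?D i j x) = 0" if "i \<noteq> j" for i j
  proof (rule integral_sphere_rot_gen[OF \<mu> that, where H = "\<lambda>y. y $ i *\<^sub>R h j y"])
    fix x :: "real ^ 'm"
    obtain h' where h': "\<And>y. y \<in> UNIV \<Longrightarrow> ((\<lambda>y. y $ i *\<^sub>R h j y) has_derivative blinfun_apply (h' y)) (at y)"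
      "continuous_on UNIV h'"
      "\<And>y. y \<in> UNIV \<Longrightarrow> frechet_derivative (\<lambda>y. y $ i *\<^sub>R h j y) (at y) = blinfun_apply (h' y)"
      by (rule C1_onE[OF C1_on_coord_scaleR[OF h[of j], of i]]) (rule that)
    show "\<exists>Y k k'. open Y \<and> x \<in> Y \<and> (\<forall>y\<in>Y. (k has_derivative blinfun_apply (k' y)) (at y)) \<and>
      continuous_on Y k' \<and> (\<forall>y\<in>Y \<inter> ?S. y $ i *\<^sub>R h j y = k y \<and> ?D i j y = k' y (rot_gen i j y))"
    proof (intro exI conjI ballI)
      show "x \<in> UNIV" ..
      fix y :: "real ^ 'm"
      show "((\<lambda>y. y $ i *\<^sub>R h j y) has_derivative blinfun_apply (h' y)) (at y)" by (rule h'(1)[OF UNIV_I])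
      show "y $ i *\<^sub>R h j y = y $ i *\<^sub>R h j y" ..
      show "?D i j y = h' y (rot_gen i j y)" by (simp only: h'(3)[OF UNIV_I])
    qed (rule open_UNIV h'(2))+
  qed
  have int: "set_integrable \<mu> ?S (?D i j)" for i j
    by (rule set_integrable_continuous_compact[OF sphere_finite_measure[OF \<mu>] sets compact_sphere])
      (intro C1_on_continuous_frechet[OF C1_on_coord_scaleR[OF h]] continuous_intros, auto)
  have "(LINT x:?S|\<mu>. \<Sum>j\<in>UNIV. \<Sum>i\<in>UNIV - {j}. ?D i j x) = (\<Sum>j\<in>UNIV. \<Sum>i\<in>UNIV - {j}. LINT x:?S|\<mu>. ?D i j x)"
    by (simp add: set_integral_finite_sum int)
  also have "\<dots> = 0" using z by (intro sum.neutral ballI) auto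
  finally have "(LINT x:?S|\<mu>. \<Sum>j\<in>UNIV. \<Sum>i\<in>UNIV - {j}. ?D i j x) = 0" .
  moreover have "(LINT x:?S|\<mu>. \<Sum>j\<in>UNIV. \<Sum>i\<in>UNIV - {j}. ?D i j x)
      = (LINT x:?S|\<mu>. - (c + real (CARD('m) - 1)) *\<^sub>R (\<Sum>j\<in>UNIV. x $ j *\<^sub>R h j x))"
    unfolding set_lebesgue_integral_def
  proof (intro Bochner_Integration.integral_cong refl)
    fix x
    show "indicator ?S x *\<^sub>R (\<Sum>j\<in>UNIV. \<Sum>i\<in>UNIV - {j}. ?D i j x)
      = indicator ?S x *\<^sub>R (- (c + real (CARD('m) - 1)) *\<^sub>R (\<Sum>j\<in>UNIV. x $ j *\<^sub>R h j x))"
    proof (cases "x \<in> ?S")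
      case True
      have "(\<Sum>i\<in>UNIV - {j}. ?D i j x) = partial_diff j (h j) x - ((c + real (CARD('m) - 1)) * x $ j) *\<^sub>R h j x" for j
        unfolding partial_diff_def
        by (rule rot_gen_sum[OF _ C1_on_has_derivative[OF h] euler]) (use True in auto)
      then have "(\<Sum>j\<in>UNIV. \<Sum>i\<in>UNIV - {j}. ?D i j x)
          = 0 - (\<Sum>j\<in>UNIV. ((c + real (CARD('m) - 1)) * x $ j) *\<^sub>R h j x)"
        by (simp only: sum_subtractf div)
      also have "\<dots> = - (c + real (CARD('m) - 1)) *\<^sub>R (\<Sum>j\<in>UNIV. x $ j *\<^sub>R h j x)"
        by (simp only: scaleR_sum_right scaleR_scaleR scaleR_minus_left mult_minus_left sum_negf diff_0)
      finally show ?thesis by simp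
    qed simp
  qed
  ultimately have "(- (c + real (CARD('m) - 1))) *\<^sub>R (LINT x:?S|\<mu>. \<Sum>j\<in>UNIV. x $ j *\<^sub>R h j x) = 0"
    by (simp only: set_integral_scaleR_right)
  then show ?thesis using c by simp
qed

section \<open>Homogeneous polynomials\<close>

text \<open>By induction over the construction of a polynomial. The symmetry of the second
  derivative is carried along: for a product, the two mixed terms change places.\<close>

lemma real_polynomial_function_derivatives:
  assumes "real_polynomial_function (f :: 'a::euclidean_space \<Rightarrow> real)"
  shows "\<exists>f' f''. (\<forall>u. (f has_derivative f' u) (at u)) \<and> (\<forall>u v. ((\<lambda>u. f' u v) has_derivative f'' u v) (at u)) \<and>
    (\<forall>u v w. f'' u v w = f'' u w v) \<and> (\<forall>v. real_polynomial_function (\<lambda>u. f' u v))"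
  using assms
proof induction
  case (linear f)
  then show ?case
    by (intro exI[of _ "\<lambda>_. f"] exI[of _ "\<lambda>_ _ _. 0"]) (auto intro: bounded_linear_imp_has_derivative)
next
  case (const c)
  show ?case
    by (intro exI[of _ "\<lambda>_ _. 0"] exI[of _ "\<lambda>_ _ _. 0"]) auto
next
  case (add f g)
  obtain f' f'' g' g'' where
    f: "\<And>u. (f has_derivative f' u) (at u)" "\<And>u v. ((\<lambda>u. f' u v) has_derivative f'' u v) (at u)"
      "\<And>u v w. f'' u v w = f'' u w v" "\<And>v. real_polynomial_function (\<lambda>u. f' u v)" and
    g: "\<And>u. (g has_derivative g' u) (at u)" "\<And>u v. ((\<lambda>u. g' u v) has_derivative g'' u v) (at u)"
      "\<And>u v w. g'' u v w = g'' u w v" "\<And>v. real_polynomial_function (\<lambda>u. g' u v)"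
    using add.IH by blast
  show ?case
  proof (intro exI conjI allI)
    show "((\<lambda>x. f x + g x) has_derivative (\<lambda>v. f' u v + g' u v)) (at u)" for u
      by (rule has_derivative_add[OF f(1) g(1)])
    show "((\<lambda>u. f' u v + g' u v) has_derivative (\<lambda>w. f'' u v w + g'' u v w)) (at u)" for u v
      by (rule has_derivative_add[OF f(2) g(2)])
    show "f'' u v w + g'' u v w = f'' u w v + g'' u w v" for u v w
      by (rule arg_cong2[where f = "(+)"], rule f(3), rule g(3))
    show "real_polynomial_function (\<lambda>u. f' u v + g' u v)" for v
      by (rule real_polynomial_function.intros(3)[OF f(4) g(4)])
  qed
next
  case (mult f g)
  obtain f' f'' g' g'' where
    f: "\<And>u. (f has_derivative f' u) (at u)" "\<And>u v. ((\<lambda>u. f' u v) has_derivative f'' u v) (at u)"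
      "\<And>u v w. f'' u v w = f'' u w v" "\<And>v. real_polynomial_function (\<lambda>u. f' u v)" and
    g: "\<And>u. (g has_derivative g' u) (at u)" "\<And>u v. ((\<lambda>u. g' u v) has_derivative g'' u v) (at u)"
      "\<And>u v w. g'' u v w = g'' u w v" "\<And>v. real_polynomial_function (\<lambda>u. g' u v)"
    using mult.IH by blast
  show ?case
  proof (intro exI conjI allI)
    show "((\<lambda>x. f x * g x) has_derivative (\<lambda>v. f u * g' u v + f' u v * g u)) (at u)" for u
      by (rule has_derivative_mult[OF f(1) g(1)])
    show "((\<lambda>u. f u * g' u v + f' u v * g u) has_derivative
        (\<lambda>w. (f u * g'' u v w + f' u w * g' u v) + (f' u v * g' u w + f'' u v w * g u))) (at u)" for u v
      by (rule has_derivative_add[OF has_derivative_mult[OF f(1) g(2)] has_derivative_mult[OF f(2) g(1)]])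
    show "(f u * g'' u v w + f' u w * g' u v) + (f' u v * g' u w + f'' u v w * g u)
        = (f u * g'' u w v + f' u v * g' u w) + (f' u w * g' u v + f'' u w v * g u)" for u v w
      using arg_cong[OF g(3)[of u v w], of "(*) (f u)"] arg_cong[OF f(3)[of u v w], of "\<lambda>x. x * g u"] by linarith
    show "real_polynomial_function (\<lambda>u. f u * g' u v + f' u v * g u)" for v
      using mult.hyps f(4) g(4) by (intro real_polynomial_function.intros(3) real_polynomial_function.intros(4))
  qed
qed

lemma polynomial_function_derivatives:
  fixes p :: "'a::euclidean_space \<Rightarrow> 'b::euclidean_space"
  assumes "polynomial_function p"
  obtains p' p'' where "\<And>u. (p has_derivative p' u) (at u)" "\<And>u v. ((\<lambda>u. p' u v) has_derivative p'' u v) (at u)"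
    "\<And>u v w. p'' u v w = p'' u w v" "\<And>v. polynomial_function (\<lambda>u. p' u v)"
proof -
  have comp: "\<forall>b. b \<in> Basis \<longrightarrow> real_polynomial_function (\<lambda>u. p u \<bullet> b)"
    using assms by (simp add: polynomial_function_iff_Basis_inner)
  define Q where "Q b f' f'' \<longleftrightarrow> (\<forall>u. ((\<lambda>u. p u \<bullet> b) has_derivative f' u) (at u)) \<and>
    (\<forall>u v. ((\<lambda>u. f' u v) has_derivative f'' u v) (at u)) \<and>
    (\<forall>u v w. f'' u v w = f'' u w v) \<and> (\<forall>v. real_polynomial_function (\<lambda>u. f' u v))"
    for b and f' :: "'a \<Rightarrow> 'a \<Rightarrow> real" and f'' :: "'a \<Rightarrow> 'a \<Rightarrow> 'a \<Rightarrow> real"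
  have "\<forall>b\<in>Basis. \<exists>f' f''. Q b f' f''"
    unfolding Q_def using comp by (intro ballI real_polynomial_function_derivatives) simp
  then obtain f' f'' where "\<And>b. b \<in> Basis \<Longrightarrow> Q b (f' b) (f'' b)" by metis
  then have f:
    "\<And>b u. b \<in> Basis \<Longrightarrow> ((\<lambda>u. p u \<bullet> b) has_derivative f' b u) (at u)"
    "\<And>b u v. b \<in> Basis \<Longrightarrow> ((\<lambda>u. f' b u v) has_derivative f'' b u v) (at u)"
    "\<And>b u v w. b \<in> Basis \<Longrightarrow> f'' b u v w = f'' b u w v"
    "\<And>b v. b \<in> Basis \<Longrightarrow> real_polynomial_function (\<lambda>u. f' b u v)"
    by (simp_all add: Q_def)
  show thesis
  proof
    have pe: "p = (\<lambda>u. \<Sum>b\<in>Basis. (p u \<bullet> b) *\<^sub>R b)" by (simp add: euclidean_representation)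
    show "(p has_derivative (\<lambda>v. \<Sum>b\<in>Basis. f' b u v *\<^sub>R b)) (at u)" for u
      by (subst pe) (intro has_derivative_sum has_derivative_scaleR_left f(1))
    show "((\<lambda>u. \<Sum>b\<in>Basis. f' b u v *\<^sub>R b) has_derivative (\<lambda>w. \<Sum>b\<in>Basis. f'' b u v w *\<^sub>R b)) (at u)" for u v
      by (intro has_derivative_sum has_derivative_scaleR_left f(2))
    show "(\<Sum>b\<in>Basis. f'' b u v w *\<^sub>R b) = (\<Sum>b\<in>Basis. f'' b u w v *\<^sub>R b)" for u v w
      by (intro sum.cong refl arg_cong2[where f = scaleR] f(3))
    show "polynomial_function (\<lambda>u. \<Sum>b\<in>Basis. f' b u v *\<^sub>R b)" for v
      using f(4) by (intro polynomial_function_sum polynomial_function_mult) (auto simp: real_polynomial_function_eq)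
  qed
qed

lemma polynomial_function_has_derivative:
  fixes p :: "'a::euclidean_space \<Rightarrow> 'b::euclidean_space"
  assumes "polynomial_function p"
  shows "(p has_derivative frechet_derivative p (at u)) (at u)"
  using polynomial_function_derivatives[OF assms] frechet_derivative_works differentiableI by metis

lemma polynomial_function_frechet:
  fixes p :: "'a::euclidean_space \<Rightarrow> 'b::euclidean_space"
  assumes "polynomial_function p"
  shows "polynomial_function (\<lambda>u. frechet_derivative p (at u) v)"
    and "frechet_derivative (\<lambda>u. frechet_derivative p (at u) v) (at u) w
      = frechet_derivative (\<lambda>u. frechet_derivative p (at u) w) (at u) v"
proof -
  obtain p' p'' where p: "\<And>u. (p has_derivative p' u) (at u)" "\<And>u v. ((\<lambda>u. p' u v) has_derivative p'' u v) (at u)"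
    "\<And>u v w. p'' u v w = p'' u w v" "\<And>v. polynomial_function (\<lambda>u. p' u v)"
    using polynomial_function_derivatives[OF assms] by blast
  have 1: "frechet_derivative p (at u) = p' u" for u
    using frechet_derivative_at[OF p(1)] by simp
  have 2: "frechet_derivative (\<lambda>u. p' u v) (at u) = p'' u v" for u v
    using frechet_derivative_at[OF p(2)] by simp
  show "polynomial_function (\<lambda>u. frechet_derivative p (at u) v)" by (simp add: 1 p(4))
  show "frechet_derivative (\<lambda>u. frechet_derivative p (at u) v) (at u) w
      = frechet_derivative (\<lambda>u. frechet_derivative p (at u) w) (at u) v"
    unfolding 1 2 by (rule p(3))
qed

lemma polynomial_function_C1:
  fixes p :: "'a::euclidean_space \<Rightarrow> 'b::euclidean_space"
  assumes "polynomial_function p"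
  shows "C1_on S p"
proof (rule C1_onI)
  show "(p has_derivative frechet_derivative p (at x)) (at x)" for x
    by (rule polynomial_function_has_derivative[OF assms])
  show "continuous_on S (\<lambda>x. frechet_derivative p (at x) v)" for v
    by (rule continuous_on_polymonial_function[OF polynomial_function_frechet(1)[OF assms]])
qed

lemma polynomial_partial_diff:
  fixes p :: "real ^ 'n::finite \<Rightarrow> 'b::euclidean_space"
  assumes "polynomial_function p"
  shows "polynomial_function (partial_diff j p)"
    and "partial_diff i (partial_diff j p) u = partial_diff j (partial_diff i p) u"
  using polynomial_function_frechet[OF assms] by (simp_all add: partial_diff_def[abs_def])

section \<open>Homogeneous components of polynomials\<close>

definition multi_exponents :: "nat \<Rightarrow> ('n::finite \<Rightarrow> nat) set" where
  "multi_exponents d = {\<alpha>. (\<Sum>j\<in>UNIV. \<alpha> j) = d}"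

definition multi_monom :: "('n::finite \<Rightarrow> nat) \<Rightarrow> real ^ 'n \<Rightarrow> real" where
  "multi_monom \<alpha> u = (\<Prod>j\<in>UNIV. (u $ j) ^ \<alpha> j)"

text \<open>\<open>real_polynomial_function\<close> provides no coefficients; this predicate places
  a function in an explicit space of finite dimension.\<close>

definition hom_span :: "nat \<Rightarrow> (real ^ 'n::finite \<Rightarrow> real) \<Rightarrow> bool" where
  "hom_span d f \<longleftrightarrow> (\<exists>c. \<forall>u. f u = (\<Sum>\<alpha>\<in>multi_exponents d. c \<alpha> * multi_monom \<alpha> u))"

lemma finite_multi_exponents: "finite (multi_exponents d :: ('n::finite \<Rightarrow> nat) set)"
proof (rule finite_subset)
  show "multi_exponents d \<subseteq> (\<Pi>\<^sub>E j\<in>(UNIV :: 'n set). {..d})"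
    by (auto simp: multi_exponents_def PiE_def intro!: member_le_sum)
  show "finite (\<Pi>\<^sub>E j\<in>(UNIV :: 'n set). {..d})" by (rule finite_PiE) auto
qed

lemma hom_span_add: "hom_span d f \<Longrightarrow> hom_span d g \<Longrightarrow> hom_span d (\<lambda>u. f u + g u)"
  unfolding hom_span_def
proof (elim exE)
  fix c c' assume "\<forall>u. f u = (\<Sum>\<alpha>\<in>multi_exponents d. c \<alpha> * multi_monom \<alpha> u)"
    "\<forall>u. g u = (\<Sum>\<alpha>\<in>multi_exponents d. c' \<alpha> * multi_monom \<alpha> u)"
  then show "\<exists>c. \<forall>u. f u + g u = (\<Sum>\<alpha>\<in>multi_exponents d. c \<alpha> * multi_monom \<alpha> u)"
    by (intro exI[of _ "\<lambda>\<alpha>. c \<alpha> + c' \<alpha>"]) (simp add: distrib_right sum.distrib)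
qed

lemma hom_span_monom:
  assumes "\<alpha> \<in> multi_exponents d"
  shows "hom_span d (\<lambda>u. a * multi_monom \<alpha> u)"
  unfolding hom_span_def
proof (intro exI allI)
  fix u
  show "a * multi_monom \<alpha> u = (\<Sum>\<beta>\<in>multi_exponents d. (if \<beta> = \<alpha> then a else 0) * multi_monom \<beta> u)"
    using assms by (simp add: if_distrib[of "\<lambda>x. x * _"] sum.delta[OF finite_multi_exponents] cong: if_cong)
qed

lemma hom_span_zero: "hom_span d (\<lambda>_. 0)"
  unfolding hom_span_def by (intro exI[of _ "\<lambda>_. 0"]) simp

lemma hom_span_sum:
  "finite I \<Longrightarrow> (\<And>i. i \<in> I \<Longrightarrow> hom_span d (f i)) \<Longrightarrow> hom_span d (\<lambda>u. \<Sum>i\<in>I. f i u)"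
  by (induction I rule: finite_induct) (auto intro: hom_span_zero hom_span_add)

lemma hom_span_mult:
  assumes "hom_span d f" "hom_span e g"
  shows "hom_span (d + e) (\<lambda>u. f u * g u)"
proof -
  obtain c c' where c: "\<And>u. f u = (\<Sum>\<alpha>\<in>multi_exponents d. c \<alpha> * multi_monom \<alpha> u)"
    "\<And>u. g u = (\<Sum>\<alpha>\<in>multi_exponents e. c' \<alpha> * multi_monom \<alpha> u)"
    using assms by (auto simp: hom_span_def)
  have "(\<lambda>u. f u * g u) = (\<lambda>u. \<Sum>\<alpha>\<in>multi_exponents d. \<Sum>\<beta>\<in>multi_exponents e.
      (c \<alpha> * c' \<beta>) * multi_monom (\<lambda>j. \<alpha> j + \<beta> j) u)"
    unfolding c sum_product by (simp add: multi_monom_def power_add prod.distrib mult_ac)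
  moreover have "hom_span (d + e) \<dots>"
    by (intro hom_span_sum finite_multi_exponents hom_span_monom)
      (auto simp: multi_exponents_def sum.distrib)
  ultimately show ?thesis by simp
qed

lemma hom_span_homogeneous:
  assumes "hom_span d f"
  shows "f (t *\<^sub>R u) = t ^ d * f u"
proof -
  have "multi_monom \<alpha> (t *\<^sub>R u) = t ^ d * multi_monom \<alpha> u" if "\<alpha> \<in> multi_exponents d" for \<alpha>
    using that by (auto simp: multi_monom_def multi_exponents_def power_mult_distrib prod.distrib power_sum)
  moreover obtain c where "\<And>u. f u = (\<Sum>\<alpha>\<in>multi_exponents d. c \<alpha> * multi_monom \<alpha> u)"
    using assms by (auto simp: hom_span_def)
  ultimately show ?thesis by (simp add: sum_distrib_left mult_ac)
qed

text \<open>Such decompositions are stable under sums and products, so the induction over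
  polynomials applies; the product of components of degrees \<open>d\<close> and \<open>e\<close> is
  homogeneous of degree \<open>d + e\<close>.\<close>

lemma real_polynomial_hom_decomposition:
  assumes "real_polynomial_function (f :: real ^ 'n::finite \<Rightarrow> real)"
  shows "\<exists>F N. (\<forall>d. hom_span d (F d)) \<and> (\<forall>u. f u = (\<Sum>d\<le>N. F d u))"
proof -
  define dec where "dec f \<longleftrightarrow> (\<exists>F N. (\<forall>d. hom_span d (F d)) \<and> (\<forall>u. f u = (\<Sum>d\<le>N. F d u)))"
    for f :: "real ^ 'n \<Rightarrow> real"
  have dec_hom: "dec f" if "hom_span d f" for d f
    unfolding dec_def
    by (intro exI[of _ "\<lambda>e. if e = d then f else (\<lambda>_. 0)"] exI[of _ d])
      (auto simp: that hom_span_zero if_distrib[of "\<lambda>g. g _"] cong: if_cong)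
  have dec_add: "dec (\<lambda>u. f u + g u)" if fg: "dec f" "dec g" for f g
  proof -
    obtain F N where F: "\<And>d. hom_span d (F d)" "\<And>u. f u = (\<Sum>d\<le>N. F d u)"
      using fg(1) by (auto simp: dec_def)
    obtain G M where G: "\<And>d. hom_span d (G d)" "\<And>u. g u = (\<Sum>d\<le>M. G d u)"
      using fg(2) by (auto simp: dec_def)
    let ?H = "\<lambda>d u. (if d \<le> N then F d u else 0) + (if d \<le> M then G d u else 0)"
    have "hom_span d (?H d)" for d
      by (intro hom_span_add) (cases "d \<le> N"; cases "d \<le> M"; simp add: F G hom_span_zero)+
    moreover have "f u + g u = (\<Sum>d\<le>max N M. ?H d u)" for u
    proof -
      have "(\<Sum>d\<le>max N M. if d \<le> N then F d u else 0) = f u"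
        unfolding F(2) by (rule sum.mono_neutral_cong_right) auto
      moreover have "(\<Sum>d\<le>max N M. if d \<le> M then G d u else 0) = g u"
        unfolding G(2) by (rule sum.mono_neutral_cong_right) auto
      ultimately show ?thesis by (simp only: sum.distrib)
    qed
    ultimately show ?thesis unfolding dec_def by (intro exI[of _ ?H] exI[of _ "max N M"] conjI allI)
  qed
  have dec_sum: "dec (\<lambda>u. \<Sum>i\<in>I. f i u)" if "finite I" "\<And>i. i \<in> I \<Longrightarrow> dec (f i)" for I :: "nat set" and f
    using that by (induction I rule: finite_induct) (auto intro: dec_add dec_hom[OF hom_span_zero])
  from assms have "dec f"
  proof induction
    case (linear f)
    have "f = (\<lambda>u. \<Sum>j\<in>UNIV. f (axis j 1) * multi_monom (\<lambda>i. if i = j then 1 else 0) u)"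
    proof
      fix u :: "real ^ 'n"
      have "f u = (\<Sum>j\<in>UNIV. u $ j * f (axis j 1))"
        using linear_axis_sum[OF bounded_linear.linear[OF linear], of u] by simp
      also have "\<dots> = (\<Sum>j\<in>UNIV. f (axis j 1) * multi_monom (\<lambda>i. if i = j then 1 else 0) u)"
        by (intro sum.cong refl) (simp add: multi_monom_def if_distrib[of "(^) _"] cong: if_cong)
      finally show "f u = (\<Sum>j\<in>UNIV. f (axis j 1) * multi_monom (\<lambda>i. if i = j then 1 else 0) u)" .
    qed
    moreover have "hom_span 1 \<dots>"
      by (intro hom_span_sum hom_span_monom) (auto simp: multi_exponents_def)
    ultimately show ?case using dec_hom by metis
  next
    case (const c)
    have "hom_span 0 (\<lambda>u. c * multi_monom (\<lambda>_. 0) u)"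
      by (rule hom_span_monom) (simp add: multi_exponents_def)
    then show ?case using dec_hom[of 0 "\<lambda>_. c"] by (simp add: multi_monom_def)
  next
    case (add f g)
    then show ?case by (intro dec_add)
  next
    case (mult f g)
    obtain F N where F: "\<And>d. hom_span d (F d)" "\<And>u. f u = (\<Sum>d\<le>N. F d u)"
      using mult.IH(1) by (auto simp: dec_def)
    obtain G M where G: "\<And>d. hom_span d (G d)" "\<And>u. g u = (\<Sum>d\<le>M. G d u)"
      using mult.IH(2) by (auto simp: dec_def)
    have "dec (\<lambda>u. \<Sum>d\<le>N. \<Sum>e\<le>M. F d u * G e u)"
      by (intro dec_sum dec_hom[OF hom_span_mult[OF F(1) G(1)]]) auto
    then show ?case by (simp add: F(2) G(2) sum_product)
  qed
  then show ?thesis by (simp add: dec_def)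
qed

text \<open>For fixed \<open>u\<close>, compare the coefficients of the powers of \<open>t\<close>
  in \<open>f (t *\<^sub>R u)\<close>: only the component of degree \<open>k\<close>
  survives.\<close>

lemma homogeneous_polynomial_hom_span:
  assumes f: "real_polynomial_function (f :: real ^ 'n::finite \<Rightarrow> real)" and hom: "\<And>t u. f (t *\<^sub>R u) = t ^ k * f u"
  shows "hom_span k f"
proof -
  obtain F N where F: "\<And>d. hom_span d (F d)" "\<And>u. f u = (\<Sum>d\<le>N. F d u)"
    using real_polynomial_hom_decomposition[OF f] by blast
  \<comment> \<open>Components above \<open>N\<close> are set to 0, since \<open>k\<close> may
    exceed \<open>N\<close>.\<close>
  define F' where "F' d u = (if d \<le> N then F d u else 0)" for d u
  have "f u = F' k u" for u
  proof -
    have "(\<Sum>d\<le>max N k. (F' d u - (if d = k then f u else 0)) * t ^ d) = 0" for t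
    proof -
      have "(\<Sum>d\<le>max N k. F' d u * t ^ d) = (\<Sum>d\<le>N. F d (t *\<^sub>R u))"
        unfolding hom_span_homogeneous[OF F(1)]
        by (rule sum.mono_neutral_cong_right) (auto simp: F'_def)
      also have "\<dots> = t ^ k * f u" by (simp only: F(2)[symmetric] hom)
      finally show ?thesis
        by (simp add: left_diff_distrib sum_subtractf if_distrib[of "\<lambda>x. x * _"] cong: if_cong)
    qed
    then have "\<forall>d\<le>max N k. F' d u - (if d = k then f u else 0) = 0"
      using polyfun_eq_0[of "\<lambda>d. F' d u - (if d = k then f u else 0)" "max N k"] by blast
    from this[rule_format, of k] show ?thesis by simp
  qed
  then have "f = (if k \<le> N then F k else (\<lambda>_. 0))" by (auto simp: F'_def)
  then show ?thesis by (auto simp: F(1) hom_span_zero)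
qed

text \<open>
  Lagrange interpolation for an arbitrary finite family of functions: a new function is taken into
  account by adding a node at which its interpolation error does not vanish.
\<close>

lemma finite_span_interpolation:
  assumes "finite I" and "\<And>i. i \<in> I \<Longrightarrow> real_polynomial_function (e i :: 'a::real_normed_vector \<Rightarrow> real)"
  shows "\<exists>(J :: nat set) a l. finite J \<and> (\<forall>j\<in>J. real_polynomial_function (l j)) \<and>
    (\<forall>i\<in>I. \<forall>u. e i u = (\<Sum>j\<in>J. l j u * e i (a j)))"
  using assms
proof (induction I rule: finite_induct)
  case empty
  show ?case by (intro exI[of _ "{}"]) auto
next
  case (insert i I)
  obtain J :: "nat set" and a l where J: "finite J" "\<And>j. j \<in> J \<Longrightarrow> real_polynomial_function (l j)"
    and eq: "\<And>i u. i \<in> I \<Longrightarrow> e i u = (\<Sum>j\<in>J. l j u * e i (a j))"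
  proof -
    have "\<exists>(J :: nat set) a l. finite J \<and> (\<forall>j\<in>J. real_polynomial_function (l j)) \<and>
        (\<forall>i\<in>I. \<forall>u. e i u = (\<Sum>j\<in>J. l j u * e i (a j)))"
      by (rule insert.IH) (simp add: insert.prems)
    then show thesis using that by blast
  qed
  define r where "r u = e i u - (\<Sum>j\<in>J. l j u * e i (a j))" for u
  have rp: "real_polynomial_function r"
    unfolding r_def using insert.prems J
    by (intro real_polynomial_function_diff real_polynomial_function_sum real_polynomial_function.intros(4)) auto
  show ?case
  proof (cases "\<forall>u. r u = 0")
    case True
    then have "e i u = (\<Sum>j\<in>J. l j u * e i (a j))" for u
      using spec[OF True, of u] unfolding r_def by linarith
    then show ?thesis using J eq by (intro exI[of _ J] exI[of _ a] exI[of _ l] conjI ballI allI) (blast+)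
  next
    case False
    then obtain u0 where u0: "r u0 \<noteq> 0" by blast
    obtain n where n: "n \<notin> J" using J(1) ex_new_if_finite infinite_UNIV_nat by blast
    \<comment> \<open>\<open>s\<close> is the error of the old interpolation, normalized to 1 at the
      new node \<open>u0\<close>. With weight \<open>s\<close> at \<open>u0\<close> and the old
      weights corrected, the new function is reproduced exactly; an old function changes by
      \<open>s\<close> times its error at \<open>u0\<close>, which is 0.\<close>
    define s where "s u = r u / r u0" for u
    define l' where "l' j u = (if j = n then s u else l j u - s u * l j u0)" for j u
    define a' where "a' = a(n := u0)"
    have key: "(\<Sum>j\<in>insert n J. l' j u * g (a' j))
        = s u * (g u0 - (\<Sum>j\<in>J. l j u0 * g (a j))) + (\<Sum>j\<in>J. l j u * g (a j))" for g u
    proof -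
      have "(\<Sum>j\<in>J. l' j u * g (a' j)) = (\<Sum>j\<in>J. l j u * g (a j) - s u * (l j u0 * g (a j)))"
        by (rule sum.cong[OF refl]) (use n in \<open>auto simp: l'_def a'_def algebra_simps\<close>)
      then show ?thesis
        using n J(1) by (simp add: l'_def a'_def sum_subtractf sum_distrib_left[symmetric] algebra_simps)
    qed
    have "e i' u = (\<Sum>j\<in>insert n J. l' j u * e i' (a' j))" if "i' \<in> insert i I" for i' u
    proof (cases "i' \<in> I")
      case True
      then show ?thesis unfolding key using eq[OF True, of u0] eq[OF True, of u] by simp
    next
      case False
      then have "i' = i" using that by blast
      then show ?thesis unfolding key using u0 by (simp add: s_def r_def[symmetric]) (simp add: r_def)
    qed
    moreover have "real_polynomial_function (l' j)" if "j \<in> insert n J" for j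
    proof -
      have sp: "real_polynomial_function s"
        unfolding s_def by (rule real_polynomial_function_divide[OF rp])
      show ?thesis
      proof (cases "j = n")
        case True
        then have "l' j = s" by (simp add: l'_def fun_eq_iff)
        then show ?thesis using sp by simp
      next
        case False
        then have "real_polynomial_function (\<lambda>u. l j u - s u * l j u0)"
          using J(2)[of j] that sp
          by (intro real_polynomial_function_diff real_polynomial_function.intros(4) real_polynomial_function.intros(2)) auto
        moreover have "l' j = (\<lambda>u. l j u - s u * l j u0)" using False by (simp add: l'_def fun_eq_iff)
        ultimately show ?thesis by simp
      qed
    qed
    ultimately show ?thesis using J(1)
      by (intro exI[of _ "insert n J"] exI[of _ a'] exI[of _ l'] conjI ballI allI) (blast+)
  qed
qed

text \<open>Nodes and weights depend on \<open>k\<close> but not on the polynomial. A family of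
  polynomials with a parameter is therefore encoded by finitely many functions of the parameter, its
  values at the nodes.\<close>

lemma hom_polys_interpolation:
  "\<exists>(J :: nat set) a l. finite J \<and> (\<forall>j\<in>J. real_polynomial_function (l j)) \<and>
    (\<forall>p\<in>hom_polys k. \<forall>u :: real ^ 'n::finite. p u = (\<Sum>j\<in>J. l j u *\<^sub>R (p (a j) :: 'b::euclidean_space)))"
proof -
  have "real_polynomial_function (multi_monom \<alpha> :: real ^ 'n \<Rightarrow> real)" for \<alpha>
    unfolding multi_monom_def[abs_def]
    by (intro real_polynomial_function_prod real_polynomial_function_power real_polynomial_function.intros(1) bounded_linear_vec_nth) auto
  from finite_span_interpolation[where e = multi_monom and I = "multi_exponents (nat k)", OF finite_multi_exponents this]
  obtain J :: "nat set" and a l where Jal: "finite J \<and> (\<forall>j\<in>J. real_polynomial_function (l j)) \<and>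
    (\<forall>\<alpha>\<in>multi_exponents (nat k). \<forall>u. multi_monom \<alpha> u = (\<Sum>j\<in>J. l j u * multi_monom \<alpha> (a j :: real ^ 'n)))"
    by (elim exE)
  note J = conjunct1[OF Jal] conjunct1[OF conjunct2[OF Jal]]
    and eq = conjunct2[OF conjunct2[OF Jal], rule_format]
  have "p u = (\<Sum>j\<in>J. l j u *\<^sub>R p (a j))" if p: "p \<in> hom_polys k" for p :: "real ^ 'n \<Rightarrow> 'b" and u
  proof (cases "k < 0")
    case True
    then have "p = (\<lambda>_. 0)" using p by (simp add: hom_polys_def)
    then show ?thesis by simp
  next
    case False
    have comp: "p u \<bullet> b = (\<Sum>j\<in>J. l j u * (p (a j) \<bullet> b))" if b: "b \<in> Basis" for b
    proof -
      have "hom_span (nat k) (\<lambda>u. p u \<bullet> b)"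
        using p False b by (intro homogeneous_polynomial_hom_span) (auto simp: hom_polys_def polynomial_function_iff_Basis_inner)
      then obtain c where c: "\<And>u. p u \<bullet> b = (\<Sum>\<alpha>\<in>multi_exponents (nat k). c \<alpha> * multi_monom \<alpha> u)"
        by (auto simp: hom_span_def)
      have "p u \<bullet> b = (\<Sum>\<alpha>\<in>multi_exponents (nat k). c \<alpha> * (\<Sum>j\<in>J. l j u * multi_monom \<alpha> (a j)))"
        unfolding c by (intro sum.cong refl) (simp only: eq[symmetric])
      also have "\<dots> = (\<Sum>j\<in>J. l j u * (p (a j) \<bullet> b))"
        unfolding c by (simp add: sum_distrib_left sum.swap[of _ J] mult_ac)
      finally show ?thesis .
    qed
    show ?thesis
      by (rule euclidean_eqI) (simp only: inner_sum_left inner_scaleR_left comp[symmetric])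
  qed
  then show ?thesis
    by (intro exI[of _ J] exI[of _ a] exI[of _ l] conjI J ballI allI)
qed

section \<open>The Fischer decomposition\<close>

interpretation cm: bounded_bilinear "cmult :: 'i::{finite,linorder} clifford \<Rightarrow> 'i clifford \<Rightarrow> 'i clifford"
  using bilinear_cmult bilinear_conv_bounded_bilinear by blast

lemma partial_diff_eq: "(p has_derivative p') (at u) \<Longrightarrow> partial_diff j p u = p' (axis j 1)"
  unfolding partial_diff_def using frechet_derivative_at by metis

lemma polynomial_function_linear_image:
  assumes "polynomial_function p" "bounded_linear l"
  shows "polynomial_function (\<lambda>u. l (p u))"
  unfolding polynomial_function_def
proof (intro allI impI)
  fix f :: "'c \<Rightarrow> real" assume "bounded_linear f"
  then have "bounded_linear (f \<circ> l)" using assms(2) by (simp add: bounded_linear_compose o_def)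
  then have "real_polynomial_function ((f \<circ> l) \<circ> p)" using assms(1) by (auto simp: polynomial_function_def)
  then show "real_polynomial_function (f \<circ> (\<lambda>u. l (p u)))" by (simp add: o_def)
qed

lemma partial_diff_linear_image:
  fixes p :: "real ^ 'n::finite \<Rightarrow> 'b::euclidean_space"
  assumes "polynomial_function p" "bounded_linear l"
  shows "partial_diff j (\<lambda>u. l (p u)) u = l (partial_diff j p u)"
  using partial_diff_eq[OF bounded_linear.has_derivative[OF assms(2) polynomial_function_has_derivative[OF assms(1)]]]
  by (simp add: partial_diff_def)

lemma hom_polys_zero: "(\<lambda>_. 0) \<in> hom_polys k"
  by (simp add: hom_polys_def)

lemma hom_polys_add: "p \<in> hom_polys k \<Longrightarrow> q \<in> hom_polys k \<Longrightarrow> (\<lambda>u. p u + q u) \<in> hom_polys k"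
  by (auto simp: hom_polys_def scaleR_add_right split: if_splits)

lemma hom_polys_linear_image:
  assumes "p \<in> hom_polys k" "bounded_linear l"
  shows "(\<lambda>u. l (p u)) \<in> hom_polys k"
  using assms polynomial_function_linear_image[OF _ assms(2)]
  by (auto simp: hom_polys_def linear_scale[OF bounded_linear.linear[OF assms(2)]] linear_0[OF bounded_linear.linear[OF assms(2)]] split: if_splits)

lemma hom_polys_sum:
  "(\<And>i. i \<in> I \<Longrightarrow> p i \<in> hom_polys k) \<Longrightarrow> (\<lambda>u. \<Sum>i\<in>I. p i u) \<in> hom_polys k"
  by (induction I rule: infinite_finite_induct) (auto intro: hom_polys_zero hom_polys_add)

lemma hom_polys_polynomial: "p \<in> hom_polys k \<Longrightarrow> polynomial_function p"
  by (auto simp: hom_polys_def split: if_splits)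

text \<open>Differentiate \<open>p (t *\<^sub>R u) = t ^ nat k *\<^sub>R p u\<close> at
  \<open>t = 1\<close>. For negative \<open>k\<close> both sides are 0.\<close>

lemma hom_polys_euler:
  fixes p :: "real ^ 'n::finite \<Rightarrow> 'b::euclidean_space"
  assumes "p \<in> hom_polys k"
  shows "frechet_derivative p (at u) u = real (nat k) *\<^sub>R p u"
    and "(\<Sum>j\<in>UNIV. u $ j *\<^sub>R partial_diff j p u) = real (nat k) *\<^sub>R p u"
proof -
  have d: "(p has_derivative frechet_derivative p (at u)) (at u)" for u
    by (rule polynomial_function_has_derivative[OF hom_polys_polynomial[OF assms]])
  have lin: "linear (frechet_derivative p (at u))" by (rule has_derivative_linear[OF d])
  have hom: "p (t *\<^sub>R u) = t ^ nat k *\<^sub>R p u" for t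
    using assms by (auto simp: hom_polys_def split: if_splits)
  have "((\<lambda>t. p (t *\<^sub>R u)) has_derivative (\<lambda>s. frechet_derivative p (at u) (s *\<^sub>R u))) (at 1)"
    by (rule has_derivative_compose[where f = "\<lambda>t. t *\<^sub>R u"]) (use d[of u] in \<open>auto intro!: derivative_eq_intros\<close>)
  moreover have "((\<lambda>t. t ^ nat k *\<^sub>R p u) has_derivative (\<lambda>s. (s * real (nat k)) *\<^sub>R p u)) (at (1::real))"
    by (auto intro!: derivative_eq_intros)
  ultimately have "(\<lambda>s. frechet_derivative p (at u) (s *\<^sub>R u)) = (\<lambda>s. (s * real (nat k)) *\<^sub>R p u)"
    unfolding hom by (rule has_derivative_unique)
  from fun_cong[OF this, of 1] show 1: "frechet_derivative p (at u) u = real (nat k) *\<^sub>R p u" by simp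
  have "frechet_derivative p (at u) u = (\<Sum>j\<in>UNIV. u $ j *\<^sub>R partial_diff j p u)"
    unfolding partial_diff_def by (rule linear_axis_sum[OF lin])
  then show "(\<Sum>j\<in>UNIV. u $ j *\<^sub>R partial_diff j p u) = real (nat k) *\<^sub>R p u" using 1 by simp
qed

text \<open>The chain rule gives homogeneity after division by \<open>t\<close>, and the case
  \<open>t = 0\<close> follows by continuity. For \<open>k \<le> 0\<close> the polynomial is
  constant, so its derivative is the zero function, as membership in
  \<open>hom_polys (k - 1)\<close> demands.\<close>

lemma hom_polys_partial_diff:
  fixes p :: "real ^ 'n::finite \<Rightarrow> 'b::euclidean_space"
  assumes p: "p \<in> hom_polys k"
  shows "partial_diff j p \<in> hom_polys (k - 1)"
proof (cases "k \<le> 0")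
  case True
  have "p u = p 0" for u
  proof (cases "k < 0")
    case False
    then have "nat k = 0" using True by simp
    moreover have "p (0 *\<^sub>R u) = 0 ^ nat k *\<^sub>R p u"
      using p False by (auto simp: hom_polys_def simp del: scaleR_zero_left)
    ultimately show ?thesis by simp
  qed (use p in \<open>simp add: hom_polys_def\<close>)
  then have "p = (\<lambda>_. p 0)" by auto
  then have "(p has_derivative (\<lambda>_. 0)) (at u)" for u by (metis has_derivative_const)
  then have "partial_diff j p = (\<lambda>_. 0)" using partial_diff_eq by fastforce
  then show ?thesis by (simp add: hom_polys_zero)
next
  case False
  then have k: "k > 0" by simp
  then obtain m where m: "nat k = Suc m" by (metis Suc_nat_eq_nat_zadd1 gr0_conv_Suc zero_less_nat_eq)
  then have km: "nat (k - 1) = m" by linarith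
  have pp: "polynomial_function p" by (rule hom_polys_polynomial[OF p])
  have d: "(p has_derivative frechet_derivative p (at u)) (at u)" for u
    by (rule polynomial_function_has_derivative[OF pp])
  have hom: "p (t *\<^sub>R u) = t ^ nat k *\<^sub>R p u" for t u
    using p k by (auto simp: hom_polys_def)
  have lin: "linear (frechet_derivative p (at u))" for u by (rule has_derivative_linear[OF d])
  have nz: "partial_diff j p (t *\<^sub>R u) = t ^ m *\<^sub>R partial_diff j p u" if t: "t \<noteq> 0" for t u
  proof -
    have "((\<lambda>u. p (t *\<^sub>R u)) has_derivative (\<lambda>v. frechet_derivative p (at (t *\<^sub>R u)) (t *\<^sub>R v))) (at u)"
      by (rule has_derivative_compose[where f = "\<lambda>u. t *\<^sub>R u"]) (use d[of "t *\<^sub>R u"] in \<open>auto intro!: derivative_eq_intros\<close>)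
    moreover have "((\<lambda>u. t ^ nat k *\<^sub>R p u) has_derivative (\<lambda>v. t ^ nat k *\<^sub>R frechet_derivative p (at u) v)) (at u)"
      by (rule has_derivative_scaleR_right[OF d])
    ultimately have "(\<lambda>v. frechet_derivative p (at (t *\<^sub>R u)) (t *\<^sub>R v)) = (\<lambda>v. t ^ nat k *\<^sub>R frechet_derivative p (at u) v)"
      unfolding hom by (rule has_derivative_unique)
    from fun_cong[OF this, of "axis j 1"]
    have "t *\<^sub>R partial_diff j p (t *\<^sub>R u) = t *\<^sub>R (t ^ m *\<^sub>R partial_diff j p u)"
      by (simp add: partial_diff_def linear_scale[OF lin] m)
    then show ?thesis using t unfolding scaleR_cancel_left by simp
  qed
  have pc: "continuous_on UNIV (partial_diff j p)"
    by (rule continuous_on_polymonial_function[OF polynomial_partial_diff(1)[OF pp]])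
  have "partial_diff j p (t *\<^sub>R u) = t ^ m *\<^sub>R partial_diff j p u" for t u
  proof (cases "t = 0")
    case True
    have lim0: "(\<lambda>i. 1 / real (Suc i)) \<longlonglongrightarrow> 0" by (rule LIMSEQ_Suc[OF lim_const_over_n])
    then have "(\<lambda>i. (1 / real (Suc i)) *\<^sub>R u) \<longlonglongrightarrow> 0 *\<^sub>R u" by (intro tendsto_intros)
    then have "(\<lambda>i. partial_diff j p ((1 / real (Suc i)) *\<^sub>R u)) \<longlonglongrightarrow> partial_diff j p (0 *\<^sub>R u)"
      by (rule continuous_on_tendsto_compose[OF pc]) auto
    moreover have "(\<lambda>i. partial_diff j p ((1 / real (Suc i)) *\<^sub>R u)) = (\<lambda>i. (1 / real (Suc i)) ^ m *\<^sub>R partial_diff j p u)"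
      by (intro ext nz) simp
    moreover have "(\<lambda>i. (1 / real (Suc i)) ^ m *\<^sub>R partial_diff j p u) \<longlonglongrightarrow> 0 ^ m *\<^sub>R partial_diff j p u"
      by (intro tendsto_intros lim0)
    ultimately show ?thesis using True LIMSEQ_unique by metis
  qed (rule nz)
  then show ?thesis using k km polynomial_partial_diff(1)[OF pp] by (auto simp: hom_polys_def)
qed

section \<open>The Clifford relations and the Dirac operator in u\<close>

lemma gen_mult_self: "gen i \<odot> (gen i \<odot> a) = - a"
proof -
  have "2 *\<^sub>R (gen i \<odot> gen i) = 2 *\<^sub>R (- cunit :: 'a clifford)"
    using gen_relations[of i i] by (simp add: scaleR_2)
  then have "gen i \<odot> gen i = - cunit" by (metis scaleR_cancel_left zero_neq_numeral)
  then show ?thesis by (simp add: cmult_assoc[symmetric] cm.minus_left)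
qed

lemma gen_swap: "gen i \<odot> (gen j \<odot> a) = - (gen j \<odot> (gen i \<odot> a)) - (if i = j then 2 else 0) *\<^sub>R a"
proof -
  have "gen i \<odot> gen j = - (gen j \<odot> gen i) - (if i = j then 2 else 0) *\<^sub>R cunit"
    using gen_relations[of i j] by (auto simp: algebra_simps eq_neg_iff_add_eq_0)
  from arg_cong[OF this, of "\<lambda>x. x \<odot> a"] show ?thesis
    by (simp add: cmult_assoc[symmetric] cm.minus_left cm.diff_left cm.scaleR_left)
qed

lemma dirac_left_hom:
  fixes p :: "real ^ 'n::{finite,linorder} \<Rightarrow> 'n option clifford"
  assumes "p \<in> hom_polys k"
  shows "dirac_left p \<in> hom_polys (k - 1)"
  unfolding dirac_left_def[abs_def]
  by (intro hom_polys_sum hom_polys_linear_image[OF hom_polys_partial_diff[OF assms] cm.bounded_linear_right])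

lemma dirac_left_add:
  fixes p q :: "real ^ 'n::{finite,linorder} \<Rightarrow> 'n option clifford"
  assumes "polynomial_function p" "polynomial_function q"
  shows "dirac_left (\<lambda>u. p u + q u) u = dirac_left p u + dirac_left q u"
proof -
  have "partial_diff j (\<lambda>u. p u + q u) u = partial_diff j p u + partial_diff j q u" for j
    using partial_diff_eq[OF has_derivative_add[OF polynomial_function_has_derivative[OF assms(1)]
          polynomial_function_has_derivative[OF assms(2)]], of j u]
    by (simp add: partial_diff_def)
  then show ?thesis by (simp add: dirac_left_def cm.add_right sum.distrib)
qed

lemma dirac_left_scaleR:
  fixes p :: "real ^ 'n::{finite,linorder} \<Rightarrow> 'n option clifford"
  assumes "polynomial_function p"
  shows "dirac_left (\<lambda>u. c *\<^sub>R p u) u = c *\<^sub>R dirac_left p u"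
  using partial_diff_linear_image[OF assms bounded_linear_scaleR_right[of c]]
  by (simp add: dirac_left_def cm.scaleR_right scaleR_sum_right)

text \<open>Second derivatives are symmetric, so adding the double sum to its transpose leaves
  anticommutators of generators, which are 0 off the diagonal and -2 on it.\<close>

lemma dirac_left_square:
  fixes p :: "real ^ 'n::{finite,linorder} \<Rightarrow> 'n option clifford"
  assumes p: "polynomial_function p"
  shows "dirac_left (dirac_left p) u = - (\<Sum>j\<in>UNIV. partial_diff j (partial_diff j p) u)"
proof -
  let ?P = "\<lambda>i j. partial_diff i (partial_diff j p) u"
  have pd: "partial_diff i (dirac_left p) u = (\<Sum>j\<in>UNIV. gen (Some j) \<odot> ?P i j)" for i
  proof -
    have "((\<lambda>u. \<Sum>j\<in>UNIV. gen (Some j) \<odot> partial_diff j p u) has_derivative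
      (\<lambda>v. \<Sum>j\<in>UNIV. gen (Some j) \<odot> frechet_derivative (partial_diff j p) (at u) v)) (at u)"
      by (intro has_derivative_sum bounded_linear.has_derivative[OF cm.bounded_linear_right]
          polynomial_function_has_derivative polynomial_partial_diff(1)[OF p])
    from partial_diff_eq[OF this, of i] show ?thesis
      by (simp add: dirac_left_def[abs_def] partial_diff_def)
  qed
  define S where "S = dirac_left (dirac_left p) u"
  have S1: "S = (\<Sum>i\<in>UNIV. \<Sum>j\<in>UNIV. gen (Some i) \<odot> (gen (Some j) \<odot> ?P i j))"
    by (simp add: S_def dirac_left_def[of "dirac_left p"] pd cm.sum_right)
  have S2: "S = (\<Sum>i\<in>UNIV. \<Sum>j\<in>UNIV. gen (Some j) \<odot> (gen (Some i) \<odot> ?P i j))"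
    unfolding S1 by (subst sum.swap) (simp only: polynomial_partial_diff(2)[OF p, of _ _ u])
  have "S + S = (\<Sum>i\<in>UNIV. \<Sum>j\<in>UNIV. gen (Some i) \<odot> (gen (Some j) \<odot> ?P i j) + gen (Some j) \<odot> (gen (Some i) \<odot> ?P i j))"
    by (subst S1, subst S2) (simp only: sum.distrib)
  also have "\<dots> = (\<Sum>i\<in>UNIV. \<Sum>j\<in>UNIV. - (if i = j then 2 *\<^sub>R ?P i i else 0))"
    by (intro sum.cong refl, subst gen_swap) auto
  also have "\<dots> = - 2 *\<^sub>R (\<Sum>i\<in>UNIV. ?P i i)"
    by (simp add: sum_negf scaleR_sum_right)
  finally have "2 *\<^sub>R S = 2 *\<^sub>R - (\<Sum>i\<in>UNIV. ?P i i)" by (simp add: scaleR_2)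
  then have "S = - (\<Sum>i\<in>UNIV. ?P i i)" unfolding scaleR_cancel_left by simp
  then show ?thesis by (simp add: S_def)
qed

lemma bounded_linear_cvec_n: "bounded_linear (cvec_n :: real ^ 'n::finite \<Rightarrow> _)"
  unfolding linear_conv_bounded_linear[symmetric] cvec_n_def
  by (intro linearI) (simp_all add: scaleR_add_left sum.distrib scaleR_sum_right)

lemma polynomial_function_cmult:
  fixes p q :: "'a::euclidean_space \<Rightarrow> 'i::{finite,linorder} clifford"
  assumes "polynomial_function p" "polynomial_function q"
  shows "polynomial_function (\<lambda>u. p u \<odot> q u)"
  unfolding cmult_def
proof (intro polynomial_function_sum finite polynomial_function_mult)
  have c: "real_polynomial_function (\<lambda>u. r u $ A)" if "polynomial_function r" for r :: "'a \<Rightarrow> 'i clifford" and A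
    using polynomial_function_linear_image[OF that bounded_linear_vec_nth] by (simp add: real_polynomial_function_eq)
  show "polynomial_function (\<lambda>u. blade_sign A B * p u $ A * q u $ B)" for A B
    unfolding real_polynomial_function_eq[symmetric]
    by (intro real_polynomial_function.intros(4) real_polynomial_function.intros(2) c assms)
qed auto

lemma cvec_n_mult_hom:
  fixes q :: "real ^ 'n::{finite,linorder} \<Rightarrow> 'n option clifford"
  assumes "q \<in> hom_polys (k - 1)" "k \<ge> 0"
  shows "(\<lambda>u. cvec_n u \<odot> q u) \<in> hom_polys k"
proof (cases "k = 0")
  case True
  then have "q = (\<lambda>_. 0)" using assms(1) by (simp add: hom_polys_def)
  then show ?thesis by (simp add: cm.zero_right hom_polys_zero)
next
  case False
  then have "nat k = Suc (nat (k - 1))" using assms(2) by linarith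
  then show ?thesis
    using assms False polynomial_function_cmult[OF polynomial_function_bounded_linear[OF bounded_linear_cvec_n]]
    by (auto simp: hom_polys_def cm.scaleR_left cm.scaleR_right linear_scale[OF bounded_linear.linear[OF bounded_linear_cvec_n]] split: if_splits)
qed

lemma gen_cvec_n:
  "gen (Some j) \<odot> (cvec_n u \<odot> a) = - (cvec_n u \<odot> (gen (Some j) \<odot> a)) - (2 * u $ j) *\<^sub>R a"
proof -
  have "gen (Some j) \<odot> (cvec_n u \<odot> a) = (\<Sum>i\<in>UNIV. u $ i *\<^sub>R (gen (Some j) \<odot> (gen (Some i) \<odot> a)))"
    by (simp add: cvec_n_def cm.sum_left cm.sum_right cm.scaleR_left cm.scaleR_right)
  also have "\<dots> = (\<Sum>i\<in>UNIV. - (u $ i *\<^sub>R (gen (Some i) \<odot> (gen (Some j) \<odot> a))) - (if i = j then (2 * u $ j) *\<^sub>R a else 0))"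
    by (intro sum.cong refl, subst gen_swap) (auto simp: scaleR_diff_right)
  also have "\<dots> = - (cvec_n u \<odot> (gen (Some j) \<odot> a)) - (2 * u $ j) *\<^sub>R a"
    by (simp add: sum_subtractf sum_negf cvec_n_def cm.sum_left cm.scaleR_left)
  finally show ?thesis .
qed

text \<open>Moving \<open>gen (Some j)\<close> past \<open>cvec_n u\<close> produces
  \<open>- 2 * u $ j\<close>, hence \<open>- 2 * nat m\<close> by Euler's relation. The derivative
  of \<open>cvec_n u\<close> is again \<open>gen (Some j)\<close>, whose square contributes -1 for
  each of the \<open>CARD('n)\<close> indices.\<close>

lemma dirac_left_cvec_n_mult:
  fixes q :: "real ^ 'n::{finite,linorder} \<Rightarrow> 'n option clifford"
  assumes q: "q \<in> hom_polys m"
  shows "dirac_left (\<lambda>u. cvec_n u \<odot> q u) u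
    = - ((real CARD('n) + 2 * real (nat m)) *\<^sub>R q u) - cvec_n u \<odot> dirac_left q u"
proof -
  have "(((\<lambda>u. cvec_n u \<odot> q u) has_derivative (\<lambda>v. cvec_n u \<odot> frechet_derivative q (at u) v + cvec_n v \<odot> q u)) (at u))"
    by (rule cm.FDERIV[OF bounded_linear_imp_has_derivative[OF bounded_linear_cvec_n]
          polynomial_function_has_derivative[OF hom_polys_polynomial[OF q]]])
  from partial_diff_eq[OF this]
  have pd: "partial_diff j (\<lambda>u. cvec_n u \<odot> q u) u = cvec_n u \<odot> partial_diff j q u + gen (Some j) \<odot> q u" for j
  proof -
    have "cvec_n (axis j 1) = (\<Sum>i\<in>UNIV. if i = j then gen (Some j) else 0)"
      unfolding cvec_n_def by (intro sum.cong refl) (auto simp: axis_def)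
    then have "cvec_n (axis j 1) = gen (Some j)" by simp
    then show ?thesis using \<open>\<And>j. partial_diff j (\<lambda>u. cvec_n u \<odot> q u) u = _ j\<close> by (simp add: partial_diff_def)
  qed
  have "dirac_left (\<lambda>u. cvec_n u \<odot> q u) u
      = (\<Sum>j\<in>UNIV. - (cvec_n u \<odot> (gen (Some j) \<odot> partial_diff j q u)) - 2 *\<^sub>R (u $ j *\<^sub>R partial_diff j q u) - q u)"
    by (simp add: dirac_left_def pd cm.add_right gen_cvec_n gen_mult_self)
  also have "\<dots> = - (cvec_n u \<odot> dirac_left q u) - 2 *\<^sub>R (\<Sum>j\<in>UNIV. u $ j *\<^sub>R partial_diff j q u) - real CARD('n) *\<^sub>R q u"
    by (simp add: sum_subtractf sum_negf cm.sum_right dirac_left_def scaleR_sum_right sum_constant_scaleR del: sum_constant)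
  also have "\<dots> = - ((real CARD('n) + 2 * real (nat m)) *\<^sub>R q u) - cvec_n u \<odot> dirac_left q u"
    by (simp add: hom_polys_euler(2)[OF q] algebra_simps)
  finally show ?thesis .
qed

text \<open>Up to sign, the factor of \<open>q\<close> in the Dirac derivative of
  \<open>cvec_n u \<odot> q u\<close> for \<open>q\<close> of degree \<open>k - 1\<close>. The
  decomposition divides by it.\<close>

lemma fischer_constant_pos: "0 < real CARD('n::finite) + 2 * real (nat (k - 1))"
  by (simp add: add_pos_nonneg)

text \<open>The Dirac operator annihilates \<open>p\<close> and sends the second summand to a
  nonzero multiple of \<open>q\<close>; so the sum determines \<open>q\<close>, and then
  \<open>p\<close>.\<close>

lemma monogenic_decomposition_unique:
  fixes p q p' q' :: "real ^ 'n::{finite,linorder} \<Rightarrow> 'n option clifford"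
  assumes p: "p \<in> monogenics_left k" "p' \<in> monogenics_left k"
    and q: "q \<in> monogenics_left (k - 1)" "q' \<in> monogenics_left (k - 1)"
    and k: "k \<ge> 0" and eq: "(\<lambda>u. p u + cvec_n u \<odot> q u) = (\<lambda>u. p' u + cvec_n u \<odot> q' u)"
  shows "p = p'"
proof -
  define c where "c = real CARD('n) + 2 * real (nat (k - 1))"
  have D: "dirac_left (\<lambda>u. p u + cvec_n u \<odot> q u) u = - (c *\<^sub>R q u)"
    if "p \<in> monogenics_left k" "q \<in> monogenics_left (k - 1)" for p q and u :: "(real, 'n) vec"
  proof -
    have hom: "p \<in> hom_polys k" "q \<in> hom_polys (k - 1)" and D0: "dirac_left p u = 0" "dirac_left q u = 0"
      using that by (auto simp: monogenics_left_def)
    show ?thesis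
      by (subst dirac_left_add[OF hom_polys_polynomial[OF hom(1)] hom_polys_polynomial[OF cvec_n_mult_hom[OF hom(2) k]]])
        (simp only: D0 dirac_left_cvec_n_mult[OF hom(2)] cm.zero_right c_def[symmetric] add_0_left diff_0_right)
  qed
  have "- (c *\<^sub>R q u) = - (c *\<^sub>R q' u)" for u
    unfolding D[OF p(1) q(1), symmetric] D[OF p(2) q(2), symmetric] eq ..
  then have "q = q'" using fischer_constant_pos[where 'n = 'n, of k] by (auto simp: c_def[symmetric])
  then show ?thesis using fun_cong[OF eq] by auto
qed

text \<open>The computation behind uniqueness dictates \<open>q\<close> as \<open>- (1 / c)\<close>
  times \<open>dirac_left h\<close>. It is monogenic because the square of the Dirac operator is
  minus the Laplacian, and the remainder \<open>p\<close> is monogenic by the choice of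
  \<open>c\<close>.\<close>

lemma harmonic_decomposition:
  fixes h :: "real ^ 'n::{finite,linorder} \<Rightarrow> 'n option clifford"
  assumes h: "h \<in> harmonic_polys k" and k: "k \<ge> 0"
  shows "\<exists>p\<in>monogenics_left k. \<exists>q\<in>monogenics_left (k - 1). h = (\<lambda>u. p u + cvec_n u \<odot> q u)"
proof -
  define c where "c = real CARD('n) + 2 * real (nat (k - 1))"
  have "c > 0" unfolding c_def by (rule fischer_constant_pos)
  have hh: "h \<in> hom_polys k" and lap: "\<And>u. (\<Sum>j\<in>UNIV. partial_diff j (partial_diff j h) u) = 0"
    using h by (auto simp: harmonic_polys_def)
  define q where "q u = (- (1 / c)) *\<^sub>R dirac_left h u" for u
  have qh: "q \<in> hom_polys (k - 1)"
    unfolding q_def[abs_def] by (rule hom_polys_linear_image[OF dirac_left_hom[OF hh] bounded_linear_scaleR_right])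
  have Dq: "dirac_left q u = 0" for u
    unfolding q_def[abs_def]
    by (subst dirac_left_scaleR[OF hom_polys_polynomial[OF dirac_left_hom[OF hh]]])
      (simp add: dirac_left_square[OF hom_polys_polynomial[OF hh]] lap)
  have q: "q \<in> monogenics_left (k - 1)" using qh Dq by (simp add: monogenics_left_def)
  define p where "p u = h u + (- 1) *\<^sub>R (cvec_n u \<odot> q u)" for u
  have uq: "(\<lambda>u. cvec_n u \<odot> q u) \<in> hom_polys k" by (rule cvec_n_mult_hom[OF qh k])
  have uq': "(\<lambda>u. (- 1) *\<^sub>R (cvec_n u \<odot> q u)) \<in> hom_polys k"
    by (rule hom_polys_linear_image[OF uq bounded_linear_scaleR_right])
  have "p \<in> hom_polys k"
    unfolding p_def[abs_def] by (rule hom_polys_add[OF hh uq'])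
  moreover have "dirac_left p u = 0" for u
  proof -
    have "dirac_left p u = dirac_left h u + (- 1) *\<^sub>R dirac_left (\<lambda>u. cvec_n u \<odot> q u) u"
      unfolding p_def[abs_def]
      by (simp only: dirac_left_add[OF hom_polys_polynomial[OF hh] hom_polys_polynomial[OF uq']]
          dirac_left_scaleR[OF hom_polys_polynomial[OF uq]])
    also have "\<dots> = dirac_left h u + c *\<^sub>R q u"
      by (simp only: dirac_left_cvec_n_mult[OF qh] Dq cm.zero_right c_def[symmetric]) simp
    finally show ?thesis using \<open>c > 0\<close> by (simp add: q_def)
  qed
  ultimately have p: "p \<in> monogenics_left k" by (simp add: monogenics_left_def)
  have hpq: "h = (\<lambda>u. p u + cvec_n u \<odot> q u)" by (simp add: p_def)
  show ?thesis using p q hpq by blast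
qed

lemma proj_left_decomposition:
  fixes h :: "real ^ 'n::{finite,linorder} \<Rightarrow> 'n option clifford"
  assumes h: "h \<in> harmonic_polys k" and k: "k \<ge> 0"
  shows "proj_left k h \<in> monogenics_left k"
    and "\<exists>q\<in>monogenics_left (k - 1). h = (\<lambda>u. proj_left k h u + cvec_n u \<odot> q u)"
proof -
  obtain p q where pq: "p \<in> monogenics_left k" "q \<in> monogenics_left (k - 1)" "h = (\<lambda>u. p u + cvec_n u \<odot> q u)"
    using harmonic_decomposition[OF assms] by blast
  have "(THE p. p \<in> monogenics_left k \<and> (\<exists>q\<in>monogenics_left (k - 1). h = (\<lambda>u. p u + cvec_n u \<odot> q u))) = p"
  proof (rule the_equality)
    show "p \<in> monogenics_left k \<and> (\<exists>q\<in>monogenics_left (k - 1). h = (\<lambda>u. p u + cvec_n u \<odot> q u))"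
      using pq by blast
    fix p' assume p': "p' \<in> monogenics_left k \<and> (\<exists>q\<in>monogenics_left (k - 1). h = (\<lambda>u. p' u + cvec_n u \<odot> q u))"
    then obtain q' where "q' \<in> monogenics_left (k - 1)" "h = (\<lambda>u. p' u + cvec_n u \<odot> q' u)" by blast
    then show "p' = p" using monogenic_decomposition_unique[of p' k p q' q] p' pq k by metis
  qed
  then have "proj_left k h = p" using h by (simp add: proj_left_def)
  then show "proj_left k h \<in> monogenics_left k"
    and "\<exists>q\<in>monogenics_left (k - 1). h = (\<lambda>u. proj_left k h u + cvec_n u \<odot> q u)"
    using pq by auto
qed

section \<open>Right monogenics by reversion\<close>

lemma reversion_nth: "reversion a $ B = (- 1) ^ (card B choose 2) * a $ B"
proof -
  have "reversion a $ B = (\<Sum>A\<in>UNIV. if A = B then (- 1) ^ (card B choose 2) * a $ B else 0)"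
    unfolding reversion_def sum_component by (intro sum.cong refl) (auto simp: blade_def axis_def)
  then show ?thesis by simp
qed

lemma reversion_reversion [simp]: "reversion (reversion a) = a"
  by (simp add: vec_eq_iff reversion_nth power_add[symmetric] mult.assoc[symmetric])

lemma bounded_linear_reversion: "bounded_linear reversion"
  using linear_reversion by (simp add: linear_conv_bounded_linear)

lemma reversion_gen [simp]: "reversion (gen i) = gen i"
  by (simp add: gen_def reversion_blade numeral_2_eq_2)

lemma reversion_cvec_n [simp]: "reversion (cvec_n u) = cvec_n u"
  by (simp add: cvec_n_def linear_sum[OF linear_reversion] linear_scale[OF linear_reversion])

lemma reversion_sum: "reversion (\<Sum>i\<in>I. f i) = (\<Sum>i\<in>I. reversion (f i))"
  by (rule linear_sum[OF linear_reversion])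

lemma dirac_right_reversion:
  fixes p :: "real ^ 'n::{finite,linorder} \<Rightarrow> 'n option clifford"
  assumes "polynomial_function p"
  shows "dirac_right p u = reversion (dirac_left (\<lambda>u. reversion (p u)) u)"
  by (simp add: dirac_right_def dirac_left_def partial_diff_linear_image[OF assms bounded_linear_reversion]
      reversion_sum reversion_mult)

text \<open>Reversion exchanges the two sides of the algebra, so right-sided statements become
  transcriptions of left-sided ones.\<close>

lemma monogenics_right_iff:
  fixes p :: "real ^ 'n::{finite,linorder} \<Rightarrow> 'n option clifford"
  shows "p \<in> monogenics_right k \<longleftrightarrow> (\<lambda>u. reversion (p u)) \<in> monogenics_left k"
proof -
  have h: "p \<in> hom_polys k \<longleftrightarrow> (\<lambda>u. reversion (p u)) \<in> hom_polys k"
    using hom_polys_linear_image[OF _ bounded_linear_reversion, of p k]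
      hom_polys_linear_image[OF _ bounded_linear_reversion, of "\<lambda>u. reversion (p u)" k] by auto
  have "reversion a = 0 \<longleftrightarrow> a = 0" for a :: "'n option clifford"
    using linear_0[OF linear_reversion] by (metis reversion_reversion)
  then have "(dirac_right p u = 0) = (dirac_left (\<lambda>u. reversion (p u)) u = 0)" if "p \<in> hom_polys k" for u
    by (simp add: dirac_right_reversion[OF hom_polys_polynomial[OF that]])
  then show ?thesis using h by (auto simp: monogenics_right_def monogenics_left_def)
qed

lemma harmonic_polys_linear_image:
  fixes p :: "real ^ 'n::finite \<Rightarrow> 'n option clifford"
  assumes p: "p \<in> harmonic_polys k" and l: "bounded_linear l"
  shows "(\<lambda>u. l (p u)) \<in> harmonic_polys k"
proof -
  have h: "p \<in> hom_polys k" and lap: "\<And>u. (\<Sum>j\<in>UNIV. partial_diff j (partial_diff j p) u) = 0"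
    using p by (auto simp: harmonic_polys_def)
  note pp = hom_polys_polynomial[OF h]
  have "partial_diff j (\<lambda>u. l (p u)) = (\<lambda>u. l (partial_diff j p u))" for j
    by (rule ext) (rule partial_diff_linear_image[OF pp l])
  then have "partial_diff j (partial_diff j (\<lambda>u. l (p u))) u = l (partial_diff j (partial_diff j p) u)" for j u
    by (simp add: partial_diff_linear_image[OF polynomial_partial_diff(1)[OF pp] l])
  then have "(\<Sum>j\<in>UNIV. partial_diff j (partial_diff j (\<lambda>u. l (p u))) u) = 0" for u
    using lap[of u] by (simp add: linear_sum[OF bounded_linear.linear[OF l], symmetric] linear_0[OF bounded_linear.linear[OF l]])
  then show ?thesis using hom_polys_linear_image[OF h l] by (simp add: harmonic_polys_def)
qed

lemma harmonic_polys_add: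
  fixes p q :: "real ^ 'n::finite \<Rightarrow> 'n option clifford"
  assumes p: "p \<in> harmonic_polys k" and q: "q \<in> harmonic_polys k"
  shows "(\<lambda>u. p u + q u) \<in> harmonic_polys k"
proof -
  have h: "p \<in> hom_polys k" "q \<in> hom_polys k"
    and lap: "\<And>u. (\<Sum>j\<in>UNIV. partial_diff j (partial_diff j p) u) = 0" "\<And>u. (\<Sum>j\<in>UNIV. partial_diff j (partial_diff j q) u) = 0"
    using p q by (auto simp: harmonic_polys_def)
  note pp = hom_polys_polynomial[OF h(1)] hom_polys_polynomial[OF h(2)]
  have add: "partial_diff j (\<lambda>u. r u + s u) u = partial_diff j r u + partial_diff j s u"
    if "polynomial_function r" "polynomial_function s" for j u and r s :: "real ^ 'n \<Rightarrow> 'n option clifford"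
    using partial_diff_eq[OF has_derivative_add[OF polynomial_function_has_derivative[OF that(1)]
          polynomial_function_has_derivative[OF that(2)]], of j u]
    by (simp add: partial_diff_def)
  have "partial_diff j (\<lambda>u. p u + q u) = (\<lambda>u. partial_diff j p u + partial_diff j q u)" for j
    by (rule ext) (rule add[OF pp])
  then have "partial_diff j (partial_diff j (\<lambda>u. p u + q u)) u
      = partial_diff j (partial_diff j p) u + partial_diff j (partial_diff j q) u" for j u
    by (simp add: add polynomial_partial_diff(1) pp)
  then show ?thesis using hom_polys_add[OF h] lap by (simp add: harmonic_polys_def sum.distrib)
qed

lemma harmonic_polys_zero: "(\<lambda>_. 0) \<in> (harmonic_polys k :: (real ^ 'n::finite \<Rightarrow> 'n option clifford) set)"
proof -
  have "partial_diff j (\<lambda>_. 0) = (\<lambda>_::real ^ 'n. 0 :: 'n option clifford)" for j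
    using partial_diff_eq[OF has_derivative_const] by blast
  then show ?thesis by (simp add: harmonic_polys_def hom_polys_zero)
qed

lemma harmonic_polys_sum:
  fixes p :: "'a \<Rightarrow> real ^ 'n::finite \<Rightarrow> 'n option clifford"
  shows "(\<And>i. i \<in> I \<Longrightarrow> p i \<in> harmonic_polys k) \<Longrightarrow> (\<lambda>u. \<Sum>i\<in>I. p i u) \<in> harmonic_polys k"
  by (induction I rule: infinite_finite_induct) (auto intro: harmonic_polys_zero harmonic_polys_add)

lemma monogenics_left_harmonic:
  fixes p :: "real ^ 'n::{finite,linorder} \<Rightarrow> 'n option clifford"
  assumes "p \<in> monogenics_left k"
  shows "p \<in> harmonic_polys k"
proof -
  have p: "p \<in> hom_polys k" "dirac_left p = (\<lambda>_. 0)" using assms by (auto simp: monogenics_left_def)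
  have "partial_diff j (\<lambda>_. 0) u = (0 :: 'n option clifford)" for j and u :: "(real, 'n) vec"
    by (rule partial_diff_eq[OF has_derivative_const])
  then have "dirac_left (dirac_left p) u = 0" for u
    by (simp add: p(2)) (simp add: dirac_left_def cm.zero_right)
  then show ?thesis using p(1) by (simp add: harmonic_polys_def dirac_left_square[OF hom_polys_polynomial[OF p(1)]])
qed

lemma monogenics_right_harmonic:
  fixes p :: "real ^ 'n::{finite,linorder} \<Rightarrow> 'n option clifford"
  assumes "p \<in> monogenics_right k"
  shows "p \<in> harmonic_polys k"
  using harmonic_polys_linear_image[OF monogenics_left_harmonic bounded_linear_reversion, of "\<lambda>u. reversion (p u)" k]
    assms by (simp add: monogenics_right_iff)

text \<open>The reversed polynomial is decomposed on the left. Reversing both parts gives existence,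
  and uniqueness is pulled back in the same way.\<close>

lemma proj_right_decomposition:
  fixes h :: "real ^ 'n::{finite,linorder} \<Rightarrow> 'n option clifford"
  assumes h: "h \<in> harmonic_polys k" and k: "k \<ge> 0"
  shows "proj_right k h \<in> monogenics_right k"
    and "\<exists>q\<in>monogenics_right (k - 1). h = (\<lambda>u. proj_right k h u + q u \<odot> cvec_n u)"
proof -
  have "(\<lambda>u. reversion (h u)) \<in> harmonic_polys k"
    by (rule harmonic_polys_linear_image[OF h bounded_linear_reversion])
  from harmonic_decomposition[OF this k]
  obtain p q where pq: "p \<in> monogenics_left k" "q \<in> monogenics_left (k - 1)"
    and eq: "(\<lambda>u. reversion (h u)) = (\<lambda>u. p u + cvec_n u \<odot> q u)"
    by blast
  define p' q' where "p' u = reversion (p u)" and "q' u = reversion (q u)" for u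
  have p'q': "p' \<in> monogenics_right k" "q' \<in> monogenics_right (k - 1)"
    using pq by (simp_all add: monogenics_right_iff p'_def q'_def)
  have heq: "h u = p' u + q' u \<odot> cvec_n u" for u
    using arg_cong[OF fun_cong[OF eq, of u], of reversion]
    by (simp add: linear_add[OF linear_reversion] reversion_mult p'_def q'_def)
  have "(THE p. p \<in> monogenics_right k \<and> (\<exists>q\<in>monogenics_right (k - 1). h = (\<lambda>u. p u + q u \<odot> cvec_n u))) = p'"
  proof (rule the_equality)
    show "p' \<in> monogenics_right k \<and> (\<exists>q\<in>monogenics_right (k - 1). h = (\<lambda>u. p' u + q u \<odot> cvec_n u))"
      using p'q' heq by blast
    fix r assume r: "r \<in> monogenics_right k \<and> (\<exists>q\<in>monogenics_right (k - 1). h = (\<lambda>u. r u + q u \<odot> cvec_n u))"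
    then obtain s where s: "s \<in> monogenics_right (k - 1)" "h = (\<lambda>u. r u + s u \<odot> cvec_n u)" by blast
    have "(\<lambda>u. reversion (r u) + cvec_n u \<odot> reversion (s u)) = (\<lambda>u. p u + cvec_n u \<odot> q u)"
      unfolding eq[symmetric] s(2) by (simp add: linear_add[OF linear_reversion] reversion_mult)
    then have "(\<lambda>u. reversion (r u)) = p"
      using monogenic_decomposition_unique[of "\<lambda>u. reversion (r u)" k p "\<lambda>u. reversion (s u)" q] r s(1) pq k
      by (simp add: monogenics_right_iff)
    then show "r = p'" by (auto simp: p'_def)
  qed
  then have "proj_right k h = p'" using h by (simp add: proj_right_def)
  then show "proj_right k h \<in> monogenics_right k"
    and "\<exists>q\<in>monogenics_right (k - 1). h = (\<lambda>u. proj_right k h u + q u \<odot> cvec_n u)"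
    using p'q' heq by auto
qed

section \<open>The pairing and the spherical Dirac operator\<close>

lemma set_integrable_polynomial_sphere:
  fixes P :: "real ^ 'n::finite \<Rightarrow> 'b::euclidean_space"
  assumes ds: "is_lebesgue_measure_on (CARD('n) - 1) (sphere 0 1) ds" and P: "polynomial_function P"
  shows "set_integrable ds (sphere 0 1) P"
  by (rule set_integrable_continuous_compact[OF sphere_finite_measure[OF ds] _ compact_sphere continuous_on_polymonial_function[OF P]])
    (use ds in \<open>simp add: is_lebesgue_measure_on_def\<close>)

lemma u_pairing_add_right:
  fixes P Q R :: "real ^ 'n::{finite,linorder} \<Rightarrow> 'n option clifford"
  assumes ds: "is_lebesgue_measure_on (CARD('n) - 1) (sphere 0 1) ds"
    and "polynomial_function P" "polynomial_function Q" "polynomial_function R"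
  shows "u_pairing ds P (\<lambda>u. Q u + R u) = u_pairing ds P Q + u_pairing ds P R"
  unfolding u_pairing_def cm.add_right
  by (intro set_integral_add set_integrable_polynomial_sphere[OF ds] polynomial_function_cmult assms)

lemma u_pairing_add_left:
  fixes P Q R :: "real ^ 'n::{finite,linorder} \<Rightarrow> 'n option clifford"
  assumes ds: "is_lebesgue_measure_on (CARD('n) - 1) (sphere 0 1) ds"
    and "polynomial_function P" "polynomial_function Q" "polynomial_function R"
  shows "u_pairing ds (\<lambda>u. Q u + R u) P = u_pairing ds Q P + u_pairing ds R P"
  unfolding u_pairing_def cm.add_left
  by (intro set_integral_add set_integrable_polynomial_sphere[OF ds] polynomial_function_cmult assms)

text \<open>The field with components \<open>h j = g e_j f\<close> has divergence
  \<open>(g D) f + g (D f) = 0\<close>, is homogeneous of degree \<open>a + b\<close> and has radial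
  component \<open>g u f\<close>. The condition \<open>0 < a + b\<close> keeps the constant
  \<open>a + b + n - 1\<close> nonzero even for \<open>n = 1\<close>.\<close>

lemma u_pairing_cvec_n_zero:
  fixes f g :: "real ^ 'n::{finite,linorder} \<Rightarrow> 'n option clifford"
  assumes ds: "is_lebesgue_measure_on (CARD('n) - 1) (sphere 0 1) ds"
    and g: "g \<in> monogenics_right a" and f: "f \<in> monogenics_left b" and ab: "0 \<le> a" "0 \<le> b" "0 < a + b"
  shows "u_pairing ds g (\<lambda>u. cvec_n u \<odot> f u) = 0"
proof -
  have hom: "g \<in> hom_polys a" "f \<in> hom_polys b" and D: "\<And>u. dirac_right g u = 0" "\<And>u. dirac_left f u = 0"
    using f g by (auto simp: monogenics_right_def monogenics_left_def)
  note pol = hom_polys_polynomial[OF hom(1)] hom_polys_polynomial[OF hom(2)]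
  define h where "h j u = g u \<odot> (gen (Some j) \<odot> f u)" for j u
  have d: "(h j has_derivative (\<lambda>v. g u \<odot> (gen (Some j) \<odot> frechet_derivative f (at u) v)
      + frechet_derivative g (at u) v \<odot> (gen (Some j) \<odot> f u))) (at u)" for j u
    unfolding h_def[abs_def]
    by (intro cm.FDERIV bounded_linear.has_derivative[OF cm.bounded_linear_right] polynomial_function_has_derivative pol)
  have fr: "frechet_derivative (h j) (at u) = (\<lambda>v. g u \<odot> (gen (Some j) \<odot> frechet_derivative f (at u) v)
      + frechet_derivative g (at u) v \<odot> (gen (Some j) \<odot> f u))" for j u
    by (rule frechet_derivative_at[OF d, symmetric])
  have "(LINT u:sphere 0 1|ds. \<Sum>j\<in>UNIV. u $ j *\<^sub>R h j u) = 0"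
  proof (rule sphere_integral_solenoidal[OF ds])
    show "C1_on UNIV (h j)" for j
      unfolding h_def[abs_def]
      by (intro polynomial_function_C1 polynomial_function_cmult polynomial_function_const pol)
    show "frechet_derivative (h j) (at u) u = real_of_int (a + b) *\<^sub>R h j u" for j u
      unfolding fr hom_polys_euler(1)[OF hom(1)] hom_polys_euler(1)[OF hom(2)] h_def
      using ab by (simp add: cm.scaleR_left cm.scaleR_right scaleR_add_left[symmetric] add.commute)
    show "(\<Sum>j\<in>UNIV. partial_diff j (h j) u) = 0" for u
    proof -
      have "(\<Sum>j\<in>UNIV. partial_diff j (h j) u) = g u \<odot> dirac_left f u + dirac_right g u \<odot> f u"
        by (simp add: partial_diff_def fr sum.distrib dirac_left_def dirac_right_def cm.sum_left cm.sum_right cmult_assoc)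
      then show ?thesis by (simp add: D cm.zero_left cm.zero_right)
    qed
    show "real_of_int (a + b) + real (CARD('n) - 1) \<noteq> 0" using ab by linarith
  qed
  moreover have "(\<Sum>j\<in>UNIV. u $ j *\<^sub>R h j u) = g u \<odot> (cvec_n u \<odot> f u)" for u
    by (simp add: h_def cvec_n_def cm.sum_left cm.sum_right cm.scaleR_left cm.scaleR_right)
  ultimately show ?thesis by (simp add: u_pairing_def)
qed

lemma u_pairing_proj_left:
  fixes g h :: "real ^ 'n::{finite,linorder} \<Rightarrow> 'n option clifford"
  assumes ds: "is_lebesgue_measure_on (CARD('n) - 1) (sphere 0 1) ds" and k: "k \<ge> 0"
    and g: "g \<in> monogenics_right k" and h: "h \<in> harmonic_polys k"
  shows "u_pairing ds g (proj_left k h) = u_pairing ds g h"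
proof -
  obtain q where q: "q \<in> monogenics_left (k - 1)" and eq: "h = (\<lambda>u. proj_left k h u + cvec_n u \<odot> q u)"
    using proj_left_decomposition(2)[OF h k] by blast
  have pol: "polynomial_function g" "polynomial_function (proj_left k h)" "polynomial_function q"
    using g q proj_left_decomposition(1)[OF h k]
    by (auto simp: monogenics_left_def monogenics_right_def intro: hom_polys_polynomial)
  have "u_pairing ds g (\<lambda>u. cvec_n u \<odot> q u) = 0"
  \<comment> \<open>In degree -1 there is only the zero polynomial; for \<open>k > 0\<close> the
    degrees \<open>k\<close> and \<open>k - 1\<close> have a positive sum.\<close>
  proof (cases "k = 0")
    case True
    then have "q = (\<lambda>_. 0)" using q by (simp add: monogenics_left_def hom_polys_def)
    then show ?thesis by (simp add: u_pairing_def cm.zero_right)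
  next
    case False
    then show ?thesis using u_pairing_cvec_n_zero[OF ds g q] k by simp
  qed
  then have "u_pairing ds g (\<lambda>u. proj_left k h u + cvec_n u \<odot> q u) = u_pairing ds g (proj_left k h)"
    by (subst u_pairing_add_right[OF ds pol(1,2) polynomial_function_cmult[OF polynomial_function_bounded_linear[OF bounded_linear_cvec_n] pol(3)]]) simp
  then show ?thesis using eq by simp
qed

lemma u_pairing_proj_right:
  fixes f h :: "real ^ 'n::{finite,linorder} \<Rightarrow> 'n option clifford"
  assumes ds: "is_lebesgue_measure_on (CARD('n) - 1) (sphere 0 1) ds" and k: "k \<ge> 0"
    and f: "f \<in> monogenics_left k" and h: "h \<in> harmonic_polys k"
  shows "u_pairing ds (proj_right k h) f = u_pairing ds h f"
proof -
  obtain q where q: "q \<in> monogenics_right (k - 1)" and eq: "h = (\<lambda>u. proj_right k h u + q u \<odot> cvec_n u)"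
    using proj_right_decomposition(2)[OF h k] by blast
  have pol: "polynomial_function f" "polynomial_function (proj_right k h)" "polynomial_function q"
    using f q proj_right_decomposition(1)[OF h k]
    by (auto simp: monogenics_left_def monogenics_right_def intro: hom_polys_polynomial)
  have "u_pairing ds (\<lambda>u. q u \<odot> cvec_n u) f = 0"
  proof (cases "k = 0")
    case True
    then have "q = (\<lambda>_. 0)" using q by (simp add: monogenics_right_def hom_polys_def)
    then show ?thesis by (simp add: u_pairing_def cm.zero_left)
  next
    case False
    then show ?thesis using u_pairing_cvec_n_zero[OF ds q f] k by (simp add: u_pairing_def cmult_assoc)
  qed
  then have "u_pairing ds (\<lambda>u. proj_right k h u + q u \<odot> cvec_n u) f = u_pairing ds (proj_right k h) f"
    by (subst u_pairing_add_left[OF ds pol(1,2) polynomial_function_cmult[OF pol(3) polynomial_function_bounded_linear[OF bounded_linear_cvec_n]]]) simp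
  then show ?thesis using eq by simp
qed

text \<open>By bilinearity the integration over \<open>u\<close> is reduced to finitely many scalar
  integrals of products of weights, which do not depend on the coefficients \<open>P\<close> and
  \<open>Q\<close>.\<close>

lemma u_pairing_expand:
  fixes P Q :: "nat \<Rightarrow> 'n::{finite,linorder} option clifford" and l l' :: "nat \<Rightarrow> (real, 'n) vec \<Rightarrow> real"
  assumes ds: "is_lebesgue_measure_on (CARD('n) - 1) (sphere 0 1) ds"
    and "finite J" "finite J'" and l: "\<And>i. i \<in> J \<Longrightarrow> real_polynomial_function (l i)" "\<And>i. i \<in> J' \<Longrightarrow> real_polynomial_function (l' i)"
  shows "u_pairing ds (\<lambda>u. \<Sum>i\<in>J. l i u *\<^sub>R P i) (\<lambda>u. \<Sum>i\<in>J'. l' i u *\<^sub>R Q i)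
    = (\<Sum>i\<in>J. \<Sum>i'\<in>J'. (LINT u:sphere 0 1|ds. l i u * l' i' u) *\<^sub>R (P i \<odot> Q i'))"
proof -
  have int: "set_integrable ds (sphere 0 1) (\<lambda>u. l i u * l' i' u)" if "i \<in> J" "i' \<in> J'" for i i'
    using l that by (intro set_integrable_polynomial_sphere[OF ds]) (auto simp: real_polynomial_function_eq[symmetric] intro: real_polynomial_function.intros(4))
  have "(\<Sum>i\<in>J. l i u *\<^sub>R P i) \<odot> (\<Sum>i\<in>J'. l' i u *\<^sub>R Q i) = (\<Sum>i\<in>J. \<Sum>i'\<in>J'. (l i u * l' i' u) *\<^sub>R (P i \<odot> Q i'))" for u
    by (subst sum.swap) (simp add: cm.sum_left cm.sum_right cm.scaleR_left cm.scaleR_right scaleR_sum_right mult.commute)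
  then have "u_pairing ds (\<lambda>u. \<Sum>i\<in>J. l i u *\<^sub>R P i) (\<lambda>u. \<Sum>i\<in>J'. l' i u *\<^sub>R Q i)
      = (LINT u:sphere 0 1|ds. \<Sum>i\<in>J. \<Sum>i'\<in>J'. (l i u * l' i' u) *\<^sub>R (P i \<odot> Q i'))"
    by (simp add: u_pairing_def)
  also have "\<dots> = (\<Sum>i\<in>J. \<Sum>i'\<in>J'. LINT u:sphere 0 1|ds. (l i u * l' i' u) *\<^sub>R (P i \<odot> Q i'))"
    using int by (simp add: set_integral_finite_sum set_integrable_scaleR_left)
  also have "\<dots> = (\<Sum>i\<in>J. \<Sum>i'\<in>J'. (LINT u:sphere 0 1|ds. l i u * l' i' u) *\<^sub>R (P i \<odot> Q i'))"
  proof (intro sum.cong refl)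
    fix i i' assume "i \<in> J" "i' \<in> J'"
    have "(LINT u:sphere 0 1|ds. (l i u * l' i' u) *\<^sub>R (P i \<odot> Q i'))
        = (LINT u|ds. (indicator (sphere 0 1) u *\<^sub>R (l i u * l' i' u)) *\<^sub>R (P i \<odot> Q i'))"
      by (simp add: set_lebesgue_integral_def)
    also have "\<dots> = (LINT u:sphere 0 1|ds. l i u * l' i' u) *\<^sub>R (P i \<odot> Q i')"
      unfolding set_lebesgue_integral_def
      by (rule integral_scaleR_left) (use int[OF \<open>i \<in> J\<close> \<open>i' \<in> J'\<close>] in \<open>simp add: set_integrable_def\<close>)
    finally show "(LINT u:sphere 0 1|ds. (l i u * l' i' u) *\<^sub>R (P i \<odot> Q i'))
        = (LINT u:sphere 0 1|ds. l i u * l' i' u) *\<^sub>R (P i \<odot> Q i')" .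
  qed
  finally show ?thesis .
qed

section \<open>The Dirac operator on radial extensions\<close>

lemma sum_pairs_less:
  fixes F :: "'i::{finite,linorder} \<Rightarrow> 'i \<Rightarrow> 'b::comm_monoid_add"
  shows "(\<Sum>i\<in>UNIV. \<Sum>j\<in>UNIV. F i j) = (\<Sum>i\<in>UNIV. F i i) + (\<Sum>(i, j) | i < j. F i j + F j i)"
proof -
  let ?L = "{(i, j). i < (j :: 'i)}" and ?G = "{(i, j). j < (i :: 'i)}" and ?D = "{(i, j). i = (j :: 'i)}"
  have "(\<Sum>i\<in>UNIV. \<Sum>j\<in>UNIV. F i j) = (\<Sum>(i, j)\<in>UNIV. F i j)"
    by (simp add: sum.cartesian_product)
  also have "(UNIV :: ('i \<times> 'i) set) = ?D \<union> (?L \<union> ?G)" by auto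
  also have "(\<Sum>(i, j)\<in>?D \<union> (?L \<union> ?G). F i j) = (\<Sum>(i, j)\<in>?D. F i j) + ((\<Sum>(i, j)\<in>?L. F i j) + (\<Sum>(i, j)\<in>?G. F i j))"
    by (subst sum.union_disjoint, auto)+
  also have "(\<Sum>(i, j)\<in>?D. F i j) = (\<Sum>i\<in>UNIV. F i i)"
    by (rule sum.reindex_bij_witness[of _ "\<lambda>i. (i, i)" fst]) auto
  also have "(\<Sum>(i, j)\<in>?G. F i j) = (\<Sum>(i, j)\<in>?L. F j i)"
    by (rule sum.reindex_bij_witness[of _ prod.swap prod.swap]) auto
  also have "(\<Sum>(i, j)\<in>?L. F i j) + (\<Sum>(i, j)\<in>?L. F j i) = (\<Sum>(i, j)\<in>?L. F i j + F j i)"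
    by (simp add: sum.distrib[symmetric] case_prod_unfold)
  finally show ?thesis .
qed

lemma cvec_square:
  fixes x :: "real ^ 'i::{finite,linorder}"
  shows "cvec x \<odot> (cvec x \<odot> a) = - (x \<bullet> x) *\<^sub>R a"
proof -
  define S where "S = cvec x \<odot> (cvec x \<odot> a)"
  have S1: "S = (\<Sum>i\<in>UNIV. \<Sum>j\<in>UNIV. (x $ i * x $ j) *\<^sub>R (gen i \<odot> (gen j \<odot> a)))"
    by (subst sum.swap)
      (simp add: S_def cvec_def cm.sum_left cm.sum_right cm.scaleR_left cm.scaleR_right scaleR_sum_right mult.commute)
  have S2: "S = (\<Sum>i\<in>UNIV. \<Sum>j\<in>UNIV. (x $ i * x $ j) *\<^sub>R (gen j \<odot> (gen i \<odot> a)))"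
    unfolding S1 by (subst sum.swap) (simp only: mult.commute)
  have "S + S = (\<Sum>i\<in>UNIV. \<Sum>j\<in>UNIV. (x $ i * x $ j) *\<^sub>R (gen i \<odot> (gen j \<odot> a) + gen j \<odot> (gen i \<odot> a)))"
    by (subst S1, subst S2) (simp only: sum.distrib scaleR_add_right)
  also have "\<dots> = (\<Sum>i\<in>UNIV. \<Sum>j\<in>UNIV. if i = j then (- 2 * (x $ i * x $ i)) *\<^sub>R a else 0)"
    by (intro sum.cong refl, subst gen_swap) auto
  also have "\<dots> = 2 *\<^sub>R (- (x \<bullet> x) *\<^sub>R a)"
    by (simp add: inner_vec_def scaleR_sum_left sum_negf scaleR_sum_right)
  finally have "2 *\<^sub>R S = 2 *\<^sub>R (- (x \<bullet> x) *\<^sub>R a)" by (simp only: scaleR_2)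
  then show ?thesis unfolding scaleR_cancel_left S_def by simp
qed

lemma radial_ext_derivative_zero:
  assumes F': "(radial_ext \<phi> has_derivative F') (at x)" and x: "norm x = 1"
  shows "F' x = 0"
proof -
  have "((\<lambda>s. radial_ext \<phi> (x + s *\<^sub>R x)) has_vector_derivative F' x) (at (0::real))"
    by (rule has_derivative_line[OF F'])
  moreover have "((\<lambda>s. radial_ext \<phi> (x + s *\<^sub>R x)) has_vector_derivative 0) (at (0::real))"
  proof (rule has_vector_derivative_transform_within_open[OF has_vector_derivative_const])
    show "open {- 1::real<..}" "(0::real) \<in> {- 1<..}" by auto
    fix s :: real assume s: "s \<in> {- 1<..}"
    have "x + s *\<^sub>R x = (1 + s) *\<^sub>R x" by (simp add: algebra_simps)
    moreover have "norm ((1 + s) *\<^sub>R x) = 1 + s" using s x by simp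
    ultimately have "(x + s *\<^sub>R x) /\<^sub>R norm (x + s *\<^sub>R x) = x" using s by simp
    then show "\<phi> x = radial_ext \<phi> (x + s *\<^sub>R x)" by (simp add: radial_ext_def)
  qed
  ultimately show ?thesis by (rule vector_derivative_unique_at)
qed

text \<open>Let \<open>D\<close> be the Dirac derivative in the ambient space. In
  \<open>cvec x \<odot> D\<close> the diagonal terms add up to minus the radial derivative, which is
  0, and the remaining terms pair up to \<open>sph_Lambda\<close>. Since \<open>cvec x\<close>
  squares to -1 on the unit sphere, multiplying by \<open>- cvec x\<close> gives \<open>D\<close>
  back.\<close>

lemma sph_dirac_eq:
  fixes \<phi> :: "real ^ 'n::{finite,linorder} option \<Rightarrow> 'n option clifford"
  assumes F': "(radial_ext \<phi> has_derivative F') (at x)" and x: "norm x = 1"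
  shows "sph_dirac \<phi> x = (\<Sum>j\<in>UNIV. gen j \<odot> (F' (axis j 1) - (real CARD('n) / 2 * x $ j) *\<^sub>R \<phi> x))"
proof -
  have lin: "linear F'" using F' by (rule has_derivative_linear)
  define d where "d j = F' (axis j 1)" for j
  have pd: "partial_diff j (radial_ext \<phi>) x = d j" for j
    unfolding d_def by (rule partial_diff_eq[OF F'])
  have xd: "(\<Sum>j\<in>UNIV. x $ j *\<^sub>R d j) = 0"
    unfolding d_def linear_axis_sum[OF lin, of x, symmetric] by (rule radial_ext_derivative_zero[OF F' x])
  define D where "D = (\<Sum>j\<in>UNIV. gen j \<odot> d j)"
  have "cvec x \<odot> D = (\<Sum>i\<in>UNIV. \<Sum>j\<in>UNIV. x $ i *\<^sub>R (gen i \<odot> (gen j \<odot> d j)))"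
    by (subst sum.swap) (simp add: cvec_def D_def cm.sum_left cm.sum_right cm.scaleR_left scaleR_sum_right)
  also have "\<dots> = (\<Sum>i\<in>UNIV. x $ i *\<^sub>R (gen i \<odot> (gen i \<odot> d i)))
      + (\<Sum>(i, j) | i < j. x $ i *\<^sub>R (gen i \<odot> (gen j \<odot> d j)) + x $ j *\<^sub>R (gen j \<odot> (gen i \<odot> d i)))"
    by (rule sum_pairs_less)
  also have "(\<Sum>i\<in>UNIV. x $ i *\<^sub>R (gen i \<odot> (gen i \<odot> d i))) = 0"
    by (simp add: gen_mult_self sum_negf xd)
  also have "(\<Sum>(i, j) | i < j. x $ i *\<^sub>R (gen i \<odot> (gen j \<odot> d j)) + x $ j *\<^sub>R (gen j \<odot> (gen i \<odot> d i))) = sph_Lambda \<phi> x"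
    unfolding sph_Lambda_def pd
  proof (intro sum.cong refl, clarify)
    fix i j :: "'n option" assume "i < j"
    then have "gen j \<odot> (gen i \<odot> d i) = - (gen i \<odot> (gen j \<odot> d i))" by (subst gen_swap) auto
    then show "x $ i *\<^sub>R (gen i \<odot> (gen j \<odot> d j)) + x $ j *\<^sub>R (gen j \<odot> (gen i \<odot> d i))
        = gen i \<odot> gen j \<odot> (x $ i *\<^sub>R d j - x $ j *\<^sub>R d i)"
      by (simp add: cmult_assoc cm.diff_right cm.scaleR_right)
  qed
  finally have "sph_Lambda \<phi> x = cvec x \<odot> D" by simp
  then have "sph_dirac \<phi> x = D - (real CARD('n) / 2) *\<^sub>R (cvec x \<odot> \<phi> x)"
    using x by (simp add: sph_dirac_def cm.add_right cm.scaleR_right cvec_square norm_eq_1)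
  also have "\<dots> = (\<Sum>j\<in>UNIV. gen j \<odot> (d j - (real CARD('n) / 2 * x $ j) *\<^sub>R \<phi> x))"
    by (simp add: D_def cvec_def cm.diff_right cm.sum_left cm.scaleR_left cm.scaleR_right sum_subtractf scaleR_sum_right)
  finally show ?thesis by (simp add: d_def)
qed

text \<open>Reversion commutes with radial extension and turns left multiplication by generators
  into right multiplication.\<close>

lemma sph_dirac_right_eq:
  fixes \<phi> :: "real ^ 'n::{finite,linorder} option \<Rightarrow> 'n option clifford"
  assumes F': "(radial_ext \<phi> has_derivative F') (at x)" and x: "norm x = 1"
  shows "sph_dirac_right \<phi> x = (\<Sum>j\<in>UNIV. (F' (axis j 1) - (real CARD('n) / 2 * x $ j) *\<^sub>R \<phi> x) \<odot> gen j)"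
proof -
  have "radial_ext (\<lambda>y. reversion (\<phi> y)) = (\<lambda>y. reversion (radial_ext \<phi> y))"
    by (auto simp: radial_ext_def)
  then have "(radial_ext (\<lambda>y. reversion (\<phi> y)) has_derivative (\<lambda>v. reversion (F' v))) (at x)"
    using bounded_linear.has_derivative[OF bounded_linear_reversion F'] by simp
  from sph_dirac_eq[OF this x] show ?thesis
    by (simp add: sph_dirac_right_def reversion_sum reversion_mult linear_diff[OF linear_reversion] linear_scale[OF linear_reversion])
qed

section \<open>Stokes' formula\<close>

lemma C1_on_linear_image:
  fixes F :: "'a::euclidean_space \<Rightarrow> 'b::real_normed_vector" and l :: "'b \<Rightarrow> 'c::real_normed_vector"
  assumes F: "C1_on S F" and l: "bounded_linear l"
  shows "C1_on S (\<lambda>x. l (F x))"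
proof (rule C1_onI)
  show "((\<lambda>x. l (F x)) has_derivative (\<lambda>v. l (frechet_derivative F (at x) v))) (at x)" if "x \<in> S" for x
    by (rule bounded_linear.has_derivative[OF l C1_on_has_derivative[OF F that]])
  show "continuous_on S (\<lambda>x. l (frechet_derivative F (at x) v))" for v
    by (rule bounded_linear.continuous_on[OF l C1_on_continuous_directional[OF F]])
qed

lemma C1_on_cmult:
  fixes F G :: "'a::euclidean_space \<Rightarrow> 'i::{finite,linorder} clifford"
  assumes F: "C1_on S F" and G: "C1_on S G"
  shows "C1_on S (\<lambda>x. F x \<odot> G x)"
proof (rule C1_onI)
  show "((\<lambda>x. F x \<odot> G x) has_derivative (\<lambda>v. F x \<odot> frechet_derivative G (at x) v + frechet_derivative F (at x) v \<odot> G x)) (at x)"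
    if "x \<in> S" for x
    by (rule cm.FDERIV[OF C1_on_has_derivative[OF F that] C1_on_has_derivative[OF G that]])
  show "continuous_on S (\<lambda>x. F x \<odot> frechet_derivative G (at x) v + frechet_derivative F (at x) v \<odot> G x)" for v
    by (intro continuous_intros cm.continuous_on C1_on_continuous[OF F] C1_on_continuous[OF G]
      C1_on_continuous_directional[OF F] C1_on_continuous_directional[OF G])
qed

lemma frechet_derivative_eq_on_open:
  assumes "(F has_derivative F') (at x)" "open S" "x \<in> S" "\<And>z. z \<in> S \<Longrightarrow> G z = F z"
  shows "frechet_derivative G (at x) = F'"
  using has_derivative_transform_within_open[OF assms(1-3), of G] assms(4) frechet_derivative_at by metis

text \<open>The cone on which the radial extension of a function is determined by its values on
  \<open>U\<close>; \<open>C1_space\<close> asks for differentiability over it.\<close>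

definition sphere_cone :: "'a::real_normed_vector set \<Rightarrow> 'a set" where
  "sphere_cone U = {y. y \<noteq> 0 \<and> y /\<^sub>R norm y \<in> U}"

lemma open_sphere_cone:
  assumes "openin (top_of_set (sphere 0 1)) (U :: 'a::euclidean_space set)"
  shows "open (sphere_cone U)"
proof -
  obtain T where T: "open T" "U = sphere 0 1 \<inter> T" using assms by (auto simp: openin_open)
  have "open ({y::'a. y \<noteq> 0} \<inter> (\<lambda>y. y /\<^sub>R norm y) -` T)"
    by (rule continuous_open_preimage) (auto intro!: continuous_intros T(1) open_delete simp: Collect_neg_eq[symmetric] open_Collect_neq)
  moreover have "{y. y \<noteq> 0} \<inter> (\<lambda>y. y /\<^sub>R norm y) -` T = sphere_cone U"
    by (auto simp: sphere_cone_def T(2))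
  ultimately show ?thesis by simp
qed

lemma sphere_cone_unit: "x \<in> U \<Longrightarrow> norm x = 1 \<Longrightarrow> x \<in> sphere_cone U"
  by (auto simp: sphere_cone_def)

lemma radial_ext_unit: "norm x = 1 \<Longrightarrow> radial_ext f x = f x"
  by (simp add: radial_ext_def)

lemma C1_space_slice:
  fixes f :: "'a::euclidean_space \<Rightarrow> 'c::real_normed_vector \<Rightarrow> 'b::real_normed_vector"
  assumes "f \<in> C1_space U X"
  shows "C1_on (sphere_cone U) (\<lambda>y. radial_ext f y u)"
proof -
  let ?S = "{(y, u). y \<noteq> 0 \<and> y /\<^sub>R norm y \<in> U} :: ('a \<times> 'c) set"
  have S: "(y, u) \<in> ?S" if "y \<in> sphere_cone U" for y using that by (simp add: sphere_cone_def)
  obtain F' where F': "\<And>z. z \<in> ?S \<Longrightarrow> ((\<lambda>(y, u). radial_ext f y u) has_derivative blinfun_apply (F' z)) (at z)"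
    "continuous_on ?S F'"
    using assms by (auto simp: C1_space_def C1_on_def)
  show ?thesis
  proof (rule C1_onI)
    fix y assume y: "y \<in> sphere_cone U"
    have "((\<lambda>y. (y, u)) has_derivative (\<lambda>v. (v, 0))) (at y)"
      by (auto intro!: derivative_eq_intros)
    from has_derivative_compose[OF this F'(1)[OF S[OF y]]]
    show "((\<lambda>y. radial_ext f y u) has_derivative (\<lambda>v. F' (y, u) (v, 0))) (at y)" by simp
  next
    fix v
    have "continuous_on (sphere_cone U) (\<lambda>y. F' (y, u))"
      by (rule continuous_on_compose2[OF F'(2)]) (auto intro!: continuous_intros simp: sphere_cone_def)
    then show "continuous_on (sphere_cone U) (\<lambda>y. F' (y, u) (v, 0))" by (intro continuous_intros)
  qed
qed

lemma C1_space_radial_mem: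
  assumes "f \<in> C1_space U X" "y \<in> sphere_cone U"
  shows "radial_ext f y \<in> X"
  using assms by (simp add: C1_space_def sphere_cone_def radial_ext_def)

lemma C1_space_reversion:
  fixes g :: "real ^ 'm::finite \<Rightarrow> (real, 'n) vec \<Rightarrow> 'n::{finite,linorder} option clifford"
  assumes "g \<in> C1_space U (monogenics_right k)"
  shows "(\<lambda>x u. reversion (g x u)) \<in> C1_space U (monogenics_left k)"
proof -
  have "C1_on {(y, u). y \<noteq> 0 \<and> y /\<^sub>R norm y \<in> U} (\<lambda>z. reversion ((\<lambda>(y, u). radial_ext g y u) z))"
    by (rule C1_on_linear_image[OF _ bounded_linear_reversion]) (use assms in \<open>simp add: C1_space_def\<close>)
  moreover have "(\<lambda>z. reversion ((\<lambda>(y, u). radial_ext g y u) z)) = (\<lambda>(y, u). radial_ext (\<lambda>x u. reversion (g x u)) y u)"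
    by (auto simp: radial_ext_def)
  ultimately show ?thesis using assms by (simp add: C1_space_def monogenics_right_iff)
qed

text \<open>Mixed derivatives in position and \<open>u\<close> are not supplied by the C1
  hypothesis. Through the nodes, the dependence on \<open>u\<close> sits in the weights and that on
  the position in the values at the nodes, so the two differentiations commute on a finite
  sum.\<close>

lemma C1_space_derivative_monogenic_left:
  fixes f :: "real ^ 'm::finite \<Rightarrow> (real, 'n) vec \<Rightarrow> 'n::{finite,linorder} option clifford"
  assumes f: "f \<in> C1_space U (monogenics_left k)" and U: "openin (top_of_set (sphere 0 1)) U"
    and y: "y \<in> sphere_cone U" and k: "k \<ge> 0"
  shows "(\<lambda>u. frechet_derivative (\<lambda>y. radial_ext f y u) (at y) v) \<in> monogenics_left k"
proof -
  let ?O = "sphere_cone U"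
  have oO: "open ?O" by (rule open_sphere_cone[OF U])
  obtain J :: "nat set" and a l where J: "finite J" "\<forall>j\<in>J. real_polynomial_function (l j)"
    and int: "\<forall>p\<in>hom_polys k. \<forall>u :: (real, 'n) vec. p u = (\<Sum>j\<in>J. l j u *\<^sub>R (p (a j) :: 'n option clifford))"
    using hom_polys_interpolation[of k, where 'n = 'n and 'b = "'n option clifford"] by (elim exE conjE)
  have mem: "radial_ext f z \<in> hom_polys k" "dirac_left (radial_ext f z) u = 0" if "z \<in> ?O" for z u
    using C1_space_radial_mem[OF f that] by (auto simp: monogenics_left_def)
  define E where "E u = frechet_derivative (\<lambda>y. radial_ext f y u) (at y) v" for u
  have d: "((\<lambda>y. radial_ext f y u) has_derivative frechet_derivative (\<lambda>y. radial_ext f y u) (at y)) (at y)" for u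
    by (rule C1_on_has_derivative[OF C1_space_slice[OF f] y])
  have E_sum: "E u = (\<Sum>j\<in>J. l j u *\<^sub>R E (a j))" for u
  proof -
    have "frechet_derivative (\<lambda>y. radial_ext f y u) (at y)
        = (\<lambda>v. \<Sum>j\<in>J. l j u *\<^sub>R frechet_derivative (\<lambda>y. radial_ext f y (a j)) (at y) v)"
    proof (rule frechet_derivative_eq_on_open[OF _ oO y])
      show "((\<lambda>y. \<Sum>j\<in>J. l j u *\<^sub>R radial_ext f y (a j)) has_derivative
          (\<lambda>v. \<Sum>j\<in>J. l j u *\<^sub>R frechet_derivative (\<lambda>y. radial_ext f y (a j)) (at y) v)) (at y)"
        by (intro has_derivative_sum has_derivative_scaleR_right d)
      show "radial_ext f z u = (\<Sum>j\<in>J. l j u *\<^sub>R radial_ext f z (a j))" if "z \<in> ?O" for z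
        by (rule int[rule_format, OF mem(1)[OF that]])
    qed
    from fun_cong[OF this, of v] show ?thesis by (simp only: E_def)
  qed
  have E_hom: "E (t *\<^sub>R u) = t ^ nat k *\<^sub>R E u" for t u
  proof -
    have "frechet_derivative (\<lambda>y. radial_ext f y (t *\<^sub>R u)) (at y)
        = (\<lambda>v. t ^ nat k *\<^sub>R frechet_derivative (\<lambda>y. radial_ext f y u) (at y) v)"
      by (rule frechet_derivative_eq_on_open[OF has_derivative_scaleR_right[OF d] oO y])
        (use mem(1) k in \<open>auto simp: hom_polys_def\<close>)
    from fun_cong[OF this, of v] show ?thesis by (simp only: E_def)
  qed
  have lp: "(l j has_derivative frechet_derivative (l j) (at u)) (at u)" if "j \<in> J" for j u
    using J(2) that by (intro polynomial_function_has_derivative) (auto simp: real_polynomial_function_eq)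
  have pd: "partial_diff i (\<lambda>u. \<Sum>j\<in>J. l j u *\<^sub>R q j) u = (\<Sum>j\<in>J. partial_diff i (l j) u *\<^sub>R q j)"
    for i u and q :: "nat \<Rightarrow> 'n option clifford"
  proof -
    have "((\<lambda>u. \<Sum>j\<in>J. l j u *\<^sub>R q j) has_derivative (\<lambda>w. \<Sum>j\<in>J. frechet_derivative (l j) (at u) w *\<^sub>R q j)) (at u)"
      by (intro has_derivative_sum has_derivative_scaleR_left lp)
    from partial_diff_eq[OF this] show ?thesis by (simp add: partial_diff_def)
  qed
  have E_poly: "polynomial_function E"
  proof -
    have "polynomial_function (\<lambda>u. \<Sum>j\<in>J. l j u *\<^sub>R E (a j))"
      using J by (intro polynomial_function_sum polynomial_function_mult polynomial_function_const)
        (auto simp: real_polynomial_function_eq[symmetric])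
    moreover have "E = (\<lambda>u. \<Sum>j\<in>J. l j u *\<^sub>R E (a j))" by (rule ext) (rule E_sum)
    ultimately show ?thesis by simp
  qed
  have "dirac_left E u = 0" for u
  proof -
    \<comment> \<open>On the cone \<open>L z\<close> is the Dirac derivative of
      \<open>radial_ext f z\<close> at \<open>u\<close>, expressed by the values at the nodes. It
      vanishes on an open set, hence so does its derivative at \<open>y\<close>.\<close>
    define L where "L z = (\<Sum>i\<in>UNIV. gen (Some i) \<odot> (\<Sum>j\<in>J. partial_diff i (l j) u *\<^sub>R radial_ext f z (a j)))" for z
    have L0: "L z = 0" if z: "z \<in> ?O" for z
    proof -
      have "radial_ext f z = (\<lambda>u. \<Sum>j\<in>J. l j u *\<^sub>R radial_ext f z (a j))"
        by (rule ext) (rule int[rule_format, OF mem(1)[OF z]])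
      then have "partial_diff i (radial_ext f z) u = (\<Sum>j\<in>J. partial_diff i (l j) u *\<^sub>R radial_ext f z (a j))" for i
        using pd[of i "\<lambda>j. radial_ext f z (a j)" u] by (simp only:)
      then show ?thesis using mem(2)[OF z, of u] by (simp add: dirac_left_def L_def)
    qed
    have "(L has_derivative (\<lambda>v. \<Sum>i\<in>UNIV. gen (Some i) \<odot>
        (\<Sum>j\<in>J. partial_diff i (l j) u *\<^sub>R frechet_derivative (\<lambda>y. radial_ext f y (a j)) (at y) v))) (at y)"
      unfolding L_def[abs_def]
      by (intro has_derivative_sum bounded_linear.has_derivative[OF cm.bounded_linear_right] has_derivative_scaleR_right d)
    from frechet_derivative_at[OF this]
    have "(\<lambda>v. \<Sum>i\<in>UNIV. gen (Some i) \<odot>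
        (\<Sum>j\<in>J. partial_diff i (l j) u *\<^sub>R frechet_derivative (\<lambda>y. radial_ext f y (a j)) (at y) v)) = (\<lambda>_. 0)"
      using frechet_derivative_eq_on_open[OF has_derivative_const oO y, of L 0] L0 by simp
    from fun_cong[OF this, of v]
    have "(\<Sum>i\<in>UNIV. gen (Some i) \<odot> (\<Sum>j\<in>J. partial_diff i (l j) u *\<^sub>R E (a j))) = 0"
      by (simp only: E_def)
    moreover have "E = (\<lambda>u. \<Sum>j\<in>J. l j u *\<^sub>R E (a j))" by (rule ext) (rule E_sum)
    then have "partial_diff i E u = (\<Sum>j\<in>J. partial_diff i (l j) u *\<^sub>R E (a j))" for i
      using pd[of i "\<lambda>j. E (a j)" u] by (simp only:)
    ultimately show ?thesis by (simp add: dirac_left_def)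
  qed
  then show ?thesis
    using E_poly E_hom k unfolding E_def by (simp add: monogenics_left_def hom_polys_def)
qed

lemma C1_space_derivative_monogenic_right:
  fixes g :: "real ^ 'm::finite \<Rightarrow> (real, 'n) vec \<Rightarrow> 'n::{finite,linorder} option clifford"
  assumes g: "g \<in> C1_space U (monogenics_right k)" and U: "openin (top_of_set (sphere 0 1)) U"
    and y: "y \<in> sphere_cone U" and k: "k \<ge> 0"
  shows "(\<lambda>u. frechet_derivative (\<lambda>y. radial_ext g y u) (at y) v) \<in> monogenics_right k"
proof -
  have "frechet_derivative (\<lambda>y. radial_ext (\<lambda>x u. reversion (g x u)) y u) (at y) v
      = reversion (frechet_derivative (\<lambda>y. radial_ext g y u) (at y) v)" for u
  proof -
    have "frechet_derivative (\<lambda>y. reversion (radial_ext g y u)) (at y)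
        = (\<lambda>v. reversion (frechet_derivative (\<lambda>y. radial_ext g y u) (at y) v))"
      by (rule frechet_derivative_at[OF bounded_linear.has_derivative[OF bounded_linear_reversion
            C1_on_has_derivative[OF C1_space_slice[OF g] y]], symmetric])
    from fun_cong[OF this, of v] show ?thesis by (simp add: radial_ext_def)
  qed
  then show ?thesis
    using C1_space_derivative_monogenic_left[OF C1_space_reversion[OF g] U y k, of v]
    by (simp add: monogenics_right_iff)
qed

lemma cvec_mult_sum: "cvec x \<odot> a = (\<Sum>j\<in>UNIV. x $ j *\<^sub>R (gen j \<odot> a))"
  by (simp add: cvec_def cm.sum_left cm.scaleR_left)

theorem theorem7:
  fixes U V :: "(real ^ 'n::{finite,linorder} option) set"
    and f g :: "real ^ 'n option \<Rightarrow> (real, 'n) vec \<Rightarrow> 'n option clifford"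
    and \<nu> :: "real ^ 'n option \<Rightarrow> real ^ 'n option"
    and k :: int
    and dS d\<Sigma> :: "(real ^ 'n option) measure"
    and ds :: "((real, 'n) vec) measure"
  assumes "sph_domain U"
    and "sph_domain V" and "V \<subseteq> U"
    and "sph_boundary V \<subseteq> U" and "C1_boundary V"
    and "k \<ge> 0"
    and "f \<in> C1_space U (monogenics_left k)"
    and "g \<in> C1_space U (monogenics_right k)"
    and "is_lebesgue_measure_on CARD('n) (sphere 0 1) dS"
    and "is_lebesgue_measure_on (CARD('n) - 1) (sph_boundary V) d\<Sigma>"
    and "is_lebesgue_measure_on (CARD('n) - 1) (sphere 0 1) ds"
    and "\<And>x. x \<in> sph_boundary V \<Longrightarrow> outward_unit_normal V x (\<nu> x)"
  shows "((LINT x:V|dS. u_pairing ds (RS_right k g x) (f x) + u_pairing ds (g x) (RS_left k f x))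
       = (LINT x:sph_boundary V|d\<Sigma>. u_pairing ds (g x) (proj_left k (\<lambda>u. cvec (\<nu> x) \<odot> f x u))))
     \<and> ((LINT x:sph_boundary V|d\<Sigma>. u_pairing ds (g x) (proj_left k (\<lambda>u. cvec (\<nu> x) \<odot> f x u)))
       = (LINT x:sph_boundary V|d\<Sigma>. u_pairing ds (proj_right k (\<lambda>u. g x u \<odot> cvec (\<nu> x))) (f x)))
     \<and> ((LINT x:sph_boundary V|d\<Sigma>. u_pairing ds (proj_right k (\<lambda>u. g x u \<odot> cvec (\<nu> x))) (f x))
       = (LINT x:sph_boundary V|d\<Sigma>. u_pairing ds (g x) (\<lambda>u. cvec (\<nu> x) \<odot> f x u)))"
proof -
  let ?O = "sphere_cone U" and ?bV = "sph_boundary V" and ?n = "real CARD('n)"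
  note U = assms(1)[unfolded sph_domain_def, THEN conjunct1]
  note V = assms(2)[unfolded sph_domain_def, THEN conjunct1]
  note k = assms(6) and f = assms(7) and g = assms(8) and ds = assms(11) and out = assms(12)
  \<comment> \<open>The index type \<open>'n option\<close> has one element more than
    \<open>'n\<close>, so the dimensions of sphere and boundary fit the general divergence
    theorem.\<close>
  have card: "CARD('n option) - 1 = CARD('n)" "CARD('n option) - 2 = CARD('n) - 1" by simp_all
  have dS: "is_lebesgue_measure_on (CARD('n option) - 1) (sphere 0 1) dS"
    and d\<Sigma>: "is_lebesgue_measure_on (CARD('n option) - 2) ?bV d\<Sigma>"
    using assms(9,10) by (simp_all only: card)
  have oO: "open ?O" by (rule open_sphere_cone[OF U])
  have unit: "norm x = 1" and inU: "x \<in> U" and inO: "x \<in> ?O" if "x \<in> V \<union> ?bV" for x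
  proof -
    show 1: "norm x = 1" using sph_closure(3)[OF V] that by auto
    show 2: "x \<in> U" using assms(3,4) that by blast
    show "x \<in> ?O" by (rule sphere_cone_unit[OF 2 1])
  qed
  then have CO: "V \<union> ?bV \<subseteq> ?O" by blast
  have fM: "f x \<in> monogenics_left k" and gM: "g x \<in> monogenics_right k" if "x \<in> V \<union> ?bV" for x
    using f g inU[OF that] by (auto simp: C1_space_def)
  obtain J :: "nat set" and a l where J: "finite J" "\<forall>j\<in>J. real_polynomial_function (l j)"
    and int: "\<forall>p\<in>hom_polys k. \<forall>u :: (real, 'n) vec. p u = (\<Sum>j\<in>J. l j u *\<^sub>R (p (a j) :: 'n option clifford))"
    using hom_polys_interpolation[of k, where 'n = 'n and 'b = "'n option clifford"] by (elim exE conjE)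
  have homL: "p \<in> hom_polys k" if "p \<in> monogenics_left k" for p :: "(real, 'n) vec \<Rightarrow> 'n option clifford"
    using that by (simp add: monogenics_left_def)
  have homR: "p \<in> hom_polys k" if "p \<in> monogenics_right k" for p :: "(real, 'n) vec \<Rightarrow> 'n option clifford"
    using that by (simp add: monogenics_right_def)
  define F where "F i y = radial_ext f y (a i)" for i y
  define G where "G i y = radial_ext g y (a i)" for i y
  have FC: "C1_on ?O (F i)" and GC: "C1_on ?O (G i)" for i
    unfolding F_def[abs_def] G_def[abs_def] by (rule C1_space_slice[OF f], rule C1_space_slice[OF g])
  \<comment> \<open>All integration over \<open>u\<close> is stored in these scalars; what remains
    depends on the position only.\<close>
  define c where "c i i' = (LINT u:sphere 0 1|ds. l i u * l i' u)" for i i'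
  have pair: "u_pairing ds (\<lambda>u. \<Sum>i\<in>J. l i u *\<^sub>R P i) (\<lambda>u. \<Sum>i\<in>J. l i u *\<^sub>R Q i)
      = (\<Sum>i\<in>J. \<Sum>i'\<in>J. c i i' *\<^sub>R (P i \<odot> Q i'))" for P Q
    unfolding c_def by (rule u_pairing_expand[OF ds J(1) J(1)]) (use J(2) in auto)
  \<comment> \<open>On the closure of \<open>V\<close> this is the pairing of \<open>g\<close> with
    \<open>e_j f\<close>, in a form that is visibly C1 on the cone.\<close>
  define H where "H j y = (\<Sum>i\<in>J. \<Sum>i'\<in>J. c i i' *\<^sub>R (G i y \<odot> (gen j \<odot> F i' y)))" for j y
  have HC: "C1_on ?O (H j)" for j
    unfolding H_def[abs_def]
    by (intro C1_on_sum C1_on_linear_image[OF _ bounded_linear_scaleR_right] C1_on_cmult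
        C1_on_linear_image[OF _ cm.bounded_linear_right] FC GC)
  have fexp: "f x u = (\<Sum>i\<in>J. l i u *\<^sub>R F i x)" and gexp: "g x u = (\<Sum>i\<in>J. l i u *\<^sub>R G i x)"
    if x: "x \<in> V \<union> ?bV" for x u
    using int[rule_format, OF homL[OF fM[OF x]], of u] int[rule_format, OF homR[OF gM[OF x]], of u] unit[OF x]
    by (simp_all add: F_def G_def radial_ext_unit)
  have bdry: "u_pairing ds (g x) (\<lambda>u. cvec (\<nu> x) \<odot> f x u) = (\<Sum>j\<in>UNIV. \<nu> x $ j *\<^sub>R H j x)"
    if x: "x \<in> ?bV" for x
  proof -
    have x': "x \<in> V \<union> ?bV" using x by blast
    have "u_pairing ds (g x) (\<lambda>u. cvec (\<nu> x) \<odot> f x u)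
        = u_pairing ds (\<lambda>u. \<Sum>i\<in>J. l i u *\<^sub>R G i x) (\<lambda>u. \<Sum>i\<in>J. l i u *\<^sub>R (cvec (\<nu> x) \<odot> F i x))"
      by (simp only: fexp[OF x'] gexp[OF x', abs_def] cm.sum_right cm.scaleR_right)
    also have "\<dots> = (\<Sum>i\<in>J. \<Sum>i'\<in>J. \<Sum>j\<in>UNIV. \<nu> x $ j *\<^sub>R (c i i' *\<^sub>R (G i x \<odot> (gen j \<odot> F i' x))))"
      unfolding pair by (simp add: cvec_mult_sum cm.sum_right cm.scaleR_right scaleR_sum_right mult.commute)
    also have "\<dots> = (\<Sum>j\<in>UNIV. \<nu> x $ j *\<^sub>R H j x)"
      unfolding H_def scaleR_sum_right by (simp only: sum.swap[of _ J UNIV])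
    finally show ?thesis .
  qed
  \<comment> \<open>The summands \<open>n / 2\<close> of the left and of the right operator add up
    to the \<open>n = CARD('n option) - 1\<close> of the divergence theorem, so no term of order
    zero is left over.\<close>
  have inner: "u_pairing ds (RS_right k g x) (f x) + u_pairing ds (g x) (RS_left k f x)
      = (\<Sum>j\<in>UNIV. partial_diff j (H j) x - (real (CARD('n option) - 1) * x $ j) *\<^sub>R H j x)" if x: "x \<in> V" for x
  proof -
    have x': "x \<in> V \<union> ?bV" using x by blast
    note x1 = unit[OF x'] and xO = inO[OF x']
    define DF where "DF i = frechet_derivative (F i) (at x)" for i
    define DG where "DG i = frechet_derivative (G i) (at x)" for i
    have dF: "(F i has_derivative DF i) (at x)" and dG: "(G i has_derivative DG i) (at x)" for i
      unfolding DF_def DG_def by (rule C1_on_has_derivative[OF FC xO], rule C1_on_has_derivative[OF GC xO])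
    have Fx: "F i x = f x (a i)" and Gx: "G i x = g x (a i)" for i
      by (simp_all add: F_def G_def radial_ext_unit[OF x1])
    define LF where "LF i = (\<Sum>j\<in>UNIV. gen j \<odot> (DF i (axis j 1) - (?n / 2 * x $ j) *\<^sub>R F i x))" for i
    define LG where "LG i = (\<Sum>j\<in>UNIV. (DG i (axis j 1) - (?n / 2 * x $ j) *\<^sub>R G i x) \<odot> gen j)" for i
    let ?df = "\<lambda>u. frechet_derivative (\<lambda>y. radial_ext f y u) (at x)"
    let ?dg = "\<lambda>u. frechet_derivative (\<lambda>y. radial_ext g y u) (at x)"
    have re: "radial_ext (\<lambda>y. h y u) = (\<lambda>y. radial_ext h y u)" for h :: "real ^ 'n option \<Rightarrow> (real, 'n) vec \<Rightarrow> 'n option clifford" and u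
      by (auto simp: radial_ext_def)
    have df: "(radial_ext (\<lambda>y. f y u) has_derivative ?df u) (at x)" for u
      unfolding re by (rule C1_on_has_derivative[OF C1_space_slice[OF f] xO])
    have dg: "(radial_ext (\<lambda>y. g y u) has_derivative ?dg u) (at x)" for u
      unfolding re by (rule C1_on_has_derivative[OF C1_space_slice[OF g] xO])
    have sf: "sph_dirac (\<lambda>y. f y u) x = (\<Sum>j\<in>UNIV. gen j \<odot> (?df u (axis j 1) + (- (?n / 2 * x $ j)) *\<^sub>R f x u))" for u
      using sph_dirac_eq[OF df x1] by simp
    have sg: "sph_dirac_right (\<lambda>y. g y u) x = (\<Sum>j\<in>UNIV. (?dg u (axis j 1) + (- (?n / 2 * x $ j)) *\<^sub>R g x u) \<odot> gen j)" for u
      using sph_dirac_right_eq[OF dg x1] by simp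
    have dfM: "(\<lambda>u. ?df u v) \<in> monogenics_left k" and dgM: "(\<lambda>u. ?dg u v) \<in> monogenics_right k" for v
      by (rule C1_space_derivative_monogenic_left[OF f U xO k], rule C1_space_derivative_monogenic_right[OF g U xO k])
    \<comment> \<open>\<open>proj_left\<close> is specified on harmonic polynomials only. Left
      multiplication by a constant such as \<open>gen j\<close> can spoil monogenicity in
      \<open>u\<close>, but it preserves harmonicity.\<close>
    have harmf: "(\<lambda>u. sph_dirac (\<lambda>y. f y u) x) \<in> harmonic_polys k"
      unfolding sf
      by (intro harmonic_polys_sum harmonic_polys_linear_image[OF _ cm.bounded_linear_right] harmonic_polys_add
          harmonic_polys_linear_image[OF _ bounded_linear_scaleR_right] monogenics_left_harmonic dfM fM[OF x'])
    have harmg: "(\<lambda>u. sph_dirac_right (\<lambda>y. g y u) x) \<in> harmonic_polys k"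
      unfolding sg
      by (intro harmonic_polys_sum harmonic_polys_linear_image[OF _ cm.bounded_linear_left] harmonic_polys_add
          harmonic_polys_linear_image[OF _ bounded_linear_scaleR_right] monogenics_right_harmonic dgM gM[OF x'])
    have dfexp: "?df u v = (\<Sum>i\<in>J. l i u *\<^sub>R DF i v)" and dgexp: "?dg u v = (\<Sum>i\<in>J. l i u *\<^sub>R DG i v)" for u v
    proof -
      have "?df u = (\<lambda>v. \<Sum>i\<in>J. l i u *\<^sub>R DF i v)"
      proof (rule frechet_derivative_eq_on_open[OF _ oO xO])
        show "((\<lambda>y. \<Sum>i\<in>J. l i u *\<^sub>R F i y) has_derivative (\<lambda>v. \<Sum>i\<in>J. l i u *\<^sub>R DF i v)) (at x)"
          by (intro has_derivative_sum has_derivative_scaleR_right dF)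
        show "radial_ext f z u = (\<Sum>i\<in>J. l i u *\<^sub>R F i z)" if "z \<in> ?O" for z
          unfolding F_def by (rule int[rule_format, OF homL[OF C1_space_radial_mem[OF f that]]])
      qed
      then show "?df u v = (\<Sum>i\<in>J. l i u *\<^sub>R DF i v)" by (rule fun_cong)
      have "?dg u = (\<lambda>v. \<Sum>i\<in>J. l i u *\<^sub>R DG i v)"
      proof (rule frechet_derivative_eq_on_open[OF _ oO xO])
        show "((\<lambda>y. \<Sum>i\<in>J. l i u *\<^sub>R G i y) has_derivative (\<lambda>v. \<Sum>i\<in>J. l i u *\<^sub>R DG i v)) (at x)"
          by (intro has_derivative_sum has_derivative_scaleR_right dG)
        show "radial_ext g z u = (\<Sum>i\<in>J. l i u *\<^sub>R G i z)" if "z \<in> ?O" for z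
          unfolding G_def by (rule int[rule_format, OF homR[OF C1_space_radial_mem[OF g that]]])
      qed
      then show "?dg u v = (\<Sum>i\<in>J. l i u *\<^sub>R DG i v)" by (rule fun_cong)
    qed
    have comb: "(\<Sum>i\<in>J. l i u *\<^sub>R A i) + (- b) *\<^sub>R (\<Sum>i\<in>J. l i u *\<^sub>R B i) = (\<Sum>i\<in>J. l i u *\<^sub>R (A i - b *\<^sub>R B i))"
      for u b and A B :: "nat \<Rightarrow> 'n option clifford"
      by (simp add: scaleR_diff_right sum_subtractf scaleR_sum_right sum_negf mult.commute)
    have sf': "sph_dirac (\<lambda>y. f y u) x = (\<Sum>i\<in>J. l i u *\<^sub>R LF i)" for u
      unfolding sf dfexp fexp[OF x'] comb unfolding LF_def cm.sum_right cm.scaleR_right scaleR_sum_right by (rule sum.swap)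
    have sg': "sph_dirac_right (\<lambda>y. g y u) x = (\<Sum>i\<in>J. l i u *\<^sub>R LG i)" for u
      unfolding sg dgexp gexp[OF x'] comb unfolding LG_def cm.sum_left cm.scaleR_left scaleR_sum_right by (rule sum.swap)
    have "u_pairing ds (g x) (RS_left k f x) = u_pairing ds (g x) (\<lambda>u. sph_dirac (\<lambda>y. f y u) x)"
      unfolding RS_left_def by (rule u_pairing_proj_left[OF ds k gM[OF x'] harmf])
    also have "\<dots> = (\<Sum>i\<in>J. \<Sum>i'\<in>J. c i i' *\<^sub>R (G i x \<odot> LF i'))"
      by (simp only: sf' gexp[OF x', abs_def] pair)
    finally have 1: "u_pairing ds (g x) (RS_left k f x) = (\<Sum>i\<in>J. \<Sum>i'\<in>J. c i i' *\<^sub>R (G i x \<odot> LF i'))" .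
    have "u_pairing ds (RS_right k g x) (f x) = u_pairing ds (\<lambda>u. sph_dirac_right (\<lambda>y. g y u) x) (f x)"
      unfolding RS_right_def by (rule u_pairing_proj_right[OF ds k fM[OF x'] harmg])
    also have "\<dots> = (\<Sum>i\<in>J. \<Sum>i'\<in>J. c i i' *\<^sub>R (LG i \<odot> F i' x))"
      by (simp only: sg' fexp[OF x', abs_def] pair)
    finally have 2: "u_pairing ds (RS_right k g x) (f x) = (\<Sum>i\<in>J. \<Sum>i'\<in>J. c i i' *\<^sub>R (LG i \<odot> F i' x))" .
    have dH: "partial_diff j (H j) x = (\<Sum>i\<in>J. \<Sum>i'\<in>J. c i i' *\<^sub>R
        (G i x \<odot> (gen j \<odot> DF i' (axis j 1)) + DG i (axis j 1) \<odot> (gen j \<odot> F i' x)))" for j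
    proof (rule partial_diff_eq)
      show "(H j has_derivative (\<lambda>v. \<Sum>i\<in>J. \<Sum>i'\<in>J. c i i' *\<^sub>R
          (G i x \<odot> (gen j \<odot> DF i' v) + DG i v \<odot> (gen j \<odot> F i' x)))) (at x)"
        unfolding H_def[abs_def]
        by (intro has_derivative_sum has_derivative_scaleR_right cm.FDERIV
            bounded_linear.has_derivative[OF cm.bounded_linear_right] dF dG)
    qed
    have expand: "LG i \<odot> F i' x + G i x \<odot> LF i' = (\<Sum>j\<in>UNIV.
        (G i x \<odot> (gen j \<odot> DF i' (axis j 1)) + DG i (axis j 1) \<odot> (gen j \<odot> F i' x))
        - (?n * x $ j) *\<^sub>R (G i x \<odot> (gen j \<odot> F i' x)))" for i i'
    proof -
      have half: "(?n / 2 * x $ j) *\<^sub>R y + (?n / 2 * x $ j) *\<^sub>R y = (?n * x $ j) *\<^sub>R y" for j and y :: "'n option clifford"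
        by (simp add: scaleR_add_left[symmetric])
      show ?thesis
        unfolding LG_def LF_def cm.sum_left cm.sum_right sum.distrib[symmetric]
        by (intro sum.cong refl)
          (simp add: cm.diff_left cm.diff_right cm.scaleR_left cm.scaleR_right cmult_assoc half[symmetric])
    qed
    have "u_pairing ds (RS_right k g x) (f x) + u_pairing ds (g x) (RS_left k f x)
        = (\<Sum>i\<in>J. \<Sum>i'\<in>J. \<Sum>j\<in>UNIV. c i i' *\<^sub>R
          (G i x \<odot> (gen j \<odot> DF i' (axis j 1)) + DG i (axis j 1) \<odot> (gen j \<odot> F i' x))
          - (?n * x $ j) *\<^sub>R (c i i' *\<^sub>R (G i x \<odot> (gen j \<odot> F i' x))))"
      unfolding 1 2 sum.distrib[symmetric] scaleR_add_right[symmetric] expand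
      by (simp only: scaleR_sum_right scaleR_diff_right scaleR_scaleR mult.commute)
    also have "\<dots> = (\<Sum>j\<in>UNIV. partial_diff j (H j) x - (real (CARD('n option) - 1) * x $ j) *\<^sub>R H j x)"
      unfolding dH H_def card scaleR_sum_right sum_subtractf[symmetric]
      by (simp only: sum.swap[of _ J UNIV])
    finally show ?thesis .
  qed
  \<comment> \<open>The values at the nodes are constant along rays, hence so are all products of
    them.\<close>
  have radial: "frechet_derivative (H j) (at x) x = 0" if x: "x \<in> V" for j x
  proof -
    have x': "x \<in> V \<union> ?bV" using x by blast
    note x1 = unit[OF x'] and xO = inO[OF x']
    have re: "F i = radial_ext (\<lambda>y. f y (a i))" "G i = radial_ext (\<lambda>y. g y (a i))" for i
      by (auto simp: F_def G_def radial_ext_def)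
    have dF: "(F i has_derivative frechet_derivative (F i) (at x)) (at x)"
      and dG: "(G i has_derivative frechet_derivative (G i) (at x)) (at x)" for i
      by (rule C1_on_has_derivative[OF FC xO], rule C1_on_has_derivative[OF GC xO])
    have z: "frechet_derivative (F i) (at x) x = 0" "frechet_derivative (G i) (at x) x = 0" for i
      using radial_ext_derivative_zero[OF dF[unfolded re] x1] radial_ext_derivative_zero[OF dG[unfolded re] x1]
      unfolding re .
    have "(H j has_derivative (\<lambda>v. \<Sum>i\<in>J. \<Sum>i'\<in>J. c i i' *\<^sub>R
        (G i x \<odot> (gen j \<odot> frechet_derivative (F i') (at x) v) + frechet_derivative (G i) (at x) v \<odot> (gen j \<odot> F i' x)))) (at x)"
      unfolding H_def[abs_def]
      by (intro has_derivative_sum has_derivative_scaleR_right cm.FDERIV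
          bounded_linear.has_derivative[OF cm.bounded_linear_right] dF dG)
    from fun_cong[OF frechet_derivative_at[OF this], of x] show ?thesis
      by (simp only: z cm.zero_left cm.zero_right add_0_left scaleR_zero_right sum.neutral_const)
  qed
  note div = sphere_divergence[OF dS d\<Sigma> V assms(5) out oO CO HC radial]
  have main: "(LINT x:V|dS. u_pairing ds (RS_right k g x) (f x) + u_pairing ds (g x) (RS_left k f x))
      = (LINT x:?bV|d\<Sigma>. u_pairing ds (g x) (\<lambda>u. cvec (\<nu> x) \<odot> f x u))"
  proof -
    have "(LINT x:V|dS. u_pairing ds (RS_right k g x) (f x) + u_pairing ds (g x) (RS_left k f x))
        = (LINT x:V|dS. \<Sum>j\<in>UNIV. partial_diff j (H j) x - (real (CARD('n option) - 1) * x $ j) *\<^sub>R H j x)"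
      by (rule set_integral_cong_on) (rule inner)
    also have "\<dots> = (\<Sum>j\<in>UNIV. LINT x:V|dS. partial_diff j (H j) x - (real (CARD('n option) - 1) * x $ j) *\<^sub>R H j x)"
      by (rule set_integral_finite_sum(1)) (rule div(2))
    also have "\<dots> = (\<Sum>j\<in>UNIV. LINT x:?bV|d\<Sigma>. \<nu> x $ j *\<^sub>R H j x)"
      by (rule sum.cong[OF refl]) (rule div(1))
    also have "\<dots> = (LINT x:?bV|d\<Sigma>. \<Sum>j\<in>UNIV. \<nu> x $ j *\<^sub>R H j x)"
      by (rule set_integral_finite_sum(1)[symmetric]) (rule div(3))
    also have "\<dots> = (LINT x:?bV|d\<Sigma>. u_pairing ds (g x) (\<lambda>u. cvec (\<nu> x) \<odot> f x u))"
      by (rule set_integral_cong_on) (rule bdry[symmetric])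
    finally show ?thesis .
  qed
  \<comment> \<open>For fixed \<open>x\<close> the vector \<open>cvec (\<nu> x)\<close> is constant
    in \<open>u\<close>, so the products are harmonic and the projections drop out under the
    pairing.\<close>
  have left: "u_pairing ds (g x) (proj_left k (\<lambda>u. cvec (\<nu> x) \<odot> f x u)) = u_pairing ds (g x) (\<lambda>u. cvec (\<nu> x) \<odot> f x u)"
    and right: "u_pairing ds (proj_right k (\<lambda>u. g x u \<odot> cvec (\<nu> x))) (f x) = u_pairing ds (g x) (\<lambda>u. cvec (\<nu> x) \<odot> f x u)"
    if x: "x \<in> ?bV" for x
  proof -
    have x': "x \<in> V \<union> ?bV" using x by blast
    show "u_pairing ds (g x) (proj_left k (\<lambda>u. cvec (\<nu> x) \<odot> f x u)) = u_pairing ds (g x) (\<lambda>u. cvec (\<nu> x) \<odot> f x u)"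
      by (rule u_pairing_proj_left[OF ds k gM[OF x'] harmonic_polys_linear_image[OF monogenics_left_harmonic[OF fM[OF x']] cm.bounded_linear_right]])
    have "u_pairing ds (proj_right k (\<lambda>u. g x u \<odot> cvec (\<nu> x))) (f x) = u_pairing ds (\<lambda>u. g x u \<odot> cvec (\<nu> x)) (f x)"
      by (rule u_pairing_proj_right[OF ds k fM[OF x'] harmonic_polys_linear_image[OF monogenics_right_harmonic[OF gM[OF x']] cm.bounded_linear_left]])
    then show "u_pairing ds (proj_right k (\<lambda>u. g x u \<odot> cvec (\<nu> x))) (f x) = u_pairing ds (g x) (\<lambda>u. cvec (\<nu> x) \<odot> f x u)"
      by (simp add: u_pairing_def cmult_assoc)
  qed
  have L: "(LINT x:?bV|d\<Sigma>. u_pairing ds (g x) (proj_left k (\<lambda>u. cvec (\<nu> x) \<odot> f x u)))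
      = (LINT x:?bV|d\<Sigma>. u_pairing ds (g x) (\<lambda>u. cvec (\<nu> x) \<odot> f x u))"
    by (rule set_integral_cong_on) (rule left)
  have R: "(LINT x:?bV|d\<Sigma>. u_pairing ds (proj_right k (\<lambda>u. g x u \<odot> cvec (\<nu> x))) (f x))
      = (LINT x:?bV|d\<Sigma>. u_pairing ds (g x) (\<lambda>u. cvec (\<nu> x) \<odot> f x u))"
    by (rule set_integral_cong_on) (rule right)
  show ?thesis
    unfolding main L R by blast
qed

end
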